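(* Let $n\ge 3$, $\mathfrak g_0=\mathfrak{so}^*(2n)$. Let $p$ and $i$ be integers such that $2\le p\le n$ and $1\le i\le[\frac p2]$. Let $a_1\ge\dots\ge a_{n-p}\ge 1$ be integers. Put $$\lambda_1=-n+p-i+1$$ and let $L_\lambda$ be the irreducible highest weight $(\mathfrak g,K)$-module with highest weight $$\lambda=(\underbrace{\lambda_1,\dots,\lambda_1}_{p},\lambda_1-a_{n-p},\dots,\lambda_1-a_1).$$ Then $L_\lambda$ is unitary.
   Context: $[x]$ denotes the integer part of $x$. $G$ is the connected simply connected Lie group with (simple) Lie algebra $\mathfrak g_0=\mathfrak{so}^*(2n)$, $K$ is the fixed point subgroup of a Cartan involution, $\mathfrak g_0=\mathfrak k_0\oplus\mathfrak p_0$ the Cartan decomposition; dropping the subscript $0$ means complexification, so $\mathfrak g=\mathfrak{so}(2n,\mathbb C)$, $\mathfrak k=\mathfrak{gl}(n,\mathbb C)$. The compact Cartan subalgebra $\mathfrak t\subset\mathfrak k$ and its dual are identified with $\mathbb C^n$ in standard coordinates. The positive compact roots are $\varepsilon_i-\varepsilon_j$ ($i<j$) and the positive noncompact roots are $\varepsilon_i+\varepsilon_j$ ($i<j$). $\mathfrak p^\pm$ is the sum of the root spaces for the positive (resp. negative) noncompact roots. For a $\mathfrak k$-dominant integral $\lambda$, $F_\lambda$ is the irreducible finite-dimensional $\mathfrak k$-module of highest weight $\lambda$, $N(\lambda)=U(\mathfrak g)\otimes_{U(\mathfrak k\oplus\mathfrak p^+)}F_\lambda$, and $L_\lambda=L(\lambda)$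 is its unique irreducible quotient. A $(\mathfrak g,K)$-module is called unitary if it is isomorphic to the $(\mathfrak g,K)$-module of $K$-finite vectors of a unitary representation of $G$. *)

theory Defs
  imports "HOL-Analysis.Analysis" "HOL-Library.Poly_Mapping" "HOL-Library.Function_Algebras"
begin

section \<open>The Lie algebras and the linear group\<close>

text \<open>
  The index type \<open>'n\<close> (finite, linearly ordered) plays the role of \<open>{1, ..., n}\<close>, and \<open>2n \<times> 2n\<close>
  matrices are indexed by \<open>'n + 'n\<close>.  Note that \<open>**\<close> is the matrix product, whereas \<open>*\<close> on vectors
  and matrices is componentwise.
\<close>

type_synonym 'n mat2 = "complex ^ ('n + 'n) ^ ('n + 'n)"

definition block ::
  "complex^'n^'n \<Rightarrow> complex^'n^'n \<Rightarrow> complex^'n^'n \<Rightarrow> complex^'n^'n \<Rightarrow> 'n::finite mat2" where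
  "block A B C D = (\<chi> r s.
     case r of Inl i \<Rightarrow> (case s of Inl j \<Rightarrow> A $ i $ j | Inr j \<Rightarrow> B $ i $ j)
             | Inr i \<Rightarrow> (case s of Inl j \<Rightarrow> C $ i $ j | Inr j \<Rightarrow> D $ i $ j))"

definition cscale :: "complex \<Rightarrow> complex^'m^'m \<Rightarrow> complex^'m^'m" where
  "cscale c A = (\<chi> i j. c * A $ i $ j)"

definition conj_transpose :: "complex^'m^'m \<Rightarrow> complex^'m^'m" where
  "conj_transpose A = (\<chi> i j. cnj (A $ j $ i))"

definition bracket :: "complex^'m^'m \<Rightarrow> complex^'m^'m \<Rightarrow> complex^'m^'m" where
  "bracket X Y = X ** Y - Y ** X"

definition sym_form :: "'n::finite mat2" where
  "sym_form = block 0 (mat 1) (mat 1) 0"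

definition herm_form :: "'n::finite mat2" where
  "herm_form = block (mat 1) 0 0 (- mat 1)"

text \<open>
  \<open>so(2n, C)\<close> is realized with respect to the symmetric form \<open>sym_form\<close>, so that it consists of the
  block matrices \<open>(A, B; C, -A\<^sup>T)\<close> with \<open>B\<close>, \<open>C\<close> skew-symmetric, and the diagonal matrices form a
  Cartan subalgebra.
\<close>

definition lie_g :: "'n::finite mat2 set" where
  "lie_g = {X. transpose X ** sym_form + sym_form ** X = 0}"

text \<open>
  \<open>SO*(2n)\<close> as \<open>SO(2n, C) \<inter> SU(n, n)\<close>.  The usual description
  \<open>g\<^sup>T g = 1\<close>, \<open>g\<^sup>* J g = J\<close> with \<open>J = (0, 1; -1, 0)\<close> is turned into this one by the base change to
  the basis \<open>(e\<^sub>j \<plusminus> i e\<^sub>n\<^sub>+\<^sub>j) / \<surd>2\<close>, which makes \<open>i J\<close> diagonal.  In this realization the Cartan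
  involution is conjugation by \<open>herm_form\<close>, its fixed points in \<open>so(2n, C)\<close> are block diagonal,
  and the compact Cartan subalgebra is diagonal.
\<close>

definition so_star_group :: "'n::finite mat2 set" where
  "so_star_group = {g. transpose g ** sym_form ** g = sym_form \<and>
                       conj_transpose g ** herm_form ** g = herm_form \<and> det g = 1}"

definition lie_g0 :: "'n::finite mat2 set" where
  "lie_g0 = {X \<in> lie_g. conj_transpose X ** herm_form + herm_form ** X = 0}"

definition cartan_inv :: "'n::finite mat2 \<Rightarrow> 'n mat2" where
  "cartan_inv X = herm_form ** X ** herm_form"

definition lie_k0 :: "'n::finite mat2 set" where
  "lie_k0 = {X \<in> lie_g0. cartan_inv X = X}"

text \<open>
  \<open>gl(n, C)\<close> as the complexification of \<open>lie_k0\<close>.  The matrix unit \<open>E\<^sub>i\<^sub>j\<close> spans the root space of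
  \<open>\<epsilon>\<^sub>i - \<epsilon>\<^sub>j\<close>; the element of \<open>lie_p_plus\<close> with \<open>B = E\<^sub>i\<^sub>j - E\<^sub>j\<^sub>i\<close> spans the one of \<open>\<epsilon>\<^sub>i + \<epsilon>\<^sub>j\<close>.
\<close>

definition gl_embed :: "complex^'n^'n \<Rightarrow> 'n::finite mat2" where
  "gl_embed A = block A 0 0 (- transpose A)"

definition lie_k :: "'n::finite mat2 set" where
  "lie_k = range gl_embed"

definition lie_p_plus :: "'n::finite mat2 set" where
  "lie_p_plus = {block 0 B 0 0 | B. transpose B = - B}"

definition mat_unit :: "'n \<Rightarrow> 'n \<Rightarrow> complex^'n^'n" where
  "mat_unit i j = (\<chi> k l. if k = i \<and> l = j then 1 else 0)"

definition diag_mat :: "complex^'n \<Rightarrow> complex^'n^'n" where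
  "diag_mat h = (\<chi> i j. if i = j then h $ i else 0)"

section \<open>Modules over Lie algebras of matrices\<close>

text \<open>The values of an action \<open>act\<close> outside the Lie algebra \<open>S\<close> are irrelevant.\<close>

definition lie_module ::
  "(complex^'m^'m) set \<Rightarrow> (complex \<Rightarrow> 'v \<Rightarrow> 'v) \<Rightarrow> (complex^'m^'m \<Rightarrow> 'v::ab_group_add \<Rightarrow> 'v) \<Rightarrow> bool"
where
  "lie_module S sc act \<longleftrightarrow>
     vector_space sc \<and>
     (\<forall>X\<in>S. Vector_Spaces.linear sc sc (act X)) \<and>
     (\<forall>X\<in>S. \<forall>Y\<in>S. \<forall>v. act (X + Y) v = act X v + act Y v) \<and>
     (\<forall>c. \<forall>X\<in>S. \<forall>v. act (cscale c X) v = sc c (act X v)) \<and>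
     (\<forall>X\<in>S. \<forall>Y\<in>S. \<forall>v. act (bracket X Y) v = act X (act Y v) - act Y (act X v))"

definition irreducible_lie_module ::
  "(complex^'m^'m) set \<Rightarrow> (complex \<Rightarrow> 'v \<Rightarrow> 'v) \<Rightarrow> (complex^'m^'m \<Rightarrow> 'v::ab_group_add \<Rightarrow> 'v) \<Rightarrow> bool"
where
  "irreducible_lie_module S sc act \<longleftrightarrow>
     lie_module S sc act \<and> (UNIV :: 'v set) \<noteq> {0} \<and>
     (\<forall>W. module.subspace sc W \<and> (\<forall>X\<in>S. act X ` W \<subseteq> W) \<longrightarrow> W = {0} \<or> W = UNIV)"

text \<open>The \<open>k\<close>-module \<open>F\<^sub>\<lambda>\<close>.\<close>

definition is_F ::
  "('n::{finite,linorder} \<Rightarrow> int) \<Rightarrow> (complex \<Rightarrow> 'f \<Rightarrow> 'f) \<Rightarrow> ('n mat2 \<Rightarrow> 'f::ab_group_add \<Rightarrow> 'f) \<Rightarrow> bool"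
where
  "is_F lam sc act \<longleftrightarrow>
     irreducible_lie_module lie_k sc act \<and>
     (\<exists>B. finite B \<and> module.span sc B = UNIV) \<and>
     (\<exists>v. v \<noteq> 0 \<and>
        (\<forall>h. act (gl_embed (diag_mat h)) v = sc (\<Sum>j\<in>UNIV. of_int (lam j) * h $ j) v) \<and>
        (\<forall>i j. i < j \<longrightarrow> act (gl_embed (mat_unit i j)) v = 0))"

section \<open>The generalized Verma module and its irreducible quotient\<close>

text \<open>
  \<open>U(g) \<otimes>\<^bsub>U(k+p\<^sup>+)\<^esub> F\<close> is presented as the quotient of the vector space with basis the pairs
  \<open>(w, f)\<close>, where \<open>w\<close> is a word in elements of \<open>g\<close> and \<open>f \<in> F\<close>, by the span of the relations expressing
  multilinearity (tensor algebra), \<open>XY - YX = [X, Y]\<close> (enveloping algebra), linearity in \<open>f\<close>,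
  and balancedness over \<open>k + p\<^sup>+\<close>, where \<open>p\<^sup>+\<close> acts on \<open>F\<close> by \<open>0\<close>.
\<close>

type_synonym ('n, 'f) words = "('n mat2 list \<times> 'f) \<Rightarrow>\<^sub>0 complex"

definition wscale :: "complex \<Rightarrow> ('k \<Rightarrow>\<^sub>0 complex) \<Rightarrow> ('k \<Rightarrow>\<^sub>0 complex)" where
  "wscale c x = Poly_Mapping.map (\<lambda>z. c * z) x"

definition pure :: "'n::finite mat2 list \<Rightarrow> 'f \<Rightarrow> ('n, 'f) words" where
  "pure w f = Poly_Mapping.single (w, f) 1"

definition words_space :: "('n::finite, 'f) words set" where
  "words_space = module.span wscale {pure w f | w f. set w \<subseteq> lie_g}"

inductive_set verma_rel ::
  "(complex \<Rightarrow> 'f \<Rightarrow> 'f) \<Rightarrow> ('n::finite mat2 \<Rightarrow> 'f::ab_group_add \<Rightarrow> 'f) \<Rightarrow> ('n, 'f) words set"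
  for sc act
where
  letter_add: "\<lbrakk>set u \<subseteq> lie_g; set w \<subseteq> lie_g; X \<in> lie_g; Y \<in> lie_g\<rbrakk> \<Longrightarrow>
    pure (u @ [X + Y] @ w) f - pure (u @ [X] @ w) f - pure (u @ [Y] @ w) f \<in> verma_rel sc act"
| letter_scale: "\<lbrakk>set u \<subseteq> lie_g; set w \<subseteq> lie_g; X \<in> lie_g\<rbrakk> \<Longrightarrow>
    pure (u @ [cscale c X] @ w) f - wscale c (pure (u @ [X] @ w) f) \<in> verma_rel sc act"
| commutator: "\<lbrakk>set u \<subseteq> lie_g; set w \<subseteq> lie_g; X \<in> lie_g; Y \<in> lie_g\<rbrakk> \<Longrightarrow>
    pure (u @ [X, Y] @ w) f - pure (u @ [Y, X] @ w) f - pure (u @ [bracket X Y] @ w) f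
      \<in> verma_rel sc act"
| vec_add: "set w \<subseteq> lie_g \<Longrightarrow> pure w (f + f') - pure w f - pure w f' \<in> verma_rel sc act"
| vec_scale: "set w \<subseteq> lie_g \<Longrightarrow> pure w (sc c f) - wscale c (pure w f) \<in> verma_rel sc act"
| balanced_k: "\<lbrakk>set w \<subseteq> lie_g; X \<in> lie_k\<rbrakk> \<Longrightarrow> pure (w @ [X]) f - pure w (act X f) \<in> verma_rel sc act"
| balanced_p: "\<lbrakk>set w \<subseteq> lie_g; X \<in> lie_p_plus\<rbrakk> \<Longrightarrow> pure (w @ [X]) f \<in> verma_rel sc act"

definition verma_class ::
  "(complex \<Rightarrow> 'f \<Rightarrow> 'f) \<Rightarrow> ('n::finite mat2 \<Rightarrow> 'f::ab_group_add \<Rightarrow> 'f) \<Rightarrow>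
   ('n, 'f) words \<Rightarrow> ('n, 'f) words set"
where
  "verma_class sc act x = {y \<in> words_space. y - x \<in> module.span wscale (verma_rel sc act)}"

text \<open>\<open>N(\<lambda>)\<close>, for \<open>F = F\<^sub>\<lambda>\<close> given by \<open>sc\<close> and \<open>act\<close>.\<close>

definition gen_verma ::
  "(complex \<Rightarrow> 'f \<Rightarrow> 'f) \<Rightarrow> ('n::finite mat2 \<Rightarrow> 'f::ab_group_add \<Rightarrow> 'f) \<Rightarrow> ('n, 'f) words set set"
where
  "gen_verma sc act = verma_class sc act ` words_space"

definition left_mult :: "'n::finite mat2 \<Rightarrow> ('n, 'f) words \<Rightarrow> ('n, 'f) words" where
  "left_mult X x = (\<Sum>(w, f)\<in>Poly_Mapping.keys x. wscale (Poly_Mapping.lookup x (w, f)) (pure (X # w) f))"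

text \<open>
  \<open>\<Psi>\<close> is a surjective \<open>g\<close>-homomorphism from \<open>N(\<lambda>)\<close> onto the module; the vector space operations and
  the action of \<open>g\<close> on \<open>N(\<lambda>)\<close> are those induced on classes.
\<close>

definition verma_epi ::
  "(complex \<Rightarrow> 'f \<Rightarrow> 'f) \<Rightarrow> ('n::finite mat2 \<Rightarrow> 'f::ab_group_add \<Rightarrow> 'f) \<Rightarrow>
   (complex \<Rightarrow> 'v \<Rightarrow> 'v) \<Rightarrow> ('n mat2 \<Rightarrow> 'v::ab_group_add \<Rightarrow> 'v) \<Rightarrow>
   (('n, 'f) words set \<Rightarrow> 'v) \<Rightarrow> bool"
where
  "verma_epi scF actF scV actV \<Psi> \<longleftrightarrow>
     (let cl = verma_class scF actF in
       \<Psi> ` gen_verma scF actF = UNIV \<and>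
       (\<forall>x\<in>words_space. \<forall>y\<in>words_space. \<Psi> (cl (x + y)) = \<Psi> (cl x) + \<Psi> (cl y)) \<and>
       (\<forall>c. \<forall>x\<in>words_space. \<Psi> (cl (wscale c x)) = scV c (\<Psi> (cl x))) \<and>
       (\<forall>X\<in>lie_g. \<forall>x\<in>words_space. \<Psi> (cl (left_mult X x)) = actV X (\<Psi> (cl x))))"

text \<open>\<open>L(\<lambda>)\<close>: the irreducible quotient of \<open>N(\<lambda>)\<close>, for \<open>F = F\<^sub>\<lambda>\<close> given by \<open>scF\<close> and \<open>actF\<close>.\<close>

definition is_L ::
  "('n::{finite,linorder} \<Rightarrow> int) \<Rightarrow>
   (complex \<Rightarrow> 'f \<Rightarrow> 'f) \<Rightarrow> ('n mat2 \<Rightarrow> 'f::ab_group_add \<Rightarrow> 'f) \<Rightarrow>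
   (complex \<Rightarrow> 'v \<Rightarrow> 'v) \<Rightarrow> ('n mat2 \<Rightarrow> 'v::ab_group_add \<Rightarrow> 'v) \<Rightarrow> bool"
where
  "is_L lam scF actF scV actV \<longleftrightarrow>
     is_F lam scF actF \<and>
     irreducible_lie_module lie_g scV actV \<and>
     (\<exists>\<Psi>. verma_epi scF actF scV actV \<Psi>)"

section \<open>The simply connected group and its unitary representations\<close>

text \<open>
  The connected simply connected group \<open>G\<close> is the universal covering group of the connected group
  \<open>SO*(2n)\<close>.  Its elements are represented by paths in \<open>SO*(2n)\<close> starting at the identity; two paths
  represent the same element iff they are homotopic relative to the endpoints, and the product is
  pointwise.  The topology of \<open>G\<close> is the quotient of the topology of uniform convergence of paths.
\<close>

definition cover_paths :: "(real \<Rightarrow> 'n::finite mat2) set" where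
  "cover_paths = {\<gamma>. path \<gamma> \<and> path_image \<gamma> \<subseteq> so_star_group \<and> pathstart \<gamma> = mat 1}"

text \<open>\<open>K\<close>: the fixed points of the lift \<open>[\<gamma>] \<mapsto> [cartan_inv \<circ> \<gamma>]\<close> of the Cartan involution to \<open>G\<close>.\<close>

definition cover_K :: "(real \<Rightarrow> 'n::finite mat2) set" where
  "cover_K = {\<gamma> \<in> cover_paths. homotopic_paths so_star_group \<gamma> (cartan_inv \<circ> \<gamma>)}"

definition mat_exp :: "complex^'m^'m \<Rightarrow> complex^'m^'m" where
  "mat_exp X = suminf (\<lambda>k. (1 / fact k) *\<^sub>R ((\<lambda>Y. X ** Y) ^^ k) (mat 1))"

text \<open>The path representing the value at \<open>X\<close> of the exponential map of \<open>G\<close>.\<close>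

definition exp_path :: "'n::finite mat2 \<Rightarrow> real \<Rightarrow> 'n mat2" where
  "exp_path X = (\<lambda>s. mat_exp (s *\<^sub>R X))"

definition ip_norm :: "('h \<Rightarrow> 'h \<Rightarrow> complex) \<Rightarrow> 'h \<Rightarrow> real" where
  "ip_norm ip x = sqrt (Re (ip x x))"

text \<open>
  A complex Hilbert space whose underlying vector space is a subspace \<open>H\<close> of an ambient vector space;
  the inner product \<open>ip\<close> is linear in the first argument.  The ambient space carries no topology.
\<close>

definition hilbert_space ::
  "(complex \<Rightarrow> 'h \<Rightarrow> 'h) \<Rightarrow> 'h::ab_group_add set \<Rightarrow> ('h \<Rightarrow> 'h \<Rightarrow> complex) \<Rightarrow> bool"
where
  "hilbert_space sc H ip \<longleftrightarrow>
     vector_space sc \<and> module.subspace sc H \<and>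
     (\<forall>x\<in>H. \<forall>y\<in>H. \<forall>z\<in>H. ip (x + y) z = ip x z + ip y z) \<and>
     (\<forall>c. \<forall>x\<in>H. \<forall>y\<in>H. ip (sc c x) y = c * ip x y) \<and>
     (\<forall>x\<in>H. \<forall>y\<in>H. ip y x = cnj (ip x y)) \<and>
     (\<forall>x\<in>H. x \<noteq> 0 \<longrightarrow> Re (ip x x) > 0) \<and>
     (\<forall>x::nat \<Rightarrow> 'h. (\<forall>k. x k \<in> H) \<and>
        (\<forall>e>0. \<exists>M. \<forall>k\<ge>M. \<forall>l\<ge>M. ip_norm ip (x k - x l) < e) \<longrightarrow>
        (\<exists>y\<in>H. (\<lambda>k. ip_norm ip (x k - y)) \<longlonglongrightarrow> 0))"

definition unitary_rep ::
  "(complex \<Rightarrow> 'h \<Rightarrow> 'h) \<Rightarrow> 'h::ab_group_add set \<Rightarrow> ('h \<Rightarrow> 'h \<Rightarrow> complex) \<Rightarrow>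
   ((real \<Rightarrow> 'n::finite mat2) \<Rightarrow> 'h \<Rightarrow> 'h) \<Rightarrow> bool"
where
  "unitary_rep sc H ip \<pi> \<longleftrightarrow>
     hilbert_space sc H ip \<and>
     (\<forall>\<gamma>\<in>cover_paths. bij_betw (\<pi> \<gamma>) H H \<and>
        (\<forall>x\<in>H. \<forall>y\<in>H. \<pi> \<gamma> (x + y) = \<pi> \<gamma> x + \<pi> \<gamma> y) \<and>
        (\<forall>c. \<forall>x\<in>H. \<pi> \<gamma> (sc c x) = sc c (\<pi> \<gamma> x)) \<and>
        (\<forall>x\<in>H. \<forall>y\<in>H. ip (\<pi> \<gamma> x) (\<pi> \<gamma> y) = ip x y)) \<and>
     (\<forall>\<gamma>\<in>cover_paths. \<forall>\<delta>\<in>cover_paths. \<forall>x\<in>H. \<pi> (\<lambda>t. \<gamma> t ** \<delta> t) x = \<pi> \<gamma> (\<pi> \<delta> x)) \<and>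
     (\<forall>\<gamma>\<in>cover_paths. \<forall>\<delta>\<in>cover_paths.
        homotopic_paths so_star_group \<gamma> \<delta> \<longrightarrow> (\<forall>x\<in>H. \<pi> \<gamma> x = \<pi> \<delta> x)) \<and>
     (\<forall>x\<in>H. \<forall>\<gamma>\<in>cover_paths. \<forall>e>0. \<exists>d>0. \<forall>\<delta>\<in>cover_paths.
        (\<forall>t\<in>{0..1}. dist (\<delta> t) (\<gamma> t) < d) \<longrightarrow> ip_norm ip (\<pi> \<delta> x - \<pi> \<gamma> x) < e)"

definition K_finite ::
  "(complex \<Rightarrow> 'h \<Rightarrow> 'h) \<Rightarrow> 'h::ab_group_add set \<Rightarrow> ((real \<Rightarrow> 'n::finite mat2) \<Rightarrow> 'h \<Rightarrow> 'h) \<Rightarrow> 'h set"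
where
  "K_finite sc H \<pi> = {x \<in> H. \<exists>B. finite B \<and> (\<forall>\<kappa>\<in>cover_K. \<pi> \<kappa> x \<in> module.span sc B)}"

text \<open>
  \<open>T\<close> is an isomorphism of \<open>(g, K)\<close>-modules onto the \<open>K\<close>-finite vectors.  Every \<open>K\<close>-finite vector is
  in particular required to be differentiable (hence smooth, the \<open>K\<close>-finite vectors being stable
  under \<open>g\<close>), and \<open>T\<close> intertwines the action of \<open>g\<close> with the differential of \<open>\<pi>\<close>.  The last clause is
  the \<open>K\<close>-equivariance: the action of \<open>K\<close> on a highest weight module is the one obtained by
  exponentiating the locally finite action of \<open>k\<close>, and \<open>K\<close> is connected, hence generated by \<open>exp k\<^sub>0\<close>.
\<close>

definition gK_iso ::
  "(complex \<Rightarrow> 'v \<Rightarrow> 'v) \<Rightarrow> ('n::finite mat2 \<Rightarrow> 'v::ab_group_add \<Rightarrow> 'v) \<Rightarrow>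
   (complex \<Rightarrow> 'h \<Rightarrow> 'h) \<Rightarrow> 'h::ab_group_add set \<Rightarrow> ('h \<Rightarrow> 'h \<Rightarrow> complex) \<Rightarrow>
   ((real \<Rightarrow> 'n mat2) \<Rightarrow> 'h \<Rightarrow> 'h) \<Rightarrow> ('v \<Rightarrow> 'h) \<Rightarrow> bool"
where
  "gK_iso scV actV sc H ip \<pi> T \<longleftrightarrow>
     Vector_Spaces.linear scV sc T \<and> bij_betw T UNIV (K_finite sc H \<pi>) \<and>
     (\<forall>X\<in>lie_g0. \<forall>v.
        ((\<lambda>t::real. ip_norm ip
            (sc (of_real (1 / t)) (\<pi> (exp_path (t *\<^sub>R X)) (T v) - T v) - T (actV X v)))
         \<longlongrightarrow> 0) (at 0)) \<and>
     (\<forall>X\<in>lie_k0. \<forall>v.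
        (\<lambda>m. ip_norm ip
            (\<pi> (exp_path X) (T v) - (\<Sum>j<m. sc (of_real (1 / fact j)) (T ((actV X ^^ j) v)))))
        \<longlonglongrightarrow> 0)"

text \<open>
  The Hilbert space is sought inside \<open>nat \<Rightarrow> complex\<close> (with pointwise operations and an arbitrary
  inner product on a subspace).  Up to isomorphism this covers all separable Hilbert spaces, and it
  is no restriction: for a module of countable dimension one may replace the representation
  space by the closure of the \<open>K\<close>-finite vectors.
\<close>

definition unitary_module ::
  "(complex \<Rightarrow> 'v \<Rightarrow> 'v) \<Rightarrow> ('n::finite mat2 \<Rightarrow> 'v::ab_group_add \<Rightarrow> 'v) \<Rightarrow> bool"
where
  "unitary_module scV actV \<longleftrightarrow>
     (\<exists>(H :: (nat \<Rightarrow> complex) set) ip \<pi> T.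
        unitary_rep (\<lambda>c x k. c * x k) H ip \<pi> \<and>
        gK_iso scV actV (\<lambda>c x k. c * x k) H ip \<pi> T)"

text \<open>The position in \<open>{1, ..., n}\<close> of an index.\<close>

definition pos :: "'n::{finite,linorder} \<Rightarrow> nat" where
  "pos j = card {k. k \<le> j}"

end

theory Submission
  imports Defs "HOL-Complex_Analysis.Cauchy_Integral_Formula"
begin

text \<open>
  Put \<open>k = - \<lambda>\<^sub>1\<close>, so that \<open>n - p \<le> k\<close>.  The Lie algebra \<open>so(2n, C)\<close> acts on the polynomials in the
  entries of an \<open>n \<times> 2k\<close> matrix by the oscillator representation of the dual pair \<open>(O\<^sup>*(2n), Sp(k))\<close>:
  \<open>gl(n, C)\<close> by polarization operators shifted by \<open>- k\<close> times the trace, \<open>p\<^sup>+\<close> by differential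
  operators of second order, and \<open>p\<^sup>-\<close> by multiplication with quadratic polynomials.  For the Fock inner
  product multiplication by a variable is adjoint to the derivative, and hence \<open>so\<^sup>*(2n)\<close> acts by
  skew-adjoint operators.  A product of powers of the minors formed by the last \<open>s\<close> rows and the first
  \<open>s\<close> columns, where \<open>s \<le> n - p\<close>, is a highest weight vector of weight \<open>\<lambda>\<close>.  The submodule
  \<open>M\<close> which it generates is \<open>L\<^sub>\<lambda>\<close>: in the submodule of \<open>L\<^sub>\<lambda> \<times> M\<close> generated by the pair of the two
  highest weight vectors, an element \<open>(0, w)\<close> has \<open>w\<close> orthogonal to the highest weight vector for weight
  reasons, hence orthogonal to \<open>M\<close>, and so \<open>w = 0\<close>; thus this submodule is the graph of an isomorphism.

  To integrate the action, decompose an element of the group with blocks \<open>A, B, C, D\<close> as the product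
  of a lower triangular element with \<open>Y = C A\<^sup>-\<^sup>1\<close>, a block diagonal one, and an upper triangular one with
  \<open>Z = A\<^sup>-\<^sup>1 B\<close>.  This suggests a formula for the matrix coefficients which involves only the
  exponentials of the locally nilpotent operators belonging to \<open>Z\<close> and to the conjugate of \<open>Y\<close>, a
  linear substitution, and \<open>det A\<^sup>-\<^sup>k\<close>; in particular it is defined on the group \<open>SO\<^sup>*(2n)\<close> itself.
  Its multiplicativity follows since the matrix coefficients of \<open>g\<close> are determined, up to a scalar, by
  the linear action of \<open>g\<close> on the span of the variables and derivatives, and the scalar is the
  coefficient at the constant polynomial 1.  The \<open>K\<close>-finite vectors in the closure of \<open>M\<close> are
  found with the centre of \<open>K\<close>, which acts by the degree.
\<close>

section \<open>Polynomials and the Fock inner product\<close>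

text \<open>The obstacle is integration. The exponential of multiplication by a quadratic polynomial
  leaves the polynomials, so a group element does not act on them. Only matrix coefficients against
  polynomials are used: there the offending factor crosses the inner product and becomes the
  exponential of a locally nilpotent operator. A coefficient is then a finite expression,
  holomorphic in the group element, and group-level facts follow from three sources: uniqueness of a
  sesquilinear form with prescribed commutation rules, the differential equation along curves, and
  Taylor expansion. Convergence in Hilbert space comes from geometry: on the real group
  \<open>C A^-1\<close> is a strict contraction, so the Taylor disc along the lower triangular
  direction has radius greater than 1 and the series may be evaluated at 1. The number of columns is
  tied to the weight by \<open>k = n - p + i - 1\<close>. Minors up to size \<open>n - p\<close>
  need that many columns, and \<open>i \<ge> 1\<close> provides them.\<close>

type_synonym 'v pol = "('v \<Rightarrow>\<^sub>0 nat) \<Rightarrow>\<^sub>0 complex"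

definition psc :: "complex \<Rightarrow> 'v pol \<Rightarrow> 'v pol" where
  "psc c p = Poly_Mapping.single 0 c * p"

definition pvar :: "'v \<Rightarrow> 'v pol" where
  "pvar v = Poly_Mapping.single (Poly_Mapping.single v 1) 1"

lemma lookup_psc [simp]: "Poly_Mapping.lookup (psc c p) m = c * Poly_Mapping.lookup p m"
  unfolding psc_def mult_map_scale_conv_mult[symmetric]
  by (transfer, auto simp: when_def)

lemma psc_add_right: "psc c (p + q) = psc c p + psc c q"
  and psc_add_left: "psc (c + d) p = psc c p + psc d p"
  and psc_psc [simp]: "psc c (psc d p) = psc (c * d) p"
  and psc_one [simp]: "psc 1 p = p"
  and psc_zero_left [simp]: "psc 0 p = 0"
  and psc_zero [simp]: "psc c 0 = 0"
  and psc_minus_left: "psc (- c) p = - psc c p"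
  and psc_diff_right: "psc c (p - q) = psc c p - psc c q"
  by (rule poly_mapping_eqI; simp add: lookup_add lookup_minus algebra_simps)+

lemma psc_mult_left: "psc c p * q = psc c (p * q)"
  by (simp add: psc_def mult.assoc)

lemma psc_mult_right: "p * psc c q = psc c (p * q)"
  by (simp add: psc_def mult.left_commute)

lemma psc_sum: "psc c (sum f A) = (\<Sum>x\<in>A. psc c (f x))"
  by (induction A rule: infinite_finite_induct) (simp_all add: psc_add_right)

lemma psc_sum_left: "psc (sum f A) p = (\<Sum>x\<in>A. psc (f x) p)"
  by (induction A rule: infinite_finite_induct) (simp_all add: psc_add_left)

lemma vector_space_psc: "vector_space psc"
  by unfold_locales (simp_all add: psc_add_right psc_add_left)

global_interpretation pol: vector_space psc
  by (rule vector_space_psc)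

lemma psc_single: "psc c (Poly_Mapping.single m d) = Poly_Mapping.single m (c * d)"
  by (rule poly_mapping_eqI) (simp add: lookup_single when_def)

lemma pvar_times_single:
  "pvar v * Poly_Mapping.single m c = Poly_Mapping.single (m + Poly_Mapping.single v 1) c"
  by (simp add: pvar_def mult_single add.commute)

lemma pol_monom_decomp: "p = (\<Sum>m\<in>Poly_Mapping.keys p. Poly_Mapping.single m (Poly_Mapping.lookup p m))"
  by (rule poly_mapping_eqI) (auto simp: lookup_sum lookup_single when_def in_keys_iff sum.If_cases)

lemma poly_mapping_add_induct [case_names single sum]:
  assumes "\<And>m c. P (Poly_Mapping.single m c)" and "\<And>p q. P p \<Longrightarrow> P q \<Longrightarrow> P (p + q)"
  shows "P (p :: 'v pol)"
proof -
  have "P (\<Sum>m\<in>F. Poly_Mapping.single m (Poly_Mapping.lookup p m))" if "finite F" for F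
    using that assms(1)[of 0 0] by (induction F) (auto intro: assms)
  then have "P (\<Sum>m\<in>Poly_Mapping.keys p. Poly_Mapping.single m (Poly_Mapping.lookup p m))" by simp
  then show ?thesis by (simp flip: pol_monom_decomp)
qed

text \<open>Induction on the total degree, taking one unit from the exponent of a variable that
  occurs.\<close>

lemma mono_induct [case_names zero step]:
  fixes m :: "'v \<Rightarrow>\<^sub>0 nat"
  assumes "P 0" and "\<And>m v. P m \<Longrightarrow> P (m + Poly_Mapping.single v 1)"
  shows "P m"
proof (induction m rule: measure_induct_rule[where f = "\<lambda>m. \<Sum>v\<in>Poly_Mapping.keys m. Poly_Mapping.lookup m v"])
  case (less m)
  show ?case
  proof (cases "m = 0")
    case True
    then show ?thesis using assms(1) by simp
  next
    case False
    then obtain v where v: "v \<in> Poly_Mapping.keys m" by fastforce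
    define m' where "m' = m - Poly_Mapping.single v 1"
    have v1: "Poly_Mapping.lookup m v \<ge> 1" using v by (simp add: in_keys_iff)
    have m: "m = m' + Poly_Mapping.single v 1"
      by (rule poly_mapping_eqI) (use v1 in \<open>auto simp: m'_def lookup_add lookup_minus lookup_single when_def\<close>)
    have "(\<Sum>u\<in>Poly_Mapping.keys m'. Poly_Mapping.lookup m' u) = (\<Sum>u\<in>Poly_Mapping.keys m. Poly_Mapping.lookup m' u)"
      by (rule sum.mono_neutral_left)
        (auto simp: m'_def in_keys_iff lookup_minus lookup_single when_def)
    also have "\<dots> < (\<Sum>u\<in>Poly_Mapping.keys m. Poly_Mapping.lookup m u)"
      by (rule sum_strict_mono_ex1)
        (use v v1 in \<open>auto simp: m'_def lookup_minus lookup_single when_def intro!: bexI[of _ v]\<close>)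
    finally have "P m'" by (rule less)
    then show ?thesis unfolding m by (rule assms(2))
  qed
qed

text \<open>The workhorse: an operator identity then only has to be checked on 1 and against
  multiplication by one variable.\<close>

lemma pol_induct [case_names one scale add var]:
  assumes "P 1" and scale: "\<And>c p. P p \<Longrightarrow> P (psc c p)"
    and add: "\<And>p q. P p \<Longrightarrow> P q \<Longrightarrow> P (p + q)"
    and var: "\<And>v p. P p \<Longrightarrow> P (pvar v * p)"
  shows "P (p :: 'v pol)"
proof -
  have 1: "P (Poly_Mapping.single m 1)" for m :: "'v \<Rightarrow>\<^sub>0 nat"
  proof (induction m rule: mono_induct)
    case zero
    then show ?case using assms(1) by simp
  next
    case (step m v)
    then have "P (pvar v * Poly_Mapping.single m 1)" by (rule var)
    then show ?case by (simp only: pvar_times_single)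
  qed
  have 2: "P (Poly_Mapping.single m c)" for m :: "'v \<Rightarrow>\<^sub>0 nat" and c
    using scale[OF 1[of m], of c] by (simp add: psc_single)
  show ?thesis by (induction p rule: poly_mapping_add_induct) (auto intro: 2 add)
qed

section \<open>Linear operators on polynomials and partial derivatives\<close>

definition plin :: "('v pol \<Rightarrow> 'w pol) \<Rightarrow> bool" where
  "plin T \<longleftrightarrow> (\<forall>p q. T (p + q) = T p + T q) \<and> (\<forall>c p. T (psc c p) = psc c (T p))"

lemma plin_add: "plin T \<Longrightarrow> T (p + q) = T p + T q"
  and plin_psc: "plin T \<Longrightarrow> T (psc c p) = psc c (T p)"
  by (auto simp: plin_def)

lemma plin_zero: "plin T \<Longrightarrow> T 0 = 0"
  by (metis plin_psc psc_zero_left)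

lemma plin_minus: "plin T \<Longrightarrow> T (- p) = - T p"
  using plin_psc[of T "-1" p] by (simp add: psc_minus_left)

lemma plin_diff: "plin T \<Longrightarrow> T (p - q) = T p - T q"
  using plin_add[of T p "- q"] by (simp add: plin_minus)

lemma plin_sum: "plin T \<Longrightarrow> T (sum f A) = (\<Sum>x\<in>A. T (f x))"
  by (induction A rule: infinite_finite_induct) (simp_all add: plin_zero plin_add)

lemma plinI:
  "(\<And>p q. T (p + q) = T p + T q) \<Longrightarrow> (\<And>c p. T (psc c p) = psc c (T p)) \<Longrightarrow> plin T"
  by (auto simp: plin_def)

lemma plin_funpow: "plin T \<Longrightarrow> plin (T ^^ j)" for T :: "'v pol \<Rightarrow> 'v pol"
  by (induction j) (simp_all add: plin_def)

definition plift :: "(('v \<Rightarrow>\<^sub>0 nat) \<Rightarrow> 'w pol) \<Rightarrow> 'v pol \<Rightarrow> 'w pol" where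
  "plift g p = (\<Sum>m\<in>Poly_Mapping.keys p. psc (Poly_Mapping.lookup p m) (g m))"

lemma plift_superset:
  assumes "finite F" "Poly_Mapping.keys p \<subseteq> F"
  shows "plift g (p :: 'v pol) = (\<Sum>m\<in>F. psc (Poly_Mapping.lookup p m) (g m))"
  unfolding plift_def
  by (rule sum.mono_neutral_left) (use assms in \<open>auto simp: in_keys_iff\<close>)

lemma plift_linear: "plin (plift (g :: ('v \<Rightarrow>\<^sub>0 nat) \<Rightarrow> 'w pol))"
proof (rule plinI)
  fix p q :: "'v pol"
  let ?F = "Poly_Mapping.keys p \<union> Poly_Mapping.keys q"
  have "Poly_Mapping.keys (p + q) \<subseteq> ?F" by (rule keys_add)
  then show "plift g (p + q) = plift g p + plift g q"
    by (simp add: plift_superset[of ?F] lookup_add psc_add_left sum.distrib)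
next
  fix c and p :: "'v pol"
  have "Poly_Mapping.keys (psc c p) \<subseteq> Poly_Mapping.keys p" by (auto simp: in_keys_iff)
  then show "plift g (psc c p) = psc c (plift g p)"
    by (simp add: plift_superset[of "Poly_Mapping.keys p"] psc_sum)
qed

lemma plift_single: "plift g (Poly_Mapping.single m c) = psc c (g m)"
  by (simp add: plift_superset[of "{m}"])

text \<open>Exponents are subtracted with truncation at 0; where that happens the coefficient
  \<open>of_nat (Poly_Mapping.lookup m v)\<close> is 0.\<close>

definition der :: "'v \<Rightarrow> 'v pol \<Rightarrow> 'v pol" where
  "der v = plift (\<lambda>m. Poly_Mapping.single (m - Poly_Mapping.single v 1) (of_nat (Poly_Mapping.lookup m v)))"

lemma plin_der [simp]: "plin (der v)"
  by (simp add: der_def plift_linear)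

lemmas der_add = plin_add[OF plin_der] and der_psc = plin_psc[OF plin_der]
  and der_sum = plin_sum[OF plin_der] and der_zero [simp] = plin_zero[OF plin_der]
  and der_minus = plin_minus[OF plin_der] and der_diff = plin_diff[OF plin_der]

lemma der_single:
  "der v (Poly_Mapping.single m c)
     = Poly_Mapping.single (m - Poly_Mapping.single v 1) (c * of_nat (Poly_Mapping.lookup m v))"
  by (simp add: der_def plift_single psc_single)

lemma der_one [simp]: "der v 1 = 0"
  using der_single[of v 0 1] by simp

lemma pol_lin_eqI:
  assumes "plin S" "plin T" "\<And>m. S (Poly_Mapping.single m 1) = T (Poly_Mapping.single m 1)"
  shows "S p = T p"
proof -
  have "S (Poly_Mapping.single m c) = T (Poly_Mapping.single m c)" for m c
    using assms(3)[of m] plin_psc[OF assms(1), of c "Poly_Mapping.single m 1"]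
      plin_psc[OF assms(2), of c "Poly_Mapping.single m 1"] by (simp add: psc_single)
  then show ?thesis
    by (subst (1 2) pol_monom_decomp) (simp add: plin_sum assms)
qed

lemma der_pvar_mult: "der v (pvar w * p) = (if v = w then p else 0) + pvar w * der v p"
proof (rule pol_lin_eqI[where S = "\<lambda>p. der v (pvar w * p)"])
  show "plin (\<lambda>p. der v (pvar w * p))"
    by (rule plinI) (simp_all add: distrib_left der_add psc_mult_right der_psc)
  show "plin (\<lambda>p. (if v = w then p else 0) + pvar w * der v p)"
    by (rule plinI) (simp_all add: distrib_left der_add psc_mult_right der_psc psc_add_right)
  fix m :: "'a \<Rightarrow>\<^sub>0 nat"
  have *: "pvar w * der v (Poly_Mapping.single m 1) =
    Poly_Mapping.single (m - Poly_Mapping.single v 1 + Poly_Mapping.single w 1) (of_nat (Poly_Mapping.lookup m v))"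
    by (simp add: der_single pvar_times_single)
  show "der v (pvar w * Poly_Mapping.single m 1)
      = (if v = w then Poly_Mapping.single m 1 else 0) + pvar w * der v (Poly_Mapping.single m 1)"
  proof (cases "v = w")
    case True
    show ?thesis
    proof (cases "Poly_Mapping.lookup m v = 0")
      case True
      then show ?thesis using \<open>v = w\<close> unfolding * by (simp add: pvar_times_single der_single lookup_add)
    next
      case False
      then have "m - Poly_Mapping.single v 1 + Poly_Mapping.single v 1 = m"
        by (intro poly_mapping_eqI) (auto simp: lookup_add lookup_minus lookup_single when_def)
      then show ?thesis using \<open>v = w\<close> unfolding *
        by (simp add: pvar_times_single der_single lookup_add flip: single_add)
    qed
  next
    case False
    show ?thesis
    proof (cases "Poly_Mapping.lookup m v = 0")
      case True
      then show ?thesis using False unfolding *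
        by (simp add: pvar_times_single der_single lookup_add lookup_single)
    next
      case nz: False
      have "m + Poly_Mapping.single w 1 - Poly_Mapping.single v 1
          = m - Poly_Mapping.single v 1 + Poly_Mapping.single w (1::nat)"
        by (intro poly_mapping_eqI) (use nz False in \<open>auto simp: lookup_add lookup_minus lookup_single when_def\<close>)
      then show ?thesis using False unfolding *
        by (simp add: pvar_times_single der_single lookup_add lookup_single)
    qed
  qed
qed

lemma der_pvar: "der v (pvar w) = (if v = w then 1 else 0)"
  using der_pvar_mult[of v w 1] by simp

lemma der_commute: "der v (der w p) = der w (der v p)"
  by (induction p rule: pol_induct)
    (auto simp: der_add der_psc der_pvar_mult)

lemma der_mult: "der v (p * q) = der v p * q + p * der v q"
  by (induction p rule: pol_induct)
    (auto simp: der_add der_psc der_pvar_mult distrib_left distrib_right psc_mult_left psc_add_right mult.assoc)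

text \<open>The derivatives of \<open>p\<close> have smaller degree than \<open>pvar v * p\<close>.\<close>

lemma pol_induct_der [case_names one scale add var]:
  assumes one: "P 1" and scale: "\<And>c p. P p \<Longrightarrow> P (psc c p)"
    and add: "\<And>p q. P p \<Longrightarrow> P q \<Longrightarrow> P (p + q)"
    and var: "\<And>v p. P p \<Longrightarrow> (\<And>w. P (der w p)) \<Longrightarrow> P (pvar v * p)"
  shows "P (p :: 'v pol)"
proof -
  have zero: "P 0" using scale[OF one, of 0] by simp
  define D where "D ds p = fold der ds p" for ds :: "'v list" and p :: "'v pol"
  have D_add: "D ds (p + q) = D ds p + D ds q" for ds p q
    unfolding D_def by (induction ds arbitrary: p q) (simp_all add: der_add)
  have D_psc: "D ds (psc c p) = psc c (D ds p)" for ds c p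
    unfolding D_def by (induction ds arbitrary: p) (simp_all add: der_psc)
  have D_snoc: "der w (D ds p) = D (ds @ [w]) p" for w ds p
    unfolding D_def by simp
  \<comment> \<open>The claim is strengthened to all iterated derivatives of \<open>p\<close>, which
    makes plain \<open>pol_induct\<close> sufficient.\<close>
  have "\<forall>ds. P (D ds p)"
  proof (induction p rule: pol_induct)
    case one
    have "D ds 1 = 1 \<or> D ds 1 = (0 :: 'v pol)" for ds
    proof -
      have z: "D ds 0 = (0 :: 'v pol)" for ds unfolding D_def by (induction ds) simp_all
      show ?thesis by (cases ds) (auto simp: D_def z[unfolded D_def])
    qed
    then show ?case using \<open>P 1\<close> zero by metis
  next
    case (scale c p)
    then show ?case using assms(2) by (simp add: D_psc)
  next
    case (add p q)
    then show ?case using assms(3) by (simp add: D_add)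
  next
    case (var v p)
    have *: "D ds (pvar v * p) \<in> {q. P q}" for ds
    proof -
      have "P (D ds (pvar v * p)) \<and> (\<exists>E. finite E \<and> (\<forall>e\<in>E. e \<in> range (\<lambda>ds. D ds p)) \<and>
              (\<exists>l. set l \<subseteq> E \<and> D ds (pvar v * p) = pvar v * D ds p + sum_list l))"
      proof -
        \<comment> \<open>Leibniz rule: beside \<open>pvar v * D ds p\<close> only iterated
          derivatives of \<open>p\<close> itself occur, and these are covered by the induction
          hypothesis.\<close>
        have "\<exists>l. set l \<subseteq> range (\<lambda>ds. D ds p) \<and> D ds (pvar v * p) = pvar v * D ds p + sum_list l"
        proof (induction ds rule: rev_induct)
          case Nil
          show ?case by (rule exI[of _ "[]"]) (simp add: D_def)
        next
          case (snoc w ds)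
          then obtain l where l: "set l \<subseteq> range (\<lambda>ds. D ds p)"
            "D ds (pvar v * p) = pvar v * D ds p + sum_list l" by blast
          have s: "der w (sum_list l) = sum_list (map (der w) l)"
            by (induction l) (simp_all add: der_add)
          have m: "set (map (der w) l) \<subseteq> range (\<lambda>ds. D ds p)"
            using l(1) D_snoc by fastforce
          have "D (ds @ [w]) (pvar v * p) = pvar v * D (ds @ [w]) p
              + sum_list ((if w = v then [D ds p] else []) @ map (der w) l)"
            unfolding D_snoc[symmetric] l(2) der_add der_pvar_mult s by simp
          then show ?case using m by (intro exI[of _ "(if w = v then [D ds p] else []) @ map (der w) l"]) auto
        qed
        then obtain l where l: "set l \<subseteq> range (\<lambda>ds. D ds p)"
            "D ds (pvar v * p) = pvar v * D ds p + sum_list l" by blast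
        have "P (sum_list l)" using l(1) var
          by (induction l) (auto simp: zero intro: assms(3))
        moreover have "P (pvar v * D ds p)"
          by (rule assms(4)) (use var D_snoc in auto)
        ultimately have "P (D ds (pvar v * p))" unfolding l(2) by (rule assms(3)[rotated])
        then show ?thesis using l by (intro conjI exI[of _ "set l"]) auto
      qed
      then show ?thesis by simp
    qed
    then show ?case by simp
  qed
  then have "P (D [] p)" by blast
  then show ?thesis by (simp add: D_def)
qed

section \<open>The Fock inner product\<close>

definition mfact :: "('v \<Rightarrow>\<^sub>0 nat) \<Rightarrow> real" where
  "mfact m = (\<Prod>v\<in>Poly_Mapping.keys m. fact (Poly_Mapping.lookup m v))"

lemma mfact_pos: "mfact m > 0"
  by (auto simp: mfact_def intro!: prod_pos)

lemma mfact_zero [simp]: "mfact 0 = 1"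
  by (simp add: mfact_def)

lemma mfact_superset:
  assumes "finite F" "Poly_Mapping.keys m \<subseteq> F"
  shows "mfact m = (\<Prod>v\<in>F. fact (Poly_Mapping.lookup m v))"
  unfolding mfact_def
  by (rule prod.mono_neutral_left) (use assms in \<open>auto simp: in_keys_iff\<close>)

lemma mfact_step:
  "mfact (m + Poly_Mapping.single v 1) = (of_nat (Poly_Mapping.lookup m v) + 1) * mfact m"
proof -
  let ?F = "insert v (Poly_Mapping.keys m)"
  have "Poly_Mapping.keys (m + Poly_Mapping.single v 1) \<subseteq> ?F"
    using keys_add[of m "Poly_Mapping.single v 1"] by auto
  then have "mfact (m + Poly_Mapping.single v 1) = (\<Prod>u\<in>?F. fact (Poly_Mapping.lookup (m + Poly_Mapping.single v 1) u))"
    by (rule mfact_superset[rotated]) simp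
  also have "\<dots> = fact (Poly_Mapping.lookup m v + 1) * (\<Prod>u\<in>?F - {v}. fact (Poly_Mapping.lookup m u))"
    by (subst prod.remove[of _ v]) (auto simp: lookup_add lookup_single when_def intro!: arg_cong2[of _ _ _ _ "(*)"] prod.cong split: if_splits)
  also have "\<dots> = (of_nat (Poly_Mapping.lookup m v) + 1) * (fact (Poly_Mapping.lookup m v) * (\<Prod>u\<in>?F - {v}. fact (Poly_Mapping.lookup m u)))"
    by (simp add: algebra_simps)
  also have "fact (Poly_Mapping.lookup m v) * (\<Prod>u\<in>?F - {v}. fact (Poly_Mapping.lookup m u)) = mfact m"
    by (subst mfact_superset[of ?F]) (auto simp: prod.remove[of _ v])
  finally show ?thesis .
qed

text \<open>Monomials are orthogonal and \<open>mfact m\<close> is the squared norm of the monomial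
  \<open>m\<close>. It is linear in the first argument.\<close>

definition fip :: "'v pol \<Rightarrow> 'v pol \<Rightarrow> complex" where
  "fip p q = (\<Sum>m\<in>Poly_Mapping.keys p. Poly_Mapping.lookup p m * cnj (Poly_Mapping.lookup q m) * of_real (mfact m))"

lemma fip_superset:
  assumes "finite F" "Poly_Mapping.keys p \<subseteq> F"
  shows "fip p q = (\<Sum>m\<in>F. Poly_Mapping.lookup p m * cnj (Poly_Mapping.lookup q m) * of_real (mfact m))"
  unfolding fip_def
  by (rule sum.mono_neutral_left) (use assms in \<open>auto simp: in_keys_iff\<close>)

lemma fip_add_left: "fip (p + p') q = fip p q + fip p' q"
proof -
  let ?F = "Poly_Mapping.keys p \<union> Poly_Mapping.keys p'"
  have "Poly_Mapping.keys (p + p') \<subseteq> ?F" by (rule keys_add)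
  then show ?thesis
    by (simp add: fip_superset[of ?F] lookup_add algebra_simps sum.distrib)
qed

lemma fip_psc_left: "fip (psc c p) q = c * fip p q"
proof -
  have "Poly_Mapping.keys (psc c p) \<subseteq> Poly_Mapping.keys p" by (auto simp: in_keys_iff)
  then show ?thesis
    by (simp add: fip_superset[of "Poly_Mapping.keys p"] sum_distrib_left mult.assoc)
qed

lemma fip_cnj: "fip q p = cnj (fip p q)"
proof -
  let ?F = "Poly_Mapping.keys p \<union> Poly_Mapping.keys q"
  show ?thesis
    by (simp add: fip_superset[of ?F] mult_ac)
qed

lemma fip_add_right: "fip p (q + q') = fip p q + fip p q'"
  by (metis fip_add_left fip_cnj complex_cnj_add)

lemma fip_psc_right: "fip p (psc c q) = cnj c * fip p q"
  by (metis fip_psc_left fip_cnj complex_cnj_mult)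

lemma fip_zero_left [simp]: "fip 0 q = 0" and fip_zero_right [simp]: "fip q 0 = 0"
  by (simp_all add: fip_def)

lemma fip_minus_left: "fip (- p) q = - fip p q"
  using fip_psc_left[of "-1" p q] by (simp add: psc_minus_left)

lemma fip_minus_right: "fip q (- p) = - fip q p"
  using fip_psc_right[of q "-1" p] by (simp add: psc_minus_left)

lemma fip_diff_left: "fip (p - p') q = fip p q - fip p' q"
  using fip_add_left[of p "- p'" q] by (simp add: fip_minus_left)

lemma fip_diff_right: "fip q (p - p') = fip q p - fip q p'"
  using fip_add_right[of q p "- p'"] by (simp add: fip_minus_right)

lemma fip_sum_left: "fip (sum f A) q = (\<Sum>x\<in>A. fip (f x) q)"
  by (induction A rule: infinite_finite_induct) (simp_all add: fip_add_left)

lemma fip_sum_right: "fip q (sum f A) = (\<Sum>x\<in>A. fip q (f x))"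
  by (induction A rule: infinite_finite_induct) (simp_all add: fip_add_right)

lemma fip_self: "fip p p = of_real (\<Sum>m\<in>Poly_Mapping.keys p. (cmod (Poly_Mapping.lookup p m))\<^sup>2 * mfact m)"
  unfolding fip_def of_real_sum of_real_mult complex_norm_square[symmetric] by simp

lemma fip_self_nonneg: "Re (fip p p) \<ge> 0" "Im (fip p p) = 0"
  unfolding fip_self by (auto intro!: sum_nonneg mult_nonneg_nonneg less_imp_le[OF mfact_pos])

lemma fip_self_eq_0: "fip p p = 0 \<longleftrightarrow> p = 0"
proof
  assume "fip p p = 0"
  then have "(\<Sum>m\<in>Poly_Mapping.keys p. (cmod (Poly_Mapping.lookup p m))\<^sup>2 * mfact m) = 0"
    unfolding fip_self by (simp only: of_real_eq_0_iff)
  then have "\<forall>m\<in>Poly_Mapping.keys p. (cmod (Poly_Mapping.lookup p m))\<^sup>2 * mfact m = 0"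
    by (subst (asm) sum_nonneg_eq_0_iff) (auto intro!: mult_nonneg_nonneg less_imp_le[OF mfact_pos])
  then show "p = 0" using mfact_pos
    by (metis all_not_in_conv in_keys_iff keys_eq_empty less_irrefl mult_eq_0_iff norm_eq_zero zero_eq_power2)
qed simp

lemma fip_single_left: "fip (Poly_Mapping.single m c) q = c * cnj (Poly_Mapping.lookup q m) * of_real (mfact m)"
  by (simp add: fip_superset[of "{m}"])

lemma lookup_der: "Poly_Mapping.lookup (der v q) m
    = (of_nat (Poly_Mapping.lookup m v) + 1) * Poly_Mapping.lookup q (m + Poly_Mapping.single v 1)"
proof (induction q rule: poly_mapping_add_induct)
  case (single k c)
  show ?case
  proof (cases "k = m + Poly_Mapping.single v 1")
    case True
    then show ?thesis by (simp add: der_single lookup_add)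
  next
    case False
    have "k - Poly_Mapping.single v 1 \<noteq> m" if "Poly_Mapping.lookup k v \<noteq> 0"
    proof
      assume "k - Poly_Mapping.single v 1 = m"
      then have "k = m + Poly_Mapping.single v 1"
        by (intro poly_mapping_eqI) (use that in \<open>auto simp: lookup_add lookup_minus lookup_single when_def\<close>)
      then show False using False by simp
    qed
    then show ?thesis using False by (auto simp: der_single lookup_single when_def)
  qed
next
  case (sum q q')
  then show ?case by (simp add: der_add lookup_add algebra_simps)
qed

text \<open>On a monomial both sides pick the same coefficient of \<open>q\<close>, and the weights
  agree because raising one exponent from \<open>a\<close> to \<open>a + 1\<close> multiplies
  \<open>mfact\<close> by \<open>a + 1\<close>.\<close>

lemma fip_pvar_left: "fip (pvar v * p) q = fip p (der v q)"
proof (induction p rule: poly_mapping_add_induct)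
  case (single m c)
  show ?case by (simp add: pvar_times_single fip_single_left mfact_step[simplified] lookup_der)
next
  case (sum p p')
  then show ?case by (simp add: fip_add_left distrib_left)
qed

lemma fip_pvar_right: "fip p (pvar v * q) = fip (der v p) q"
  by (metis fip_pvar_left fip_cnj)

lemma fip_der_left: "fip (der v p) q = fip p (pvar v * q)"
  by (simp add: fip_pvar_right)

lemma fip_one_one [simp]: "fip 1 1 = (1::complex)"
  using fip_single_left[of 0 1 1] by (simp add: lookup_one)

text \<open>Used to derive an operator identity from the identity for the adjoint operators.\<close>

lemma fip_eqI:
  assumes "\<And>u. fip p u = fip q u"
  shows "p = q"
proof -
  have "fip (p - q) (p - q) = 0" by (simp add: fip_diff_left assms)
  then show ?thesis by (simp add: fip_self_eq_0)
qed

subsection \<open>Substitution\<close>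

definition psub :: "('v \<Rightarrow> 'w pol) \<Rightarrow> 'v pol \<Rightarrow> 'w pol" where
  "psub s = plift (\<lambda>m. \<Prod>v\<in>Poly_Mapping.keys m. s v ^ Poly_Mapping.lookup m v)"

lemma plin_psub [simp]: "plin (psub s)"
  by (simp add: psub_def plift_linear)

lemmas psub_add = plin_add[OF plin_psub] and psub_psc = plin_psc[OF plin_psub]

lemma psub_one [simp]: "psub s 1 = 1"
  unfolding psub_def single_one[symmetric] by (subst plift_single) simp

lemma psub_pvar_mult: "psub s (pvar v * p) = s v * psub s p" for s :: "'v \<Rightarrow> 'w pol"
proof (rule pol_lin_eqI[where S = "\<lambda>p. psub s (pvar v * p)"])
  show "plin (\<lambda>p. psub s (pvar v * p))"
    by (rule plinI) (simp_all add: distrib_left psub_add psc_mult_right psub_psc)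
  show "plin (\<lambda>p. s v * psub s p)"
    by (rule plinI) (simp_all add: distrib_left psub_add psc_mult_right psub_psc)
  fix m :: "'v \<Rightarrow>\<^sub>0 nat"
  define g where "g m = (\<Prod>v\<in>Poly_Mapping.keys m. s v ^ Poly_Mapping.lookup m v)" for m :: "'v \<Rightarrow>\<^sub>0 nat"
  have gF: "g m = (\<Prod>v\<in>F. s v ^ Poly_Mapping.lookup m v)" if "finite F" "Poly_Mapping.keys m \<subseteq> F" for F m
    unfolding g_def by (rule prod.mono_neutral_left) (use that in \<open>auto simp: in_keys_iff\<close>)
  let ?F = "insert v (Poly_Mapping.keys m)"
  have "Poly_Mapping.keys (m + Poly_Mapping.single v 1) \<subseteq> ?F"
    using keys_add[of m "Poly_Mapping.single v 1"] by auto
  then have "g (m + Poly_Mapping.single v 1) = (\<Prod>u\<in>?F. s u ^ (Poly_Mapping.lookup (m + Poly_Mapping.single v 1) u))"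
    by (rule gF[rotated]) simp
  also have "\<dots> = s v ^ (Poly_Mapping.lookup m v + 1) * (\<Prod>u\<in>?F - {v}. s u ^ (Poly_Mapping.lookup m u))"
    by (subst prod.remove[of _ v]) (auto simp: lookup_add lookup_single when_def intro!: arg_cong2[of _ _ _ _ "(*)"] prod.cong split: if_splits)
  also have "\<dots> = s v * g m"
    by (subst gF[of ?F]) (auto simp: prod.remove[of _ v] mult.assoc)
  finally show "psub s (pvar v * Poly_Mapping.single m 1) = s v * psub s (Poly_Mapping.single m 1)"
    by (simp add: psub_def plift_single pvar_times_single g_def)
qed

lemma psub_pvar [simp]: "psub s (pvar v) = s v"
  using psub_pvar_mult[of s v 1] by simp

lemma psub_mult: "psub s (p * q) = psub s p * psub s q"
  by (induction p rule: pol_induct)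
    (auto simp: psub_add psub_psc psub_pvar_mult distrib_right psc_mult_left mult.assoc)

lemma psub_id: "psub pvar p = p"
  by (induction p rule: pol_induct)
    (auto simp: psub_add psub_psc psub_pvar_mult)

subsection \<open>Exponentials of locally nilpotent operators\<close>

definition lnil :: "('v pol \<Rightarrow> 'v pol) \<Rightarrow> bool" where
  "lnil D \<longleftrightarrow> plin D \<and> (\<forall>p. \<exists>N. (D ^^ N) p = 0)"

text \<open>For \<open>D\<close> locally nilpotent the index set is finite for every
  \<open>p\<close>, and the sum is the whole exponential series.\<close>

definition pexp :: "('v pol \<Rightarrow> 'v pol) \<Rightarrow> 'v pol \<Rightarrow> 'v pol" where
  "pexp D p = (\<Sum>j\<in>{j. (D ^^ j) p \<noteq> 0}. psc (1 / fact j) ((D ^^ j) p))"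

lemma lnil_plin: "lnil D \<Longrightarrow> plin D"
  by (simp add: lnil_def)

lemma funpow_zero_mono:
  fixes D :: "'v pol \<Rightarrow> 'v pol"
  assumes "plin D" "(D ^^ N) p = 0" "N \<le> j"
  shows "(D ^^ j) p = 0"
proof -
  have "(D ^^ j) p = (D ^^ (j - N)) ((D ^^ N) p)"
    using assms(3) by (metis comp_apply funpow_add le_add_diff_inverse2)
  then show ?thesis using assms by (simp add: plin_zero plin_funpow)
qed

lemma pexp_eq:
  assumes "plin D" "(D ^^ N) p = 0"
  shows "pexp D p = (\<Sum>j<N. psc (1 / fact j) ((D ^^ j) p))"
  unfolding pexp_def
  by (rule sum.mono_neutral_left) (use funpow_zero_mono[OF assms] in \<open>auto simp: not_less[symmetric]\<close>)

lemma lnil_obtain: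
  assumes "lnil D" "finite F"
  obtains N where "\<And>p. p \<in> F \<Longrightarrow> (D ^^ N) p = 0"
proof -
  obtain n where n: "\<And>p. (D ^^ n p) p = 0" using assms(1) unfolding lnil_def by metis
  have "(D ^^ (Max (n ` F))) p = 0" if "p \<in> F" for p
    by (rule funpow_zero_mono[OF lnil_plin[OF assms(1)] n]) (use that assms(2) in simp)
  then show ?thesis using that by blast
qed

lemma plin_pexp:
  assumes "lnil D"
  shows "plin (pexp D)"
proof (rule plinI)
  note D = lnil_plin[OF assms]
  fix p q
  obtain N where N: "\<And>r. r \<in> {p, q, p + q} \<Longrightarrow> (D ^^ N) r = 0"
    using lnil_obtain[OF assms, of "{p, q, p + q}"] by blast
  show "pexp D (p + q) = pexp D p + pexp D q"
    by (simp add: pexp_eq[OF D, of N] N plin_add[OF plin_funpow[OF D]] psc_add_right sum.distrib)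
next
  note D = lnil_plin[OF assms]
  fix p c
  obtain N where N: "\<And>r. r \<in> {p, psc c p} \<Longrightarrow> (D ^^ N) r = 0"
    using lnil_obtain[OF assms, of "{p, psc c p}"] by blast
  show "pexp D (psc c p) = psc c (pexp D p)"
    by (simp add: pexp_eq[OF D, of N] N plin_psc[OF plin_funpow[OF D]] psc_sum mult.commute)
qed

text \<open>Here \<open>S\<close> is the commutator of \<open>D\<close> and \<open>T\<close>, and it
  commutes with \<open>D\<close>. The truncated \<open>j - 1\<close> at \<open>j = 0\<close> is
  harmless because of the factor \<open>of_nat j\<close>.\<close>

lemma funpow_comm:
  fixes D :: "'v pol \<Rightarrow> 'v pol"
  assumes D: "plin D" and DT: "\<And>p. D (T p) = T (D p) + S p" and DS: "\<And>p. D (S p) = S (D p)"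
  shows "(D ^^ j) (T p) = T ((D ^^ j) p) + psc (of_nat j) (S ((D ^^ (j - 1)) p))"
proof (induction j)
  case (Suc j)
  show ?case
  proof (cases j)
    case 0
    then show ?thesis by (simp add: DT)
  next
    case (Suc i)
    have two: "psc 2 q = q + q" for q :: "'v pol" using psc_add_left[of 1 1 q] by simp
    have "(D ^^ Suc j) (T p) = T ((D ^^ Suc j) p) + psc (1 + of_nat j) (S ((D ^^ j) p))"
      unfolding funpow.simps comp_apply Suc.IH
      by (simp add: \<open>j = Suc i\<close> plin_add[OF D] DT plin_psc[OF D] DS psc_add_left two algebra_simps)
    then show ?thesis by simp
  qed
qed simp

text \<open>Conjugation by an exponential whose series stops after the first commutator: the
  conjugate of \<open>T\<close> is \<open>T + S\<close>.\<close>

lemma pexp_comm: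
  assumes D: "lnil D" and T: "plin T" and S: "plin S"
    and DT: "\<And>p. D (T p) = T (D p) + S p" and DS: "\<And>p. D (S p) = S (D p)"
  shows "pexp D (T p) = T (pexp D p) + S (pexp D p)"
proof -
  note Dl = lnil_plin[OF D]
  note pow = funpow_comm[of D T S, OF Dl DT DS]
  obtain N where N: "\<And>r. r \<in> {p, T p} \<Longrightarrow> (D ^^ N) r = 0"
    using lnil_obtain[OF D, of "{p, T p}"] by blast
  have N1: "(D ^^ Suc N) (T p) = 0" using N by (simp add: plin_zero[OF Dl])
  have "pexp D (T p) = (\<Sum>j<Suc N. psc (1 / fact j) (T ((D ^^ j) p)))
      + (\<Sum>j<Suc N. psc (of_nat j / fact j) (S ((D ^^ (j - 1)) p)))"
    unfolding pexp_eq[OF Dl N1] pow by (simp add: psc_add_right sum.distrib)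
  \<comment> \<open>The factor \<open>j\<close> cancels against the factorial and shifts the index,
    which reproduces the exponential series.\<close>
  also have "(\<Sum>j<Suc N. psc (of_nat j / fact j) (S ((D ^^ (j - 1)) p)))
      = (\<Sum>j<N. psc (1 / fact j) (S ((D ^^ j) p)))"
    by (subst sum.lessThan_Suc_shift) (simp add: field_simps del: of_nat_Suc)
  also have "\<dots> = S (pexp D p)"
    by (simp add: pexp_eq[OF Dl N] plin_sum[OF S] plin_psc[OF S])
  also have "(\<Sum>j<Suc N. psc (1 / fact j) (T ((D ^^ j) p))) = T (pexp D p)"
    by (simp add: pexp_eq[OF Dl N] plin_sum[OF T] plin_psc[OF T] N plin_zero[OF T])
  finally show ?thesis .
qed

section \<open>Block matrices\<close>

text \<open>\<open>sym_form\<close> is the permutation matrix of \<open>sw\<close>, and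
  \<open>herm_form\<close> is the diagonal matrix of \<open>sg\<close>. Conditions on matrices thus
  become conditions on entries.\<close>

fun sw :: "'n + 'n \<Rightarrow> 'n + 'n" where
  "sw (Inl i) = Inr i" | "sw (Inr i) = Inl i"

fun sg :: "'n + 'n \<Rightarrow> complex" where
  "sg (Inl i) = 1" | "sg (Inr i) = - 1"

lemma sw_sw [simp]: "sw (sw r) = r"
  by (cases r) auto

lemma sw_eq_iff [simp]: "sw r = sw s \<longleftrightarrow> r = s"
  by (metis sw_sw)

lemma sg_sw [simp]: "sg (sw r) = - sg r"
  by (cases r) auto

lemma sg_mult_self [simp]: "sg r * sg r = 1" "sg r * (sg r * z) = z"
  by (cases r; simp)+

lemma cnj_sg [simp]: "cnj (sg r) = sg r"
  by (cases r) auto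

lemma sum_sw: "(\<Sum>r\<in>UNIV. f (sw r)) = (\<Sum>r\<in>UNIV. f (r :: 'n::finite + 'n))"
  by (rule sum.reindex_bij_witness[of _ sw sw]) auto

lemma sum_UNIV_Plus: "(\<Sum>r\<in>UNIV. f (r :: 'a::finite + 'b::finite)) = (\<Sum>i\<in>UNIV. f (Inl i)) + (\<Sum>i\<in>UNIV. f (Inr i))"
  by (simp add: sum.Plus flip: UNIV_Plus_UNIV)

definition ul :: "'n::finite mat2 \<Rightarrow> complex^'n^'n" where "ul X = (\<chi> i j. X $ Inl i $ Inl j)"
definition ur :: "'n::finite mat2 \<Rightarrow> complex^'n^'n" where "ur X = (\<chi> i j. X $ Inl i $ Inr j)"
definition ll :: "'n::finite mat2 \<Rightarrow> complex^'n^'n" where "ll X = (\<chi> i j. X $ Inr i $ Inl j)"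
definition lr :: "'n::finite mat2 \<Rightarrow> complex^'n^'n" where "lr X = (\<chi> i j. X $ Inr i $ Inr j)"

lemma block_nth [simp]:
  "block A B C D $ Inl i $ Inl j = A $ i $ j" "block A B C D $ Inl i $ Inr j = B $ i $ j"
  "block A B C D $ Inr i $ Inl j = C $ i $ j" "block A B C D $ Inr i $ Inr j = D $ i $ j"
  by (simp_all add: block_def)

lemma quarter_nth [simp]:
  "ul X $ i $ j = X $ Inl i $ Inl j" "ur X $ i $ j = X $ Inl i $ Inr j"
  "ll X $ i $ j = X $ Inr i $ Inl j" "lr X $ i $ j = X $ Inr i $ Inr j"
  by (simp_all add: ul_def ur_def ll_def lr_def)

lemma mat2_eqI:
  assumes "ul X = ul Y" "ur X = ur Y" "ll X = ll Y" "lr X = lr Y"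
  shows "X = Y"
proof -
  have "X $ r $ s = Y $ r $ s" for r s
    using assms by (cases r; cases s) (simp_all add: vec_eq_iff)
  then show ?thesis by (simp add: vec_eq_iff)
qed

lemma quarter_block [simp]:
  "ul (block A B C D) = A" "ur (block A B C D) = B" "ll (block A B C D) = C" "lr (block A B C D) = D"
  by (simp_all add: vec_eq_iff)

lemma quarter_mult:
  "ul (X ** Y) = ul X ** ul Y + ur X ** ll Y" "ur (X ** Y) = ul X ** ur Y + ur X ** lr Y"
  "ll (X ** Y) = ll X ** ul Y + lr X ** ll Y" "lr (X ** Y) = ll X ** ur Y + lr X ** lr Y"
  by (simp_all add: vec_eq_iff matrix_matrix_mult_def sum_UNIV_Plus)

lemma quarter_add [simp]:
  "ul (X + Y) = ul X + ul Y" "ur (X + Y) = ur X + ur Y" "ll (X + Y) = ll X + ll Y" "lr (X + Y) = lr X + lr Y"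
  by (simp_all add: vec_eq_iff)

lemma quarter_diff [simp]:
  "ul (X - Y) = ul X - ul Y" "ur (X - Y) = ur X - ur Y" "ll (X - Y) = ll X - ll Y" "lr (X - Y) = lr X - lr Y"
  by (simp_all add: vec_eq_iff)

lemma quarter_cscale [simp]:
  "ul (cscale c X) = cscale c (ul X)" "ur (cscale c X) = cscale c (ur X)"
  "ll (cscale c X) = cscale c (ll X)" "lr (cscale c X) = cscale c (lr X)"
  by (simp_all add: vec_eq_iff cscale_def)

lemma quarter_mat1 [simp]: "ul (mat 1) = mat 1" "ur (mat 1) = 0" "ll (mat 1) = 0" "lr (mat 1) = mat 1"
  by (simp_all add: vec_eq_iff mat_def)

lemma sym_form_nth: "sym_form $ r $ s = (if s = sw r then 1 else 0)"
  by (cases r; cases s) (auto simp: sym_form_def mat_def)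

lemma herm_form_nth: "herm_form $ r $ s = (if s = r then sg r else 0)"
  by (cases r; cases s) (auto simp: herm_form_def mat_def)

lemma matmul_nth: "(X ** Y) $ r $ s = (\<Sum>q\<in>UNIV. X $ r $ q * Y $ q $ s)"
  by (simp add: matrix_matrix_mult_def)

lemma sym_form_mult: "(sym_form ** X) $ r $ s = X $ sw r $ s" "(X ** sym_form) $ r $ s = X $ r $ sw s"
proof -
  have *: "(if s = sw q then (1::complex) else 0) = (if q = sw s then 1 else 0)" for q s :: "'a + 'a"
    by auto
  show "(sym_form ** X) $ r $ s = X $ sw r $ s" "(X ** sym_form) $ r $ s = X $ r $ sw s"
    unfolding matmul_nth sym_form_nth *[of s] by (simp_all add: if_distrib if_distribR cong: if_cong)
qed

lemma herm_form_mult: "(herm_form ** X) $ r $ s = sg r * X $ r $ s" "(X ** herm_form) $ r $ s = X $ r $ s * sg s"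
  by (simp_all add: matmul_nth herm_form_nth if_distrib if_distribR cong: if_cong)

lemma lie_g_iff: "X \<in> lie_g \<longleftrightarrow> (\<forall>r s. X $ sw s $ r = - X $ sw r $ s)"
  unfolding lie_g_def
  by (simp add: vec_eq_iff sym_form_mult transpose_def add_eq_0_iff2)

lemma lie_g_quarters:
  "X \<in> lie_g \<longleftrightarrow> transpose (ur X) = - ur X \<and> transpose (ll X) = - ll X \<and> lr X = - transpose (ul X)"
proof
  assume X: "X \<in> lie_g"
  have *: "X $ sw s $ r = - X $ sw r $ s" for r s using X unfolding lie_g_iff by blast
  show "transpose (ur X) = - ur X \<and> transpose (ll X) = - ll X \<and> lr X = - transpose (ul X)"
    unfolding vec_eq_iff transpose_def vec_lambda_beta quarter_nth vector_uminus_component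
    using *[of "Inr _" "Inr _"] *[of "Inl _" "Inl _"] *[of "Inl _" "Inr _"] unfolding sw.simps
    by (intro conjI allI)
next
  assume a: "transpose (ur X) = - ur X \<and> transpose (ll X) = - ll X \<and> lr X = - transpose (ul X)"
  have b: "X $ Inl j $ Inr i = - X $ Inl i $ Inr j" "X $ Inr j $ Inl i = - X $ Inr i $ Inl j"
    "X $ Inr i $ Inr j = - X $ Inl j $ Inl i" for i j
    using a[THEN conjunct1, THEN arg_cong[of _ _ "\<lambda>M. M $ i $ j"]]
      a[THEN conjunct2, THEN conjunct1, THEN arg_cong[of _ _ "\<lambda>M. M $ i $ j"]]
      a[THEN conjunct2, THEN conjunct2, THEN arg_cong[of _ _ "\<lambda>M. M $ i $ j"]]
    by (simp_all only: transpose_def vec_lambda_beta quarter_nth vector_uminus_component)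
  have "X $ sw s $ r = - X $ sw r $ s" for r s
    by (cases r; cases s; simp only: sw.simps; (rule b(1) b(2) | simp only: b(3) minus_minus))
  then show "X \<in> lie_g" unfolding lie_g_iff by blast
qed

lemma block_in_lie_g: "transpose B = - B \<Longrightarrow> transpose C = - C \<Longrightarrow> block A B C (- transpose A) \<in> lie_g"
  by (simp add: lie_g_quarters)

lemma lie_g_bracket: assumes "X \<in> lie_g" "Y \<in> lie_g" shows "bracket X Y \<in> lie_g"
proof -
  have X: "X $ sw s $ r = - X $ sw r $ s" and Y: "Y $ sw s $ r = - Y $ sw r $ s" for r s
    using assms unfolding lie_g_iff by blast+
  \<comment> \<open>Transposition with respect to the form reverses products. The minus signs of the
    two factors cancel, so \<open>X ** Y\<close> turns into \<open>Y ** X\<close> and the commutator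
    changes sign.\<close>
  have "(X ** Y) $ sw s $ r = (Y ** X) $ sw r $ s" if
    X: "\<And>r s. X $ sw s $ r = - X $ sw r $ s" and Y: "\<And>r s. Y $ sw s $ r = - Y $ sw r $ s" for X Y :: "'n::finite mat2" and r s
  proof -
    have "(X ** Y) $ sw s $ r = (\<Sum>q\<in>UNIV. X $ sw s $ sw q * Y $ sw q $ r)"
      unfolding matmul_nth by (rule sum_sw[symmetric])
    also have "\<dots> = (\<Sum>q\<in>UNIV. Y $ sw r $ q * X $ q $ s)"
    proof (rule sum.cong)
      fix q
      have "X $ sw s $ sw q = - X $ q $ s" "Y $ sw q $ r = - Y $ sw r $ q"
        using X[of s "sw q"] Y[of q r] by (simp_all only: sw_sw)
      then show "X $ sw s $ sw q * Y $ sw q $ r = Y $ sw r $ q * X $ q $ s"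
        by (simp only: minus_mult_minus mult.commute)
    qed simp
    finally show ?thesis by (simp add: matmul_nth)
  qed
  note XY = this[OF X Y] this[OF Y X]
  show ?thesis
    unfolding lie_g_iff bracket_def vector_minus_component minus_diff_eq
    by (intro allI arg_cong2[of _ _ _ _ "(-)"] XY)
qed

lemma lie_g_add: "X \<in> lie_g \<Longrightarrow> Y \<in> lie_g \<Longrightarrow> X + Y \<in> lie_g"
  unfolding lie_g_iff vector_add_component minus_add_distrib by metis

lemma lie_g_cscale: "X \<in> lie_g \<Longrightarrow> cscale c X \<in> lie_g"
  unfolding lie_g_iff cscale_def vec_lambda_beta by (metis mult_minus_right)

lemma lie_g_zero [simp]: "0 \<in> lie_g"
  by (simp add: lie_g_iff)

lemma transpose_zero [simp]: "transpose 0 = 0"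
  by (simp_all add: vec_eq_iff transpose_def)

lemma lie_k_subset_lie_g: "lie_k \<subseteq> lie_g"
  by (auto simp: lie_k_def gl_embed_def lie_g_quarters transpose_zero)

lemma lie_p_plus_subset_lie_g: "lie_p_plus \<subseteq> lie_g"
  by (auto simp: lie_p_plus_def lie_g_quarters transpose_zero)

lemma skew_nth: "transpose B = - B \<Longrightarrow> B $ i $ j = - B $ j $ i" for B :: "complex^'n^'n"
  by (drule arg_cong[of _ _ "\<lambda>M. M $ j $ i"]) (simp add: transpose_def)

definition cnjm :: "complex^'m^'n \<Rightarrow> complex^'m^'n" where "cnjm A = (\<chi> i j. cnj (A $ i $ j))"

lemma cnjm_nth [simp]: "cnjm A $ i $ j = cnj (A $ i $ j)"
  by (simp add: cnjm_def)

lemma cnjm_cnjm [simp]: "cnjm (cnjm A) = A"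
  by (simp add: vec_eq_iff)

lemma cnjm_skew: "transpose B = - B \<Longrightarrow> transpose (cnjm B) = - cnjm B"
proof -
  assume B: "transpose B = - B"
  have "transpose (cnjm B) = cnjm (transpose B)" by (simp add: vec_eq_iff transpose_def)
  also have "\<dots> = - cnjm B" unfolding B by (simp add: vec_eq_iff)
  finally show ?thesis .
qed

lemma conj_transpose_nth [simp]: "conj_transpose A $ i $ j = cnj (A $ j $ i)"
  by (simp add: conj_transpose_def)

section \<open>The oscillator representation on polynomials\<close>

text \<open>A variable is given by a row, a column and a sign; \<open>False\<close> and \<open>True\<close> index the two halves of the columns.\<close>

type_synonym 'n var = "'n \<times> nat \<times> bool"

text \<open>The sign of the symplectic form that pairs the two halves of the columns.\<close>

definition eps :: "bool \<Rightarrow> complex" where "eps s = (if s then 1 else - 1)"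

lemma eps_simps [simp]: "eps True = 1" "eps False = - 1" "eps (\<not> s) = - eps s" "eps s * eps s = 1" "eps s * (eps s * z) = z" "cnj (eps s) = eps s"
  by (simp_all add: eps_def)

text \<open>
  For each column \<open>c\<close> and each \<open>s\<close>, multiplications by variables and derivatives are assembled into a
  vector of \<open>2n\<close> operators on which \<open>so(2n, C)\<close> acts through its defining representation.
\<close>

definition xi :: "nat \<Rightarrow> bool \<Rightarrow> 'n + 'n \<Rightarrow> 'n var pol \<Rightarrow> 'n var pol" where
  "xi c s r p = (case r of Inl i \<Rightarrow> pvar (i, c, s) * p | Inr i \<Rightarrow> psc (eps s) (der (i, c, \<not> s) p))"

text \<open>The Fock adjoints of the operators \<open>xi\<close>, indexed in the same way so that
  commutation rules can be moved across the inner product as vectors.\<close>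

definition xia :: "nat \<Rightarrow> bool \<Rightarrow> 'n + 'n \<Rightarrow> 'n var pol \<Rightarrow> 'n var pol" where
  "xia c s r p = (case r of Inl i \<Rightarrow> der (i, c, s) p | Inr i \<Rightarrow> psc (eps s) (pvar (i, c, \<not> s) * p))"

lemma xi_simps [simp]:
  "xi c s (Inl i) p = pvar (i, c, s) * p" "xi c s (Inr i) p = psc (eps s) (der (i, c, \<not> s) p)"
  "xia c s (Inl i) p = der (i, c, s) p" "xia c s (Inr i) p = psc (eps s) (pvar (i, c, \<not> s) * p)"
  by (simp_all add: xi_def xia_def)

lemma plin_xi [simp]: "plin (xi c s r)"
  by (rule plinI; cases r) (simp_all add: distrib_left psc_add_right der_add der_psc psc_mult_right mult.commute[of "eps s"])

lemma fip_xi: "fip (xi c s r p) q = fip p (xia c s r q)"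
  by (cases r) (simp_all add: fip_pvar_left fip_psc_left fip_psc_right fip_der_left)

text \<open>The system of operators is closed under adjoints: multiplications and derivatives trade
  places, which swaps the halves of the index and of the columns. Every rule for \<open>xi\<close>
  therefore has a counterpart for \<open>xia\<close>.\<close>

lemma xia_xi: "xia c s r p = psc (- eps s * sg r) (xi c (\<not> s) (sw r) p)"
  by (cases r) simp_all

lemma xi_xia: "xi c s r p = psc (eps s * sg (sw r)) (xia c (\<not> s) (sw r) p)"
  by (cases r) simp_all

lemma if_conj_nested: "(if P \<and> Q then x else y) = (if P then if Q then x else y else y)"
  by simp

text \<open>The number of columns depends on the weight, but the type of variables cannot. Columns
  are therefore numbered by all naturals, the operators use those in \<open>C\<close>, and the other
  variables are inert.\<close>

locale fock =
  fixes C :: "nat set"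
  assumes finC: "finite C"
begin

text \<open>The contragredient action on rows: \<open>mat_unit i j\<close> differentiates by row
  \<open>i\<close> and multiplies by row \<open>j\<close>, with a minus sign. The trace term is the
  normal ordering constant forced by the bracket of \<open>opD\<close> and \<open>opM\<close>; see
  \<open>opD_qf\<close>.\<close>

definition opE :: "complex^'n^'n \<Rightarrow> 'n::finite var pol \<Rightarrow> 'n var pol" where
  "opE A p = - (\<Sum>i\<in>UNIV. \<Sum>j\<in>UNIV. psc (A $ i $ j) (\<Sum>c\<in>C. \<Sum>s\<in>UNIV. pvar (j, c, s) * der (i, c, s) p))
     - psc (of_nat (card C) * trace A) p"

definition opD :: "complex^'n^'n \<Rightarrow> 'n::finite var pol \<Rightarrow> 'n var pol" where
  "opD B p = (\<Sum>i\<in>UNIV. \<Sum>j\<in>UNIV. psc (B $ i $ j) (\<Sum>c\<in>C. der (i, c, False) (der (j, c, True) p)))"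

definition qf :: "complex^'n^'n \<Rightarrow> 'n::finite var pol" where
  "qf Y = (\<Sum>i\<in>UNIV. \<Sum>j\<in>UNIV. psc (Y $ i $ j) (\<Sum>c\<in>C. pvar (i, c, False) * pvar (j, c, True)))"

definition opM :: "complex^'n^'n \<Rightarrow> 'n::finite var pol \<Rightarrow> 'n var pol" where
  "opM Y p = qf Y * p"

text \<open>On \<open>lie_g\<close> the lower right block is determined by the upper left one, so
  three blocks carry all the information.\<close>

definition gact :: "'n::finite mat2 \<Rightarrow> 'n var pol \<Rightarrow> 'n var pol" where
  "gact X p = opE (ul X) p + opD (ur X) p + opM (ll X) p"

lemma plin_opE [simp]: "plin (opE A)"
  by (rule plinI)
    (simp_all add: opE_def der_add der_psc distrib_left psc_add_right sum.distrib psc_mult_right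
      psc_sum psc_diff_right mult.commute)

lemma plin_opD [simp]: "plin (opD A)"
  by (rule plinI)
    (simp_all add: opD_def der_add der_psc psc_add_right sum.distrib psc_sum mult.commute)

lemma plin_opM [simp]: "plin (opM A)"
  by (rule plinI) (simp_all add: opM_def distrib_left psc_mult_right)

lemma plin_gact [simp]: "plin (gact X)"
  by (rule plinI) (simp_all add: gact_def plin_add[OF plin_opE] plin_add[OF plin_opD] plin_add[OF plin_opM]
      plin_psc[OF plin_opE] plin_psc[OF plin_opD] plin_psc[OF plin_opM] psc_add_right)

lemma sum_col_delta:
  "(\<Sum>c'\<in>C. \<Sum>s'\<in>UNIV. if i = l \<and> c' = c \<and> s' = s then f c' s' else 0)
    = (if i = l \<and> c \<in> C then f c (s :: bool) else (0 :: 'a::comm_monoid_add))"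
proof -
  have "(\<Sum>c'\<in>C. \<Sum>s'\<in>UNIV. if i = l \<and> c' = c \<and> s' = s then f c' s' else 0)
      = (\<Sum>c'\<in>C. if c' = c then (if i = l then f c' s else 0) else 0)"
    by (rule sum.cong[OF refl], cases s) (auto simp: UNIV_bool)
  then show ?thesis using finC by auto
qed

text \<open>The operator has order one, so its commutator with a variable is a linear form in the
  variables of the same column and half.\<close>

lemma opE_pvar:
  "opE A (pvar (l, c, s) * p)
    = pvar (l, c, s) * opE A p - (if c \<in> C then \<Sum>j\<in>UNIV. psc (A $ l $ j) (pvar (j, c, s) * p) else 0)"
proof -
  have "(\<Sum>c'\<in>C. \<Sum>s'\<in>UNIV. pvar (j, c', s') * der (i, c', s') (pvar (l, c, s) * p))
     = (if i = l \<and> c \<in> C then pvar (j, c, s) * p else 0)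
       + pvar (l, c, s) * (\<Sum>c'\<in>C. \<Sum>s'\<in>UNIV. pvar (j, c', s') * der (i, c', s') p)" for i j
  proof -
    have "(\<Sum>c'\<in>C. \<Sum>s'\<in>UNIV. pvar (j, c', s') * der (i, c', s') (pvar (l, c, s) * p))
      = (\<Sum>c'\<in>C. \<Sum>s'\<in>UNIV. (if i = l \<and> c' = c \<and> s' = s then pvar (j, c', s') * p else 0))
       + (\<Sum>c'\<in>C. \<Sum>s'\<in>UNIV. pvar (l, c, s) * (pvar (j, c', s') * der (i, c', s') p))"
      unfolding sum.distrib[symmetric]
      by (intro sum.cong refl) (auto simp: der_pvar_mult distrib_left mult.left_commute)
    then show ?thesis by (simp only: sum_col_delta sum_distrib_left)
  qed
  note 1 = this
  have "(\<Sum>i\<in>UNIV. \<Sum>j\<in>UNIV. psc (A $ i $ j) (\<Sum>c'\<in>C. \<Sum>s'\<in>UNIV. pvar (j, c', s') * der (i, c', s') (pvar (l, c, s) * p)))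
    = (\<Sum>i\<in>UNIV. \<Sum>j\<in>UNIV. if i = l then (if c \<in> C then psc (A $ i $ j) (pvar (j, c, s) * p) else 0) else 0)
      + pvar (l, c, s) * (\<Sum>i\<in>UNIV. \<Sum>j\<in>UNIV. psc (A $ i $ j) (\<Sum>c'\<in>C. \<Sum>s'\<in>UNIV. pvar (j, c', s') * der (i, c', s') p))"
    unfolding 1 psc_add_right sum.distrib
    by (simp only: sum_distrib_left[of _ _ UNIV] psc_mult_right) (simp only: psc_zero if_distrib[of "psc _"] if_conj_nested)
  also have "(\<Sum>i\<in>UNIV. \<Sum>j\<in>UNIV. if i = l then (if c \<in> C then psc (A $ i $ j) (pvar (j, c, s) * p) else 0) else 0)
    = (if c \<in> C then \<Sum>j\<in>UNIV. psc (A $ l $ j) (pvar (j, c, s) * p) else 0)"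
    by (subst sum.swap) simp
  finally show ?thesis
    by (simp add: opE_def right_diff_distrib psc_mult_right)
qed

text \<open>The Fock adjoint of \<open>opE_pvar\<close> for the conjugate transpose.\<close>

lemma opE_der:
  "der (l, c, s) (opE A p)
    = opE A (der (l, c, s) p) - (if c \<in> C then \<Sum>i\<in>UNIV. psc (A $ i $ l) (der (i, c, s) p) else 0)"
proof (rule fip_eqI)
  fix u
  have adj: "fip (opE A p) u = fip p (opE (conj_transpose A) u)" for A p and u :: "'a var pol"
  proof -
    have "fip (opE A p) u = - (\<Sum>i\<in>UNIV. \<Sum>j\<in>UNIV. A $ i $ j * (\<Sum>c\<in>C. \<Sum>s\<in>UNIV. fip p (pvar (i, c, s) * der (j, c, s) u)))
        - of_nat (card C) * trace A * fip p u"
      by (simp add: opE_def fip_diff_left fip_minus_left fip_sum_left fip_psc_left fip_pvar_left fip_der_left)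
    also have "\<dots> = fip p (opE (conj_transpose A) u)"
      by (subst sum.swap) (simp add: opE_def fip_diff_right fip_minus_right fip_sum_right fip_psc_right trace_def)
    finally show ?thesis .
  qed
  show "fip (der (l, c, s) (opE A p)) u = fip (opE A (der (l, c, s) p) -
      (if c \<in> C then \<Sum>i\<in>UNIV. psc (A $ i $ l) (der (i, c, s) p) else 0)) u"
    by (simp add: fip_der_left adj opE_pvar fip_diff_left fip_diff_right fip_sum_left fip_sum_right
        fip_psc_left fip_psc_right)
qed

lemma fip_opE: "fip (opE A p) u = fip p (opE (conj_transpose A) u)"
proof -
  have "fip (opE A p) u = - (\<Sum>i\<in>UNIV. \<Sum>j\<in>UNIV. A $ i $ j * (\<Sum>c\<in>C. \<Sum>s\<in>UNIV. fip p (pvar (i, c, s) * der (j, c, s) u)))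
      - of_nat (card C) * trace A * fip p u"
    by (simp add: opE_def fip_diff_left fip_minus_left fip_sum_left fip_psc_left fip_pvar_left fip_der_left)
  also have "\<dots> = fip p (opE (conj_transpose A) u)"
    by (subst sum.swap) (simp add: opE_def fip_diff_right fip_minus_right fip_sum_right fip_psc_right trace_def)
  finally show ?thesis .
qed

lemma opD_der: "der v (opD B p) = opD B (der v p)"
  by (simp add: opD_def der_sum der_psc der_commute[of v])

lemma opD_comm: "opD B (opD B' p) = opD B' (opD B p)"
proof -
  have "opD B (opD B' p) = (\<Sum>i\<in>UNIV. \<Sum>j\<in>UNIV. psc (B' $ i $ j) (\<Sum>c\<in>C. opD B (der (i, c, False) (der (j, c, True) p))))"
    unfolding opD_def[of B'] by (simp add: plin_sum plin_psc)
  also have "\<dots> = opD B' (opD B p)"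
    unfolding opD_def[of B'] by (simp add: opD_der)
  finally show ?thesis .
qed

lemma opM_pvar: "opM Y (pvar v * p) = pvar v * opM Y p"
  by (simp add: opM_def algebra_simps)

lemma fip_opD: "fip (opD B p) u = fip p (opM (cnjm B) u)"
proof -
  have "fip (opD B p) u = (\<Sum>i\<in>UNIV. \<Sum>j\<in>UNIV. B $ i $ j * (\<Sum>c\<in>C. fip p (pvar (i, c, False) * pvar (j, c, True) * u)))"
    by (simp add: opD_def fip_sum_left fip_psc_left fip_der_left mult_ac)
  also have "\<dots> = fip p (opM (cnjm B) u)"
    by (simp add: opM_def qf_def sum_distrib_right psc_mult_left fip_sum_right fip_psc_right)
  finally show ?thesis .
qed

lemma fip_opM: "fip (opM Y p) u = fip p (opD (cnjm Y) u)"
  by (metis fip_opD fip_cnj cnjm_cnjm)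

lemma sum_col_delta1:
  "(\<Sum>c'\<in>C. if i = l \<and> c' = c \<and> P then f c' else 0)
    = (if i = l \<and> c \<in> C \<and> P then f c else (0 :: 'a::comm_monoid_add))"
proof -
  have "(\<Sum>c'\<in>C. if i = l \<and> c' = c \<and> P then f c' else 0)
      = (\<Sum>c'\<in>C. if c' = c then (if i = l \<and> P then f c' else 0) else 0)"
    by (intro sum.cong refl) auto
  then show ?thesis using finC by auto
qed

lemma opM_der:
  assumes "transpose Y = - Y"
  shows "der (l, c, s) (opM Y p) = opM Y (der (l, c, s) p)
    - (if c \<in> C then psc (eps s) (\<Sum>j\<in>UNIV. psc (Y $ l $ j) (pvar (j, c, \<not> s) * p)) else 0)"
proof -
  have 1: "der (l, c, s) (\<Sum>c'\<in>C. pvar (i, c', False) * pvar (j, c', True))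
      = (if i = l \<and> c \<in> C \<and> \<not> s then pvar (j, c, True) else 0) + (if j = l \<and> c \<in> C \<and> s then pvar (i, c, False) else 0)" for i j
  proof -
    have "der (l, c, s) (\<Sum>c'\<in>C. pvar (i, c', False) * pvar (j, c', True))
      = (\<Sum>c'\<in>C. if i = l \<and> c' = c \<and> \<not> s then pvar (j, c', True) else 0)
       + (\<Sum>c'\<in>C. if j = l \<and> c' = c \<and> s then pvar (i, c', False) else 0)"
      unfolding der_sum sum.distrib[symmetric]
      by (intro sum.cong refl) (auto simp: der_pvar_mult der_pvar)
    then show ?thesis by (simp only: sum_col_delta1)
  qed
  have 2: "der (l, c, s) (qf Y) = - (if c \<in> C then psc (eps s) (\<Sum>j\<in>UNIV. psc (Y $ l $ j) (pvar (j, c, \<not> s))) else 0)"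
  proof (cases "c \<in> C")
    case True
    have "der (l, c, s) (qf Y) = (\<Sum>i\<in>UNIV. \<Sum>j\<in>UNIV. (if i = l then (if s then 0 else psc (Y $ i $ j) (pvar (j, c, True))) else 0))
       + (\<Sum>i\<in>UNIV. \<Sum>j\<in>UNIV. (if j = l then (if s then psc (Y $ i $ j) (pvar (i, c, False)) else 0) else 0))"
      unfolding qf_def der_sum[of _ _ UNIV] der_psc 1 sum.distrib[symmetric]
      by (intro sum.cong refl) (auto simp: True)
    also have "(\<Sum>i\<in>UNIV. \<Sum>j\<in>UNIV. (if i = l then (if s then 0 else psc (Y $ i $ j) (pvar (j, c, True))) else 0))
        = (if s then 0 else \<Sum>j\<in>UNIV. psc (Y $ l $ j) (pvar (j, c, True)))"
      by (subst sum.swap) simp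
    finally have "der (l, c, s) (qf Y) = (if s then \<Sum>i\<in>UNIV. psc (Y $ i $ l) (pvar (i, c, False))
        else \<Sum>j\<in>UNIV. psc (Y $ l $ j) (pvar (j, c, True)))" by simp
    \<comment> \<open>Skewness turns the column of \<open>Y\<close> into minus its row, and this
      sign is what \<open>eps s\<close> records, so one formula serves both halves.\<close>
    also have "(\<Sum>i\<in>UNIV. psc (Y $ i $ l) (pvar (i, c, False))) = - (\<Sum>i\<in>UNIV. psc (Y $ l $ i) (pvar (i, c, False)))"
      by (subst skew_nth[OF assms]) (simp add: psc_minus_left sum_negf)
    finally show ?thesis using True by (simp add: psc_minus_left)
  next
    case False
    then show ?thesis unfolding qf_def der_sum[of _ _ UNIV] der_psc 1 by simp
  qed
  show ?thesis
    unfolding opM_def der_mult 2 by (simp add: psc_mult_left sum_distrib_right)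
qed

text \<open>The Fock adjoint of \<open>opM_der\<close>, applied to the conjugate matrix.\<close>

lemma opD_pvar:
  assumes "transpose B = - B"
  shows "opD B (pvar (l, c, s) * p) = pvar (l, c, s) * opD B p
    - (if c \<in> C then psc (eps s) (\<Sum>j\<in>UNIV. psc (B $ l $ j) (der (j, c, \<not> s) p)) else 0)"
proof (rule fip_eqI)
  fix u
  note sk = cnjm_skew[OF assms]
  show "fip (opD B (pvar (l, c, s) * p)) u = fip (pvar (l, c, s) * opD B p
    - (if c \<in> C then psc (eps s) (\<Sum>j\<in>UNIV. psc (B $ l $ j) (der (j, c, \<not> s) p)) else 0)) u"
    by (simp add: fip_opD fip_pvar_left opM_der[OF sk] fip_diff_left fip_diff_right fip_sum_left fip_sum_right
        fip_psc_left fip_psc_right fip_der_left)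
qed

text \<open>All commutation rules in one formula: for \<open>c\<close> in \<open>C\<close> the
  commutator of \<open>gact X\<close> with the vector \<open>xi c s\<close> is minus the matrix
  \<open>X\<close> applied to that vector. Columns outside \<open>C\<close> commute with the
  action.\<close>

lemma gact_xi:
  assumes "X \<in> lie_g"
  shows "gact X (xi c s r p) = xi c s r (gact X p)
    - (if c \<in> C then \<Sum>q\<in>UNIV. psc (X $ r $ q) (xi c s q p) else 0)"
proof -
  have B: "transpose (ur X) = - ur X" and Y: "transpose (ll X) = - ll X"
    and D': "lr X = - transpose (ul X)"
    using assms by (simp_all only: lie_g_quarters)
  have D: "X $ Inr i $ Inr j = - X $ Inl j $ Inl i" for i j
    using arg_cong[OF D', of "\<lambda>M. M $ i $ j"] by (simp add: transpose_def)
  show ?thesis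
  proof (cases r)
    case (Inl i)
    then show ?thesis
      by (simp add: gact_def opE_pvar opD_pvar[OF B] opM_pvar sum_UNIV_Plus psc_sum distrib_left mult.commute[of _ "eps s"])
  next
    case (Inr i)
    have "gact X (der (i, c, \<not> s) p) = der (i, c, \<not> s) (gact X p)
      + (if c \<in> C then (\<Sum>j\<in>UNIV. psc (X $ Inl j $ Inl i) (der (j, c, \<not> s) p))
        - psc (eps s) (\<Sum>j\<in>UNIV. psc (X $ Inr i $ Inl j) (pvar (j, c, s) * p)) else 0)"
      by (simp add: gact_def der_add opE_der opD_der opM_der[OF Y] psc_minus_left)
    then show ?thesis using Inr
      by (simp add: plin_psc D sum_UNIV_Plus psc_add_right psc_diff_right psc_minus_left sum_negf psc_sum
          algebra_simps)
  qed
qed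

end

section \<open>The adjoint for the hermitian form, and the triangular decomposition in the
  orthogonal group\<close>

lemma matrix_add_rdistrib: "((A :: complex^'n^'m) + B) ** M = A ** M + B ** M"
  by (simp add: vec_eq_iff matrix_matrix_mult_def sum.distrib distrib_right)

text \<open>The adjoint with respect to \<open>herm_form\<close>. It corresponds to the Fock adjoint
  of the action, and on \<open>lie_g0\<close> it is multiplication by -1.\<close>

definition adjm :: "'n::finite mat2 \<Rightarrow> 'n mat2" where
  "adjm X = (\<chi> r s. sg r * sg s * cnj (X $ s $ r))"

lemma adjm_nth: "adjm X $ r $ s = sg r * sg s * cnj (X $ s $ r)"
  by (simp add: adjm_def)

lemma adjm_eq: "adjm X = herm_form ** conj_transpose X ** herm_form"
  by (simp add: vec_eq_iff adjm_nth herm_form_mult)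

lemma lie_g_adjm: assumes "X \<in> lie_g" shows "adjm X \<in> lie_g"
proof -
  have X: "X $ sw s $ r = - X $ sw r $ s" for r s using assms unfolding lie_g_iff by blast
  have "adjm X $ sw s $ r = - adjm X $ sw r $ s" for r s
    using X[of "sw r" "sw s"] by (simp add: adjm_nth)
  then show ?thesis unfolding lie_g_iff by blast
qed

lemma adjm_lie_g0: assumes "X \<in> lie_g0" shows "adjm X = cscale (- 1) X"
proof -
  have "cnj (X $ s $ r) * sg s + sg r * X $ r $ s = 0" for r s
    using assms by (simp add: lie_g0_def vec_eq_iff herm_form_mult)
  then have "sg r * (cnj (X $ s $ r) * sg s + sg r * X $ r $ s) = 0" for r s by simp
  then show ?thesis
    by (simp add: vec_eq_iff adjm_nth cscale_def distrib_left add_eq_0_iff2 mult_ac)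
qed

lemma adjm_quarters:
  assumes "X \<in> lie_g"
  shows "ul (adjm X) = conj_transpose (ul X)" "ur (adjm X) = cnjm (ll X)" "ll (adjm X) = cnjm (ur X)"
proof -
  have B: "transpose (ur X) = - ur X" and Y: "transpose (ll X) = - ll X"
    using assms by (simp_all only: lie_g_quarters)
  have "- cnj (X $ Inr j $ Inl i) = cnj (X $ Inr i $ Inl j)" "- cnj (X $ Inl j $ Inr i) = cnj (X $ Inl i $ Inr j)" for i j
    using skew_nth[OF B, of i j] skew_nth[OF Y, of i j] by (simp_all only: quarter_nth complex_cnj_minus)
  then show "ul (adjm X) = conj_transpose (ul X)" "ur (adjm X) = cnjm (ll X)" "ll (adjm X) = cnjm (ur X)"
    by (simp_all add: vec_eq_iff adjm_nth)
qed

text \<open>The inverse on \<open>so_c\<close>. It is linear in the entries of \<open>g\<close>, so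
  limits and derivatives of inverses along curves need no computation.\<close>

definition ginv :: "'n::finite mat2 \<Rightarrow> 'n mat2" where
  "ginv g = (\<chi> r s. g $ sw s $ sw r)"

definition so_c :: "'n::finite mat2 set" where
  "so_c = {g. transpose g ** sym_form ** g = sym_form}"

definition yof :: "'n::finite mat2 \<Rightarrow> complex^'n^'n" where
  "yof g = ll g ** matrix_inv (ul g)"

definition zof :: "'n::finite mat2 \<Rightarrow> complex^'n^'n" where
  "zof g = matrix_inv (ul g) ** ur g"

definition nplus :: "complex^'n^'n \<Rightarrow> 'n::finite mat2" where "nplus Z = block (mat 1) Z 0 (mat 1)"
definition nminus :: "complex^'n^'n \<Rightarrow> 'n::finite mat2" where "nminus Y = block (mat 1) 0 Y (mat 1)"

lemma ginv_nth: "ginv g $ r $ s = g $ sw s $ sw r"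
  by (simp add: ginv_def)

lemma so_c_iff: "g \<in> so_c \<longleftrightarrow> ginv g ** g = mat 1"
proof -
  have 1: "ginv g = sym_form ** transpose g ** sym_form"
    by (simp add: vec_eq_iff ginv_nth sym_form_mult transpose_def)
  have 2: "sym_form ** sym_form = mat 1"
    by (simp add: vec_eq_iff sym_form_mult sym_form_nth mat_def)
  have 3: "ginv g ** g = sym_form ** (transpose g ** sym_form ** g)"
    by (simp add: 1 matrix_mul_assoc)
  have 4: "transpose g ** sym_form ** g = sym_form ** (ginv g ** g)"
    unfolding 3 by (simp only: matrix_mul_assoc 2 matrix_mul_lid)
  show ?thesis
    unfolding so_c_def mem_Collect_eq using 2 3 4 by (auto simp del: matrix_mul_assoc)
qed

lemma ginv_left: "g \<in> so_c \<Longrightarrow> ginv g ** g = mat 1"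
  and ginv_right: "g \<in> so_c \<Longrightarrow> g ** ginv g = mat 1"
  by (simp_all add: so_c_iff matrix_left_right_inverse)

lemma ginv_mult: "ginv (g ** h) = ginv h ** ginv g"
proof -
  have "(\<Sum>q\<in>UNIV. g $ sw s $ q * h $ q $ sw r) = (\<Sum>q\<in>UNIV. h $ sw q $ sw r * g $ sw s $ sw q)" for r s
    by (subst sum_sw[symmetric]) (simp add: mult.commute)
  then show ?thesis by (simp add: vec_eq_iff ginv_nth matmul_nth)
qed

lemma so_c_mult: assumes "g \<in> so_c" "h \<in> so_c" shows "g ** h \<in> so_c"
proof -
  have "ginv (g ** h) ** (g ** h) = ginv h ** (ginv g ** g) ** h"
    by (simp only: ginv_mult matrix_mul_assoc)
  then show ?thesis by (simp only: so_c_iff assms[THEN ginv_left] matrix_mul_rid)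
qed

lemma quarter_ginv [simp]:
  "ul (ginv g) = transpose (lr g)" "ur (ginv g) = transpose (ur g)"
  "ll (ginv g) = transpose (ll g)" "lr (ginv g) = transpose (ul g)"
  by (simp_all add: vec_eq_iff ginv_nth transpose_def)

lemma matrix_inv_mult: "invertible A \<Longrightarrow> A ** matrix_inv A = mat 1" "invertible A \<Longrightarrow> matrix_inv A ** A = mat 1"
  for A :: "complex^'n^'n"
  unfolding matrix_inv_def invertible_def by (drule someI_ex, blast)+

lemma yof_mult: "invertible (ul g) \<Longrightarrow> yof g ** ul g = ll g"
  by (simp add: yof_def flip: matrix_mul_assoc) (simp add: matrix_inv_mult)

lemma zof_mult: "invertible (ul g) \<Longrightarrow> ul g ** zof g = ur g"
  by (simp add: zof_def matrix_mul_assoc matrix_inv_mult)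

lemma transpose_mult: "transpose ((A :: complex^'n^'n) ** B) = transpose B ** transpose A"
  by (simp add: matrix_transpose_mul)

lemma matrix_minus_mult: "(- A) ** B = - (A ** B)" "A ** (- B) = - (A ** B)" for A B :: "complex^'n^'n"
  by (simp_all add: vec_eq_iff matmul_nth sum_negf)

lemma so_c_quarters:
  assumes "g \<in> so_c"
  shows "transpose (ul g) ** ll g + transpose (ll g) ** ul g = 0"
    and "transpose (lr g) ** ul g + transpose (ur g) ** ll g = mat 1"
    and "ul g ** transpose (ur g) + ur g ** transpose (ul g) = 0"
proof -
  show "transpose (ul g) ** ll g + transpose (ll g) ** ul g = 0"
    using arg_cong[OF ginv_left[OF assms], of ll] by (simp add: quarter_mult add.commute)
  show "transpose (lr g) ** ul g + transpose (ur g) ** ll g = mat 1"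
    using arg_cong[OF ginv_left[OF assms], of ul] by (simp add: quarter_mult)
  show "ul g ** transpose (ur g) + ur g ** transpose (ul g) = 0"
    using arg_cong[OF ginv_right[OF assms], of ur] by (simp add: quarter_mult)
qed

text \<open>Multiply \<open>A^T C + C^T A = 0\<close> by the inverse transpose of \<open>A\<close>
  on the left and by the inverse of \<open>A\<close> on the right.\<close>

lemma yof_skew:
  assumes "g \<in> so_c" "invertible (ul g)"
  shows "transpose (yof g) = - yof g"
proof -
  let ?A = "ul g" and ?I = "matrix_inv (ul g)"
  have "transpose ?I ** (transpose ?A ** ll g + transpose (ll g) ** ?A) ** ?I = 0"
    by (simp add: so_c_quarters(1)[OF assms(1)])
  also have "transpose ?I ** (transpose ?A ** ll g + transpose (ll g) ** ?A) ** ?I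
    = (transpose (?A ** ?I)) ** (ll g ** ?I) + transpose (ll g ** ?I) ** (?A ** ?I)"
    by (simp add: matrix_add_ldistrib matrix_add_rdistrib matrix_mul_assoc transpose_mult)
  finally show ?thesis
    by (simp add: matrix_inv_mult assms(2) yof_def add_eq_0_iff)
qed

lemma zof_skew:
  assumes "g \<in> so_c" "invertible (ul g)"
  shows "transpose (zof g) = - zof g"
proof -
  let ?A = "ul g" and ?I = "matrix_inv (ul g)"
  have "?I ** (?A ** transpose (ur g) + ur g ** transpose ?A) ** transpose ?I = 0"
    by (simp add: so_c_quarters(3)[OF assms(1)])
  also have "?I ** (?A ** transpose (ur g) + ur g ** transpose ?A) ** transpose ?I
    = (?I ** ?A) ** transpose (?I ** ur g) + (?I ** ur g) ** transpose (?I ** ?A)"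
    by (simp add: matrix_add_ldistrib matrix_add_rdistrib matrix_mul_assoc transpose_mult)
  finally show ?thesis
    by (simp add: matrix_inv_mult assms(2) zof_def add_eq_0_iff2)
qed

lemma nminus_add: "nminus Y ** nminus W = nminus (Y + W)"
  by (rule mat2_eqI) (simp_all add: quarter_mult nminus_def)

lemma nplus_add: "nplus Y ** nplus W = nplus (W + Y)"
  by (rule mat2_eqI) (simp_all add: quarter_mult nplus_def)

lemma nplus_zero: "nplus 0 = mat 1" and nminus_zero: "nminus 0 = mat 1"
  by (rule mat2_eqI; simp add: nplus_def nminus_def)+

text \<open>The triangular decomposition of \<open>g\<close>, solved for the part that acts on
  polynomials. The right-hand side is the matrix by which \<open>thalf g\<close> transforms the
  operators \<open>xi\<close>.\<close>

lemma ginv_triangular: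
  assumes "g \<in> so_c" "invertible (ul g)"
  shows "ginv g ** nminus (yof g)
    = nplus (- zof g) ** block (matrix_inv (ul g)) 0 0 (transpose (ul g))"
proof (rule mat2_eqI)
  let ?I = "matrix_inv (ul g)"
  show "ul (ginv g ** nminus (yof g)) = ul (nplus (- zof g) ** block ?I 0 0 (transpose (ul g)))"
  proof -
    have "(transpose (lr g) + transpose (ur g) ** yof g) = (transpose (lr g) ** ul g + transpose (ur g) ** ll g) ** ?I"
      by (simp add: yof_def matrix_add_rdistrib matrix_inv_mult[OF assms(2)] flip: matrix_mul_assoc)
    then show ?thesis by (simp add: quarter_mult nminus_def nplus_def so_c_quarters(2)[OF assms(1)])
  qed
  show "ur (ginv g ** nminus (yof g)) = ur (nplus (- zof g) ** block ?I 0 0 (transpose (ul g)))"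
  proof -
    have "transpose (ur g) = transpose (zof g) ** transpose (ul g)"
      by (simp add: zof_mult[OF assms(2)] flip: transpose_mult)
    then show ?thesis by (simp add: quarter_mult nminus_def nplus_def zof_skew[OF assms])
  qed
  show "ll (ginv g ** nminus (yof g)) = ll (nplus (- zof g) ** block ?I 0 0 (transpose (ul g)))"
  proof -
    have "transpose (ll g) = transpose (ul g) ** transpose (yof g)"
      by (simp add: yof_mult[OF assms(2)] flip: transpose_mult)
    then show ?thesis
      by (simp add: quarter_mult nminus_def nplus_def yof_skew[OF assms] flip: matrix_add_ldistrib)
  qed
  show "lr (ginv g ** nminus (yof g)) = lr (nplus (- zof g) ** block ?I 0 0 (transpose (ul g)))"
    by (simp add: quarter_mult nminus_def nplus_def)
qed

section \<open>The operators form a representation of so(2n, C), with adjoints\<close>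

context fock
begin

text \<open>\<open>adjm\<close> exchanges the off-diagonal blocks, up to conjugation, just as
  adjunction exchanges \<open>opD\<close> and \<open>opM\<close>.\<close>

lemma fip_gact: "X \<in> lie_g \<Longrightarrow> fip (gact X p) u = fip p (gact (adjm X) u)"
  by (simp add: gact_def adjm_quarters fip_add_left fip_add_right fip_opE fip_opD fip_opM)

lemma opE_add: "opE (A + B) p = opE A p + opE B p"
  by (simp add: opE_def psc_add_left sum.distrib trace_def distrib_left)

lemma opD_add: "opD (A + B) p = opD A p + opD B p"
  by (simp add: opD_def psc_add_left sum.distrib)

lemma qf_add: "qf (A + B) = qf A + qf B"
  by (simp add: qf_def psc_add_left sum.distrib)

lemma opM_add: "opM (A + B) p = opM A p + opM B p"
  by (simp add: opM_def qf_add distrib_right)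

lemma opE_cscale: "opE (cscale c A) p = psc c (opE A p)"
  by (simp add: opE_def cscale_def trace_def psc_diff_right sum_distrib_left mult.left_commute psc_sum)

lemma opD_cscale: "opD (cscale c A) p = psc c (opD A p)"
  by (simp add: opD_def cscale_def psc_sum)

lemma qf_cscale: "qf (cscale c A) = psc c (qf A)"
  by (simp add: qf_def cscale_def psc_sum)

lemma opM_cscale: "opM (cscale c A) p = psc c (opM A p)"
  by (simp add: opM_def qf_cscale psc_mult_left)

lemma op_zero [simp]: "opE 0 p = 0" "opD 0 p = 0" "opM 0 p = 0" "qf 0 = 0"
  by (simp_all add: opE_def opD_def opM_def qf_def trace_def)

lemma gact_add: "gact (X + Y) p = gact X p + gact Y p"
  by (simp add: gact_def opE_add opD_add opM_add)

lemma gact_cscale: "gact (cscale c X) p = psc c (gact X p)"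
  by (simp add: gact_def opE_cscale opD_cscale opM_cscale psc_add_right)

lemma opE_one: "opE A 1 = psc (- of_nat (card C) * trace A) 1"
  by (simp add: opE_def psc_minus_left)

lemma opD_one: "opD B 1 = 0"
  by (simp add: opD_def)

lemma gact_one: "gact X 1 = psc (- of_nat (card C) * trace (ul X)) 1 + qf (ll X)"
  by (simp add: gact_def opE_one opD_one opM_def)

text \<open>The only constant term in the brackets of the three kinds of operators; every column in
  \<open>C\<close> contributes the same amount. It must be matched by the trace term of
  \<open>opE\<close>.\<close>

lemma opD_qf:
  assumes "transpose Y = - Y"
  shows "opD B (qf Y) = psc (of_nat (card C) * (\<Sum>i\<in>UNIV. \<Sum>j\<in>UNIV. B $ i $ j * Y $ i $ j)) 1"
proof -
  have "der (i, c, False) (der (j, c, True) (qf Y)) = psc (Y $ i $ j) 1" if "c \<in> C" for i j c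
  proof -
    have "der (j, c, True) (qf Y) = - (\<Sum>l\<in>UNIV. psc (Y $ j $ l) (pvar (l, c, False)))"
      using opM_der[OF assms, of j c True 1] that by (simp add: opM_def psc_minus_left)
    then have "der (i, c, False) (der (j, c, True) (qf Y)) = - psc (Y $ j $ i) 1"
      by (simp add: der_minus der_sum der_psc der_pvar if_distrib cong: if_cong)
    also have "\<dots> = psc (Y $ i $ j) 1"
      using skew_nth[OF assms, of i j] by (simp only: psc_minus_left)
    finally show ?thesis .
  qed
  moreover have "of_nat k * q = psc (of_nat k) q" for k and q :: "'a var pol"
    by (simp add: psc_def)
  ultimately show ?thesis
    by (simp add: opD_def psc_sum_left sum_distrib_left mult.left_commute)
qed

text \<open>The difference \<open>D\<close> of the two sides commutes with all variables and
  derivatives. Hence it maps 1 to a constant and is determined by that constant, which is found by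
  pairing with 1.\<close>

lemma gact_bracket:
  assumes X: "X \<in> lie_g" and Y: "Y \<in> lie_g"
  shows "gact (bracket X Y) p = gact X (gact Y p) - gact Y (gact X p)"
proof -
  define D where "D p = gact (bracket X Y) p - (gact X (gact Y p) - gact Y (gact X p))" for p
  have D_lin: "plin D"
    by (rule plinI) (simp_all add: D_def plin_add[OF plin_gact] plin_psc[OF plin_gact] psc_diff_right)
  have D_xi: "D (xi c s r p) = xi c s r (D p)" for c s r p
  proof -
    \<comment> \<open>The two middle terms are exchanged when \<open>X\<close> and \<open>Y\<close>
      are, so they cancel in the commutator.\<close>
    have XY: "gact X (gact Y (xi c s r p)) = xi c s r (gact X (gact Y p))
        - (if c \<in> C then \<Sum>q\<in>UNIV. psc (X $ r $ q) (xi c s q (gact Y p)) else 0)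
        - (if c \<in> C then \<Sum>q\<in>UNIV. psc (Y $ r $ q) (xi c s q (gact X p)) else 0)
        + (if c \<in> C then \<Sum>q\<in>UNIV. psc ((Y ** X) $ r $ q) (xi c s q p) else 0)"
      if X: "X \<in> lie_g" and Y: "Y \<in> lie_g" for X Y :: "'a mat2"
    proof -
      have "(\<Sum>q\<in>UNIV. \<Sum>t\<in>UNIV. psc (Y $ r $ q * X $ q $ t) (xi c s t p))
        = (\<Sum>q\<in>UNIV. psc ((Y ** X) $ r $ q) (xi c s q p))"
        by (subst sum.swap) (simp add: matmul_nth psc_sum_left)
      then show ?thesis
        by (simp add: gact_xi[OF X] gact_xi[OF Y] plin_diff[OF plin_gact] plin_sum[OF plin_gact] plin_psc[OF plin_gact]
            plin_zero[OF plin_gact] psc_diff_right sum_subtractf psc_sum)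
    qed
    show ?thesis
      unfolding D_def XY[OF X Y] XY[OF Y X] gact_xi[OF lie_g_bracket[OF X Y]]
      by (simp add: plin_diff[OF plin_xi] bracket_def sum_subtractf psc_add_left psc_minus_left
          pol.scale_left_diff_distrib)
  qed
  have D_pvar: "D (pvar v * p) = pvar v * D p" for v p
    using D_xi[of "fst (snd v)" "snd (snd v)" "Inl (fst v)" p] by simp
  have D_der: "D (der v p) = der v (D p)" for v p
  proof -
    define e where "e = eps (\<not> snd (snd v))"
    have e: "e * e = 1" unfolding e_def by (rule eps_simps)
    have "psc e (D (der v p)) = psc e (der v (D p))"
      using D_xi[of "fst (snd v)" "\<not> snd (snd v)" "Inr (fst v)" p]
      unfolding xi_simps e_def[symmetric] plin_psc[OF D_lin] by simp
    then have "psc e (psc e (D (der v p))) = psc e (psc e (der v (D p)))" by (rule arg_cong)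
    then show ?thesis by (simp add: e)
  qed
  \<comment> \<open>\<open>D 1\<close> is annihilated by all derivatives, hence constant.\<close>
  have D1: "D 1 = psc (fip (D 1) 1) 1"
  proof -
    have "der v (D 1) = 0" for v by (simp flip: D_der add: plin_zero[OF D_lin])
    then have *: "Poly_Mapping.lookup (D 1) (m + Poly_Mapping.single v 1) = 0" for m v
      using lookup_der[of v "D 1" m] of_nat_neq_0[of "Poly_Mapping.lookup m v", where 'a = complex] by (simp add: add.commute)
    have lk: "Poly_Mapping.lookup (D 1) m = 0" if "m \<noteq> 0" for m
      using that by (induction m rule: mono_induct) (use * in auto)
    have "D 1 = psc (Poly_Mapping.lookup (D 1) 0) 1"
      by (rule poly_mapping_eqI) (use lk in \<open>auto simp: lookup_one when_def\<close>)
    then show ?thesis by (metis fip_one_one fip_psc_left mult.right_neutral)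
  qed
  \<comment> \<open>The product of the two traces is symmetric and drops out of the commutator; the
    remaining term is the one from \<open>opD_qf\<close>.\<close>
  have c: "fip (gact X (gact Y 1)) 1 = of_nat (card C) ^ 2 * trace (ul X) * trace (ul Y)
      + of_nat (card C) * (\<Sum>i\<in>UNIV. \<Sum>j\<in>UNIV. ur X $ i $ j * ll Y $ i $ j)"
    if X: "X \<in> lie_g" and Y: "Y \<in> lie_g" for X Y :: "'a mat2"
  proof -
    have Ys: "transpose (ll Y) = - ll Y" using Y by (simp only: lie_g_quarters)
    have 1: "fip (opM M q) 1 = 0" for M :: "complex^'a^'a" and q :: "'a var pol"
      by (simp add: fip_opM opD_one)
    have 2: "fip (opE A (qf (ll Y))) 1 = 0" for A :: "complex^'a^'a"
      using 1[of "ll Y" 1] by (simp add: fip_opE opE_one fip_psc_right fip_minus_right psc_minus_left opM_def)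
    have "fip (gact X (gact Y 1)) 1 = fip (gact X (psc (- of_nat (card C) * trace (ul Y)) 1)) 1 + fip (gact X (qf (ll Y))) 1"
      by (simp only: gact_one[of Y] plin_add[OF plin_gact] fip_add_left)
    also have "fip (gact X (psc (- of_nat (card C) * trace (ul Y)) 1)) 1 = of_nat (card C) ^ 2 * trace (ul X) * trace (ul Y)"
      using 1[of "ll X" 1] by (simp add: plin_psc[OF plin_gact] plin_minus[OF plin_gact] fip_minus_left fip_diff_left psc_minus_left gact_one fip_psc_left fip_add_left opM_def power2_eq_square)
    also have "fip (gact X (qf (ll Y))) 1 = of_nat (card C) * (\<Sum>i\<in>UNIV. \<Sum>j\<in>UNIV. ur X $ i $ j * ll Y $ i $ j)"
      by (simp add: gact_def fip_add_left 1 2 opD_qf[OF Ys] fip_psc_left)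
    finally show ?thesis .
  qed
  have tr: "trace (A ** B) = (\<Sum>i\<in>UNIV. \<Sum>j\<in>UNIV. A $ i $ j * B $ j $ i)" for A B :: "complex^'a^'a"
    by (simp add: trace_def matmul_nth)
  have trs: "trace (ur X ** ll Y) = - (\<Sum>i\<in>UNIV. \<Sum>j\<in>UNIV. ur X $ i $ j * ll Y $ i $ j)"
    if "X \<in> lie_g" "Y \<in> lie_g" for X Y :: "'a mat2"
  proof -
    have s: "transpose (ll Y) = - ll Y" using that by (simp only: lie_g_quarters)
    show ?thesis unfolding tr by (subst skew_nth[OF s]) (simp only: mult_minus_right sum_negf)
  qed
  have "fip (gact (bracket X Y) 1) 1 = - of_nat (card C) * trace (ul (bracket X Y))"
    using fip_opM[of "ll (bracket X Y)" 1 1] by (simp add: gact_one fip_add_left fip_diff_left psc_minus_left fip_psc_left opM_def opD_one)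
  also have "trace (ul (bracket X Y)) = trace (ur X ** ll Y) - trace (ur Y ** ll X)"
    using trace_mul_sym[of "ul X" "ul Y"] by (simp add: bracket_def quarter_mult trace_add trace_sub)
  finally have "fip (D 1) 1 = 0"
    unfolding D_def fip_diff_left c[OF X Y] c[OF Y X] trs[OF X Y] trs[OF Y X] by (simp add: algebra_simps)
  then have "D 1 = 0" using D1 by simp
  then have "D p = 0"
    by (induction p rule: pol_induct) (simp_all add: plin_add[OF D_lin] plin_psc[OF D_lin] D_pvar)
  then show ?thesis by (simp add: D_def)
qed

lemma gact_p_plus [simp]: "gact (block 0 B 0 0) p = opD B p"
  and gact_p_minus [simp]: "gact (block 0 0 Y 0) p = opM Y p"
  and gact_gl_embed [simp]: "gact (gl_embed A) p = opE A p"
  by (simp_all add: gact_def gl_embed_def)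

end

lemma invertible_kernel:
  fixes A :: "complex^'n^'n"
  assumes "invertible A" "A *v x = 0"
  shows "x = 0"
proof -
  have "matrix_inv A *v (A *v x) = x"
    by (simp add: matrix_vector_mul_assoc matrix_inv_mult[OF assms(1)])
  then show ?thesis by (simp add: assms(2))
qed

section \<open>Intertwiners for the triangular factors, and the matrix coefficients of the
  group\<close>

context fock
begin

text \<open>The matrix felt by column \<open>c\<close>: the inert columns see the identity.\<close>

definition colm :: "nat \<Rightarrow> 'n::finite mat2 \<Rightarrow> 'n mat2" where
  "colm c G = (if c \<in> C then G else mat 1)"

lemma colm_mult: "colm c (G ** H) = colm c G ** colm c H"
  by (simp add: colm_def)

lemma colm_mat1 [simp]: "colm c (mat 1) = mat 1"
  by (simp add: colm_def)

definition itw :: "'n::finite mat2 \<Rightarrow> ('n var pol \<Rightarrow> 'n var pol) \<Rightarrow> bool" where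
  "itw G T \<longleftrightarrow> plin T \<and>
    (\<forall>c s r p. T (xi c s r p) = (\<Sum>q\<in>UNIV. psc (colm c G $ r $ q) (xi c s q (T p))))"

lemma itw_plin: "itw G T \<Longrightarrow> plin T"
  and itw_xi: "itw G T \<Longrightarrow> T (xi c s r p) = (\<Sum>q\<in>UNIV. psc (colm c G $ r $ q) (xi c s q (T p)))"
  by (auto simp: itw_def)

text \<open>The operator applied first contributes the left factor, since its scalar coefficients
  pass through the second operator.\<close>

lemma itw_comp:
  assumes "itw G T" "itw H U"
  shows "itw (G ** H) (\<lambda>p. U (T p))"
proof -
  have "(\<Sum>q\<in>UNIV. psc (colm c G $ r $ q) (\<Sum>t\<in>UNIV. psc (colm c H $ q $ t) (f t)))
      = (\<Sum>t\<in>UNIV. psc (colm c (G ** H) $ r $ t) (f t))" for c r and f :: "'a + 'a \<Rightarrow> 'a var pol"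
    unfolding psc_sum psc_psc
    by (subst sum.swap) (simp add: colm_mult matmul_nth psc_sum_left)
  then show ?thesis
    using itw_plin[OF assms(1)] itw_plin[OF assms(2)]
    by (auto simp: itw_def plin_def itw_xi[OF assms(1)] itw_xi[OF assms(2)]
        plin_sum[OF itw_plin[OF assms(2)]] plin_psc[OF itw_plin[OF assms(2)]])
qed

lemma itw_psc: "itw G T \<Longrightarrow> itw G (\<lambda>p. psc a (T p))"
  by (auto simp: itw_def plin_def psc_add_right psc_sum plin_psc[OF plin_xi] mult.commute[of a])

lemma opD_xi:
  assumes "transpose Z = - Z"
  shows "opD Z (xi c s r p) = xi c s r (opD Z p)
    - (if c \<in> C then \<Sum>q\<in>UNIV. psc (block 0 Z 0 0 $ r $ q) (xi c s q p) else 0)"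
proof -
  have "block 0 Z 0 0 \<in> lie_g"
    using assms block_in_lie_g[of Z 0 0] by simp
  from gact_xi[OF this] show ?thesis by simp
qed

text \<open>By \<open>funpow_comm\<close>, multiplication by a variable raises the order of
  nilpotency by at most one.\<close>

lemma lnil_opD:
  assumes "transpose Z = - Z"
  shows "lnil (opD Z)"
  unfolding lnil_def
proof (intro conjI allI)
  show "plin (opD Z)" by simp
  fix p
  show "\<exists>N. (opD Z ^^ N) p = 0"
  proof (induction p rule: pol_induct)
    case one
    show ?case by (rule exI[of _ 1]) (simp add: opD_one)
  next
    case (scale c p)
    then show ?case by (auto simp: plin_psc[OF plin_funpow])
  next
    case (add p q)
    then obtain N M where "(opD Z ^^ N) p = 0" "(opD Z ^^ M) q = 0" by blast
    then have "(opD Z ^^ (max N M)) (p + q) = 0"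
      by (simp add: plin_add[OF plin_funpow] funpow_zero_mono[of _ N _ "max N M"] funpow_zero_mono[of _ M _ "max N M"])
    then show ?case by blast
  next
    case (var v p)
    then obtain N where N: "(opD Z ^^ N) p = 0" by blast
    obtain l c s where v: "v = (l, c, s)" by (cases v)
    define S where "S p = - (if c \<in> C then psc (eps s) (\<Sum>j\<in>UNIV. psc (Z $ l $ j) (der (j, c, \<not> s) p)) else 0)" for p
    have S: "S 0 = 0" by (simp add: S_def)
    have "(opD Z ^^ (Suc N)) (pvar v * p) = pvar v * (opD Z ^^ (Suc N)) p + psc (of_nat (Suc N)) (S ((opD Z ^^ (Suc N - 1)) p))"
      by (rule funpow_comm)
        (simp_all add: v S_def opD_pvar[OF assms] plin_minus[OF plin_opD] plin_zero[OF plin_opD]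
          plin_psc[OF plin_opD] plin_sum[OF plin_opD] opD_der)
    then have "(opD Z ^^ (Suc N)) (pvar v * p) = 0" by (simp add: N S plin_zero)
    then show ?case by blast
  qed
qed

lemma itw_pexp:
  assumes "transpose Z = - Z"
  shows "itw (nplus (- Z)) (pexp (opD Z))"
  unfolding itw_def
proof (intro conjI allI)
  show "plin (pexp (opD Z))" by (rule plin_pexp[OF lnil_opD[OF assms]])
  fix c s r p
  let ?X = "block 0 Z 0 0"
  define S where "S p = - (if c \<in> C then \<Sum>q\<in>UNIV. psc (?X $ r $ q) (xi c s q p) else 0)" for p
  have S: "plin S"
    by (rule plinI) (simp_all add: S_def plin_add[OF plin_xi] plin_psc[OF plin_xi] psc_add_right
        sum.distrib psc_sum mult.commute)
  have "pexp (opD Z) (xi c s r p) = xi c s r (pexp (opD Z) p) + S (pexp (opD Z) p)"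
  proof (rule pexp_comm[OF lnil_opD[OF assms] plin_xi S])
    show "opD Z (xi c s r p) = xi c s r (opD Z p) + S p" for p
      by (simp add: S_def opD_xi[OF assms])
    \<comment> \<open>The strictly upper triangular block matrix has square zero. Hence the second
      commutator vanishes and \<open>pexp_comm\<close> applies.\<close>
    have X2: "(\<Sum>q\<in>UNIV. psc (?X $ r $ q) (\<Sum>t\<in>UNIV. psc (?X $ q $ t) (f t))) = 0" for f :: "'a + 'a \<Rightarrow> 'a var pol"
      by (cases r) (simp_all add: sum_UNIV_Plus)
    show "opD Z (S p) = S (opD Z p)" for p
      by (simp add: S_def plin_minus[OF plin_opD] plin_sum[OF plin_opD] plin_psc[OF plin_opD] plin_zero[OF plin_opD]
          opD_xi[OF assms] psc_diff_right sum_subtractf X2)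
  qed
  also have "\<dots> = (\<Sum>q\<in>UNIV. psc (colm c (nplus (- Z)) $ r $ q) (xi c s q (pexp (opD Z) p)))"
  proof -
    have "colm c (nplus (- Z)) $ r $ q = (if r = q then 1 else 0) - (if c \<in> C then ?X $ r $ q else 0)" for q
      by (cases r; cases q) (auto simp: colm_def nplus_def mat_def)
    then show ?thesis
      by (simp add: S_def pol.scale_left_diff_distrib sum_subtractf if_distrib[of "\<lambda>a. psc a _"] cong: if_cong)
  qed
  finally show "pexp (opD Z) (xi c s r p) = (\<Sum>q\<in>UNIV. psc (colm c (nplus (- Z)) $ r $ q) (xi c s q (pexp (opD Z) p)))" .
qed

text \<open>The group action of GL(n) on the rows, without the determinant factor. It is defined for
  singular matrices too, which \<open>dsub_perp\<close> exploits.\<close>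

definition dsub :: "complex^'n^'n \<Rightarrow> 'n::finite var pol \<Rightarrow> 'n var pol" where
  "dsub B = psub (\<lambda>(l, c, s). if c \<in> C then \<Sum>j\<in>UNIV. psc (B $ l $ j) (pvar (j, c, s)) else pvar (l, c, s))"

lemma plin_dsub [simp]: "plin (dsub B)"
  by (simp add: dsub_def)

lemma dsub_one [simp]: "dsub B 1 = 1"
  by (simp add: dsub_def)

lemma dsub_pvar:
  "dsub B (pvar (l, c, s) * p) = (if c \<in> C then \<Sum>j\<in>UNIV. psc (B $ l $ j) (pvar (j, c, s) * dsub B p) else pvar (l, c, s) * dsub B p)"
  by (simp add: dsub_def psub_pvar_mult sum_distrib_right psc_mult_left)

text \<open>The chain rule; derivatives transform by the transposed matrix.\<close>

lemma der_dsub: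
  "der (j, c, s) (dsub B p) = (if c \<in> C then \<Sum>l\<in>UNIV. psc (B $ l $ j) (dsub B (der (l, c, s) p)) else dsub B (der (j, c, s) p))"
proof (induction p rule: pol_induct)
  case one
  show ?case by (simp add: plin_zero)
next
  case (scale a p)
  then show ?case by (simp add: plin_psc[OF plin_dsub] der_psc psc_sum mult.commute)
next
  case (add p q)
  then show ?case by (simp add: plin_add[OF plin_dsub] der_add psc_add_right sum.distrib)
next
  case (var v p)
  obtain l' c' s' where v: "v = (l', c', s')" by (cases v)
  show ?case
  proof (cases "c' \<in> C")
    case False
    have ne: "c \<in> C \<Longrightarrow> c \<noteq> c'" using False by auto
    show ?thesis
    proof (cases "c \<in> C")
      case True
      then show ?thesis using var ne False
        by (simp add: v dsub_pvar der_pvar_mult sum_distrib_left psc_mult_right)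
    next
      case cC: False
      then show ?thesis using var False
        by (simp add: v dsub_pvar der_pvar_mult plin_add[OF plin_dsub] plin_zero[OF plin_dsub])
    qed
  next
    case True
    have "der (j, c, s) (dsub B (pvar v * p)) = (\<Sum>i\<in>UNIV. psc (B $ l' $ i) ((if (j, c, s) = (i, c', s') then dsub B p else 0) + pvar (i, c', s') * der (j, c, s) (dsub B p)))"
      using True by (simp add: v dsub_pvar der_sum der_psc der_pvar_mult)
    also have "\<dots> = (if c = c' \<and> s = s' then psc (B $ l' $ j) (dsub B p) else 0)
        + (\<Sum>i\<in>UNIV. psc (B $ l' $ i) (pvar (i, c', s') * der (j, c, s) (dsub B p)))"
      by (cases "c = c' \<and> s = s'") (auto simp: psc_add_right sum.distrib if_distrib[of "psc _"] cong: if_cong)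
    finally have L: "der (j, c, s) (dsub B (pvar v * p)) = \<dots>" .
    show ?thesis
    proof (cases "c \<in> C")
      case False
      then have "c \<noteq> c'" using True by auto
      then show ?thesis using False True var
        by (simp add: L) (simp add: v der_pvar_mult dsub_pvar)
    next
      case cC: True
      have "(\<Sum>l\<in>UNIV. psc (B $ l $ j) (dsub B (der (l, c, s) (pvar v * p))))
        = (\<Sum>l\<in>UNIV. psc (B $ l $ j) (if l = l' \<and> c = c' \<and> s = s' then dsub B p else 0))
          + (\<Sum>l\<in>UNIV. psc (B $ l $ j) (\<Sum>i\<in>UNIV. psc (B $ l' $ i) (pvar (i, c', s') * dsub B (der (l, c, s) p))))"
        unfolding sum.distrib[symmetric]
        by (rule sum.cong[OF refl])
          (use True in \<open>auto simp: v der_pvar_mult plin_add[OF plin_dsub] psc_add_right dsub_pvar plin_zero[OF plin_dsub]\<close>)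
      also have "(\<Sum>l\<in>UNIV. psc (B $ l $ j) (if l = l' \<and> c = c' \<and> s = s' then dsub B p else 0))
        = (if c = c' \<and> s = s' then psc (B $ l' $ j) (dsub B p) else 0)"
        by (simp add: if_distrib cong: if_cong)
      also have "(\<Sum>l\<in>UNIV. psc (B $ l $ j) (\<Sum>i\<in>UNIV. psc (B $ l' $ i) (pvar (i, c', s') * dsub B (der (l, c, s) p))))
        = (\<Sum>i\<in>UNIV. psc (B $ l' $ i) (pvar (i, c', s') * der (j, c, s) (dsub B p)))"
        unfolding psc_sum var
        by (subst sum.swap) (simp add: cC psc_sum sum_distrib_left psc_mult_right mult.commute)
      finally show ?thesis using cC by (simp add: L)
    qed
  qed
qed

text \<open>By induction: a substituted variable crosses the inner product as a combination of
  derivatives, which the chain rule identifies with the derivatives of the substituted second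
  argument.\<close>

lemma fip_dsub: "fip (dsub B p) q = fip p (dsub (conj_transpose B) q)"
proof (induction p arbitrary: q rule: pol_induct)
  case one
  show ?case
  proof (induction q rule: pol_induct)
    case one
    show ?case by simp
  next
    case (scale a q)
    then show ?case by (simp add: plin_psc[OF plin_dsub] fip_psc_right)
  next
    case (add p q)
    then show ?case by (simp add: plin_add[OF plin_dsub] fip_add_right)
  next
    case (var v q)
    have "fip 1 (pvar v * q) = 0" for v :: "'a var" and q by (simp add: fip_pvar_right)
    then show ?case by (cases v) (simp add: dsub_pvar fip_sum_right fip_psc_right)
  qed
next
  case (scale a p)
  then show ?case by (simp add: plin_psc[OF plin_dsub] fip_psc_left)
next
  case (add p p')
  then show ?case by (simp add: plin_add[OF plin_dsub] fip_add_left)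
next
  case (var v p)
  obtain l c s where v: "v = (l, c, s)" by (cases v)
  show ?case
    by (simp add: v dsub_pvar fip_sum_left fip_psc_left fip_pvar_left var der_dsub fip_sum_right fip_psc_right)
qed

lemma itw_dsub:
  assumes "B ** A = mat 1"
  shows "itw (block B 0 0 (transpose A)) (dsub B)"
  unfolding itw_def
proof (intro conjI allI)
  show "plin (dsub B)" by simp
  have AB: "A ** B = mat 1" using assms by (simp add: matrix_left_right_inverse)
  \<comment> \<open>Solves the chain rule for the derivatives before substitution; here the inverse
    matrix enters.\<close>
  have inv: "(\<Sum>j\<in>UNIV. psc (A $ j $ i) (\<Sum>l\<in>UNIV. psc (B $ l $ j) (f l))) = f i" for i and f :: "'a \<Rightarrow> 'a var pol"
  proof -
    have "(\<Sum>j\<in>UNIV. psc (A $ j $ i) (\<Sum>l\<in>UNIV. psc (B $ l $ j) (f l))) = (\<Sum>l\<in>UNIV. psc ((B ** A) $ l $ i) (f l))"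
      unfolding psc_sum psc_psc
      by (subst sum.swap) (simp add: matmul_nth psc_sum_left mult.commute)
    then show ?thesis by (simp add: assms mat_def if_distrib if_distribR cong: if_cong)
  qed
  fix c s r p
  show "dsub B (xi c s r p) = (\<Sum>q\<in>UNIV. psc (colm c (block B 0 0 (transpose A)) $ r $ q) (xi c s q (dsub B p)))"
  proof (cases r)
    case (Inl i)
    then show ?thesis
      by (cases "c \<in> C")
        (simp_all add: dsub_pvar colm_def sum_UNIV_Plus mat_def if_distrib[of "\<lambda>a. psc a _"] cong: if_cong)
  next
    case (Inr i)
    show ?thesis
    proof (cases "c \<in> C")
      case True
      have "dsub B (der (i, c, \<not> s) p) = (\<Sum>j\<in>UNIV. psc (A $ j $ i) (der (j, c, \<not> s) (dsub B p)))"
        using True by (simp add: der_dsub inv)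
      then show ?thesis
        using True Inr by (simp add: plin_psc[OF plin_dsub] colm_def sum_UNIV_Plus transpose_def psc_sum mult.commute)
    next
      case False
      then show ?thesis using Inr
        by (simp add: plin_psc[OF plin_dsub] der_dsub colm_def sum_UNIV_Plus mat_def if_distrib[of "\<lambda>a. psc a _"] cong: if_cong)
    qed
  qed
qed

text \<open>The action of the two factors of \<open>g\<close> that preserve polynomials, the upper
  triangular one first and then the block diagonal one.\<close>

definition thalf :: "'n::finite mat2 \<Rightarrow> 'n var pol \<Rightarrow> 'n var pol" where
  "thalf g v = psc (1 / det (ul g) ^ card C) (dsub (matrix_inv (ul g)) (pexp (opD (zof g)) v))"

text \<open>The intended value of the inner product of \<open>g v\<close> with \<open>u\<close>. The
  exponential of \<open>opM (yof g)\<close> would produce power series, so it is applied to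
  \<open>u\<close> as the exponential of its adjoint, which is locally nilpotent.\<close>

definition phi :: "'n::finite mat2 \<Rightarrow> 'n var pol \<Rightarrow> 'n var pol \<Rightarrow> complex" where
  "phi g v u = fip (thalf g v) (pexp (opD (cnjm (yof g))) u)"

lemma itw_thalf:
  assumes "g \<in> so_c" "invertible (ul g)"
  shows "itw (ginv g ** nminus (yof g)) (thalf g)"
  unfolding ginv_triangular[OF assms] thalf_def
  by (intro itw_psc itw_comp itw_pexp itw_dsub zof_skew assms matrix_inv_mult)

text \<open>\<open>itw_pexp\<close> transported along \<open>xia_xi\<close>: the swap of the index
  halves turns the upper triangular matrix into a lower triangular one, and the signs absorb the
  minus.\<close>

lemma pexp_xia:
  assumes "transpose W = - W"
  shows "pexp (opD W) (xia c s r u) = (\<Sum>q\<in>UNIV. psc (colm c (nminus W) $ r $ q) (xia c s q (pexp (opD W) u)))"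
proof -
  have pl: "plin (pexp (opD W))" by (rule plin_pexp[OF lnil_opD[OF assms]])
  have "pexp (opD W) (xia c s r u) = psc (- eps s * sg r) (pexp (opD W) (xi c (\<not> s) (sw r) u))"
    unfolding xia_xi plin_psc[OF pl] ..
  also have "\<dots> = psc (- eps s * sg r) (\<Sum>q\<in>UNIV. psc (colm c (nplus (- W)) $ sw r $ q) (xi c (\<not> s) q (pexp (opD W) u)))"
    by (subst itw_xi[OF itw_pexp[OF assms]]) rule
  also have "\<dots> = psc (- eps s * sg r) (\<Sum>q\<in>UNIV. psc (colm c (nplus (- W)) $ sw r $ sw q) (xi c (\<not> s) (sw q) (pexp (opD W) u)))"
    by (subst sum_sw[symmetric]) rule
  also have "\<dots> = (\<Sum>q\<in>UNIV. psc (colm c (nminus W) $ r $ q) (xia c s q (pexp (opD W) u)))"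
    unfolding psc_sum xi_xia psc_psc
  proof (rule sum.cong[OF refl])
    fix q
    have "- eps s * sg r * (colm c (nplus (- W)) $ sw r $ sw q * (eps (\<not> s) * sg (sw (sw q)))) = colm c (nminus W) $ r $ q"
      by (cases r; cases q) (auto simp: colm_def nplus_def nminus_def mat_def)
    then show "psc (- eps s * sg r * (colm c (nplus (- W)) $ sw r $ sw q * (eps (\<not> s) * sg (sw (sw q))))) (xia c (\<not> \<not> s) (sw (sw q)) (pexp (opD W) u))
        = psc (colm c (nminus W) $ r $ q) (xia c s q (pexp (opD W) u))"
      by (simp only: sw_sw not_not)
  qed
  finally show ?thesis .
qed

definition sesq :: "('n var pol \<Rightarrow> 'n var pol \<Rightarrow> complex) \<Rightarrow> bool" where
  "sesq S \<longleftrightarrow> (\<forall>v v' u. S (v + v') u = S v u + S v' u) \<and> (\<forall>v u u'. S v (u + u') = S v u + S v u') \<and>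
    (\<forall>c v u. S (psc c v) u = c * S v u) \<and> (\<forall>c v u. S v (psc c u) = cnj c * S v u)"

text \<open>
  The matrix coefficients of an element \<open>g\<close> of the complex orthogonal group are characterized, up to a
  scalar, by the way in which \<open>g\<close> transforms the vectors of operators \<open>xi\<close>.
\<close>

definition bog :: "'n::finite mat2 \<Rightarrow> ('n var pol \<Rightarrow> 'n var pol \<Rightarrow> complex) \<Rightarrow> bool" where
  "bog g S \<longleftrightarrow> sesq S \<and>
    (\<forall>c s r v u. S (xi c s r v) u = (\<Sum>t\<in>UNIV. colm c (ginv g) $ r $ t * S v (xia c s t u)))"

lemma sesq_sum_left: "sesq S \<Longrightarrow> S (sum f A) u = (\<Sum>x\<in>A. S (f x) u)"
proof (induction A rule: infinite_finite_induct)
  case (infinite A)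
  have "S (psc 0 0) u = 0 * S 0 u" using infinite.prems unfolding sesq_def by blast
  then show ?case using infinite by simp
next
  case empty
  have "S (psc 0 0) u = 0 * S 0 u" using empty unfolding sesq_def by blast
  then show ?case by simp
next
  case (insert x F)
  then show ?case by (simp add: sesq_def)
qed

lemma sesq_sum_right: "sesq S \<Longrightarrow> S u (sum f A) = (\<Sum>x\<in>A. S u (f x))"
proof (induction A rule: infinite_finite_induct)
  case (infinite A)
  have "S u (psc 0 0) = cnj 0 * S u 0" using infinite.prems unfolding sesq_def by blast
  then show ?case using infinite by simp
next
  case empty
  have "S u (psc 0 0) = cnj 0 * S u 0" using empty unfolding sesq_def by blast
  then show ?case by simp
next
  case (insert x F)
  then show ?case by (simp add: sesq_def)
qed

lemma plin_thalf:
  assumes "g \<in> so_c" "invertible (ul g)"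
  shows "plin (thalf g)"
  using itw_plin[OF itw_thalf[OF assms]] .

lemma plin_pexp_yof:
  assumes "g \<in> so_c" "invertible (ul g)"
  shows "plin (pexp (opD (cnjm (yof g))))"
  by (intro plin_pexp lnil_opD cnjm_skew yof_skew assms)

lemma sesq_phi:
  assumes "g \<in> so_c" "invertible (ul g)"
  shows "sesq (phi g)"
  unfolding sesq_def phi_def
  by (simp add: plin_add[OF plin_thalf[OF assms]] plin_psc[OF plin_thalf[OF assms]]
      plin_add[OF plin_pexp_yof[OF assms]] plin_psc[OF plin_pexp_yof[OF assms]]
      fip_add_left fip_add_right fip_psc_left fip_psc_right)

text \<open>The first argument contributes \<open>ginv g ** nminus (yof g)\<close> by
  \<open>itw_thalf\<close>, the second one contributes \<open>nminus (yof g)\<close> by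
  \<open>pexp_xia\<close>, and the two sides match.\<close>

lemma bog_phi:
  assumes "g \<in> so_c" "invertible (ul g)"
  shows "bog g (phi g)"
  unfolding bog_def
proof (intro conjI allI)
  show "sesq (phi g)" by (rule sesq_phi[OF assms])
  fix c s r v u
  let ?Y = "yof g" and ?E = "pexp (opD (cnjm (yof g)))"
  have Ys: "transpose (cnjm ?Y) = - cnjm ?Y" by (intro cnjm_skew yof_skew assms)
  have cn: "cnj (colm c (nminus (cnjm ?Y)) $ t $ q) = colm c (nminus ?Y) $ t $ q" for t q
    by (cases t; cases q) (auto simp: colm_def nminus_def mat_def)
  have R: "phi g v (xia c s t u) = (\<Sum>q\<in>UNIV. colm c (nminus ?Y) $ t $ q * fip (thalf g v) (xia c s q (?E u)))" for t
    unfolding phi_def pexp_xia[OF Ys] fip_sum_right fip_psc_right cn ..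
  have "(\<Sum>t\<in>UNIV. colm c (ginv g) $ r $ t * phi g v (xia c s t u))
      = (\<Sum>q\<in>UNIV. colm c (ginv g ** nminus ?Y) $ r $ q * fip (thalf g v) (xia c s q (?E u)))"
    unfolding R sum_distrib_left
    by (subst sum.swap) (simp add: colm_mult matmul_nth sum_distrib_right mult.assoc)
  also have "\<dots> = phi g (xi c s r v) u"
    unfolding phi_def itw_xi[OF itw_thalf[OF assms]] fip_sum_left fip_psc_left fip_xi ..
  finally show "phi g (xi c s r v) u = (\<Sum>t\<in>UNIV. colm c (ginv g) $ r $ t * phi g v (xia c s t u))" ..
qed

lemma colm_inverse:
  assumes "g \<in> so_c"
  shows "(\<Sum>t\<in>UNIV. colm c g $ r $ t * (\<Sum>q\<in>UNIV. colm c (ginv g) $ t $ q * f q)) = f r"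
proof -
  have "(\<Sum>t\<in>UNIV. colm c g $ r $ t * (\<Sum>q\<in>UNIV. colm c (ginv g) $ t $ q * f q))
      = (\<Sum>q\<in>UNIV. colm c (g ** ginv g) $ r $ q * f q)"
    unfolding sum_distrib_left by (subst sum.swap) (simp add: colm_mult matmul_nth sum_distrib_right mult.assoc)
  also have "\<dots> = f r"
    unfolding ginv_right[OF assms] colm_mat1 by (simp add: mat_def if_distrib if_distribR cong: if_cong)
  finally show ?thesis .
qed

lemma bog_inverse:
  assumes "bog g S" "g \<in> so_c"
  shows "S v (xia c s t u) = (\<Sum>r\<in>UNIV. colm c g $ t $ r * S (xi c s r v) u)"
proof -
  have "S (xi c s r v) u = (\<Sum>q\<in>UNIV. colm c (ginv g) $ r $ q * S v (xia c s q u))" for r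
    using assms(1) by (auto simp: bog_def)
  then show ?thesis by (simp only: colm_inverse[OF assms(2)])
qed

text \<open>The commutation rules determine the form from its value at \<open>1, 1\<close>; this is
  a uniqueness statement in the style of Stone and von Neumann.\<close>

lemma bog_unique_zero:
  assumes S: "bog g S" and g: "g \<in> so_c" "invertible (ul g)" and S11: "S 1 1 = 0"
  shows "S v u = 0"
proof -
  have sq: "sesq S" using S by (simp add: bog_def)
  have Sadd: "S (v + v') u = S v u + S v' u" "S v (u + u') = S v u + S v u'"
    and sc: "S (psc a v) u = a * S v u" "S v (psc a u) = cnj a * S v u" for v v' u u' a
    using sq by (auto simp: sesq_def)
  have z: "S v 0 = 0" for v using sc(2)[of v 0 0] by simp
  \<comment> \<open>With \<open>u = 1\<close> the derivatives among the \<open>xia\<close> vanish,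
    and the terms with a derivative of \<open>p\<close> vanish by induction. What remains is a
    homogeneous linear system with the invertible matrix \<open>ul g\<close>.\<close>
  have S1: "S v 1 = 0" for v
  proof (induction v rule: pol_induct_der)
    case one
    show ?case by (rule S11)
  next
    case (scale c p)
    then show ?case by (simp add: sc)
  next
    case (add p q)
    then show ?case by (simp add: Sadd)
  next
    case (var v p)
    obtain l c s where v: "v = (l, c, s)" by (cases v)
    have *: "S p (xia c s t 1) = (\<Sum>r\<in>UNIV. colm c g $ t $ r * S (xi c s r p) 1)" for t
      by (rule bog_inverse[OF S g(1)])
    have r0: "S (xi c s (Inr i) p) 1 = 0" for i
      using var(2) by (simp add: sc)
    show ?case
    proof (cases "c \<in> C")
      case True
      have "0 = (\<Sum>j\<in>UNIV. ul g $ i $ j * S (pvar (j, c, s) * p) 1)" for i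
        using *[of "Inl i"] True r0 by (simp add: sum_UNIV_Plus colm_def z)
      then have "ul g *v (\<chi> j. S (pvar (j, c, s) * p) 1) = 0"
        by (simp add: vec_eq_iff matrix_vector_mult_def)
      then have "(\<chi> j. S (pvar (j, c, s) * p) 1) = 0"
        by (rule invertible_kernel[OF g(2)])
      then show ?thesis by (simp add: v vec_eq_iff)
    next
      case False
      then show ?thesis using *[of "Inl l"] by (simp add: v colm_def mat_def z if_distrib if_distribR cong: if_cong)
    qed
  qed
  \<comment> \<open>A variable in the second argument is, up to sign, an \<open>xia\<close>
    operator. It is moved to the first argument, which is why \<open>v\<close> stays
    arbitrary.\<close>
  show ?thesis
  proof (induction u arbitrary: v rule: pol_induct)
    case one
    show ?case by (rule S1)
  next
    case (scale c p)
    then show ?case by (simp add: sc)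
  next
    case (add p q)
    then show ?case by (simp add: Sadd)
  next
    case (var w u)
    obtain l c s where w: "w = (l, c, s)" by (cases w)
    have "S v (xia c (\<not> s) (Inr l) u) = 0"
      unfolding bog_inverse[OF S g(1)] by (simp add: var)
    then show ?case by (auto simp: w sc eps_def split: if_splits)
  qed
qed

lemma bog_unique:
  assumes "bog g S" "bog g S'" "g \<in> so_c" "invertible (ul g)" "S 1 1 = S' 1 1"
  shows "S v u = S' v u"
proof -
  have "bog g (\<lambda>v u. S v u - S' v u)"
    using assms(1,2) by (auto simp: bog_def sesq_def algebra_simps sum_subtractf)
  from bog_unique_zero[OF this assms(3,4)] assms(5) show ?thesis by simp
qed

lemma pexp_one: "transpose W = - W \<Longrightarrow> pexp (opD W) 1 = 1"
  by (subst pexp_eq[of _ 1]) (simp_all add: opD_one)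

lemma phi_one_one:
  assumes "g \<in> so_c" "invertible (ul g)"
  shows "phi g 1 1 = 1 / det (ul g) ^ card C"
  by (simp add: phi_def thalf_def pexp_one cnjm_skew yof_skew zof_skew assms fip_psc_left)

end

section \<open>Matrix coefficients along paths\<close>

lemma has_field_derivative_det:
  fixes A :: "complex \<Rightarrow> complex^'n^'n"
  assumes "\<And>i j. ((\<lambda>w. A w $ i $ j) has_field_derivative A' $ i $ j) (at z)"
  shows "((\<lambda>w. det (A w)) has_field_derivative (\<Sum>i\<in>UNIV. det (\<chi> a b. if a = i then A' $ i $ b else A z $ a $ b))) (at z)"
proof -
  have "((\<lambda>w. det (A w)) has_field_derivative
      (\<Sum>p | p permutes UNIV. of_int (sign p) * (\<Sum>i\<in>UNIV. A' $ i $ p i * (\<Prod>a\<in>UNIV - {i}. A z $ a $ p a)))) (at z)"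
    unfolding det_def
    by (intro DERIV_sum DERIV_cmult has_field_derivative_prod assms)
  also have "(\<Sum>p | p permutes UNIV. of_int (sign p) * (\<Sum>i\<in>UNIV. A' $ i $ p i * (\<Prod>a\<in>UNIV - {i}. A z $ a $ p a)))
      = (\<Sum>i\<in>UNIV. det (\<chi> a b. if a = i then A' $ i $ b else A z $ a $ b))"
    unfolding det_def sum_distrib_left
  proof (subst sum.swap, intro sum.cong refl)
    fix i :: 'n and p :: "'n \<Rightarrow> 'n"
    have "(\<Prod>a\<in>UNIV. (\<chi> a b. if a = i then A' $ i $ b else A z $ a $ b) $ a $ p a) = A' $ i $ p i * (\<Prod>a\<in>UNIV - {i}. A z $ a $ p a)"
      by (subst prod.remove[of _ i]) (auto intro!: arg_cong2[of _ _ _ _ "(*)"] prod.cong)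
    then show "of_int (sign p) * (A' $ i $ p i * (\<Prod>a\<in>UNIV - {i}. A z $ a $ p a))
        = of_int (sign p) * (\<Prod>a\<in>UNIV. (\<chi> a b. if a = i then A' $ i $ b else A z $ a $ b) $ a $ p a)" by simp
  qed
  finally show ?thesis .
qed

text \<open>Write \<open>A' = N A\<close>. Then row \<open>i\<close> of \<open>A'\<close> is a
  combination of the rows of \<open>A\<close>, so replacing row \<open>i\<close> multiplies the
  determinant by the diagonal entry of \<open>N\<close>.\<close>

lemma jacobi_formula:
  fixes A :: "complex \<Rightarrow> complex^'n^'n"
  assumes d: "\<And>i j. ((\<lambda>w. A w $ i $ j) has_field_derivative A' $ i $ j) (at z)" and inv: "invertible (A z)"
  shows "((\<lambda>w. det (A w)) has_field_derivative det (A z) * trace (matrix_inv (A z) ** A')) (at z)"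
proof -
  define N where "N = A' ** matrix_inv (A z)"
  have NA: "N ** A z = A'"
    by (simp add: N_def matrix_inv_mult inv flip: matrix_mul_assoc)
  have "det (\<chi> a b. if a = i then A' $ i $ b else A z $ a $ b) = N $ i $ i * det (A z)" for i
  proof -
    have "det (\<chi> a. if a = i then sum (\<lambda>j. row i N $ j *s row j (A z)) UNIV else row a (A z)) = row i N $ i * det (A z)"
      by (rule cramer_lemma_transpose)
    also have "(\<chi> a. if a = i then sum (\<lambda>j. row i N $ j *s row j (A z)) UNIV else row a (A z))
        = (\<chi> a b. if a = i then A' $ i $ b else A z $ a $ b)"
      unfolding NA[symmetric] by (simp add: vec_eq_iff row_def matmul_nth)
    finally show ?thesis by (simp add: row_def)
  qed
  then have "(\<Sum>i\<in>UNIV. det (\<chi> a b. if a = i then A' $ i $ b else A z $ a $ b)) = det (A z) * trace N"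
    by (simp add: trace_def sum_distrib_left mult.commute)
  moreover have "trace N = trace (matrix_inv (A z) ** A')"
    unfolding N_def by (rule trace_mul_sym)
  ultimately show ?thesis
    using has_field_derivative_det[of A A' z, OF d] by simp
qed

lemma matrix_inv_nth:
  fixes A :: "complex^'n^'n"
  assumes "invertible A"
  shows "matrix_inv A $ i $ j = det (\<chi> a b. if b = i then (if a = j then 1 else 0) else A $ a $ b) / det A"
proof -
  have d: "det A \<noteq> 0" using assms by (simp add: invertible_det_nz)
  have "A *v column j (matrix_inv A) = (\<chi> a. if a = j then 1 else 0)"
  proof -
    have "A *v column j (matrix_inv A) = column j (A ** matrix_inv A)"
      by (simp add: vec_eq_iff column_def matrix_vector_mult_def matmul_nth)
    also have "\<dots> = (\<chi> a. if a = j then 1 else 0)"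
      by (simp add: matrix_inv_mult assms column_def mat_def)
    finally show ?thesis .
  qed
  from cramer[OF d, THEN iffD1, OF this]
  have "column j (matrix_inv A) $ i = (\<chi> k. det (\<chi> a b. if b = k then (\<chi> a. if a = j then 1 else 0) $ a else A $ a $ b) / det A) $ i"
    by (rule arg_cong)
  then show ?thesis
    by (simp add: column_def cong: if_cong)
qed

text \<open>Cramer's rule shows that a derivative exists; its value then follows by differentiating
  the product of the inverse with \<open>A\<close>.\<close>

lemma has_field_derivative_matrix_inv:
  fixes A :: "complex \<Rightarrow> complex^'n^'n"
  assumes d: "\<And>i j. ((\<lambda>w. A w $ i $ j) has_field_derivative A' $ i $ j) (at z)"
    and S: "open S" "z \<in> S" and inv: "\<And>w. w \<in> S \<Longrightarrow> invertible (A w)"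
  shows "((\<lambda>w. matrix_inv (A w) $ i $ j) has_field_derivative
     - ((matrix_inv (A z) ** A' ** matrix_inv (A z)) $ i $ j)) (at z)"
proof -
  have nz: "det (A z) \<noteq> 0" using inv S by (simp flip: invertible_det_nz)
  have "\<exists>D. ((\<lambda>w. matrix_inv (A w) $ i $ j) has_field_derivative D) (at z)" for i j
  proof -
    have 1: "\<exists>D. ((\<lambda>w. det (\<chi> a b. if b = i then (if a = j then 1 else 0) else A w $ a $ b)) has_field_derivative D) (at z)"
      by (rule exI, rule has_field_derivative_det[where A' = "\<chi> a b. if b = i then 0 else A' $ a $ b"])
        (use d in \<open>auto intro!: derivative_eq_intros\<close>)
    obtain D where D: "((\<lambda>w. det (\<chi> a b. if b = i then (if a = j then 1 else 0) else A w $ a $ b)) has_field_derivative D) (at z)"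
      using 1 by blast
    note E = has_field_derivative_det[of A A' z, OF d]
    have "\<exists>D. ((\<lambda>w. det (\<chi> a b. if b = i then (if a = j then 1 else 0) else A w $ a $ b) / det (A w)) has_field_derivative D) (at z)"
      using DERIV_divide[OF D E nz] by blast
    then obtain D' where "((\<lambda>w. det (\<chi> a b. if b = i then (if a = j then 1 else 0) else A w $ a $ b) / det (A w)) has_field_derivative D') (at z)"
      by blast
    then have "((\<lambda>w. matrix_inv (A w) $ i $ j) has_field_derivative D') (at z)"
      by (rule has_field_derivative_transform_within_open[OF _ S]) (simp add: matrix_inv_nth inv)
    then show ?thesis by blast
  qed
  then obtain I' where I': "\<And>i j. ((\<lambda>w. matrix_inv (A w) $ i $ j) has_field_derivative I' i j) (at z)"
    by metis
  define I where "I = (\<chi> i j. I' i j)"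
  have I: "((\<lambda>w. matrix_inv (A w) $ i $ j) has_field_derivative I $ i $ j) (at z)" for i j
    using I' by (simp add: I_def)
  have "(matrix_inv (A z) ** A' + I ** A z) $ i $ j = 0" for i j
  proof -
    have "((\<lambda>w. \<Sum>q\<in>UNIV. matrix_inv (A w) $ i $ q * A w $ q $ j) has_field_derivative
        (\<Sum>q\<in>UNIV. I $ i $ q * A z $ q $ j + A' $ q $ j * matrix_inv (A z) $ i $ q)) (at z)"
      by (intro DERIV_sum DERIV_mult I d)
    moreover have "((\<lambda>w. \<Sum>q\<in>UNIV. matrix_inv (A w) $ i $ q * A w $ q $ j) has_field_derivative 0) (at z)"
    proof (rule has_field_derivative_transform_within_open[OF _ S])
      show "((\<lambda>w. mat 1 $ i $ j :: complex) has_field_derivative 0) (at z)" by simp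
      show "mat 1 $ i $ j = (\<Sum>q\<in>UNIV. matrix_inv (A w) $ i $ q * A w $ q $ j)" if "w \<in> S" for w
        by (simp add: matrix_inv_mult[OF inv[OF that]] flip: matmul_nth)
    qed
    ultimately have "(\<Sum>q\<in>UNIV. I $ i $ q * A z $ q $ j + A' $ q $ j * matrix_inv (A z) $ i $ q) = 0"
      by (rule DERIV_unique)
    then show ?thesis by (simp add: matmul_nth sum.distrib mult.commute add.commute)
  qed
  then have "matrix_inv (A z) ** A' + I ** A z = 0" by (simp add: vec_eq_iff)
  then have "I ** A z ** matrix_inv (A z) = - (matrix_inv (A z) ** A') ** matrix_inv (A z)"
    by (simp add: add_eq_0_iff)
  then have "I = - (matrix_inv (A z) ** A' ** matrix_inv (A z))"
    by (simp add: matrix_inv_mult[OF inv[OF S(2)]] matrix_minus_mult flip: matrix_mul_assoc)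
  then show ?thesis using I[of i j] by simp
qed

lemma tendsto_det:
  fixes A :: "'a \<Rightarrow> complex^'n^'n"
  assumes "\<And>i j. ((\<lambda>w. A w $ i $ j) \<longlongrightarrow> B $ i $ j) F"
  shows "((\<lambda>w. det (A w)) \<longlongrightarrow> det B) F"
  unfolding det_def by (intro tendsto_intros assms)

lemma tendsto_matrix_inv:
  fixes A :: "'a \<Rightarrow> complex^'n^'n"
  assumes A: "\<And>i j. ((\<lambda>w. A w $ i $ j) \<longlongrightarrow> B $ i $ j) F" and inv: "\<And>w. invertible (A w)" "invertible B"
  shows "((\<lambda>w. matrix_inv (A w) $ i $ j) \<longlongrightarrow> matrix_inv B $ i $ j) F"
  unfolding matrix_inv_nth[OF inv(1)] matrix_inv_nth[OF inv(2)]
  by (intro tendsto_divide tendsto_det A) (use inv in \<open>auto simp: invertible_det_nz intro: A\<close>)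

lemma psc_two: "psc 2 p = p + p"
  using psc_add_left[of 1 1 p] by simp

section \<open>Matrix coefficients of the constant 1 and of quadratic forms\<close>

context fock
begin

text \<open>Unlike in \<open>lnil_opD\<close>, the order is uniform in \<open>Z\<close>, so
  exponentials along a curve of matrices are sums of one fixed length.\<close>

lemma opD_nil: "\<exists>N. \<forall>Z. transpose Z = - Z \<longrightarrow> (opD Z ^^ N) p = 0"
proof (induction p rule: pol_induct)
  case one
  show ?case by (rule exI[of _ 1]) (simp add: opD_one)
next
  case (scale c p)
  then show ?case by (auto simp: plin_psc[OF plin_funpow])
next
  case (add p q)
  then obtain N M where "\<And>Z. transpose Z = - Z \<Longrightarrow> (opD Z ^^ N) p = 0" "\<And>Z. transpose Z = - Z \<Longrightarrow> (opD Z ^^ M) q = 0"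
    by blast
  then have "\<forall>Z. transpose Z = - Z \<longrightarrow> (opD Z ^^ (max N M)) (p + q) = 0"
    by (simp add: plin_add[OF plin_funpow] funpow_zero_mono[of _ N _ "max N M"] funpow_zero_mono[of _ M _ "max N M"])
  then show ?case by blast
next
  case (var v p)
  then obtain N where N: "\<And>Z. transpose Z = - Z \<Longrightarrow> (opD Z ^^ N) p = 0" by blast
  obtain l c s where v: "v = (l, c, s)" by (cases v)
  have "(opD Z ^^ (Suc N)) (pvar v * p) = 0" if Z: "transpose Z = - Z" for Z :: "complex^'a^'a"
  proof -
    define S where "S p = - (if c \<in> C then psc (eps s) (\<Sum>j\<in>UNIV. psc (Z $ l $ j) (der (j, c, \<not> s) p)) else 0)" for p
    have S: "S 0 = 0" by (simp add: S_def)
    have "(opD Z ^^ (Suc N)) (pvar v * p) = pvar v * (opD Z ^^ (Suc N)) p + psc (of_nat (Suc N)) (S ((opD Z ^^ (Suc N - 1)) p))"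
      by (rule funpow_comm)
        (simp_all add: v S_def opD_pvar[OF Z] plin_minus[OF plin_opD] plin_zero[OF plin_opD]
          plin_psc[OF plin_opD] plin_sum[OF plin_opD] opD_der)
    then show ?thesis by (simp add: N[OF Z] S plin_zero)
  qed
  then show ?case by blast
qed

lemma fip_qf_left: "fip (qf Y * p) u = fip p (opD (cnjm Y) u)"
  using fip_opM[of Y p u] by (simp add: opM_def)

lemma fip_qf_nth: "fip (qf Y * p) u = (\<Sum>i\<in>UNIV. \<Sum>j\<in>UNIV. Y $ i $ j * (\<Sum>c\<in>C. fip p (der (i, c, False) (der (j, c, True) u))))"
  by (simp add: fip_qf_left opD_def fip_sum_right fip_psc_right)

text \<open>Weak differentiability, tested against fixed polynomials; a topology on polynomials is
  avoided.\<close>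

definition wder :: "(complex \<Rightarrow> 'v pol) \<Rightarrow> 'v pol \<Rightarrow> complex \<Rightarrow> bool" where
  "wder F F' z \<longleftrightarrow> (\<forall>u. ((\<lambda>w. fip (F w) u) has_field_derivative fip F' u) (at z))"

lemma wder_qf:
  assumes Y: "\<And>i j. ((\<lambda>w. Y w $ i $ j) has_field_derivative Y' $ i $ j) (at z)" and F: "wder F F' z"
  shows "wder (\<lambda>w. qf (Y w) * F w) (qf Y' * F z + qf (Y z) * F') z"
  unfolding wder_def
proof
  fix u
  note F' = F[unfolded wder_def, rule_format]
  have "((\<lambda>w. fip (qf (Y w) * F w) u) has_field_derivative (\<Sum>i\<in>UNIV. \<Sum>j\<in>UNIV.
     Y' $ i $ j * (\<Sum>c\<in>C. fip (F z) (der (i, c, False) (der (j, c, True) u)))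
     + (\<Sum>c\<in>C. fip F' (der (i, c, False) (der (j, c, True) u))) * Y z $ i $ j)) (at z)"
    unfolding fip_qf_nth by (intro DERIV_sum DERIV_mult Y F')
  also have "(\<Sum>i\<in>UNIV. \<Sum>j\<in>UNIV.
     Y' $ i $ j * (\<Sum>c\<in>C. fip (F z) (der (i, c, False) (der (j, c, True) u)))
     + (\<Sum>c\<in>C. fip F' (der (i, c, False) (der (j, c, True) u))) * Y z $ i $ j)
    = fip (qf Y' * F z + qf (Y z) * F') u"
    unfolding fip_add_left fip_qf_nth sum.distrib[symmetric] by (simp add: mult.commute)
  finally show "((\<lambda>w. fip (qf (Y w) * F w) u) has_field_derivative fip (qf Y' * F z + qf (Y z) * F') u) (at z)" .
qed

lemma wder_qf_power:
  assumes Y: "\<And>i j. ((\<lambda>w. Y w $ i $ j) has_field_derivative Y' $ i $ j) (at z)"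
  shows "wder (\<lambda>w. qf (Y w) ^ j) (psc (of_nat j) (qf Y' * qf (Y z) ^ (j - 1))) z"
proof (induction j)
  case 0
  show ?case by (simp add: wder_def)
next
  case (Suc j)
  have "qf Y' * qf (Y z) ^ j + qf (Y z) * psc (of_nat j) (qf Y' * qf (Y z) ^ (j - 1))
      = psc (of_nat (Suc j)) (qf Y' * qf (Y z) ^ (Suc j - 1))"
    by (cases j) (simp_all add: psc_mult_right psc_add_left psc_two distrib_left mult.left_commute)
  then show ?case using wder_qf[OF Y Suc] by simp
qed

text \<open>Moving \<open>opD\<close> back across the inner product removes both conjugations, which
  exhibits the left-hand side as a polynomial in the entries of \<open>Y\<close>.\<close>

lemma fip_one_pexp:
  assumes "transpose Y = - Y" and "\<And>Z. transpose Z = - Z \<Longrightarrow> (opD Z ^^ N) u = 0"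
  shows "fip 1 (pexp (opD (cnjm Y)) u) = (\<Sum>j<N. fip (qf Y ^ j) u / fact j)"
proof -
  have "fip (qf Y ^ j) u = fip 1 ((opD (cnjm Y) ^^ j) u)" for j
    by (induction j arbitrary: u) (simp_all add: fip_qf_left funpow_swap1)
  then show ?thesis
    by (simp add: pexp_eq[OF plin_opD assms(2)[OF cnjm_skew[OF assms(1)]]] fip_sum_right fip_psc_right)
qed

lemma pexp_opD_comm:
  assumes "transpose W = - W"
  shows "pexp (opD W) (opD B u) = opD B (pexp (opD W) u)"
proof -
  have "pexp (opD W) (opD B u) = opD B (pexp (opD W) u) + (\<lambda>p. 0) (pexp (opD W) u)"
    by (rule pexp_comm[OF lnil_opD[OF assms] plin_opD]) (auto intro: plinI opD_comm simp: plin_zero)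
  then show ?thesis by simp
qed

lemma fip_one_pexp_deriv:
  assumes Y: "\<And>i j. ((\<lambda>w. Y w $ i $ j) has_field_derivative Y' $ i $ j) (at z)"
    and S: "open S" "z \<in> S" and sk: "\<And>w. w \<in> S \<Longrightarrow> transpose (Y w) = - Y w"
  shows "((\<lambda>w. fip 1 (pexp (opD (cnjm (Y w))) u)) has_field_derivative
     fip (qf Y') (pexp (opD (cnjm (Y z))) u)) (at z)"
proof -
  obtain N where N: "\<And>Z. transpose Z = - Z \<Longrightarrow> (opD Z ^^ N) u = 0" using opD_nil by blast
  obtain M where M: "\<And>Z. transpose Z = - Z \<Longrightarrow> (opD Z ^^ M) (opD (cnjm Y') u) = 0" using opD_nil by blast
  define K where "K = max N M"
  \<comment> \<open>One bound for \<open>u\<close> and for its image under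
    \<open>opD (cnjm Y')\<close>; the extra 1 is consumed by the index shift under
    differentiation.\<close>
  have N': "(opD Z ^^ Suc K) u = 0" and M': "(opD Z ^^ K) (opD (cnjm Y') u) = 0" if "transpose Z = - Z" for Z
    using funpow_zero_mono[OF plin_opD N[OF that], of "Suc K"] funpow_zero_mono[OF plin_opD M[OF that], of K]
    by (simp_all only: K_def)
  have "((\<lambda>w. \<Sum>j<Suc K. fip (qf (Y w) ^ j) u / fact j) has_field_derivative
      (\<Sum>j<Suc K. fip (psc (of_nat j) (qf Y' * qf (Y z) ^ (j - 1))) u / fact j)) (at z)"
    by (intro DERIV_sum DERIV_cdivide) (use wder_qf_power[of Y Y' z, OF Y] in \<open>auto simp: wder_def\<close>)
  also have "(\<Sum>j<Suc K. fip (psc (of_nat j) (qf Y' * qf (Y z) ^ (j - 1))) u / fact j)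
      = (\<Sum>j<K. fip (qf Y' * qf (Y z) ^ j) u / fact j)"
    by (subst sum.lessThan_Suc_shift) (simp add: fip_psc_left field_simps del: of_nat_Suc)
  also have "\<dots> = (\<Sum>j<K. fip (qf (Y z) ^ j) (opD (cnjm Y') u) / fact j)"
    by (simp add: fip_qf_left)
  also have "\<dots> = fip 1 (pexp (opD (cnjm (Y z))) (opD (cnjm Y') u))"
    by (rule fip_one_pexp[symmetric, OF sk[OF S(2)] M'])
  also have "\<dots> = fip (qf Y') (pexp (opD (cnjm (Y z))) u)"
    using fip_qf_left[of Y' 1] by (simp add: pexp_opD_comm cnjm_skew sk S)
  finally show ?thesis
    by (rule has_field_derivative_transform_within_open[OF _ S]) (rule fip_one_pexp[OF sk N', symmetric])
qed

lemma dsub_qf: "dsub B (qf Y) = qf (transpose B ** Y ** B)"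
proof -
  have c: "dsub B (pvar (i, c, False) * pvar (j, c, True)) =
     (\<Sum>a\<in>UNIV. \<Sum>b\<in>UNIV. psc (B $ i $ a * B $ j $ b) (pvar (a, c, False) * pvar (b, c, True)))" if "c \<in> C" for i j c
    using dsub_pvar[of B j c True 1] that
    by (simp add: dsub_pvar sum_distrib_left sum_distrib_right psc_mult_right psc_mult_left psc_sum)
  have "dsub B (qf Y) = (\<Sum>i\<in>UNIV. \<Sum>j\<in>UNIV. \<Sum>a\<in>UNIV. \<Sum>b\<in>UNIV.
      psc (Y $ i $ j * (B $ i $ a * B $ j $ b)) (\<Sum>c\<in>C. pvar (a, c, False) * pvar (b, c, True)))"
  proof -
    have "(\<Sum>c\<in>C. dsub B (pvar (i, c, False) * pvar (j, c, True)))
        = (\<Sum>a\<in>UNIV. \<Sum>b\<in>UNIV. psc (B $ i $ a * B $ j $ b) (\<Sum>c\<in>C. pvar (a, c, False) * pvar (b, c, True)))" for i j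
    proof -
      have "(\<Sum>c\<in>C. dsub B (pvar (i, c, False) * pvar (j, c, True)))
        = (\<Sum>c\<in>C. \<Sum>a\<in>UNIV. \<Sum>b\<in>UNIV. psc (B $ i $ a * B $ j $ b) (pvar (a, c, False) * pvar (b, c, True)))"
        by (rule sum.cong) (simp_all add: c)
      also have "\<dots> = (\<Sum>a\<in>UNIV. \<Sum>c\<in>C. \<Sum>b\<in>UNIV. psc (B $ i $ a * B $ j $ b) (pvar (a, c, False) * pvar (b, c, True)))"
        by (rule sum.swap)
      also have "\<dots> = (\<Sum>a\<in>UNIV. \<Sum>b\<in>UNIV. psc (B $ i $ a * B $ j $ b) (\<Sum>c\<in>C. pvar (a, c, False) * pvar (b, c, True)))"
        by (rule sum.cong[OF refl], subst sum.swap) (simp add: psc_sum)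
      finally show ?thesis .
    qed
    then show ?thesis
      unfolding qf_def plin_sum[OF plin_dsub] plin_psc[OF plin_dsub] by (simp add: psc_sum)
  qed
  also have "\<dots> = (\<Sum>a\<in>UNIV. \<Sum>b\<in>UNIV. \<Sum>i\<in>UNIV. \<Sum>j\<in>UNIV.
      psc (Y $ i $ j * (B $ i $ a * B $ j $ b)) (\<Sum>c\<in>C. pvar (a, c, False) * pvar (b, c, True)))"
  proof -
    have "(\<Sum>i\<in>UNIV. \<Sum>j\<in>UNIV. \<Sum>a\<in>UNIV. \<Sum>b\<in>UNIV. f i j a b) = (\<Sum>a\<in>UNIV. \<Sum>b\<in>UNIV. \<Sum>i\<in>UNIV. \<Sum>j\<in>UNIV. f i j a b)"
      for f :: "'a \<Rightarrow> 'a \<Rightarrow> 'a \<Rightarrow> 'a \<Rightarrow> 'a var pol"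
      unfolding sum.cartesian_product
      by (rule sum.reindex_bij_witness[of _ "\<lambda>(a, b, i, j). (i, j, a, b)" "\<lambda>(i, j, a, b). (a, b, i, j)"]) auto
    then show ?thesis .
  qed
  also have "\<dots> = qf (transpose B ** Y ** B)"
  proof -
    have "(\<Sum>i\<in>UNIV. \<Sum>j\<in>UNIV. Y $ i $ j * (B $ i $ a * B $ j $ b)) = (transpose B ** Y ** B) $ a $ b" for a b
    proof -
      have "(\<Sum>i\<in>UNIV. \<Sum>j\<in>UNIV. Y $ i $ j * (B $ i $ a * B $ j $ b)) = (\<Sum>j\<in>UNIV. \<Sum>i\<in>UNIV. Y $ i $ j * (B $ i $ a * B $ j $ b))"
        by (rule sum.swap)
      also have "\<dots> = (transpose B ** Y ** B) $ a $ b"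
        by (simp add: matmul_nth transpose_def sum_distrib_right sum_distrib_left mult_ac)
      finally show ?thesis .
    qed
    then show ?thesis by (simp add: qf_def flip: psc_sum_left)
  qed
  finally show ?thesis .
qed

text \<open>The exponential of \<open>opD\<close> stops after its first-order term on a quadratic
  form. Together with \<open>phi_one\<close> this evaluates \<open>phi g\<close> on
  \<open>gact X 1\<close>, the base case of \<open>phi_deriv\<close>.\<close>

lemma phi_qf:
  assumes g: "g \<in> so_c" "invertible (ul g)" and Y: "transpose Y = - Y"
  shows "phi g (qf Y) u = (fip (qf (transpose (matrix_inv (ul g)) ** Y ** matrix_inv (ul g))) (pexp (opD (cnjm (yof g))) u)
      - of_nat (card C) * trace (zof g ** Y) * fip 1 (pexp (opD (cnjm (yof g))) u)) / det (ul g) ^ card C"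
proof -
  have Z: "transpose (zof g) = - zof g" by (rule zof_skew[OF g])
  have tr: "(\<Sum>i\<in>UNIV. \<Sum>j\<in>UNIV. zof g $ i $ j * Y $ i $ j) = - trace (zof g ** Y)"
    unfolding trace_def matmul_nth by (subst skew_nth[OF Y]) (simp only: mult_minus_right sum_negf)
  have o1: "opD (zof g) (qf Y) = psc (- (of_nat (card C) * trace (zof g ** Y))) 1"
    unfolding opD_qf[OF Y] tr by simp
  have o2: "(opD (zof g) ^^ 2) (qf Y) = 0"
    unfolding numeral_2_eq_2 by (simp add: o1 plin_psc[OF plin_opD] plin_minus[OF plin_opD] psc_minus_left opD_one)
  have "pexp (opD (zof g)) (qf Y) = qf Y + opD (zof g) (qf Y)"
    unfolding pexp_eq[OF plin_opD o2] by (simp add: numeral_2_eq_2)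
  then have "dsub (matrix_inv (ul g)) (pexp (opD (zof g)) (qf Y))
      = qf (transpose (matrix_inv (ul g)) ** Y ** matrix_inv (ul g)) + psc (- (of_nat (card C) * trace (zof g ** Y))) 1"
    unfolding o1 by (simp only: plin_add[OF plin_dsub] plin_psc[OF plin_dsub] dsub_qf dsub_one)
  then show ?thesis
    by (simp only: phi_def thalf_def fip_add_left fip_psc_left) (simp add: diff_divide_distrib)
qed

end

lemma ginv_lie_g: "X \<in> lie_g \<Longrightarrow> ginv (g ** X) = - (X ** ginv g)"
proof -
  assume "X \<in> lie_g"
  then have "X $ sw s $ r = - X $ sw r $ s" for r s unfolding lie_g_iff by blast
  from this[of _ "sw _"] have "ginv X = - X"
    unfolding vec_eq_iff ginv_nth vector_uminus_component sw_sw by blast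
  then show ?thesis by (simp add: ginv_mult matrix_minus_mult)
qed

lemma transpose_add: "transpose (A + B) = transpose A + transpose B" for A B :: "complex^'n^'m"
  by (simp add: vec_eq_iff transpose_def)

lemma matrix_sub_rdistrib: "((A :: complex^'n^'m) - B) ** M = A ** M - B ** M"
  by (simp add: vec_eq_iff matrix_matrix_mult_def sum_subtractf left_diff_distrib)

text \<open>The Schur complement of the upper left block.\<close>

lemma lr_minus_yof:
  assumes g: "g \<in> so_c" "invertible (ul g)"
  shows "lr g - yof g ** ur g = transpose (matrix_inv (ul g))"
proof -
  let ?I = "matrix_inv (ul g)"
  have "transpose (ul g) ** lr g + transpose (ll g) ** ur g = mat 1"
    using arg_cong[OF so_c_quarters(2)[OF g(1)], of transpose]
    by (simp add: transpose_mult transpose_add transpose_transpose)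
  then have "transpose ?I ** (transpose (ul g) ** lr g + transpose (ll g) ** ur g) = transpose ?I" by simp
  also have "transpose ?I ** (transpose (ul g) ** lr g + transpose (ll g) ** ur g)
     = transpose (ul g ** ?I) ** lr g + transpose (ll g ** ?I) ** ur g"
    by (simp add: matrix_add_ldistrib matrix_mul_assoc transpose_mult)
  also have "\<dots> = lr g - yof g ** ur g"
    using yof_skew[OF g] by (simp add: matrix_inv_mult g(2) matrix_minus_mult flip: yof_def)
  finally show ?thesis .
qed

text \<open>The quotient rule gives \<open>(C' - Y A') A^-1\<close>. Inserting
  \<open>g' = g X\<close>, the terms with \<open>ul X\<close> cancel and the Schur complement of
  \<open>ul g\<close> is left in front of \<open>ll X\<close>.\<close>

lemma yof_has_derivative:
  assumes S: "open S" "z \<in> S" and g: "\<And>w. w \<in> S \<Longrightarrow> g w \<in> so_c" "\<And>w. w \<in> S \<Longrightarrow> invertible (ul (g w))"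
    and d: "\<And>r s. ((\<lambda>w. g w $ r $ s) has_field_derivative (g z ** X) $ r $ s) (at z)"
  shows "((\<lambda>w. yof (g w) $ i $ j) has_field_derivative
     (transpose (matrix_inv (ul (g z))) ** ll X ** matrix_inv (ul (g z))) $ i $ j) (at z)"
proof -
  let ?I = "matrix_inv (ul (g z))" and ?A' = "ul (g z ** X)" and ?C' = "ll (g z ** X)"
  have A: "((\<lambda>w. ul (g w) $ i $ j) has_field_derivative ?A' $ i $ j) (at z)" for i j
    unfolding quarter_nth by (rule d)
  have C: "((\<lambda>w. ll (g w) $ i $ j) has_field_derivative ?C' $ i $ j) (at z)" for i j
    unfolding quarter_nth by (rule d)
  have "((\<lambda>w. \<Sum>q\<in>UNIV. ll (g w) $ i $ q * matrix_inv (ul (g w)) $ q $ j) has_field_derivative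
      (\<Sum>q\<in>UNIV. ?C' $ i $ q * ?I $ q $ j + - ((?I ** ?A' ** ?I) $ q $ j) * ll (g z) $ i $ q)) (at z)"
    by (intro DERIV_sum DERIV_mult C has_field_derivative_matrix_inv[OF A S g(2)])
  also have "(\<lambda>w. \<Sum>q\<in>UNIV. ll (g w) $ i $ q * matrix_inv (ul (g w)) $ q $ j) = (\<lambda>w. yof (g w) $ i $ j)"
    by (simp only: yof_def matmul_nth)
  also have "(\<Sum>q\<in>UNIV. ?C' $ i $ q * ?I $ q $ j + - ((?I ** ?A' ** ?I) $ q $ j) * ll (g z) $ i $ q)
      = (?C' ** ?I - ll (g z) ** (?I ** ?A' ** ?I)) $ i $ j"
    by (simp add: matmul_nth[of _ ?I] matmul_nth[of "ll (g z)"] sum.distrib sum_negf sum_subtractf mult.commute)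
  also have "?C' ** ?I - ll (g z) ** (?I ** ?A' ** ?I) = transpose ?I ** ll X ** ?I"
  proof -
    note gz = g[OF S(2)]
    have "?C' ** ?I - ll (g z) ** (?I ** ?A' ** ?I) = (?C' - yof (g z) ** ?A') ** ?I"
      by (simp add: yof_def matrix_mul_assoc matrix_sub_rdistrib)
    also have "?C' - yof (g z) ** ?A' = (lr (g z) - yof (g z) ** ur (g z)) ** ll X"
      by (simp add: quarter_mult matrix_add_ldistrib matrix_mul_assoc yof_mult[OF gz(2)] matrix_sub_rdistrib)
    finally show ?thesis by (simp add: lr_minus_yof[OF gz])
  qed
  finally show ?thesis .
qed

section \<open>The differential equation of the matrix coefficients\<close>

context fock
begin

lemma plin_phi: "g \<in> so_c \<Longrightarrow> invertible (ul g) \<Longrightarrow> phi g (v + v') u = phi g v u + phi g v' u"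
  "g \<in> so_c \<Longrightarrow> invertible (ul g) \<Longrightarrow> phi g (psc c v) u = c * phi g v u"
  "g \<in> so_c \<Longrightarrow> invertible (ul g) \<Longrightarrow> phi g (v - v') u = phi g v u - phi g v' u"
  by (simp_all add: phi_def plin_add[OF plin_thalf] plin_psc[OF plin_thalf] plin_diff[OF plin_thalf]
      fip_add_left fip_psc_left fip_diff_left)

lemma phi_sum_left: "g \<in> so_c \<Longrightarrow> invertible (ul g) \<Longrightarrow> phi g (sum f A) u = (\<Sum>x\<in>A. phi g (f x) u)"
  by (simp add: phi_def plin_sum[OF plin_thalf] fip_sum_left)

lemma phi_one:
  assumes "g \<in> so_c" "invertible (ul g)"
  shows "phi g 1 u = inverse (det (ul g)) ^ card C * fip 1 (pexp (opD (cnjm (yof g))) u)"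
  by (simp add: phi_def thalf_def pexp_one zof_skew[OF assms] fip_psc_left divide_inverse power_inverse)

lemma phi_xi:
  assumes "g \<in> so_c" "invertible (ul g)"
  shows "phi g (xi c s r v) u = (\<Sum>t\<in>UNIV. colm c (ginv g) $ r $ t * phi g v (xia c s t u))"
  using bog_phi[OF assms] by (auto simp: bog_def)

text \<open>The link between group and Lie algebra: along a curve with \<open>g' = g X\<close> the
  derivative falls on \<open>v\<close> as \<open>gact X\<close>. For \<open>v = 1\<close> this is an
  explicit computation; a variable is handled by \<open>phi_xi\<close> and
  \<open>gact_xi\<close>.\<close>

lemma phi_deriv:
  assumes S: "open S" "z \<in> S" and g: "\<And>w. w \<in> S \<Longrightarrow> g w \<in> so_c" "\<And>w. w \<in> S \<Longrightarrow> invertible (ul (g w))"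
    and X: "X \<in> lie_g"
    and d: "\<And>r s. ((\<lambda>w. g w $ r $ s) has_field_derivative (g z ** X) $ r $ s) (at z)"
  shows "((\<lambda>w. phi (g w) v u) has_field_derivative phi (g z) (gact X v) u) (at z)"
proof (induction v arbitrary: u rule: pol_induct)
  case one
  let ?A = "\<lambda>w. ul (g w)" and ?A' = "ul (g z ** X)" and ?I = "matrix_inv (ul (g z))"
  let ?E = "\<lambda>w. pexp (opD (cnjm (yof (g w)))) u" and ?Y' = "transpose ?I ** ll X ** ?I"
  define e where "e w = inverse (det (?A w))" for w
  note gz = g[OF S(2)]
  have A: "((\<lambda>w. ?A w $ i $ j) has_field_derivative ?A' $ i $ j) (at z)" for i j
    unfolding quarter_nth by (rule d)
  have nz: "det (?A z) \<noteq> 0" using gz(2) by (simp add: invertible_det_nz)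
  have "(e has_field_derivative - (inverse (det (?A z)) * (det (?A z) * trace (?I ** ?A')) * inverse (det (?A z)))) (at z)"
    unfolding e_def by (rule DERIV_inverse'[OF jacobi_formula[OF A gz(2)] nz])
  note e0 = this
  have e: "(e has_field_derivative - trace (?I ** ?A') * e z) (at z)"
  proof -
    have "inverse (det (?A z)) * (det (?A z) * t) * inverse (det (?A z)) = t * inverse (det (?A z))" for t
      using nz by (simp add: field_simps)
    then show ?thesis using e0 by (simp only: e_def minus_mult_left)
  qed
  have ek: "((\<lambda>w. e w ^ k) has_field_derivative - of_nat k * trace (?I ** ?A') * e z ^ k) (at z)" for k
  proof (cases k)
    case (Suc m)
    have "of_nat k * (t * e z * e z ^ (k - Suc 0)) = of_nat k * t * e z ^ k" for t
      by (simp add: Suc)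
    with DERIV_power[OF e, of k] show ?thesis by (simp only: mult_minus_left mult_minus_right)
  qed simp
  have F: "((\<lambda>w. fip 1 (?E w)) has_field_derivative fip (qf ?Y') (?E z)) (at z)"
    by (rule fip_one_pexp_deriv[OF yof_has_derivative[OF S g d] S]) (simp_all add: yof_skew g)
  \<comment> \<open>The first summand matches the constant in \<open>gact_one\<close>, the second
    one the correction term in \<open>phi_qf\<close>.\<close>
  have tr: "trace (?I ** ?A') = trace (ul X) + trace (zof (g z) ** ll X)"
    by (simp add: quarter_mult matrix_add_ldistrib matrix_mul_assoc matrix_inv_mult gz trace_add zof_def)
  have Xs: "transpose (ll X) = - ll X" using X by (simp only: lie_g_quarters)
  have "((\<lambda>w. e w ^ card C * fip 1 (?E w)) has_field_derivative
      (- of_nat (card C) * trace (?I ** ?A') * e z ^ card C) * fip 1 (?E z) + fip (qf ?Y') (?E z) * e z ^ card C) (at z)"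
    by (rule DERIV_mult[OF ek F])
  also have "(- of_nat (card C) * trace (?I ** ?A') * e z ^ card C) * fip 1 (?E z) + fip (qf ?Y') (?E z) * e z ^ card C
     = phi (g z) (gact X 1) u"
    unfolding gact_one plin_phi[OF gz] phi_qf[OF gz Xs] phi_one[OF gz] tr
    by (simp add: e_def divide_inverse power_inverse algebra_simps)
  finally show ?case
    by (rule has_field_derivative_transform_within_open[OF _ S]) (simp add: phi_one g e_def)
next
  case (scale c p)
  have "((\<lambda>w. c * phi (g w) p u) has_field_derivative c * phi (g z) (gact X p) u) (at z)"
    by (rule DERIV_cmult[OF scale])
  also have "c * phi (g z) (gact X p) u = phi (g z) (gact X (psc c p)) u"
    by (simp add: plin_phi g S plin_psc[OF plin_gact])
  finally show ?case
    by (rule has_field_derivative_transform_within_open[OF _ S]) (simp add: plin_phi g)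
next
  case (add p q)
  have "((\<lambda>w. phi (g w) p u + phi (g w) q u) has_field_derivative phi (g z) (gact X p) u + phi (g z) (gact X q) u) (at z)"
    by (rule DERIV_add[OF add])
  also have "phi (g z) (gact X p) u + phi (g z) (gact X q) u = phi (g z) (gact X (p + q)) u"
    by (simp add: plin_phi g S plin_add[OF plin_gact])
  finally show ?case
    by (rule has_field_derivative_transform_within_open[OF _ S]) (simp add: plin_phi g)
next
  case (var v p)
  obtain l c s where v: "v = (l, c, s)" by (cases v)
  note gz = g[OF S(2)]
  let ?r = "Inl l"
  define G' where "G' = (if c \<in> C then - (X ** ginv (g z)) else 0)"
  have G': "((\<lambda>w. colm c (ginv (g w)) $ r $ t) has_field_derivative G' $ r $ t) (at z)" for r t
  proof (cases "c \<in> C")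
    case True
    have "((\<lambda>w. g w $ sw t $ sw r) has_field_derivative (g z ** X) $ sw t $ sw r) (at z)" by (rule d)
    then show ?thesis using True by (simp add: colm_def ginv_nth G'_def flip: ginv_lie_g[OF X])
  qed (simp add: colm_def G'_def)
  \<comment> \<open>By \<open>phi_xi\<close> a variable in the first argument is traded for
    operators on \<open>u\<close>, with entries of \<open>ginv (g w)\<close> as coefficients. This
    is why \<open>u\<close> is arbitrary in the induction.\<close>
  have "((\<lambda>w. \<Sum>t\<in>UNIV. colm c (ginv (g w)) $ ?r $ t * phi (g w) p (xia c s t u)) has_field_derivative
     (\<Sum>t\<in>UNIV. G' $ ?r $ t * phi (g z) p (xia c s t u) + phi (g z) (gact X p) (xia c s t u) * colm c (ginv (g z)) $ ?r $ t)) (at z)"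
    by (intro DERIV_sum DERIV_mult G' var)
  also have "(\<Sum>t\<in>UNIV. G' $ ?r $ t * phi (g z) p (xia c s t u) + phi (g z) (gact X p) (xia c s t u) * colm c (ginv (g z)) $ ?r $ t)
     = (\<Sum>t\<in>UNIV. G' $ ?r $ t * phi (g z) p (xia c s t u)) + phi (g z) (xi c s ?r (gact X p)) u"
    unfolding sum.distrib phi_xi[OF gz] by (simp add: mult.commute)
  also have "(\<Sum>t\<in>UNIV. G' $ ?r $ t * phi (g z) p (xia c s t u))
     = - (if c \<in> C then \<Sum>q\<in>UNIV. X $ ?r $ q * phi (g z) (xi c s q p) u else 0)"
  proof (cases "c \<in> C")
    case True
    have "(\<Sum>q\<in>UNIV. X $ ?r $ q * phi (g z) (xi c s q p) u) = (\<Sum>q\<in>UNIV. \<Sum>t\<in>UNIV. X $ ?r $ q * (ginv (g z) $ q $ t * phi (g z) p (xia c s t u)))"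
      using True by (simp add: phi_xi[OF gz] colm_def sum_distrib_left)
    also have "\<dots> = (\<Sum>t\<in>UNIV. (X ** ginv (g z)) $ ?r $ t * phi (g z) p (xia c s t u))"
      by (subst sum.swap) (simp add: matmul_nth sum_distrib_right mult.assoc)
    finally show ?thesis using True by (simp add: G'_def sum_negf)
  qed (simp add: G'_def)
  also have "- (if c \<in> C then \<Sum>q\<in>UNIV. X $ ?r $ q * phi (g z) (xi c s q p) u else 0) + phi (g z) (xi c s ?r (gact X p)) u
     = phi (g z) (gact X (xi c s ?r p)) u"
    unfolding gact_xi[OF X] using phi_sum_left[OF gz, of "\<lambda>x. x" "{}" u] by (simp add: plin_phi[OF gz] phi_sum_left[OF gz])
  finally have "((\<lambda>w. \<Sum>t\<in>UNIV. colm c (ginv (g w)) $ ?r $ t * phi (g w) p (xia c s t u)) has_field_derivative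
      phi (g z) (gact X (xi c s ?r p)) u) (at z)" .
  then have "((\<lambda>w. phi (g w) (xi c s ?r p) u) has_field_derivative phi (g z) (gact X (xi c s ?r p)) u) (at z)"
    by (rule has_field_derivative_transform_within_open[OF _ S]) (rule phi_xi[OF g, symmetric])
  then show ?case by (simp add: v)
qed

lemma fip_one_pexp_tendsto:
  assumes Y: "\<And>i j. ((\<lambda>w. Y w $ i $ j) \<longlongrightarrow> Y0 $ i $ j) F"
    and sk: "\<And>w. transpose (Y w) = - Y w" "transpose Y0 = - Y0"
  shows "((\<lambda>w. fip 1 (pexp (opD (cnjm (Y w))) u)) \<longlongrightarrow> fip 1 (pexp (opD (cnjm Y0)) u)) F"
proof -
  obtain N where N: "\<And>Z. transpose Z = - Z \<Longrightarrow> (opD Z ^^ N) u = 0" using opD_nil by blast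
  have "((\<lambda>w. fip (qf (Y w) ^ j) u) \<longlongrightarrow> fip (qf Y0 ^ j) u) F" for j u
  proof (induction j arbitrary: u)
    case (Suc j)
    show ?case unfolding power_Suc fip_qf_nth by (intro tendsto_intros Y Suc)
  qed simp
  then have "((\<lambda>w. \<Sum>j<N. fip (qf (Y w) ^ j) u / fact j) \<longlongrightarrow> (\<Sum>j<N. fip (qf Y0 ^ j) u / fact j)) F"
    by (intro tendsto_intros) auto
  moreover have "fip 1 (pexp (opD (cnjm (Y w))) u) = (\<Sum>j<N. fip (qf (Y w) ^ j) u / fact j)" for w
    by (rule fip_one_pexp[OF sk(1)]) (rule N)
  moreover have "fip 1 (pexp (opD (cnjm Y0)) u) = (\<Sum>j<N. fip (qf Y0 ^ j) u / fact j)"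
    by (rule fip_one_pexp[OF sk(2)]) (rule N)
  ultimately show ?thesis by simp
qed

lemma phi_tendsto:
  assumes d: "\<And>r s. ((\<lambda>w. g w $ r $ s) \<longlongrightarrow> h $ r $ s) F"
    and g: "\<And>w. g w \<in> so_c" "\<And>w. invertible (ul (g w))" and h: "h \<in> so_c" "invertible (ul h)"
  shows "((\<lambda>w. phi (g w) v u) \<longlongrightarrow> phi h v u) F"
proof (induction v arbitrary: u rule: pol_induct)
  case one
  have A: "((\<lambda>w. ul (g w) $ i $ j) \<longlongrightarrow> ul h $ i $ j) F" for i j
    unfolding quarter_nth by (rule d)
  have "((\<lambda>w. \<Sum>q\<in>UNIV. ll (g w) $ i $ q * matrix_inv (ul (g w)) $ q $ j) \<longlongrightarrow> (\<Sum>q\<in>UNIV. ll h $ i $ q * matrix_inv (ul h) $ q $ j)) F" for i j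
    by (intro tendsto_sum tendsto_mult tendsto_matrix_inv A g h) (unfold quarter_nth, rule d)
  then have Y: "((\<lambda>w. yof (g w) $ i $ j) \<longlongrightarrow> yof h $ i $ j) F" for i j
    by (simp only: yof_def matmul_nth)
  show ?case unfolding phi_one[OF g] phi_one[OF h]
    by (intro tendsto_intros tendsto_det A fip_one_pexp_tendsto Y yof_skew g h)
      (use h in \<open>simp flip: invertible_det_nz\<close>)
next
  case (scale c p)
  then show ?case unfolding plin_phi[OF g] plin_phi[OF h] by (intro tendsto_intros)
next
  case (add p q)
  then show ?case unfolding plin_phi[OF g] plin_phi[OF h] by (intro tendsto_intros)
next
  case (var v p)
  obtain l c s where v: "v = (l, c, s)" by (cases v)
  have G: "((\<lambda>w. colm c (ginv (g w)) $ r $ t) \<longlongrightarrow> colm c (ginv h) $ r $ t) F" for r t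
    by (cases "c \<in> C") (simp_all add: colm_def ginv_nth d)
  have "((\<lambda>w. phi (g w) (xi c s (Inl l) p) u) \<longlongrightarrow> phi h (xi c s (Inl l) p) u) F"
    unfolding phi_xi[OF g] phi_xi[OF h] by (intro tendsto_intros G var)
  then show ?case by (simp add: v)
qed

text \<open>Iterating \<open>phi_deriv\<close> gives all derivatives at 0. Holomorphy on the disc
  then gives convergence on the whole disc, without estimates of the coefficients.\<close>

lemma phi_taylor:
  assumes R: "0 < R" and g: "\<And>w. w \<in> ball 0 R \<Longrightarrow> g w \<in> so_c" "\<And>w. w \<in> ball 0 R \<Longrightarrow> invertible (ul (g w))"
    and X: "X \<in> lie_g"
    and d: "\<And>w r s. w \<in> ball 0 R \<Longrightarrow> ((\<lambda>w. g w $ r $ s) has_field_derivative (g w ** X) $ r $ s) (at w)"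
    and w: "w \<in> ball 0 R"
  shows "(\<lambda>j. phi (g 0) ((gact X ^^ j) v) u / fact j * w ^ j) sums phi (g w) v u"
proof -
  have D: "((\<lambda>w. phi (g w) v u) has_field_derivative phi (g z) (gact X v) u) (at z)" if "z \<in> ball 0 R" for v z
    by (rule phi_deriv[OF open_ball that g X d[OF that]])
  have hol: "(\<lambda>w. phi (g w) v u) holomorphic_on ball 0 R"
    using D field_differentiable_at_within
    by (auto simp: holomorphic_on_def field_differentiable_def) (meson DERIV_subset D subset_UNIV mem_ball_0)+
  have hd: "(deriv ^^ j) (\<lambda>w. phi (g w) v u) z = phi (g z) ((gact X ^^ j) v) u" if "z \<in> ball 0 R" for j z
    using that
  proof (induction j arbitrary: z)
    case (Suc j)
    have "(deriv ^^ Suc j) (\<lambda>w. phi (g w) v u) z = deriv ((deriv ^^ j) (\<lambda>w. phi (g w) v u)) z" by simp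
    also have "\<dots> = deriv (\<lambda>z. phi (g z) ((gact X ^^ j) v) u) z"
    proof (rule deriv_cong_ev)
      show "eventually (\<lambda>z. (deriv ^^ j) (\<lambda>w. phi (g w) v u) z = phi (g z) ((gact X ^^ j) v) u) (nhds z)"
        using eventually_nhds_in_open[OF open_ball Suc.prems] Suc.IH by (auto elim: eventually_mono)
    qed simp
    also have "\<dots> = phi (g z) (gact X ((gact X ^^ j) v)) u"
      by (rule DERIV_imp_deriv[OF D[OF Suc.prems]])
    finally show ?case by simp
  qed simp
  have "(\<lambda>n. (deriv ^^ n) (\<lambda>w. phi (g w) v u) 0 / fact n * (w - 0) ^ n) sums phi (g w) v u"
    by (rule holomorphic_power_series[OF hol w])
  then show ?thesis using R by (simp add: hd)
qed

end

section \<open>The group and the contraction property\<close>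

text \<open>The elements of the complex orthogonal group that preserve \<open>herm_form\<close>;
  this group contains \<open>so_star_group\<close>.\<close>

definition gp :: "'n::finite mat2 set" where
  "gp = {g \<in> so_c. adjm g = ginv g}"

lemma gp_so_c: "g \<in> gp \<Longrightarrow> g \<in> so_c"
  and gp_adjm: "g \<in> gp \<Longrightarrow> adjm g = ginv g"
  by (simp_all add: gp_def)

lemma ginv_ginv [simp]: "ginv (ginv g) = g"
  by (simp add: vec_eq_iff ginv_nth)

lemma adjm_mult: "adjm (g ** h) = adjm h ** adjm g"
  unfolding vec_eq_iff adjm_nth matmul_nth
proof (intro allI)
  fix r s
  have "sg r * sg s * cnj (\<Sum>q\<in>UNIV. g $ s $ q * h $ q $ r) = (\<Sum>q\<in>UNIV. sg r * sg s * (cnj (g $ s $ q) * cnj (h $ q $ r)))"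
    by (simp add: sum_distrib_left)
  also have "\<dots> = (\<Sum>q\<in>UNIV. sg r * sg q * cnj (h $ q $ r) * (sg q * sg s * cnj (g $ s $ q)))"
  proof (rule sum.cong[OF refl])
    fix q :: "'a + 'a"
    have "sg r * sg q * cnj (h $ q $ r) * (sg q * sg s * cnj (g $ s $ q)) = (sg q * sg q) * (sg r * sg s * (cnj (g $ s $ q) * cnj (h $ q $ r)))"
      by (simp only: mult_ac)
    then show "sg r * sg s * (cnj (g $ s $ q) * cnj (h $ q $ r)) = sg r * sg q * cnj (h $ q $ r) * (sg q * sg s * cnj (g $ s $ q))"
      by simp
  qed
  finally show "sg r * sg s * cnj (\<Sum>q\<in>UNIV. g $ s $ q * h $ q $ r)
    = (\<Sum>q\<in>UNIV. sg r * sg q * cnj (h $ q $ r) * (sg q * sg s * cnj (g $ s $ q)))" .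
qed

lemma adjm_adjm [simp]: "adjm (adjm g) = g"
  by (simp add: vec_eq_iff adjm_nth mult.assoc)

lemma adjm_ginv: "adjm (ginv g) = ginv (adjm g)"
  by (simp add: vec_eq_iff adjm_nth ginv_nth mult_ac)

lemma so_c_ginv: "g \<in> so_c \<Longrightarrow> ginv g \<in> so_c"
  using ginv_right[of g] by (simp add: so_c_iff)

lemma gp_mult: "g \<in> gp \<Longrightarrow> h \<in> gp \<Longrightarrow> g ** h \<in> gp"
  by (simp add: gp_def so_c_mult adjm_mult ginv_mult)

lemma gp_ginv: "g \<in> gp \<Longrightarrow> ginv g \<in> gp"
  by (simp add: gp_def so_c_ginv adjm_ginv)

lemma mat1_gp [simp]: "(mat 1 :: 'a::finite mat2) \<in> gp"
proof -
  have "ginv (mat 1 :: 'a mat2) = mat 1" "adjm (mat 1 :: 'a mat2) = mat 1"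
    by (auto simp: vec_eq_iff ginv_nth adjm_nth mat_def)
  then show ?thesis by (simp add: gp_def so_c_iff)
qed

lemma herm_form_sq: "herm_form ** herm_form = mat 1"
  by (auto simp: vec_eq_iff herm_form_mult herm_form_nth mat_def)

lemma gp_I:
  assumes "transpose g ** sym_form ** g = sym_form" "conj_transpose g ** herm_form ** g = herm_form"
  shows "g \<in> gp"
proof -
  have s: "g \<in> so_c" using assms(1) by (simp add: so_c_def)
  have "adjm g ** g = herm_form ** (conj_transpose g ** herm_form ** g)"
    by (simp add: adjm_eq matrix_mul_assoc)
  then have "adjm g ** g = mat 1" by (simp add: assms(2) herm_form_sq)
  then have "adjm g ** g ** ginv g = ginv g" by simp
  then have "adjm g = ginv g" by (simp add: ginv_right[OF s] flip: matrix_mul_assoc)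
  then show ?thesis using s by (simp add: gp_def)
qed

lemma so_star_subset_gp: "so_star_group \<subseteq> gp"
  by (auto simp: so_star_group_def intro: gp_I)

definition cip :: "complex^'n \<Rightarrow> complex^'n \<Rightarrow> complex" where
  "cip x y = (\<Sum>i\<in>UNIV. x $ i * cnj (y $ i))"

lemma cip_self: "cip x x = of_real ((norm x)\<^sup>2)"
  by (simp add: cip_def norm_vec_def L2_set_def sum_nonneg complex_norm_square[symmetric] del: of_real_power)

lemma cip_mult: "cip (A *v x) y = cip x (conj_transpose A *v y)"
  unfolding cip_def matrix_vector_mult_def
  by (simp add: sum_distrib_left sum_distrib_right, subst sum.swap) (simp add: mult_ac)

lemma cip_diff_left: "cip (x - y) z = cip x z - cip y z"
  by (simp add: cip_def left_diff_distrib sum_subtractf)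

lemma quarter_adjm:
  "ul (adjm g) = conj_transpose (ul g)" "ur (adjm g) = - conj_transpose (ll g)"
  "ll (adjm g) = - conj_transpose (ur g)" "lr (adjm g) = conj_transpose (lr g)"
  by (simp_all add: vec_eq_iff adjm_nth)

lemma conj_conj_transpose [simp]: "conj_transpose (conj_transpose A) = A"
  by (simp add: vec_eq_iff)

text \<open>The upper left block of the invariance of the hermitian form. It yields both the
  invertibility of \<open>ul g\<close> and the contraction property of \<open>yof g\<close>.\<close>

lemma gp_norm:
  assumes "g \<in> gp"
  shows "(norm (ul g *v x))\<^sup>2 = (norm x)\<^sup>2 + (norm (ll g *v x))\<^sup>2"
proof -
  have "adjm g ** g = mat 1" using assms by (simp add: gp_def ginv_left)
  from arg_cong[OF this, of ul]
  have e: "conj_transpose (ul g) ** ul g - conj_transpose (ll g) ** ll g = mat 1"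
    by (simp add: quarter_mult quarter_adjm matrix_minus_mult)
  have n: "cip (conj_transpose A ** A *v x) x = of_real ((norm (A *v x))\<^sup>2)" for A :: "complex^'a^'a"
    using cip_mult[of "conj_transpose A" "A *v x" x] by (simp add: cip_self matrix_vector_mul_assoc)
  have "cip x x = cip ((conj_transpose (ul g) ** ul g - conj_transpose (ll g) ** ll g) *v x) x"
    unfolding e by simp
  also have "\<dots> = of_real ((norm (ul g *v x))\<^sup>2) - of_real ((norm (ll g *v x))\<^sup>2)"
    by (simp only: matrix_vector_mult_diff_rdistrib cip_diff_left n)
  finally have "(norm x)\<^sup>2 = (norm (ul g *v x))\<^sup>2 - (norm (ll g *v x))\<^sup>2"
    unfolding cip_self of_real_diff[symmetric] of_real_eq_iff .
  then show ?thesis by simp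
qed

lemma invertible_of_kernel:
  fixes A :: "complex^'n^'n"
  assumes "\<And>x. A *v x = 0 \<Longrightarrow> x = 0"
  shows "invertible A"
  using assms matrix_left_invertible_ker[of A] by (auto simp: invertible_left_inverse)

lemma gp_invertible: assumes "g \<in> gp" shows "invertible (ul g)"
proof (rule invertible_of_kernel)
  fix x assume "ul g *v x = 0"
  then have "(norm x)\<^sup>2 + (norm (ll g *v x))\<^sup>2 = 0" using gp_norm[OF assms, of x] by simp
  then show "x = 0" by (simp add: add_nonneg_eq_0_iff)
qed

definition contr :: "complex^'n^'n \<Rightarrow> bool" where
  "contr Y \<longleftrightarrow> transpose Y = - Y \<and> (\<exists>r\<ge>0. r < 1 \<and> (\<forall>x. norm (Y *v x) \<le> r * norm x))"

lemma norm_matrix_bound: "norm (A *v x) \<le> (\<Sum>i\<in>UNIV. \<Sum>j\<in>UNIV. cmod (A $ i $ j)) * norm (x :: complex^'n)"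
proof -
  have "norm (A *v x) \<le> (\<Sum>i\<in>UNIV. norm ((A *v x) $ i))"
    unfolding norm_vec_def by (rule L2_set_le_sum) simp
  also have "\<dots> \<le> (\<Sum>i\<in>UNIV. \<Sum>j\<in>UNIV. cmod (A $ i $ j) * norm x)"
    unfolding matrix_vector_mult_def vec_lambda_beta
    by (intro sum_mono order_trans[OF norm_sum]) (simp add: norm_mult mult_left_mono Finite_Cartesian_Product.norm_nth_le)
  finally show ?thesis by (simp add: sum_distrib_right)
qed

lemma gp_contr: assumes "g \<in> gp" shows "contr (yof g)"
proof -
  define K where "K = 1 + (\<Sum>i\<in>UNIV. \<Sum>j\<in>UNIV. cmod (ul g $ i $ j))"
  have K1: "K \<ge> 1" by (simp add: K_def sum_nonneg)
  have K: "norm (ul g *v x) \<le> K * norm x" for x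
    using norm_matrix_bound[of "ul g" x] by (simp add: K_def distrib_right) (smt (verit) norm_ge_zero)
  \<comment> \<open>With \<open>y = A x\<close> one has \<open>|C x|^2 = |y|^2 - |x|^2\<close> and
    \<open>|x| \<ge> |y| / K\<close>. The summand 1 in \<open>K\<close> keeps the radicand
    nonnegative.\<close>
  define r where "r = sqrt (1 - 1 / K\<^sup>2)"
  have K2: "1 / K\<^sup>2 > 0" "1 / K\<^sup>2 \<le> 1" using K1 by (auto simp: divide_simps)
  have r: "r \<ge> 0" "r < 1" "r\<^sup>2 = 1 - 1 / K\<^sup>2" using K2 by (auto simp: r_def real_sqrt_lt_1_iff)
  have "norm (yof g *v y) \<le> r * norm y" for y
  proof -
    define x where "x = matrix_inv (ul g) *v y"
    have y: "y = ul g *v x"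
      by (simp add: x_def matrix_vector_mul_assoc matrix_inv_mult gp_invertible assms)
    have Cx: "yof g *v y = ll g *v x"
      by (simp add: y matrix_vector_mul_assoc yof_mult gp_invertible assms)
    have "(norm y)\<^sup>2 \<le> (K * norm x)\<^sup>2" unfolding y using K by (intro power_mono) auto
    then have "(norm y)\<^sup>2 / K\<^sup>2 \<le> (norm x)\<^sup>2" using K1 by (simp add: divide_simps power_mult_distrib mult.commute)
    then have "(norm (yof g *v y))\<^sup>2 \<le> (r * norm y)\<^sup>2"
      using gp_norm[OF assms, of x] unfolding Cx y[symmetric] power_mult_distrib r(3)
      by (simp add: left_diff_distrib)
    then show ?thesis by (rule power2_le_imp_le) (use r in simp)
  qed
  then show ?thesis using r yof_skew[OF gp_so_c gp_invertible] assms unfolding contr_def by blast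
qed

lemma ul_nplus_nminus: "ul (nplus Z ** nminus Y) = mat 1 + Z ** Y"
  by (simp add: quarter_mult nplus_def nminus_def)

lemma ginv_nplus: "transpose Z = - Z \<Longrightarrow> ginv (nplus Z) = nplus (- Z)"
  and ginv_nminus: "transpose Z = - Z \<Longrightarrow> ginv (nminus Z) = nminus (- Z)"
  by (rule mat2_eqI; simp add: nplus_def nminus_def transpose_zero)+

lemma nplus_so_c: "transpose Z = - Z \<Longrightarrow> nplus Z \<in> so_c"
  and nminus_so_c: "transpose Z = - Z \<Longrightarrow> nminus Z \<in> so_c"
  by (simp_all add: so_c_iff ginv_nplus ginv_nminus nplus_add nminus_add nplus_zero nminus_zero)

lemma cscale_skew: "transpose Y = - Y \<Longrightarrow> transpose (cscale z Y) = - cscale z Y"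
proof -
  assume Y: "transpose Y = - Y"
  have "transpose (cscale z Y) = cscale z (transpose Y)" by (simp add: vec_eq_iff transpose_def cscale_def)
  also have "\<dots> = - cscale z Y" unfolding Y by (simp add: vec_eq_iff cscale_def)
  finally show ?thesis .
qed

lemma norm_cnjm: "norm (cnjm W *v x) = norm (W *v (\<chi> i. cnj (x $ i)))" "norm (\<chi> i. cnj (x $ i)) = norm x"
proof -
  have n: "norm (\<chi> i. cnj (y $ i)) = norm y" for y :: "complex^'c"
    by (simp add: norm_vec_def)
  show "norm (\<chi> i. cnj (x $ i)) = norm x" by (rule n)
  have "cnjm W *v x = (\<chi> i. cnj ((W *v (\<chi> i. cnj (x $ i))) $ i))"
    by (simp add: vec_eq_iff matrix_vector_mult_def)
  then show "norm (cnjm W *v x) = norm (W *v (\<chi> i. cnj (x $ i)))" by (simp only: n)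
qed

text \<open>The disc reaches beyond 1, so that Taylor series along this curve may be evaluated at
  1.\<close>

lemma nplus_nminus_path:
  assumes Y: "contr Y" and W: "contr W"
  obtains R where "R > 1" "\<And>z. z \<in> ball 0 R \<Longrightarrow> invertible (ul (nplus (cnjm W) ** nminus (cscale z Y)))"
proof -
  obtain r where r: "r \<ge> 0" "r < 1" "\<And>x. norm (Y *v x) \<le> r * norm x" using Y by (auto simp: contr_def)
  obtain t where t: "t \<ge> 0" "t < 1" "\<And>x. norm (W *v x) \<le> t * norm x" using W by (auto simp: contr_def)
  have W': "norm (cnjm W *v x) \<le> t * norm x" for x
    using t(3)[of "\<chi> i. cnj (x $ i)"] by (simp add: norm_cnjm)
  define q where "q = t * r"
  have q: "q \<ge> 0" "q < 1" using r t mult_strict_mono[of t 1 r 1] by (auto simp: q_def mult_nonneg_nonneg)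
  \<comment> \<open>A choice that satisfies both \<open>R > 1\<close> and \<open>R * q < 1\<close>,
    given \<open>q < 1\<close>.\<close>
  define R where "R = 2 / (1 + q)"
  have R: "R > 1" "R * q < 1" using q by (auto simp: R_def field_simps)
  have "invertible (ul (nplus (cnjm W) ** nminus (cscale z Y)))" if z: "z \<in> ball 0 R" for z
  proof (rule invertible_of_kernel)
    fix x assume "ul (nplus (cnjm W) ** nminus (cscale z Y)) *v x = 0"
    then have "x + cnjm W *v (cscale z Y *v x) = 0"
      by (simp add: ul_nplus_nminus matrix_vector_mult_add_rdistrib matrix_vector_mul_assoc)
    then have x: "x = - (cnjm W *v (cscale z Y *v x))" by (simp add: eq_neg_iff_add_eq_0)
    have sc: "cscale z Y *v x = z *s (Y *v x)"
      by (simp add: vec_eq_iff matrix_vector_mult_def cscale_def sum_distrib_left mult.assoc)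
    have ns: "norm (z *s y) = cmod z * norm y" for y :: "complex^'a"
      by (simp add: norm_vec_def norm_mult L2_set_right_distrib)
    have "norm x \<le> t * norm (cscale z Y *v x)"
      by (subst x) (simp add: W')
    also have "\<dots> = t * (cmod z * norm (Y *v x))" unfolding sc ns ..
    also have "\<dots> \<le> t * (cmod z * (r * norm x))"
      by (intro mult_left_mono r t) auto
    also have "\<dots> = cmod z * q * norm x" by (simp add: q_def)
    finally have n: "norm x \<le> cmod z * q * norm x" .
    have "cmod z * q < 1"
    proof -
      have "cmod z * q \<le> R * q" using z q by (intro mult_right_mono) auto
      then show ?thesis using R by simp
    qed
    show "x = 0"
    proof (rule ccontr)
      assume "x \<noteq> 0"
      then have "cmod z * q * norm x < 1 * norm x"
        using \<open>cmod z * q < 1\<close> by (intro mult_strict_right_mono) auto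
      then show False using n by simp
    qed
  qed
  then show ?thesis using that R by blast
qed

lemma det_conj_transpose: "det (conj_transpose A) = cnj (det A)"
proof -
  have "det (conj_transpose A) = det (cnjm A)"
    using det_transpose[of "cnjm A"] by (simp add: conj_transpose_def cnjm_def transpose_def)
  also have "\<dots> = cnj (det A)"
    by (simp add: det_def)
  finally show ?thesis .
qed

section \<open>Convergence of the lower triangular factor, and multiplicativity\<close>

context fock
begin

lemma dsub_mat1: "dsub (mat 1) p = p" for p :: "'a::finite var pol"
proof -
  have "(\<Sum>j\<in>UNIV. psc (mat 1 $ l $ j) (pvar (j, c, s))) = pvar (l, c, s)" for l :: 'a and c s
    by (simp add: mat_def if_distrib[of "\<lambda>a. psc a _"] cong: if_cong)
  then have "(\<lambda>(l, c, s). if c \<in> C then \<Sum>j\<in>UNIV. psc (mat 1 $ l $ j) (pvar (j, c, s)) else pvar (l, c, s)) = (pvar :: 'a var \<Rightarrow> _)"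
    by (auto simp: fun_eq_iff)
  then show ?thesis by (simp only: dsub_def psub_id)
qed

lemma matrix_inv_mat1: "matrix_inv (mat 1 :: complex^'n^'n) = mat 1"
  by (metis invertible_def matrix_inv_mult(1) matrix_mul_lid)

lemma pexp_zero_op: "pexp (opD 0) p = p"
  by (subst pexp_eq[of _ 1]) simp_all

lemma phi_nplus: assumes "transpose Z = - Z" shows "phi (nplus Z) v u = fip (pexp (opD Z) v) u"
proof -
  have "cnjm (0 :: complex^'a^'a) = 0" by (simp add: vec_eq_iff)
  then have "cnjm (yof (nplus Z)) = 0" by (simp add: yof_def nplus_def)
  moreover have "zof (nplus Z) = Z" by (simp add: zof_def nplus_def matrix_inv_mat1)
  moreover have "ul (nplus Z) = mat 1" by (simp add: nplus_def)
  ultimately show ?thesis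
    by (simp add: phi_def thalf_def pexp_zero_op matrix_inv_mat1 dsub_mat1)
qed

text \<open>The Taylor series at 1 of the curve
  \<open>nplus (cnjm W) ** nminus (cscale z Y)\<close>. It makes sense of the inner product of the
  exponentials of \<open>opM Y\<close> at \<open>v\<close> and \<open>opM W\<close> at
  \<open>u\<close>.\<close>

lemma pairing_sums:
  assumes Y: "contr Y" and W: "contr W"
  shows "(\<lambda>j. fip (pexp (opD (cnjm W)) ((opM Y ^^ j) v)) u / fact j) sums phi (nplus (cnjm W) ** nminus Y) v u"
proof -
  obtain R where R: "R > 1" "\<And>z. z \<in> ball 0 R \<Longrightarrow> invertible (ul (nplus (cnjm W) ** nminus (cscale z Y)))"
    using nplus_nminus_path[OF Y W] by blast
  have sk: "transpose Y = - Y" "transpose (cnjm W) = - cnjm W" using Y W by (auto simp: contr_def cnjm_skew)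
  let ?g = "\<lambda>z. nplus (cnjm W) ** nminus (cscale z Y)" and ?X = "block 0 0 Y 0"
  have X: "?X \<in> lie_g" using block_in_lie_g[of 0 Y 0] sk by simp
  have X2: "nminus (cscale z Y) ** ?X = ?X" for z
    by (rule mat2_eqI) (simp_all add: quarter_mult nminus_def)
  have dn: "((\<lambda>z. nminus (cscale z Y) $ r $ s) has_field_derivative ?X $ r $ s) (at z)" for r s z
    by (cases r; cases s) (auto simp: nminus_def cscale_def intro!: derivative_eq_intros)
  have "(\<lambda>j. phi (?g 0) ((gact ?X ^^ j) v) u / fact j * 1 ^ j) sums phi (?g 1) v u"
  proof (rule phi_taylor[of R ?g ?X 1 v u])
    show "?g w \<in> so_c" for w
      by (intro so_c_mult nplus_so_c nminus_so_c cscale_skew sk)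
    show "((\<lambda>w. ?g w $ r $ s) has_field_derivative (?g w ** ?X) $ r $ s) (at w)" for w r s
    proof -
      have "((\<lambda>w. \<Sum>q\<in>UNIV. nplus (cnjm W) $ r $ q * nminus (cscale w Y) $ q $ s) has_field_derivative
          (\<Sum>q\<in>UNIV. nplus (cnjm W) $ r $ q * ?X $ q $ s)) (at w)"
        by (intro DERIV_sum DERIV_cmult dn)
      then show ?thesis by (simp add: X2 flip: matrix_mul_assoc matmul_nth)
    qed
  qed (use R X in auto)
  moreover have "?g 0 = nplus (cnjm W)"
  proof -
    have "cscale 0 Y = 0" by (simp add: vec_eq_iff cscale_def)
    then show ?thesis by (simp add: nminus_zero)
  qed
  moreover have "cscale 1 Y = Y" by (simp add: vec_eq_iff cscale_def)
  moreover have "gact ?X = opM Y" by (rule ext) simp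
  ultimately show ?thesis by (simp add: phi_nplus sk)
qed

text \<open>If an operator transforms \<open>xi\<close> by \<open>M\<close>, then in the
  conjugate-linear argument of a form it transforms \<open>xia\<close> by \<open>tw M\<close>. The
  map sends \<open>ginv h\<close> to \<open>adjm h\<close>.\<close>

definition tw :: "'n::finite mat2 \<Rightarrow> 'n mat2" where
  "tw M = (\<chi> r q. sg r * sg q * cnj (M $ sw r $ sw q))"

lemma tw_nth: "tw M $ r $ q = sg r * sg q * cnj (M $ sw r $ sw q)"
  by (simp add: tw_def)

lemma tw_mult: "tw (M ** N) = tw M ** tw N"
proof -
  have "sg r * sg s * cnj (\<Sum>q\<in>UNIV. M $ sw r $ q * N $ q $ sw s)
     = (\<Sum>q\<in>UNIV. sg r * sg q * cnj (M $ sw r $ sw q) * (sg q * sg s * cnj (N $ sw q $ sw s)))" for r s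
  proof -
    have "sg r * sg s * cnj (\<Sum>q\<in>UNIV. M $ sw r $ q * N $ q $ sw s)
      = (\<Sum>q\<in>UNIV. sg r * sg s * (cnj (M $ sw r $ sw q) * cnj (N $ sw q $ sw s)))"
      by (subst sum_sw[symmetric]) (simp add: sum_distrib_left)
    also have "\<dots> = (\<Sum>q\<in>UNIV. sg r * sg q * cnj (M $ sw r $ sw q) * (sg q * sg s * cnj (N $ sw q $ sw s)))"
    proof (rule sum.cong[OF refl])
      fix q :: "'a + 'a"
      have "sg r * sg q * cnj (M $ sw r $ sw q) * (sg q * sg s * cnj (N $ sw q $ sw s))
         = (sg q * sg q) * (sg r * sg s * (cnj (M $ sw r $ sw q) * cnj (N $ sw q $ sw s)))"
        by (simp only: mult_ac)
      then show "sg r * sg s * (cnj (M $ sw r $ sw q) * cnj (N $ sw q $ sw s))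
         = sg r * sg q * cnj (M $ sw r $ sw q) * (sg q * sg s * cnj (N $ sw q $ sw s))" by simp
    qed
    finally show ?thesis .
  qed
  then show ?thesis by (simp add: vec_eq_iff tw_nth matmul_nth)
qed

lemma thalf_xia:
  assumes h: "h \<in> gp" and g: "g \<in> so_c" "invertible (ul g)"
  shows "phi g v (thalf h (xia c s r u)) = (\<Sum>q\<in>UNIV. colm c (ginv h ** nplus (- cnjm (yof h))) $ r $ q * phi g v (xia c s q (thalf h u)))"
proof -
  note hs = gp_so_c[OF h] gp_invertible[OF h]
  let ?H = "ginv h ** nminus (yof h)"
  have sq: "sesq (phi g)" by (rule sesq_phi[OF g])
  have sc: "phi g v (psc a u) = cnj a * phi g v u" for a u using sq by (auto simp: sesq_def)
  have "tw ?H = ginv h ** nplus (- cnjm (yof h))"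
  proof -
    have "tw (ginv h) = adjm h"
      by (simp add: vec_eq_iff tw_nth adjm_nth ginv_nth)
    moreover have "tw (nminus (yof h)) = nplus (- cnjm (yof h))"
      by (rule mat2_eqI) (simp_all add: vec_eq_iff tw_nth nminus_def nplus_def mat_def)
    ultimately show ?thesis by (simp add: tw_mult gp_adjm h)
  qed
  then have tw: "tw (colm c ?H) = colm c (ginv h ** nplus (- cnjm (yof h)))"
    by (simp add: colm_def) (auto simp: vec_eq_iff tw_nth mat_def)
  have "thalf h (xia c s r u) = psc (- eps s * sg r) (\<Sum>q\<in>UNIV. psc (colm c ?H $ sw r $ q) (xi c (\<not> s) q (thalf h u)))"
    unfolding xia_xi plin_psc[OF plin_thalf[OF hs]] itw_xi[OF itw_thalf[OF hs]] ..
  also have "\<dots> = psc (- eps s * sg r) (\<Sum>q\<in>UNIV. psc (colm c ?H $ sw r $ sw q) (xi c (\<not> s) (sw q) (thalf h u)))"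
    by (subst sum_sw[symmetric]) rule
  also have "\<dots> = (\<Sum>q\<in>UNIV. psc (sg r * sg q * colm c ?H $ sw r $ sw q) (xia c s q (thalf h u)))"
    unfolding psc_sum xi_xia psc_psc
  proof (rule sum.cong[OF refl])
    fix q :: "'a + 'a"
    have "- eps s * sg r * (colm c ?H $ sw r $ sw q * (eps (\<not> s) * sg (sw (sw q)))) = (eps s * eps s) * (sg r * sg q * colm c ?H $ sw r $ sw q)"
      by (simp only: eps_simps(3) sw_sw mult_minus_left mult_minus_right minus_minus mult_ac)
    then show "psc (- eps s * sg r * (colm c ?H $ sw r $ sw q * (eps (\<not> s) * sg (sw (sw q))))) (xia c (\<not> \<not> s) (sw (sw q)) (thalf h u))
        = psc (sg r * sg q * colm c ?H $ sw r $ sw q) (xia c s q (thalf h u))"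
      by (simp only: sw_sw not_not eps_simps mult_1)
  qed
  finally show ?thesis
    by (simp add: sesq_sum_right[OF sq] sc tw_nth flip: tw)
qed

lemma invertible_nplus_nminus: "contr Y \<Longrightarrow> contr W \<Longrightarrow> invertible (ul (nplus (cnjm W) ** nminus Y))"
proof -
  assume "contr Y" "contr W"
  then obtain R where R: "R > 1" "\<And>z. z \<in> ball 0 R \<Longrightarrow> invertible (ul (nplus (cnjm W) ** nminus (cscale z Y)))"
    using nplus_nminus_path by blast
  have "cscale 1 Y = Y" by (simp add: vec_eq_iff cscale_def)
  then show ?thesis using R(2)[of 1] R(1) by simp
qed

text \<open>The polynomial form of the relation \<open>\<langle>\<rho>(g) v, \<rho>(h) u\<rangle> = \<langle>\<rho>(h\<^sup>-\<^sup>1 g) v, u\<rangle>\<close>.\<close>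

lemma phi_thalf:
  assumes g: "g \<in> gp" and h: "h \<in> gp"
  shows "phi (nplus (cnjm (yof h)) ** nminus (yof g)) (thalf g v) (thalf h u) = phi (ginv h ** g) v u"
proof -
  let ?g1 = "nplus (cnjm (yof h)) ** nminus (yof g)" and ?x = "ginv h ** g"
  note gs = gp_so_c[OF g] gp_invertible[OF g] and hs = gp_so_c[OF h] gp_invertible[OF h]
  have Ys: "transpose (yof g) = - yof g" "transpose (cnjm (yof h)) = - cnjm (yof h)"
    by (auto intro!: cnjm_skew yof_skew gs hs)
  have g1: "?g1 \<in> so_c" "invertible (ul ?g1)"
    by (auto intro!: so_c_mult nplus_so_c nminus_so_c Ys invertible_nplus_nminus gp_contr g h)
  have x: "?x \<in> gp" using g h by (intro gp_mult gp_ginv)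
  note xs = gp_so_c[OF x] gp_invertible[OF x]
  define S where "S v u = phi ?g1 (thalf g v) (thalf h u)" for v u
  have sq: "sesq (phi ?g1)" by (rule sesq_phi[OF g1])
  \<comment> \<open>Both sides obey the commutation rules of \<open>ginv h ** g\<close>, so by
    \<open>bog_unique\<close> only their values at \<open>1, 1\<close> have to be compared.\<close>
  have "bog ?x S"
    unfolding bog_def
  proof (intro conjI allI)
    show "sesq S"
      using sq unfolding sesq_def S_def
      by (simp add: plin_add[OF plin_thalf[OF gs]] plin_psc[OF plin_thalf[OF gs]]
          plin_add[OF plin_thalf[OF hs]] plin_psc[OF plin_thalf[OF hs]])
    fix c s r v u
    let ?f = "\<lambda>q. phi ?g1 (thalf g v) (xia c s q (thalf h u))"
    have comp: "(\<Sum>q\<in>UNIV. colm c M $ r $ q * (\<Sum>t\<in>UNIV. colm c N $ q $ t * f t)) = (\<Sum>t\<in>UNIV. colm c (M ** N) $ r $ t * f t)"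
      for M N :: "'a mat2" and f :: "'a + 'a \<Rightarrow> complex"
      unfolding sum_distrib_left
      by (subst sum.swap) (simp add: colm_mult matmul_nth sum_distrib_right mult.assoc)
    have sc: "phi ?g1 (psc a v) u = a * phi ?g1 v u" for a v u using sq by (auto simp: sesq_def)
    have "S (xi c s r v) u = (\<Sum>q\<in>UNIV. colm c (ginv g ** nminus (yof g)) $ r $ q * phi ?g1 (xi c s q (thalf g v)) (thalf h u))"
      unfolding S_def itw_xi[OF itw_thalf[OF gs]] by (simp add: sesq_sum_left[OF sq] sc)
    also have "\<dots> = (\<Sum>t\<in>UNIV. colm c (ginv g ** nminus (yof g) ** ginv ?g1) $ r $ t * ?f t)"
      unfolding phi_xi[OF g1] comp ..
    also have "ginv g ** nminus (yof g) ** ginv ?g1 = ginv g ** nplus (- cnjm (yof h))"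
    proof -
      have "nminus (yof g) ** (ginv (nminus (yof g)) ** ginv (nplus (cnjm (yof h)))) = nplus (- cnjm (yof h))"
        using ginv_right[OF nminus_so_c[OF Ys(1)]] by (simp add: matrix_mul_assoc ginv_nplus[OF Ys(2)])
      then show ?thesis by (simp add: ginv_mult flip: matrix_mul_assoc)
    qed
    also have "\<dots> = ginv ?x ** (ginv h ** nplus (- cnjm (yof h)))"
    proof -
      have "ginv ?x ** (ginv h ** nplus (- cnjm (yof h))) = ginv g ** (h ** ginv h) ** nplus (- cnjm (yof h))"
        by (simp add: ginv_mult matrix_mul_assoc)
      then show ?thesis by (simp add: ginv_right[OF hs(1)])
    qed
    also have "(\<Sum>t\<in>UNIV. colm c (ginv ?x ** (ginv h ** nplus (- cnjm (yof h)))) $ r $ t * ?f t)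
       = (\<Sum>t\<in>UNIV. colm c (ginv ?x) $ r $ t * S v (xia c s t u))"
      unfolding comp[symmetric] S_def thalf_xia[OF h g1] ..
    finally show "S (xi c s r v) u = (\<Sum>t\<in>UNIV. colm c (ginv ?x) $ r $ t * S v (xia c s t u))" .
  qed
  moreover have "S 1 1 = phi ?x 1 1"
  proof -
    have t1: "thalf g 1 = psc (1 / det (ul g) ^ card C) 1" if "g \<in> gp" for g :: "'a mat2"
      using that by (simp add: thalf_def pexp_one zof_skew gp_so_c gp_invertible)
    have sc: "phi ?g1 (psc a v) (psc b u) = a * (cnj b * phi ?g1 v u)" for a b v u using sq by (auto simp: sesq_def)
    have "S 1 1 = 1 / (det (ul g) * cnj (det (ul h)) * det (ul ?g1)) ^ card C"
      unfolding S_def t1[OF g] t1[OF h] sc phi_one_one[OF g1] by (simp add: power_mult_distrib)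
    \<comment> \<open>Because \<open>ginv h = adjm h\<close>, the block \<open>ul ?x\<close> factors
      into the conjugate transpose of \<open>ul h\<close>, then \<open>ul ?g1\<close>, then
      \<open>ul g\<close>.\<close>
    also have "det (ul g) * cnj (det (ul h)) * det (ul ?g1) = det (ul ?x)"
    proof -
      have "ul ?x = ul (adjm h ** g)" by (simp add: gp_adjm h)
      also have "\<dots> = conj_transpose (ul h) ** ul g - conj_transpose (ll h) ** ll g"
        by (simp add: quarter_mult quarter_adjm matrix_minus_mult)
      also have "conj_transpose (ll h) = - (conj_transpose (ul h) ** cnjm (yof h))"
      proof -
        have "conj_transpose (ll h) = conj_transpose (yof h ** ul h)" by (simp add: yof_mult hs)
        also have "\<dots> = conj_transpose (ul h) ** conj_transpose (yof h)"
          by (simp add: vec_eq_iff matmul_nth mult.commute)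
        also have "conj_transpose (yof h) = transpose (cnjm (yof h))" by (simp add: vec_eq_iff transpose_def)
        finally show ?thesis by (simp add: Ys matrix_minus_mult)
      qed
      also have "conj_transpose (ul h) ** ul g - - (conj_transpose (ul h) ** cnjm (yof h)) ** ll g
         = conj_transpose (ul h) ** ul ?g1 ** ul g"
        unfolding ul_nplus_nminus yof_mult[OF gs(2), symmetric]
        by (simp add: matrix_minus_mult matrix_add_ldistrib matrix_add_rdistrib matrix_mul_assoc)
      finally show ?thesis by (simp add: det_mul det_conj_transpose)
    qed
    finally show ?thesis by (simp add: phi_one_one[OF xs])
  qed
  ultimately have "S v u = phi ?x v u" by (rule bog_unique[OF _ bog_phi[OF xs] xs])
  then show ?thesis by (simp add: S_def)
qed

end

section \<open>Square-summable sequences\<close>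

text \<open>The completion of the Fock space is taken in coordinates, since
  \<open>unitary_module\<close> asks for a Hilbert space inside
  \<open>nat \<Rightarrow> complex\<close>.\<close>

definition ell2 :: "(nat \<Rightarrow> complex) set" where
  "ell2 = {x. summable (\<lambda>n. (cmod (x n))\<^sup>2)}"

definition l2ip :: "(nat \<Rightarrow> complex) \<Rightarrow> (nat \<Rightarrow> complex) \<Rightarrow> complex" where
  "l2ip x y = (suminf (\<lambda>n. x n * cnj (y n)))"

definition l2n :: "(nat \<Rightarrow> complex) \<Rightarrow> real" where
  "l2n x = sqrt (suminf (\<lambda>n. (cmod (x n))\<^sup>2))"

abbreviation scl :: "complex \<Rightarrow> (nat \<Rightarrow> complex) \<Rightarrow> nat \<Rightarrow> complex" where
  "scl c x \<equiv> (\<lambda>k. c * x k)"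

lemma ell2_add: assumes "x \<in> ell2" "y \<in> ell2" shows "x + y \<in> ell2"
proof -
  have s: "summable (\<lambda>n. 2 * (cmod (x n))\<^sup>2 + 2 * (cmod (y n))\<^sup>2)"
    using assms unfolding ell2_def by (intro summable_add summable_mult) auto
  have b: "(cmod (x n + y n))\<^sup>2 \<le> 2 * (cmod (x n))\<^sup>2 + 2 * (cmod (y n))\<^sup>2" for n
  proof -
    have "(cmod (x n + y n))\<^sup>2 \<le> (cmod (x n) + cmod (y n))\<^sup>2" by (intro power_mono norm_triangle_ineq) auto
    also have "\<dots> \<le> 2 * (cmod (x n))\<^sup>2 + 2 * (cmod (y n))\<^sup>2"
      using sum_squares_ge_zero[of "cmod (x n) - cmod (y n)" 0] by (simp add: power2_eq_square algebra_simps)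
    finally show ?thesis .
  qed
  have "summable (\<lambda>n. (cmod (x n + y n))\<^sup>2)"
    by (rule summable_comparison_test'[OF s, where N = 0]) (use b in simp)
  then show ?thesis by (simp add: ell2_def)
qed

lemma ell2_scl: "x \<in> ell2 \<Longrightarrow> scl c x \<in> ell2"
  by (simp add: ell2_def norm_mult power_mult_distrib summable_mult)

lemma ell2_zero [simp]: "0 \<in> ell2"
  by (simp add: ell2_def)

lemma ell2_minus: "x \<in> ell2 \<Longrightarrow> - x \<in> ell2"
  by (simp add: ell2_def)

lemma ell2_diff: "x \<in> ell2 \<Longrightarrow> y \<in> ell2 \<Longrightarrow> x - y \<in> ell2"
  using ell2_add[of x "- y"] ell2_minus by auto

lemma ell2_sum: "(\<And>i. i \<in> A \<Longrightarrow> f i \<in> ell2) \<Longrightarrow> sum f A \<in> ell2"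
  by (induction A rule: infinite_finite_induct) (auto intro: ell2_add)

lemma ell2_prod_abs_summable: assumes "x \<in> ell2" "y \<in> ell2" shows "summable (\<lambda>n. cmod (x n * cnj (y n)))"
proof -
  have s: "summable (\<lambda>n. (cmod (x n))\<^sup>2 + (cmod (y n))\<^sup>2)"
    using assms unfolding ell2_def by (intro summable_add) auto
  have b: "cmod (x n * cnj (y n)) \<le> (cmod (x n))\<^sup>2 + (cmod (y n))\<^sup>2" for n
  proof -
    have "0 \<le> (cmod (x n) - cmod (y n))\<^sup>2" by simp
    moreover have "0 \<le> cmod (x n) * cmod (y n)" by simp
    ultimately show ?thesis by (simp add: power2_eq_square norm_mult algebra_simps) (smt (verit) mult_nonneg_nonneg norm_ge_zero)
  qed
  show ?thesis
    by (rule summable_comparison_test'[OF s, where N = 0]) (use b in simp)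
qed

lemma ell2_prod_summable: "x \<in> ell2 \<Longrightarrow> y \<in> ell2 \<Longrightarrow> summable (\<lambda>n. x n * cnj (y n))"
  by (rule summable_norm_cancel) (rule ell2_prod_abs_summable)

lemma l2ip_add_left: "x \<in> ell2 \<Longrightarrow> y \<in> ell2 \<Longrightarrow> z \<in> ell2 \<Longrightarrow> l2ip (x + y) z = l2ip x z + l2ip y z"
  by (simp add: l2ip_def distrib_right suminf_add ell2_prod_summable)

lemma l2ip_scl_left: "x \<in> ell2 \<Longrightarrow> z \<in> ell2 \<Longrightarrow> l2ip (scl c x) z = c * l2ip x z"
  by (simp add: l2ip_def mult.assoc suminf_mult ell2_prod_summable)

lemma l2ip_cnj: assumes "x \<in> ell2" "y \<in> ell2" shows "l2ip y x = cnj (l2ip x y)"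
proof -
  have "(\<lambda>n. cnj (x n * cnj (y n))) sums cnj (l2ip x y)"
    unfolding l2ip_def sums_cnj by (rule summable_sums[OF ell2_prod_summable[OF assms]])
  then show ?thesis by (simp add: l2ip_def sums_iff mult.commute)
qed

lemma l2ip_minus_left: "x \<in> ell2 \<Longrightarrow> z \<in> ell2 \<Longrightarrow> l2ip (- x) z = - l2ip x z"
  using l2ip_scl_left[of x z "-1"] by (simp add: fun_Compl_def)

lemma l2ip_diff_left: "x \<in> ell2 \<Longrightarrow> y \<in> ell2 \<Longrightarrow> z \<in> ell2 \<Longrightarrow> l2ip (x - y) z = l2ip x z - l2ip y z"
  using l2ip_add_left[of x "- y" z] by (simp add: l2ip_minus_left ell2_minus)

lemma l2ip_add_right: "x \<in> ell2 \<Longrightarrow> y \<in> ell2 \<Longrightarrow> z \<in> ell2 \<Longrightarrow> l2ip z (x + y) = l2ip z x + l2ip z y"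
  by (simp add: l2ip_cnj[of _ z] l2ip_add_left ell2_add)

lemma l2ip_scl_right: "x \<in> ell2 \<Longrightarrow> z \<in> ell2 \<Longrightarrow> l2ip z (scl c x) = cnj c * l2ip z x"
  by (simp add: l2ip_cnj[of _ z] l2ip_scl_left ell2_scl)

lemma l2ip_diff_right: "x \<in> ell2 \<Longrightarrow> y \<in> ell2 \<Longrightarrow> z \<in> ell2 \<Longrightarrow> l2ip z (x - y) = l2ip z x - l2ip z y"
  by (simp add: l2ip_cnj[of _ z] l2ip_diff_left ell2_diff)

lemma l2ip_zero [simp]: "l2ip 0 z = 0" "l2ip z 0 = 0"
  by (simp_all add: l2ip_def)

lemma l2ip_sum_left: "(\<And>i. i \<in> A \<Longrightarrow> f i \<in> ell2) \<Longrightarrow> z \<in> ell2 \<Longrightarrow> l2ip (sum f A) z = (\<Sum>i\<in>A. l2ip (f i) z)"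
  by (induction A rule: infinite_finite_induct) (auto simp: l2ip_add_left ell2_sum)

lemma l2ip_sum_right: "(\<And>i. i \<in> A \<Longrightarrow> f i \<in> ell2) \<Longrightarrow> z \<in> ell2 \<Longrightarrow> l2ip z (sum f A) = (\<Sum>i\<in>A. l2ip z (f i))"
  by (induction A rule: infinite_finite_induct) (auto simp: l2ip_add_right ell2_sum)

lemma l2n_nonneg [simp]: "x \<in> ell2 \<Longrightarrow> 0 \<le> l2n x"
  by (simp add: l2n_def ell2_def suminf_nonneg)

lemma l2n_sq: "x \<in> ell2 \<Longrightarrow> (l2n x)\<^sup>2 = (suminf (\<lambda>n. (cmod (x n))\<^sup>2))"
  by (simp add: l2n_def ell2_def suminf_nonneg)

lemma l2ip_self: assumes "x \<in> ell2" shows "l2ip x x = of_real ((l2n x)\<^sup>2)"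
  unfolding l2n_sq[OF assms]
  using assms by (simp add: l2ip_def complex_norm_square[symmetric] ell2_def suminf_of_real del: of_real_power)

lemma ip_norm_l2ip: "x \<in> ell2 \<Longrightarrow> ip_norm l2ip x = l2n x"
  by (simp add: ip_norm_def l2ip_self del: of_real_power)

lemma l2n_eq_0: assumes "x \<in> ell2" "l2n x = 0" shows "x = 0"
proof -
  have "(suminf (\<lambda>n. (cmod (x n))\<^sup>2)) = 0" using l2n_sq[OF assms(1)] assms(2) by simp
  then have "\<forall>n. (cmod (x n))\<^sup>2 = 0"
    using assms(1) by (subst (asm) suminf_eq_zero_iff) (auto simp: ell2_def)
  then show ?thesis by (simp add: fun_eq_iff)
qed

lemma l2_cauchy_schwarz: assumes "x \<in> ell2" "y \<in> ell2" shows "cmod (l2ip x y) \<le> l2n x * l2n y"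
proof -
  have s: "summable (\<lambda>n. cmod (x n) * cmod (y n))"
    using ell2_prod_abs_summable[OF assms] by (simp add: norm_mult)
  have "cmod (l2ip x y) \<le> (suminf (\<lambda>n. cmod (x n * cnj (y n))))"
    unfolding l2ip_def by (rule summable_norm[OF ell2_prod_abs_summable[OF assms]])
  also have "\<dots> = (suminf (\<lambda>n. cmod (x n) * cmod (y n)))" by (simp add: norm_mult)
  also have "\<dots> \<le> l2n x * l2n y"
  proof (rule suminf_le_const[OF s])
    fix N
    have "(\<Sum>n<N. cmod (x n) * cmod (y n)) \<le> L2_set (\<lambda>n. cmod (x n)) {..<N} * L2_set (\<lambda>n. cmod (y n)) {..<N}"
      using L2_set_mult_ineq[of "\<lambda>n. cmod (x n)" "\<lambda>n. cmod (y n)" "{..<N}"] by simp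
    also have "\<dots> \<le> l2n x * l2n y"
      using assms unfolding l2n_def L2_set_def ell2_def
      by (intro mult_mono real_sqrt_le_mono sum_le_suminf) (auto intro: sum_nonneg suminf_nonneg)
    finally show "(\<Sum>n<N. cmod (x n) * cmod (y n)) \<le> l2n x * l2n y" .
  qed
  finally show ?thesis .
qed

lemma l2n_sq_diff: "x \<in> ell2 \<Longrightarrow> y \<in> ell2 \<Longrightarrow> (l2n (x - y))\<^sup>2 = (l2n x)\<^sup>2 + (l2n y)\<^sup>2 - 2 * Re (l2ip x y)"
proof -
  assume a: "x \<in> ell2" "y \<in> ell2"
  have "complex_of_real ((l2n (x - y))\<^sup>2) = l2ip (x - y) (x - y)" using a by (simp only: l2ip_self ell2_diff)
  also have "\<dots> = l2ip x x - l2ip y x - (l2ip x y - l2ip y y)"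
    using a by (simp add: l2ip_diff_left l2ip_diff_right ell2_diff)
  also have "Re \<dots> = (l2n x)\<^sup>2 + (l2n y)\<^sup>2 - 2 * Re (l2ip x y)"
    using a l2ip_cnj[of x y] by (simp add: l2ip_self del: of_real_power)
  finally show ?thesis by (metis Re_complex_of_real)
qed

lemma l2n_triangle: assumes "x \<in> ell2" "y \<in> ell2" shows "l2n (x + y) \<le> l2n x + l2n y"
proof (rule power2_le_imp_le)
  have "(l2n (x + y))\<^sup>2 = (l2n x)\<^sup>2 + (l2n (- y))\<^sup>2 - 2 * Re (l2ip x (- y))"
    using l2n_sq_diff[of x "- y"] assms by (simp add: ell2_minus)
  moreover have "l2n (- y) = l2n y" by (simp add: l2n_def)
  moreover have "l2ip x (- y) = - l2ip x y"
    using l2ip_diff_right[of 0 y x] assms by simp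
  moreover have "Re (l2ip x y) \<le> l2n x * l2n y"
    using l2_cauchy_schwarz[OF assms] complex_Re_le_cmod order_trans by blast
  ultimately show "(l2n (x + y))\<^sup>2 \<le> (l2n x + l2n y)\<^sup>2"
    by (simp add: power2_eq_square algebra_simps)
qed (use assms in simp)

lemma l2n_minus_commute: "l2n (x - y) = l2n (y - x)"
  by (simp add: l2n_def norm_minus_commute)

lemma l2n_scl: "l2n (scl c x) = cmod c * l2n x" if "x \<in> ell2"
  using that by (simp add: l2n_def norm_mult power_mult_distrib suminf_mult ell2_def real_sqrt_mult)

lemma coord_le_l2n: assumes "x \<in> ell2" shows "cmod (x n) \<le> l2n x"
proof -
  have "(cmod (x n))\<^sup>2 \<le> (suminf (\<lambda>n. (cmod (x n))\<^sup>2))"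
    using sum_le_suminf[of "\<lambda>n. (cmod (x n))\<^sup>2" "{n}"] assms by (simp add: ell2_def)
  then show ?thesis by (simp add: l2n_def real_le_rsqrt)
qed

text \<open>Truncations are coordinate sequences of polynomials, see \<open>trnc_crd\<close>; they
  are the dense subspace on which identities of operators are checked.\<close>

definition trnc :: "nat \<Rightarrow> (nat \<Rightarrow> complex) \<Rightarrow> nat \<Rightarrow> complex" where
  "trnc N x = (\<lambda>n. if n < N then x n else 0)"

lemma trnc_ell2 [simp]: "trnc N x \<in> ell2"
  unfolding ell2_def by (auto intro!: summable_finite[of "{..<N}"] simp: trnc_def split: if_splits)

lemma trnc_tendsto: assumes "x \<in> ell2" shows "(\<lambda>N. l2n (x - trnc N x)) \<longlonglongrightarrow> 0"
proof -
  have s: "summable (\<lambda>n. (cmod (x n))\<^sup>2)" using assms by (simp add: ell2_def)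
  have "(suminf (\<lambda>n. (cmod ((x - trnc N x) n))\<^sup>2)) = (suminf (\<lambda>n. (cmod (x n))\<^sup>2)) - (\<Sum>n<N. (cmod (x n))\<^sup>2)" for N
  proof -
    have "(\<lambda>n. (cmod (x n))\<^sup>2 - (if n \<in> {..<N} then (cmod (x n))\<^sup>2 else 0)) sums ((suminf (\<lambda>n. (cmod (x n))\<^sup>2)) - (\<Sum>n<N. (cmod (x n))\<^sup>2))"
      by (intro sums_diff summable_sums s sums_If_finite_set) simp
    also have "(\<lambda>n. (cmod (x n))\<^sup>2 - (if n \<in> {..<N} then (cmod (x n))\<^sup>2 else 0)) = (\<lambda>n. (cmod ((x - trnc N x) n))\<^sup>2)"
      by (auto simp: trnc_def)
    finally show ?thesis by (simp add: sums_iff)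
  qed
  moreover have "(\<lambda>N. (suminf (\<lambda>n. (cmod (x n))\<^sup>2)) - (\<Sum>n<N. (cmod (x n))\<^sup>2)) \<longlonglongrightarrow> (suminf (\<lambda>n. (cmod (x n))\<^sup>2)) - (suminf (\<lambda>n. (cmod (x n))\<^sup>2))"
    by (intro tendsto_intros summable_LIMSEQ s)
  ultimately have "(\<lambda>N. sqrt (suminf (\<lambda>n. (cmod ((x - trnc N x) n))\<^sup>2))) \<longlonglongrightarrow> sqrt 0"
    by (intro tendsto_real_sqrt) simp
  then show ?thesis by (simp add: l2n_def)
qed

lemma l2ip_tendsto_left:
  assumes "\<And>k. x k \<in> ell2" "y \<in> ell2" "z \<in> ell2" "(\<lambda>k. l2n (x k - y)) \<longlonglongrightarrow> 0"
  shows "(\<lambda>k. l2ip (x k) z) \<longlonglongrightarrow> l2ip y z"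
proof -
  have "(\<lambda>k. l2n (x k - y) * l2n z) \<longlonglongrightarrow> 0" using tendsto_mult_left_zero[OF assms(4)] by simp
  then have "(\<lambda>k. l2ip (x k) z - l2ip y z) \<longlonglongrightarrow> 0"
    by (rule Lim_null_comparison[rotated])
      (use assms l2_cauchy_schwarz in \<open>auto simp: ell2_diff simp flip: l2ip_diff_left\<close>)
  then show ?thesis by (simp add: LIM_zero_iff)
qed

lemma l2ip_tendsto_right:
  assumes "\<And>k. x k \<in> ell2" "y \<in> ell2" "z \<in> ell2" "(\<lambda>k. l2n (x k - y)) \<longlonglongrightarrow> 0"
  shows "(\<lambda>k. l2ip z (x k)) \<longlonglongrightarrow> l2ip z y"
  using tendsto_cnj[OF l2ip_tendsto_left[OF assms]] by (simp add: l2ip_cnj[of _ z] assms)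

lemma ell2_complete:
  assumes x: "\<And>k. x k \<in> ell2" and c: "\<And>e. e > 0 \<Longrightarrow> \<exists>M. \<forall>k\<ge>M. \<forall>l\<ge>M. l2n (x k - x l) < e"
  obtains y where "y \<in> ell2" "(\<lambda>k. l2n (x k - y)) \<longlonglongrightarrow> 0"
proof -
  have "Cauchy (\<lambda>k. x k n)" for n
    unfolding Cauchy_altdef2
  proof (intro allI impI)
    fix e :: real assume "e > 0"
    then obtain M where M: "\<forall>k\<ge>M. \<forall>l\<ge>M. l2n (x k - x l) < e" using c by blast
    have "dist (x k n) (x M n) < e" if "k \<ge> M" for k
      using coord_le_l2n[OF ell2_diff[OF x x], of k M n] M that by (force simp: dist_norm)
    then show "\<exists>N. \<forall>k\<ge>N. dist (x k n) (x N n) < e" by blast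
  qed
  then have "\<exists>y. (\<lambda>k. x k n) \<longlonglongrightarrow> y" for n by (simp add: Cauchy_convergent_iff convergent_def)
  then obtain y where y: "\<And>n. (\<lambda>k. x k n) \<longlonglongrightarrow> y n" by metis
  \<comment> \<open>A bound on finite partial sums survives the coordinatewise limit, so it holds
    for the whole series.\<close>
  have main: "x k - y \<in> ell2 \<and> l2n (x k - y) \<le> e" if e: "e > 0" and M: "\<forall>k\<ge>M. \<forall>l\<ge>M. l2n (x k - x l) < e" and k: "k \<ge> M" for e M k
  proof -
    have b: "(\<Sum>n<N. (cmod ((x k - y) n))\<^sup>2) \<le> e\<^sup>2" for N
    proof (rule LIMSEQ_le_const2)
      show "(\<lambda>l. \<Sum>n<N. (cmod ((x k - x l) n))\<^sup>2) \<longlonglongrightarrow> (\<Sum>n<N. (cmod ((x k - y) n))\<^sup>2)"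
        unfolding minus_apply by (intro tendsto_intros y)
      have "(\<Sum>n<N. (cmod ((x k - x l) n))\<^sup>2) \<le> e\<^sup>2" if "l \<ge> M" for l
      proof -
        have "(\<Sum>n<N. (cmod ((x k - x l) n))\<^sup>2) \<le> (suminf (\<lambda>n. (cmod ((x k - x l) n))\<^sup>2))"
          by (rule sum_le_suminf) (use ell2_diff[OF x x] in \<open>auto simp: ell2_def\<close>)
        also have "\<dots> = (l2n (x k - x l))\<^sup>2" by (rule l2n_sq[OF ell2_diff[OF x x], symmetric])
        also have "\<dots> \<le> e\<^sup>2" using M k that by (intro power_mono less_imp_le l2n_nonneg ell2_diff x) auto
        finally show ?thesis .
      qed
      then show "\<exists>N'. \<forall>l\<ge>N'. (\<Sum>n<N. (cmod ((x k - x l) n))\<^sup>2) \<le> e\<^sup>2" by blast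
    qed
    have s: "summable (\<lambda>n. (cmod ((x k - y) n))\<^sup>2)"
      by (rule summableI_nonneg_bounded[OF _ b]) simp
    moreover have "l2n (x k - y) \<le> e"
      unfolding l2n_def using suminf_le_const[OF s b] e by (intro real_le_lsqrt suminf_nonneg s) auto
    ultimately show ?thesis by (simp add: ell2_def)
  qed
  obtain M where M: "\<forall>k\<ge>M. \<forall>l\<ge>M. l2n (x k - x l) < 1" using c[of 1] by auto
  then have xy: "x M - y \<in> ell2" using main[of 1 M M] by simp
  have "y = x M - (x M - y)" by (simp add: fun_eq_iff)
  then have y2: "y \<in> ell2" using ell2_diff[OF x xy] by metis
  have "(\<lambda>k. l2n (x k - y)) \<longlonglongrightarrow> 0"
  proof (rule LIMSEQ_I)
    fix r :: real assume r: "r > 0"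
    then obtain M where M: "\<forall>k\<ge>M. \<forall>l\<ge>M. l2n (x k - x l) < r / 2" using c[of "r / 2"] by auto
    have "norm (l2n (x k - y) - 0) < r" if "k \<ge> M" for k
      using main[OF _ M that] r l2n_nonneg[OF ell2_diff[OF x y2], of k] by auto
    then show "\<exists>no. \<forall>k\<ge>no. norm (l2n (x k - y) - 0) < r" by blast
  qed
  then show ?thesis using that y2 by blast
qed

lemma bessel:
  assumes u: "\<And>n. u n \<in> ell2" and on: "\<And>n m. l2ip (u n) (u m) = (if n = m then 1 else 0)" and y: "y \<in> ell2"
  shows "(\<lambda>n. l2ip y (u n)) \<in> ell2" "l2n (\<lambda>n. l2ip y (u n)) \<le> l2n y"
proof -
  have b: "(\<Sum>n<N. (cmod (l2ip y (u n)))\<^sup>2) \<le> (l2n y)\<^sup>2" for N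
  proof -
    define c where "c n = l2ip y (u n)" for n
    \<comment> \<open>The projection of \<open>y\<close> to the first \<open>N\<close> vectors; the
      bound is the nonnegativity of the squared distance between \<open>y\<close> and
      \<open>s\<close>.\<close>
    define s where "s = (\<Sum>n<N. scl (c n) (u n))"
    have s2: "s \<in> ell2" unfolding s_def by (intro ell2_sum ell2_scl u)
    have ys: "l2ip y s = (\<Sum>n<N. of_real ((cmod (c n))\<^sup>2))"
      unfolding s_def
      by (subst l2ip_sum_right) (simp_all add: ell2_scl u y l2ip_scl_right complex_norm_square mult.commute flip: c_def del: of_real_power)
    have us: "l2ip (u n) s = cnj (c n)" if "n < N" for n
      unfolding s_def using that
      by (subst l2ip_sum_right) (simp_all add: ell2_scl u l2ip_scl_right on if_distrib cong: if_cong)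
    have ss: "l2ip s s = (\<Sum>n<N. of_real ((cmod (c n))\<^sup>2))"
    proof -
      have "l2ip s s = (\<Sum>n<N. l2ip (scl (c n) (u n)) s)"
        using s2 by (subst (1) s_def) (simp add: l2ip_sum_left ell2_scl u)
      also have "\<dots> = (\<Sum>n<N. of_real ((cmod (c n))\<^sup>2))"
        by (rule sum.cong) (simp_all add: l2ip_scl_left u s2 us complex_norm_square del: of_real_power)
      finally show ?thesis .
    qed
    have "(l2n s)\<^sup>2 = (\<Sum>n<N. (cmod (c n))\<^sup>2)"
      using ss unfolding l2ip_self[OF s2] of_real_sum[symmetric] of_real_eq_iff .
    moreover have "Re (l2ip y s) = (\<Sum>n<N. (cmod (c n))\<^sup>2)"
      unfolding ys of_real_sum[symmetric] by simp
    moreover have "0 \<le> (l2n (y - s))\<^sup>2" by simp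
    ultimately show ?thesis
      using l2n_sq_diff[OF y s2] by (simp add: c_def)
  qed
  have s: "summable (\<lambda>n. (cmod (l2ip y (u n)))\<^sup>2)"
    by (rule summableI_nonneg_bounded[OF _ b]) simp
  then show "(\<lambda>n. l2ip y (u n)) \<in> ell2" by (simp add: ell2_def)
  show "l2n (\<lambda>n. l2ip y (u n)) \<le> l2n y"
    unfolding l2n_def[of "\<lambda>n. l2ip y (u n)"] using suminf_le_const[OF s b] y by (intro real_le_lsqrt suminf_nonneg s) auto
qed

section \<open>Coordinates of polynomials\<close>

definition menum :: "nat \<Rightarrow> 'v::countable \<Rightarrow>\<^sub>0 nat" where
  "menum = from_nat_into UNIV"

lemma bij_menum: "bij (menum :: nat \<Rightarrow> 'v::countable \<Rightarrow>\<^sub>0 nat)"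
proof -
  \<comment> \<open>A monomial is encoded by the finite graph of its nonzero exponents, and a
    countable set has only countably many finite subsets.\<close>
  let ?f = "\<lambda>m :: 'v \<Rightarrow>\<^sub>0 nat. (\<lambda>v. (v, Poly_Mapping.lookup m v)) ` Poly_Mapping.keys m"
  have "inj ?f"
  proof (rule injI, rule poly_mapping_eqI)
    fix m m' :: "'v \<Rightarrow>\<^sub>0 nat" and v assume e: "?f m = ?f m'"
    have "(v, Poly_Mapping.lookup m v) \<in> ?f m \<longleftrightarrow> v \<in> Poly_Mapping.keys m"
      "(v, Poly_Mapping.lookup m' v) \<in> ?f m' \<longleftrightarrow> v \<in> Poly_Mapping.keys m'" by auto
    moreover have "(v, a) \<in> ?f m \<Longrightarrow> a = Poly_Mapping.lookup m v" "(v, a) \<in> ?f m' \<Longrightarrow> a = Poly_Mapping.lookup m' v" for a by auto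
    ultimately show "Poly_Mapping.lookup m v = Poly_Mapping.lookup m' v"
      using e by (metis in_keys_iff)
  qed
  moreover have "countable (?f ` UNIV)"
    by (rule countable_subset[OF _ countable_Collect_finite]) auto
  ultimately have "countable (UNIV :: ('v \<Rightarrow>\<^sub>0 nat) set)" by (rule countable_image_inj_on[rotated])
  moreover have "infinite (UNIV :: ('v \<Rightarrow>\<^sub>0 nat) set)"
  proof -
    have "inj (\<lambda>n. Poly_Mapping.single (undefined :: 'v) (n :: nat))"
      by (rule injI) (metis lookup_single_eq)
    then show ?thesis using finite_subset[OF subset_UNIV] range_inj_infinite by metis
  qed
  ultimately show ?thesis unfolding menum_def by (rule bij_betw_from_nat_into)
qed

text \<open>The orthonormal basis of normalized monomials.\<close>

definition bas :: "nat \<Rightarrow> 'v::countable pol" where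
  "bas n = psc (of_real (1 / sqrt (mfact (menum n :: 'v \<Rightarrow>\<^sub>0 nat)))) (Poly_Mapping.single (menum n) 1)"

definition crd :: "'v::countable pol \<Rightarrow> nat \<Rightarrow> complex" where
  "crd p n = fip p (bas n)"

lemma crd_eq:
  fixes p :: "'v::countable pol"
  shows "crd p n = Poly_Mapping.lookup p (menum n) * of_real (sqrt (mfact (menum n :: 'v \<Rightarrow>\<^sub>0 nat)))"
proof -
  let ?m = "menum n :: 'v \<Rightarrow>\<^sub>0 nat"
  have pos: "mfact ?m > 0" by (rule mfact_pos)
  have "crd p n = cnj (fip (bas n) p)" by (simp add: crd_def flip: fip_cnj)
  also have "fip (bas n) p = of_real (1 / sqrt (mfact ?m) * mfact ?m) * cnj (Poly_Mapping.lookup p ?m)"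
    by (simp add: bas_def fip_psc_left fip_single_left mult.commute)
  also have "1 / sqrt (mfact ?m) * mfact ?m = sqrt (mfact ?m)"
    using pos by (simp add: real_div_sqrt)
  finally show ?thesis by simp
qed

lemma crd_add: "crd (p + q) = crd p + crd q"
  and crd_psc: "crd (psc c p) = scl c (crd p)"
  and crd_diff: "crd (p - q) = crd p - crd q"
  by (simp_all add: fun_eq_iff crd_def fip_add_left fip_psc_left fip_diff_left)

lemma crd_inj: "crd p = crd q \<Longrightarrow> p = q" for p q :: "'a::countable pol"
proof (rule poly_mapping_eqI)
  fix m :: "'a \<Rightarrow>\<^sub>0 nat" assume e: "crd p = crd q"
  obtain n where n: "m = menum n" using bij_menum by (metis bij_pointE)
  have "sqrt (mfact (menum n :: 'a \<Rightarrow>\<^sub>0 nat)) \<noteq> 0" using mfact_pos[of "menum n :: 'a \<Rightarrow>\<^sub>0 nat"] by simp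
  then show "Poly_Mapping.lookup p m = Poly_Mapping.lookup q m"
    using fun_cong[OF e, of n] unfolding n crd_eq by simp
qed

lemma crd_finite: "finite {n. crd p n \<noteq> 0}"
proof -
  have "{n. crd p n \<noteq> 0} \<subseteq> menum -` Poly_Mapping.keys p"
    using crd_eq[of p] by (auto simp: in_keys_iff)
  then show ?thesis
    using finite_vimageI[OF finite_keys, of menum p] bij_menum by (metis bij_is_inj finite_subset)
qed

lemma crd_ell2 [simp]: "crd p \<in> ell2"
  unfolding ell2_def by (auto intro!: summable_finite[OF crd_finite[of p]])

lemma crd_bas: "crd (bas n :: 'v::countable pol) m = (if n = m then 1 else 0)"
proof -
  have inj: "menum n = (menum m :: 'v \<Rightarrow>\<^sub>0 nat) \<longleftrightarrow> n = m" using bij_menum by (metis bij_is_inj inj_eq)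
  have "sqrt (mfact (menum n :: 'v \<Rightarrow>\<^sub>0 nat)) \<noteq> 0" using mfact_pos[of "menum n :: 'v \<Rightarrow>\<^sub>0 nat"] by simp
  then show ?thesis by (auto simp: crd_eq bas_def lookup_single when_def inj)
qed

lemma pol_expand:
  fixes p :: "'a::countable pol"
  assumes "\<And>n. n \<ge> N \<Longrightarrow> crd p n = 0"
  shows "p = (\<Sum>n<N. psc (crd p n) (bas n))"
proof (rule crd_inj, rule ext)
  fix m
  have "crd (\<Sum>n<N. psc (crd p n) (bas n :: 'a pol)) m = (\<Sum>n<N. crd p n * crd (bas n :: 'a pol) m)"
    by (simp add: crd_def fip_sum_left fip_psc_left)
  also have "\<dots> = crd p m"
    using assms[of m] by (auto simp: crd_bas if_distrib not_less cong: if_cong)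
  finally show "crd p m = crd (\<Sum>n<N. psc (crd p n) (bas n :: 'a pol)) m" ..
qed

lemma crd_bound: obtains N where "\<And>n. n \<ge> N \<Longrightarrow> crd p n = 0"
proof -
  obtain N where "{n. crd p n \<noteq> 0} \<subseteq> {..<N}" using finite_nat_iff_bounded crd_finite by blast
  then show ?thesis using that[of N] by force
qed

lemma l2ip_crd_finite: assumes "\<And>n. n \<ge> N \<Longrightarrow> crd p n = 0" shows "l2ip (crd p) y = (\<Sum>n<N. crd p n * cnj (y n))"
  unfolding l2ip_def by (rule suminf_finite) (use assms in \<open>auto simp: not_less\<close>)

lemma l2ip_crd: "l2ip (crd p) (crd q) = fip p q"
proof -
  obtain N where N: "\<And>n. n \<ge> N \<Longrightarrow> crd p n = 0" using crd_bound[of p] by blast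
  have "fip p q = (\<Sum>n<N. crd p n * fip (bas n) q)"
    by (subst pol_expand[OF N]) (simp_all add: fip_sum_left fip_psc_left)
  also have "\<dots> = (\<Sum>n<N. crd p n * cnj (crd q n))"
    by (simp add: crd_def flip: fip_cnj)
  finally show ?thesis by (simp add: l2ip_crd_finite[OF N])
qed

lemma trnc_crd: "trnc N x = crd (\<Sum>n<N. psc (x n) (bas n :: 'v::countable pol))"
  by (simp add: fun_eq_iff trnc_def crd_def fip_sum_left fip_psc_left)
    (simp add: crd_bas if_distrib flip: crd_def cong: if_cong)

section \<open>The unitary representation on the Fock space\<close>

lemma ginv_mat1: "ginv (mat 1) = mat 1"
  by (auto simp: vec_eq_iff ginv_nth mat_def)

context fock
begin

text \<open>Only the variables in the columns from \<open>C\<close> count for the degree.\<close>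

definition chom :: "int \<Rightarrow> 'n::finite var pol \<Rightarrow> bool" where
  "chom d p \<longleftrightarrow> (\<forall>z. z \<noteq> 0 \<longrightarrow> dsub (cscale z (mat 1)) p = psc (z powi d) p)"

lemma dsub_scalar_pvar:
  "dsub (cscale z (mat 1)) (pvar (l, c, s) * p) = psc (if c \<in> C then z else 1) (pvar (l, c, s) * dsub (cscale z (mat 1)) p)"
proof -
  have "(\<Sum>j\<in>UNIV. psc (cscale z (mat 1) $ l $ j) (f j)) = psc z (f l)" for f :: "'a \<Rightarrow> 'a var pol"
    by (simp add: cscale_def mat_def if_distrib[of "\<lambda>a. psc (z * a) _"] cong: if_cong)
  then show ?thesis by (simp add: dsub_pvar)
qed

lemma der_dsub_scalar:
  "der (l, c, s) (dsub (cscale z (mat 1)) p) = psc (if c \<in> C then z else 1) (dsub (cscale z (mat 1)) (der (l, c, s) p))"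
proof -
  have "(\<Sum>j\<in>UNIV. psc (cscale z (mat 1) $ j $ l) (f j)) = psc z (f l)" for f :: "'a \<Rightarrow> 'a var pol"
    by (simp add: cscale_def mat_def if_distrib[of "\<lambda>a. psc (z * a) _"] cong: if_cong)
  then show ?thesis by (simp add: der_dsub)
qed

lemma chom_one: "chom 0 1"
  by (simp add: chom_def)

lemma chom_zero: "chom d 0"
  by (simp add: chom_def plin_zero)

lemma chom_add: "chom d p \<Longrightarrow> chom d q \<Longrightarrow> chom d (p + q)"
  by (simp add: chom_def plin_add[OF plin_dsub] psc_add_right)

lemma chom_psc: "chom d p \<Longrightarrow> chom d (psc c p)"
  by (simp add: chom_def plin_psc[OF plin_dsub] mult.commute)

lemma chom_minus: "chom d p \<Longrightarrow> chom d (- p)"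
  by (simp add: chom_def plin_minus[OF plin_dsub])

lemma chom_diff: "chom d p \<Longrightarrow> chom d q \<Longrightarrow> chom d (p - q)"
  by (simp add: chom_def plin_diff[OF plin_dsub] psc_diff_right)

lemma chom_sum: "(\<And>i. i \<in> A \<Longrightarrow> chom d (f i)) \<Longrightarrow> chom d (sum f A)"
  by (induction A rule: infinite_finite_induct) (auto intro: chom_zero chom_add)

lemma chom_pvar: "chom d p \<Longrightarrow> chom (if c \<in> C then d + 1 else d) (pvar (l, c, s) * p)"
  by (auto simp: chom_def dsub_scalar_pvar psc_mult_right power_int_add_1')

lemma chom_der:
  assumes "chom d p" shows "chom (if c \<in> C then d - 1 else d) (der (l, c, s) p)"
proof -
  have "dsub (cscale z (mat 1)) (der (l, c, s) p) = psc (z powi (if c \<in> C then d - 1 else d)) (der (l, c, s) p)" if z: "z \<noteq> 0" for z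
  proof -
    have e: "psc (if c \<in> C then z else 1) (dsub (cscale z (mat 1)) (der (l, c, s) p)) = psc (z powi d) (der (l, c, s) p)"
      using assms z by (simp add: chom_def der_psc flip: der_dsub_scalar)
    show ?thesis
    proof (cases "c \<in> C")
      case True
      have "psc (1 / z) (psc z (dsub (cscale z (mat 1)) (der (l, c, s) p))) = psc (1 / z) (psc (z powi d) (der (l, c, s) p))"
        using e True by simp
      moreover have "z powi (d - 1) = z powi d / z" using z by (simp add: power_int_diff)
      ultimately show ?thesis using True z by simp
    qed (use e in simp)
  qed
  then show ?thesis by (simp add: chom_def)
qed

lemma chom_opE: assumes "chom d p" shows "chom d (opE A p)"
proof -
  have "chom d (pvar (j, c, s) * der (i, c, s) p)" if "c \<in> C" for i j c s
    using chom_pvar[OF chom_der[OF assms, of c i s], of c j s] that by simp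
  then show ?thesis
    unfolding opE_def by (intro chom_diff chom_minus chom_sum chom_psc assms) auto
qed

lemma chom_opM: assumes "chom d p" shows "chom (d + 2) (opM Y p)"
proof -
  have "chom (d + 2) (pvar (i, c, False) * pvar (j, c, True) * p)" if "c \<in> C" for i j c
    using chom_pvar[OF chom_pvar[OF assms, of c j True], of c i False] that by (simp add: mult.assoc add.assoc)
  then show ?thesis
    unfolding opM_def qf_def sum_distrib_right psc_mult_left by (intro chom_sum chom_psc) auto
qed

lemma chom_opM_pow: "chom d p \<Longrightarrow> chom (d + 2 * int j) ((opM Y ^^ j) p)"
proof (induction j)
  case (Suc j)
  then show ?case using chom_opM[of "d + 2 * int j" "(opM Y ^^ j) p" Y] by (simp add: algebra_simps)
qed simp

lemma chom_monomial: "\<exists>d. chom d (Poly_Mapping.single m c)"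
proof -
  have "\<exists>d. chom d (Poly_Mapping.single m 1)"
  proof (induction m rule: mono_induct)
    case zero
    then show ?case using chom_one by auto
  next
    case (step m v)
    then obtain d where "chom d (Poly_Mapping.single m 1)" by blast
    from chom_pvar[OF this, of "fst (snd v)" "fst v" "snd (snd v)"]
    show ?case unfolding prod.collapse pvar_times_single by blast
  qed
  then obtain d where "chom d (psc c (Poly_Mapping.single m 1))" using chom_psc by blast
  then show ?thesis unfolding psc_single by auto
qed

lemma chom_orth:
  assumes p: "chom d p" and q: "chom e q" and "d \<noteq> e"
  shows "fip p q = 0"
proof -
  \<comment> \<open>Scaling by 2 is self-adjoint and has different eigenvalues
    \<open>2 powi d\<close> in different degrees.\<close>
  have ct: "conj_transpose (cscale 2 (mat 1)) = cscale 2 (mat 1 :: complex^'a^'a)"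
    by (simp add: vec_eq_iff cscale_def mat_def)
  have "(2 powi d) * fip p q = fip (dsub (cscale 2 (mat 1)) p) q"
    using p by (simp add: chom_def fip_psc_left)
  also have "\<dots> = fip p (dsub (cscale 2 (mat 1)) q)" by (simp add: fip_dsub ct)
  also have "\<dots> = (2 powi e) * fip p q"
    using q by (simp add: chom_def fip_psc_right)
  finally have "(2 powi d - 2 powi e) * fip p q = 0" by (simp add: left_diff_distrib)
  moreover have "(2 :: complex) powi d \<noteq> 2 powi e"
  proof
    assume "(2 :: complex) powi d = 2 powi e"
    then have "norm ((2 :: complex) powi d) = norm ((2 :: complex) powi e)" by simp
    then have "(2 :: real) powi d = 2 powi e" by (simp add: norm_power_int)
    then show False using \<open>d \<noteq> e\<close> power_int_strict_increasing[of d e "2 :: real"] power_int_strict_increasing[of e d "2 :: real"]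
      by (cases "d < e") auto
  qed
  ultimately show ?thesis by simp
qed

text \<open>Partial sums of the exponential of \<open>opM Y\<close>, whose limit is in general no
  polynomial.\<close>

definition pJ :: "complex^'n^'n \<Rightarrow> 'n::finite var pol \<Rightarrow> nat \<Rightarrow> 'n var pol" where
  "pJ Y v J = (\<Sum>j<J. psc (1 / fact j) ((opM Y ^^ j) v))"

text \<open>The coordinates of that limit, written down before convergence is known: moved to the
  basis vector, the exponential is a finite sum.\<close>

definition ey :: "complex^'n^'n \<Rightarrow> 'n::finite var pol \<Rightarrow> nat \<Rightarrow> complex" where
  "ey Y v n = fip v (pexp (opD (cnjm Y)) (bas n))"

lemma plin_pJ: "plin (\<lambda>v. pJ Y v J)"
  by (rule plinI) (simp_all add: pJ_def plin_add[OF plin_funpow] plin_psc[OF plin_funpow] psc_add_right sum.distrib psc_sum mult.commute)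

lemma fip_opM_pow: "fip ((opM Y ^^ j) v) u = fip v ((opD (cnjm Y) ^^ j) u)"
proof (induction j arbitrary: u)
  case (Suc j)
  have "fip ((opM Y ^^ Suc j) v) u = fip v ((opD (cnjm Y) ^^ j) (opD (cnjm Y) u))"
    by (simp add: fip_opM Suc)
  then show ?case by (simp add: funpow_swap1)
qed simp

lemma pJ_coord: assumes "transpose Y = - Y" shows "(\<lambda>J. crd (pJ Y v J) n) \<longlonglongrightarrow> ey Y v n"
proof -
  have sk: "transpose (cnjm Y) = - cnjm Y" by (rule cnjm_skew[OF assms])
  obtain N where N: "(opD (cnjm Y) ^^ N) (bas n :: 'a var pol) = 0"
    using lnil_opD[OF sk] by (auto simp: lnil_def)
  have "crd (pJ Y v J) n = ey Y v n" if "J \<ge> N" for J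
  proof -
    have NJ: "(opD (cnjm Y) ^^ J) (bas n :: 'a var pol) = 0" by (rule funpow_zero_mono[OF plin_opD N that])
    show ?thesis
      unfolding ey_def pexp_eq[OF plin_opD NJ] crd_def pJ_def
      by (simp add: fip_sum_left fip_sum_right fip_psc_left fip_psc_right fip_opM_pow)
  qed
  then show ?thesis by (intro tendsto_eventually eventually_sequentiallyI[of N])
qed

text \<open>\<open>pairing_sums\<close> with \<open>W = Y\<close> and \<open>u = v\<close>. By
  homogeneity only one term of each inner exponential survives, and the summands become the squared
  norms of the terms of the exponential series.\<close>

lemma pJ_norm_summable:
  assumes Y: "contr Y" and v: "chom d v"
  shows "summable (\<lambda>j. Re (fip ((opM Y ^^ j) v) ((opM Y ^^ j) v)) / (fact j)\<^sup>2)"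
proof -
  have sk: "transpose (cnjm Y) = - cnjm Y" using Y by (auto simp: contr_def cnjm_skew)
  have "fip (pexp (opD (cnjm Y)) ((opM Y ^^ j) v)) v / fact j = fip ((opM Y ^^ j) v) ((opM Y ^^ j) v) / (fact j)\<^sup>2" for j
  proof -
    obtain N where N: "(opD (cnjm Y) ^^ N) ((opM Y ^^ j) v) = 0"
      using lnil_opD[OF sk] by (auto simp: lnil_def)
    define M where "M = max N (Suc j)"
    have M: "(opD (cnjm Y) ^^ M) ((opM Y ^^ j) v) = 0" by (rule funpow_zero_mono[OF plin_opD N]) (simp add: M_def)
    have i: "fip ((opD (cnjm Y) ^^ i) ((opM Y ^^ j) v)) v = (if i = j then fip ((opM Y ^^ j) v) ((opM Y ^^ j) v) else 0)" for i
    proof -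
      have "fip ((opD (cnjm Y) ^^ i) ((opM Y ^^ j) v)) v = cnj (fip ((opM Y ^^ i) v) ((opM Y ^^ j) v))"
        by (simp add: fip_opM_pow flip: fip_cnj)
      also have "\<dots> = fip ((opM Y ^^ j) v) ((opM Y ^^ i) v)" by (simp flip: fip_cnj)
      finally show ?thesis using chom_orth[OF chom_opM_pow[OF v, of j Y] chom_opM_pow[OF v, of i Y]] by auto
    qed
    show ?thesis
      unfolding pexp_eq[OF plin_opD M]
      by (simp add: fip_sum_left fip_psc_left i if_distrib M_def power2_eq_square cong: if_cong)
  qed
  with sums_summable[OF pairing_sums[OF Y Y, of v v]]
  have "summable (\<lambda>j. fip ((opM Y ^^ j) v) ((opM Y ^^ j) v) / (fact j)\<^sup>2)" by simp
  moreover have "Re (x / (fact j)\<^sup>2) = Re x / (fact j)\<^sup>2" for x j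
    using Re_divide_of_real[of x "(fact j)\<^sup>2"] by simp
  ultimately show ?thesis using summable_Re by fastforce
qed

text \<open>The terms of the series have different degrees and are orthogonal, so summability of the
  squared norms gives a Cauchy sequence. Its limit is identified coordinatewise.\<close>

lemma ey_limit_hom:
  assumes Y: "contr Y" and v: "chom d v"
  shows "ey Y v \<in> ell2 \<and> (\<lambda>J. l2n (crd (pJ Y v J) - ey Y v)) \<longlonglongrightarrow> 0"
proof -
  define a where "a j = Re (fip ((opM Y ^^ j) v) ((opM Y ^^ j) v)) / (fact j)\<^sup>2" for j
  have a0: "a j \<ge> 0" for j by (simp add: a_def fip_self_nonneg)
  have sa: "summable a" unfolding a_def by (rule pJ_norm_summable[OF Y v])
  have sq: "(l2n (crd (pJ Y v J) - crd (pJ Y v I)))\<^sup>2 = (\<Sum>j=I..<J. a j)" if "I \<le> J" for I J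
  proof -
    have "pJ Y v J - pJ Y v I = (\<Sum>j=I..<J. psc (1 / fact j) ((opM Y ^^ j) v))"
      unfolding pJ_def lessThan_atLeast0 using that by (simp add: sum_diff_nat_ivl)
    then have "fip (pJ Y v J - pJ Y v I) (pJ Y v J - pJ Y v I)
        = (\<Sum>i=I..<J. \<Sum>j=I..<J. 1 / fact i * (1 / fact j) * fip ((opM Y ^^ i) v) ((opM Y ^^ j) v))"
      by (simp only: fip_sum_left) (simp add: fip_sum_right fip_psc_left fip_psc_right sum_distrib_left mult_ac)
    also have "\<dots> = (\<Sum>i=I..<J. \<Sum>j=I..<J. if j = i then of_real (a i) else 0)"
    proof (intro sum.cong refl)
      fix i j
      have r: "fip ((opM Y ^^ i) v) ((opM Y ^^ i) v) = of_real (Re (fip ((opM Y ^^ i) v) ((opM Y ^^ i) v)))" for i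
        by (simp add: complex_eq_iff fip_self_nonneg)
      show "1 / fact i * (1 / fact j) * fip ((opM Y ^^ i) v) ((opM Y ^^ j) v) = (if j = i then of_real (a i) else 0)"
        using chom_orth[OF chom_opM_pow[OF v, of i Y] chom_opM_pow[OF v, of j Y]] r[of i]
        by (auto simp: a_def power2_eq_square)
    qed
    also have "\<dots> = of_real (\<Sum>j=I..<J. a j)" by (simp cong: if_cong)
    finally have "complex_of_real ((l2n (crd (pJ Y v J - pJ Y v I)))\<^sup>2) = of_real (\<Sum>j=I..<J. a j)"
      by (simp only: l2ip_self[symmetric] crd_ell2 l2ip_crd)
    then show ?thesis by (simp only: of_real_eq_iff crd_diff)
  qed
  have C: "\<exists>M. \<forall>k\<ge>M. \<forall>l\<ge>M. l2n (crd (pJ Y v k) - crd (pJ Y v l)) < e" if "e > 0" for e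
  proof -
    have "e\<^sup>2 > 0" using that by simp
    then obtain M where M: "\<And>m n. m \<ge> M \<Longrightarrow> norm (\<Sum>j=m..<n. a j) < e\<^sup>2"
      using sa unfolding summable_Cauchy by metis
    have lt: "l2n (crd (pJ Y v k) - crd (pJ Y v l)) < e" if "l \<le> k" "l \<ge> M" for k l
    proof -
      have "(l2n (crd (pJ Y v k) - crd (pJ Y v l)))\<^sup>2 < e\<^sup>2"
        unfolding sq[OF that(1)] using M[OF that(2), of k] by simp
      then show ?thesis using \<open>e > 0\<close> by (simp add: power_less_imp_less_base)
    qed
    have "l2n (crd (pJ Y v k) - crd (pJ Y v l)) < e" if "k \<ge> M" "l \<ge> M" for k l
      using lt[of l k] lt[of k l] that l2n_minus_commute[of "crd (pJ Y v k)"] by (cases "l \<le> k") auto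
    then show ?thesis by blast
  qed
  obtain y where y: "y \<in> ell2" "(\<lambda>k. l2n (crd (pJ Y v k) - y)) \<longlonglongrightarrow> 0"
    using ell2_complete[of "\<lambda>k. crd (pJ Y v k)", OF crd_ell2 C] by blast
  have "y n = ey Y v n" for n
  proof -
    have "(\<lambda>k. crd (pJ Y v k) n - y n) \<longlonglongrightarrow> 0"
      by (rule Lim_null_comparison[OF _ y(2)])
        (use coord_le_l2n[OF ell2_diff[OF crd_ell2 y(1)], of _ n] in \<open>auto intro: always_eventually\<close>)
    then have "(\<lambda>k. crd (pJ Y v k) n) \<longlonglongrightarrow> y n" by (simp add: LIM_zero_iff)
    moreover have "(\<lambda>J. crd (pJ Y v J) n) \<longlonglongrightarrow> ey Y v n"
      by (rule pJ_coord) (use Y in \<open>simp add: contr_def\<close>)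
    ultimately show ?thesis by (rule LIMSEQ_unique)
  qed
  then have "y = ey Y v" by (simp add: fun_eq_iff)
  then show ?thesis using y by simp
qed

lemma ey_limit:
  assumes Y: "contr Y"
  shows "ey Y v \<in> ell2 \<and> (\<lambda>J. l2n (crd (pJ Y v J) - ey Y v)) \<longlonglongrightarrow> 0"
proof (induction v rule: poly_mapping_add_induct)
  case (single m c)
  then show ?case using chom_monomial ey_limit_hom[OF Y] by blast
next
  case (sum p q)
  have e: "ey Y (p + q) = ey Y p + ey Y q" by (simp add: fun_eq_iff ey_def fip_add_left)
  have P: "pJ Y (p + q) J = pJ Y p J + pJ Y q J" for J using plin_add[OF plin_pJ] .
  have "(\<lambda>J. l2n (crd (pJ Y (p + q) J) - ey Y (p + q))) \<longlonglongrightarrow> 0"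
  proof (rule tendsto_sandwich[OF _ _ tendsto_const])
    show "(\<lambda>J. l2n (crd (pJ Y p J) - ey Y p) + l2n (crd (pJ Y q J) - ey Y q)) \<longlonglongrightarrow> 0"
      by (rule tendsto_add_zero[OF conjunct2[OF sum(1)] conjunct2[OF sum(2)]])
    show "\<forall>\<^sub>F J in sequentially. l2n (crd (pJ Y (p + q) J) - ey Y (p + q)) \<le> l2n (crd (pJ Y p J) - ey Y p) + l2n (crd (pJ Y q J) - ey Y q)"
    proof (rule always_eventually, rule allI)
      fix J
      have "crd (pJ Y (p + q) J) - ey Y (p + q) = (crd (pJ Y p J) - ey Y p) + (crd (pJ Y q J) - ey Y q)"
        by (simp add: P e crd_add)
      then show "l2n (crd (pJ Y (p + q) J) - ey Y (p + q)) \<le> l2n (crd (pJ Y p J) - ey Y p) + l2n (crd (pJ Y q J) - ey Y q)"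
        using l2n_triangle[of "crd (pJ Y p J) - ey Y p" "crd (pJ Y q J) - ey Y q"] sum by (simp add: ell2_diff)
    qed
    show "\<forall>\<^sub>F J in sequentially. 0 \<le> l2n (crd (pJ Y (p + q) J) - ey Y (p + q))"
      using sum by (intro always_eventually allI l2n_nonneg) (simp add: e ell2_diff ell2_add)
  qed
  then show ?case
    using ell2_add[OF conjunct1[OF sum(1)] conjunct1[OF sum(2)]] unfolding e by blast
qed

text \<open>First with a polynomial on the left, where the sum is finite, and then along the partial
  sums \<open>pJ\<close>, where \<open>pairing_sums\<close> supplies the limit.\<close>

lemma l2ip_ey:
  assumes Y: "contr Y" and W: "contr W"
  shows "l2ip (ey Y v) (ey W u) = phi (nplus (cnjm W) ** nminus Y) v u"
proof -
  have sk: "transpose (cnjm W) = - cnjm W" using W by (auto simp: contr_def cnjm_skew)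
  note pl = plin_pexp[OF lnil_opD[OF sk]]
  have c: "l2ip (crd p) (ey W u) = fip (pexp (opD (cnjm W)) p) u" for p
  proof -
    obtain N where N: "\<And>n. n \<ge> N \<Longrightarrow> crd p n = 0" using crd_bound[of p] by blast
    have "fip (pexp (opD (cnjm W)) p) u = (\<Sum>n<N. crd p n * fip (pexp (opD (cnjm W)) (bas n)) u)"
      by (subst pol_expand[OF N]) (simp_all add: plin_sum[OF pl] plin_psc[OF pl] fip_sum_left fip_psc_left)
    also have "\<dots> = (\<Sum>n<N. crd p n * cnj (ey W u n))"
      by (simp add: ey_def flip: fip_cnj)
    finally show ?thesis by (simp add: l2ip_crd_finite[OF N])
  qed
  have "(\<lambda>J. l2ip (crd (pJ Y v J)) (ey W u)) \<longlonglongrightarrow> l2ip (ey Y v) (ey W u)"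
    using ey_limit[OF Y, of v] ey_limit[OF W, of u] by (intro l2ip_tendsto_left) auto
  moreover have "l2ip (crd (pJ Y v J)) (ey W u) = (\<Sum>j<J. fip (pexp (opD (cnjm W)) ((opM Y ^^ j) v)) u / fact j)" for J
    by (simp add: c pJ_def plin_sum[OF pl] plin_psc[OF pl] fip_sum_left fip_psc_left)
  moreover have "(\<lambda>J. \<Sum>j<J. fip (pexp (opD (cnjm W)) ((opM Y ^^ j) v)) u / fact j) \<longlonglongrightarrow> phi (nplus (cnjm W) ** nminus Y) v u"
    using pairing_sums[OF Y W, of v u] by (simp add: sums_def)
  ultimately show ?thesis by (simp add: LIMSEQ_unique)
qed

text \<open>The image of the polynomial \<open>v\<close> under \<open>g\<close>, in
  coordinates.\<close>

definition rho :: "'n::finite mat2 \<Rightarrow> 'n var pol \<Rightarrow> nat \<Rightarrow> complex" where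
  "rho g v n = phi g v (bas n)"

lemma rho_ey: "rho g v = ey (yof g) (thalf g v)"
  by (simp add: fun_eq_iff rho_def ey_def phi_def)

lemma rho_ell2 [simp]: "g \<in> gp \<Longrightarrow> rho g v \<in> ell2"
  using ey_limit[OF gp_contr, THEN conjunct1] by (simp add: rho_ey)

lemma l2ip_rho:
  assumes "g \<in> gp" "h \<in> gp"
  shows "l2ip (rho g v) (rho h u) = phi (ginv h ** g) v u"
  unfolding rho_ey by (simp add: l2ip_ey gp_contr phi_thalf assms)

lemma phi_mat1: "phi (mat 1) v u = fip v u"
proof -
  have "transpose (0 :: complex^'a^'a) = - 0" by simp
  from phi_nplus[OF this, of v u] show ?thesis by (simp add: nplus_zero pexp_zero_op)
qed

lemma rho_mat1: "rho (mat 1) v = crd v"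
  by (simp add: fun_eq_iff rho_def crd_def phi_mat1)

lemma l2ip_rho_same: "g \<in> gp \<Longrightarrow> l2ip (rho g v) (rho g u) = fip v u"
  by (simp add: l2ip_rho ginv_left gp_so_c phi_mat1)

lemma rho_lin: assumes "g \<in> gp"
  shows "rho g (v + u) = rho g v + rho g u" "rho g (psc c v) = scl c (rho g v)"
  using plin_phi[OF gp_so_c[OF assms] gp_invertible[OF assms]] by (simp_all add: fun_eq_iff rho_def)

lemma rho_sum: "g \<in> gp \<Longrightarrow> rho g (sum f A) = (\<Sum>x\<in>A. rho g (f x))"
proof (induction A rule: infinite_finite_induct)
  case (infinite A)
  have "rho g (psc 0 0) = scl 0 (rho g 0)" by (rule rho_lin[OF infinite(2)])
  then show ?case using infinite by (simp add: zero_fun_def)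
next
  case empty
  have "rho g (psc 0 0) = scl 0 (rho g 0)" by (rule rho_lin[OF empty])
  then show ?case by (simp add: zero_fun_def)
qed (simp add: rho_lin)

text \<open>The action on the whole space is defined through the adjoint: coordinate
  \<open>n\<close> is the pairing with the image of the basis vector under the inverse. No extension
  by continuity is needed, and Bessel's inequality gives boundedness.\<close>

definition pact :: "'n::finite mat2 \<Rightarrow> (nat \<Rightarrow> complex) \<Rightarrow> nat \<Rightarrow> complex" where
  "pact g y n = l2ip y (rho (ginv g) (bas n))"

lemma pact_crd: assumes g: "g \<in> gp" shows "pact g (crd v) = rho g v"
proof
  fix n
  have "pact g (crd v) n = l2ip (rho (mat 1) v) (rho (ginv g) (bas n))"
    by (simp add: pact_def rho_mat1)
  also have "\<dots> = rho g v n" by (subst l2ip_rho) (simp_all add: g gp_ginv rho_def)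
  finally show "pact g (crd v) n = rho g v n" .
qed

lemma fip_bas: "fip (bas n) (bas m :: 'v::countable pol) = (if n = m then 1 else 0)"
  using crd_bas[of n m] by (simp add: crd_def)

lemma rho_orthonormal:
  "g \<in> gp \<Longrightarrow> l2ip (rho g (bas n)) (rho g (bas m)) = (if n = m then 1 else 0)"
  by (simp add: l2ip_rho_same fip_bas)

lemma pact_ell2 [simp]: "g \<in> gp \<Longrightarrow> y \<in> ell2 \<Longrightarrow> pact g y \<in> ell2"
  and pact_contraction: "g \<in> gp \<Longrightarrow> y \<in> ell2 \<Longrightarrow> l2n (pact g y) \<le> l2n y"
  unfolding pact_def
  using bessel[of "\<lambda>n. rho (ginv g) (bas n)", OF _ rho_orthonormal] by (auto simp: gp_ginv)

lemma pact_add: "g \<in> gp \<Longrightarrow> x \<in> ell2 \<Longrightarrow> y \<in> ell2 \<Longrightarrow> pact g (x + y) = pact g x + pact g y"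
  and pact_diff: "g \<in> gp \<Longrightarrow> x \<in> ell2 \<Longrightarrow> y \<in> ell2 \<Longrightarrow> pact g (x - y) = pact g x - pact g y"
  and pact_scl: "g \<in> gp \<Longrightarrow> x \<in> ell2 \<Longrightarrow> pact g (scl c x) = scl c (pact g x)"
  by (simp_all add: fun_eq_iff pact_def l2ip_add_left l2ip_diff_left l2ip_scl_left gp_ginv)

lemma trnc_l2_tendsto_pact:
  assumes "g \<in> gp" "y \<in> ell2"
  shows "(\<lambda>N. l2n (pact g (trnc N y) - pact g y)) \<longlonglongrightarrow> 0"
proof (rule tendsto_sandwich[OF _ _ tendsto_const trnc_tendsto[OF assms(2)]])
  show "\<forall>\<^sub>F N in sequentially. l2n (pact g (trnc N y) - pact g y) \<le> l2n (y - trnc N y)"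
    using assms pact_contraction[of g "trnc _ y - y"]
    by (intro always_eventually allI) (simp add: ell2_diff l2n_minus_commute[of y] flip: pact_diff)
qed (use assms in \<open>auto simp: ell2_diff\<close>)

text \<open>On truncations, which are polynomials, this is \<open>l2ip_rho\<close>; both sides are
  continuous in \<open>y\<close>.\<close>

lemma pact_mult:
  assumes g: "g \<in> gp" and h: "h \<in> gp" and y: "y \<in> ell2"
  shows "pact g (pact h y) = pact (g ** h) y"
proof
  fix n
  note gh = gp_mult[OF g h]
  have "pact g (pact h (trnc N y)) n = pact (g ** h) (trnc N y) n" for N
  proof -
    define v where "v = (\<Sum>n<N. psc (y n) (bas n :: 'a var pol))"
    have v: "trnc N y = crd v" unfolding v_def by (rule trnc_crd)
    have "pact g (pact h (trnc N y)) n = l2ip (rho h v) (rho (ginv g) (bas n))"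
      by (simp add: v pact_crd h pact_def)
    also have "\<dots> = rho (g ** h) v n" by (subst l2ip_rho) (simp_all add: g h gp_ginv rho_def)
    finally show ?thesis by (simp add: v pact_crd gh)
  qed
  moreover have "(\<lambda>N. pact (g ** h) (trnc N y) n) \<longlonglongrightarrow> pact (g ** h) y n"
    unfolding pact_def
    by (rule l2ip_tendsto_left) (use trnc_tendsto[OF y] in \<open>simp_all add: y gh gp_ginv l2n_minus_commute[of y]\<close>)
  moreover have "(\<lambda>N. pact g (pact h (trnc N y)) n) \<longlonglongrightarrow> pact g (pact h y) n"
    unfolding pact_def[of g]
    by (rule l2ip_tendsto_left) (use trnc_l2_tendsto_pact[OF h y] in \<open>simp_all add: y g h gp_ginv\<close>)
  ultimately show "pact g (pact h y) n = pact (g ** h) y n" by (simp add: LIMSEQ_unique)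
qed

lemma pact_mat1: assumes "y \<in> ell2" shows "pact (mat 1 :: 'a::finite mat2) y = y"
proof
  fix n
  have "pact (mat 1 :: 'a mat2) y n = cnj (l2ip (crd (bas n :: 'a var pol)) y)"
    unfolding pact_def ginv_mat1 rho_mat1 by (rule l2ip_cnj) (use assms in auto)
  also have "l2ip (crd (bas n :: 'a var pol)) y = (\<Sum>m<Suc n. crd (bas n :: 'a var pol) m * cnj (y m))"
    by (rule l2ip_crd_finite) (simp add: crd_bas)
  also have "\<dots> = cnj (y n)" by (simp add: crd_bas if_distrib cong: if_cong)
  finally show "pact (mat 1 :: 'a mat2) y n = y n" by simp
qed

lemma pact_inverse:
  assumes "g \<in> gp" "y \<in> ell2"
  shows "pact (ginv g) (pact g y) = y" "pact g (pact (ginv g) y) = y"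
  using assms by (simp_all add: pact_mult gp_ginv ginv_left ginv_right gp_so_c pact_mat1)

text \<open>Truncating only \<open>z\<close> turns the inner product into a finite sum of
  coordinates of \<open>pact (ginv g) (pact g y)\<close>, which is \<open>y\<close>.\<close>

lemma pact_isometry:
  assumes g: "g \<in> gp" and y: "y \<in> ell2" and z: "z \<in> ell2"
  shows "l2ip (pact g y) (pact g z) = l2ip y z"
proof -
  have "l2ip (pact g y) (pact g (trnc N z)) = l2ip y (trnc N z)" for N
  proof -
    have r: "l2ip (pact g y) (rho g (bas n)) = y n" for n
      using fun_cong[OF pact_inverse(1)[OF g y], of n] by (simp add: pact_def[of "ginv g"])
    have e: "l2ip x (rho h (\<Sum>n<N. psc (z n) (bas n))) = (\<Sum>n<N. cnj (z n) * l2ip x (rho h (bas n)))"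
      if "x \<in> ell2" "h \<in> gp" for x and h :: "'a mat2"
      using that by (simp add: rho_sum rho_lin l2ip_sum_right ell2_scl l2ip_scl_right)
    have "l2ip (pact g y) (pact g (trnc N z)) = (\<Sum>n<N. cnj (z n) * y n)"
      unfolding trnc_crd[where 'v = "'a var"] pact_crd[OF g] by (simp add: e g y r)
    also have "\<dots> = (\<Sum>n<N. cnj (z n) * l2ip y (rho (mat 1 :: 'a mat2) (bas n)))"
    proof -
      have "l2ip y (rho (mat 1 :: 'a mat2) (bas n)) = y n" for n
        using fun_cong[OF pact_mat1[OF y, where 'a = 'a], of n]
        by (simp add: pact_def ginv_mat1)
      then show ?thesis by simp
    qed
    also have "\<dots> = l2ip y (trnc N z)"
      unfolding trnc_crd[where 'v = "'a var"] rho_mat1[symmetric] by (rule e[symmetric]) (simp_all add: y)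
    finally show ?thesis .
  qed
  moreover have "(\<lambda>N. l2ip y (trnc N z)) \<longlonglongrightarrow> l2ip y z"
    by (rule l2ip_tendsto_right) (use trnc_tendsto[OF z] in \<open>simp_all add: y z l2n_minus_commute[of z]\<close>)
  moreover have "(\<lambda>N. l2ip (pact g y) (pact g (trnc N z))) \<longlonglongrightarrow> l2ip (pact g y) (pact g z)"
    by (rule l2ip_tendsto_right) (use trnc_l2_tendsto_pact[OF g z] in \<open>simp_all add: y z g\<close>)
  ultimately show ?thesis by (simp add: LIMSEQ_unique)
qed

end

section \<open>One-parameter groups\<close>

definition mpow :: "complex^'m^'m \<Rightarrow> nat \<Rightarrow> complex^'m^'m" where
  "mpow X k = ((\<lambda>Y. X ** Y) ^^ k) (mat 1)"

lemma mpow_0 [simp]: "mpow X 0 = mat 1" and mpow_Suc: "mpow X (Suc k) = X ** mpow X k"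
  by (simp_all add: mpow_def)

lemma mpow_Suc': "mpow X (Suc k) = mpow X k ** X"
proof (induction k)
  case (Suc k)
  have "mpow X (Suc (Suc k)) = X ** (mpow X k ** X)" by (simp only: mpow_Suc[of X "Suc k"] Suc)
  then show ?case by (simp only: matrix_mul_assoc mpow_Suc[of X k, symmetric])
qed (simp add: mpow_Suc)

lemma cscale_mult: "cscale z X ** Y = cscale z (X ** Y)" "X ** cscale z Y = cscale z (X ** Y)"
  for X Y :: "complex^'m^'m"
  by (simp_all add: vec_eq_iff cscale_def matmul_nth sum_distrib_left mult_ac)

lemma cscale_cscale: "cscale a (cscale b X) = cscale (a * b) X" and cscale_one [simp]: "cscale 1 X = X"
  by (simp_all add: vec_eq_iff cscale_def)

lemma mpow_cscale: "mpow (cscale z X) k = cscale (z ^ k) (mpow X k)"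
  by (induction k) (simp_all add: mpow_Suc cscale_mult cscale_cscale mult.commute)

lemma mpow_bound: "cmod (mpow X k $ r $ s) \<le> (\<Sum>r\<in>UNIV. \<Sum>s\<in>UNIV. cmod (X $ r $ s)) ^ k"
proof (induction k arbitrary: r s)
  case 0
  show ?case by (simp add: mat_def)
next
  case (Suc k)
  let ?K = "\<Sum>r\<in>UNIV. \<Sum>s\<in>UNIV. cmod (X $ r $ s)"
  have "cmod (mpow X (Suc k) $ r $ s) \<le> (\<Sum>q\<in>UNIV. cmod (X $ r $ q) * cmod (mpow X k $ q $ s))"
    unfolding mpow_Suc matmul_nth by (intro order_trans[OF norm_sum]) (simp add: norm_mult)
  also have "\<dots> \<le> (\<Sum>q\<in>UNIV. cmod (X $ r $ q) * ?K ^ k)"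
    by (intro sum_mono mult_left_mono Suc) auto
  also have "\<dots> = (\<Sum>q\<in>UNIV. cmod (X $ r $ q)) * ?K ^ k" by (simp add: sum_distrib_right)
  also have "\<dots> \<le> ?K * ?K ^ k"
    by (intro mult_right_mono member_le_sum[of r UNIV "\<lambda>r. \<Sum>s\<in>UNIV. cmod (X $ r $ s)"] zero_le_power sum_nonneg) auto
  finally show ?case by simp
qed

lemma mexp_summable: "summable (\<lambda>k. mpow X k $ r $ s / fact k * z ^ k)"
proof (rule summable_comparison_test'[where N = 0])
  let ?K = "\<Sum>r\<in>UNIV. \<Sum>s\<in>UNIV. cmod (X $ r $ s)"
  show "summable (\<lambda>k. inverse (fact k) * (?K * cmod z) ^ k)" by (rule summable_exp)
  show "norm (mpow X k $ r $ s / fact k * z ^ k) \<le> inverse (fact k) * (?K * cmod z) ^ k" for k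
  proof -
    have "norm (mpow X k $ r $ s / fact k * z ^ k) = cmod (mpow X k $ r $ s) * (cmod z ^ k / fact k)"
      by (simp add: norm_mult norm_divide norm_power)
    also have "\<dots> \<le> ?K ^ k * (cmod z ^ k / fact k)"
      by (rule mult_right_mono[OF mpow_bound]) simp
    finally show ?thesis by (simp add: power_mult_distrib divide_inverse mult_ac)
  qed
qed

lemma scaleR_nth_nth: "(c *\<^sub>R M) $ r $ s = of_real c * (M :: complex^'m^'k) $ r $ s"
  unfolding vector_scaleR_component by (rule scaleR_conv_of_real)

lemma cscale_nth: "cscale c A $ i $ j = c * A $ i $ j"
  by (simp add: cscale_def)

lemma sums_vecI: "(\<And>i. (\<lambda>k. f k $ i) sums (L $ i)) \<Longrightarrow> f sums L"
  unfolding sums_def by (rule vec_tendstoI) (simp add: sum_component)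

lemma mat_exp_nth: "mat_exp (cscale z X) $ r $ s = (suminf (\<lambda>k. mpow X k $ r $ s / fact k * z ^ k))"
proof -
  define L where "L = (\<chi> r s. (suminf (\<lambda>k. mpow X k $ r $ s / fact k * z ^ k)))"
  have "(\<lambda>k. (1 / fact k) *\<^sub>R mpow (cscale z X) k) sums L"
  proof (intro sums_vecI)
    fix r s
    have "(\<lambda>k. mpow X k $ r $ s / fact k * z ^ k) sums L $ r $ s"
      using summable_sums[OF mexp_summable] by (simp add: L_def)
    then show "(\<lambda>k. ((1 / fact k) *\<^sub>R mpow (cscale z X) k) $ r $ s) sums L $ r $ s"
      by (simp add: mpow_cscale cscale_nth scaleR_nth_nth mult_ac del: vector_scaleR_component)
  qed
  then have "mat_exp (cscale z X) = L" by (simp add: mat_exp_def mpow_def sums_iff)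
  then show ?thesis by (simp add: L_def)
qed

lemma mat_exp_has_derivative:
  "((\<lambda>z. mat_exp (cscale z X) $ r $ s) has_field_derivative (mat_exp (cscale z X) ** X) $ r $ s) (at z)"
proof -
  define c where "c k = mpow X k $ r $ s / fact k" for k
  have "((\<lambda>z. (suminf (\<lambda>k. c k * z ^ k))) has_field_derivative (suminf (\<lambda>k. diffs c k * z ^ k))) (at z)"
    by (rule termdiffs_strong_converges_everywhere) (unfold c_def, rule mexp_summable)
  also have "(\<lambda>z. (suminf (\<lambda>k. c k * z ^ k))) = (\<lambda>z. mat_exp (cscale z X) $ r $ s)"
    by (simp add: fun_eq_iff mat_exp_nth c_def)
  also have "(suminf (\<lambda>k. diffs c k * z ^ k)) = (mat_exp (cscale z X) ** X) $ r $ s"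
  proof -
    have d: "diffs c k * z ^ k = (\<Sum>q\<in>UNIV. mpow X k $ r $ q / fact k * z ^ k * X $ q $ s)" for k
      by (simp add: diffs_def c_def mpow_Suc' matmul_nth sum_distrib_left sum_divide_distrib sum_distrib_right
          field_simps del: of_nat_Suc)
    have "(\<lambda>k. \<Sum>q\<in>UNIV. mpow X k $ r $ q / fact k * z ^ k * X $ q $ s) sums
        (\<Sum>q\<in>UNIV. mat_exp (cscale z X) $ r $ q * X $ q $ s)"
      unfolding mat_exp_nth by (intro sums_sum sums_mult2 summable_sums mexp_summable)
    then show ?thesis by (simp add: d sums_iff matmul_nth)
  qed
  finally show ?thesis .
qed

lemma mat_exp_zero: "mat_exp (cscale 0 X) = mat 1"
proof -
  have "mat_exp (cscale 0 X) $ r $ s = mat 1 $ r $ s" for r s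
    unfolding mat_exp_nth by (subst suminf_finite[of "{0}"]) auto
  then show ?thesis by (simp add: vec_eq_iff)
qed

text \<open>The product of the exponential with its \<open>ginv\<close> has derivative zero, because
  \<open>ginv (g ** X) = - (X ** ginv g)\<close>.\<close>

lemma mat_exp_so_c:
  assumes X: "X \<in> lie_g"
  shows "mat_exp (cscale z X) \<in> so_c"
proof -
  let ?e = "\<lambda>z. mat_exp (cscale z X)"
  have "(?e z ** ginv (?e z)) $ r $ s = mat 1 $ r $ s" for r s
  proof -
    have d: "((\<lambda>z. (?e z ** ginv (?e z)) $ r $ s) has_field_derivative 0) (at z)" for z
    proof -
      have "((\<lambda>z. \<Sum>q\<in>UNIV. ?e z $ r $ q * ginv (?e z) $ q $ s) has_field_derivative
          (\<Sum>q\<in>UNIV. (?e z ** X) $ r $ q * ginv (?e z) $ q $ s + ginv (?e z ** X) $ q $ s * ?e z $ r $ q)) (at z)"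
        unfolding ginv_nth by (intro DERIV_sum DERIV_mult mat_exp_has_derivative)
      also have "(\<Sum>q\<in>UNIV. (?e z ** X) $ r $ q * ginv (?e z) $ q $ s + ginv (?e z ** X) $ q $ s * ?e z $ r $ q)
         = (?e z ** X ** ginv (?e z) + ?e z ** ginv (?e z ** X)) $ r $ s"
        by (simp add: matmul_nth[of "?e z ** X"] matmul_nth[of "?e z" "ginv _"] sum.distrib mult.commute)
      also have "?e z ** X ** ginv (?e z) + ?e z ** ginv (?e z ** X) = 0"
        by (simp add: ginv_lie_g[OF X] matrix_minus_mult matrix_mul_assoc)
      finally show ?thesis
        by (simp add: matmul_nth)
    qed
    have "\<exists>c. \<forall>z\<in>UNIV. (?e z ** ginv (?e z)) $ r $ s = c"
      by (rule has_field_derivative_zero_constant[OF convex_UNIV]) (auto intro: d has_field_derivative_at_within)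
    then have "(?e z ** ginv (?e z)) $ r $ s = (?e 0 ** ginv (?e 0)) $ r $ s" by (metis UNIV_I)
    then show ?thesis by (simp add: mat_exp_zero ginv_mat1)
  qed
  then have "?e z ** ginv (?e z) = mat 1" by (simp add: vec_eq_iff)
  then show ?thesis by (simp add: so_c_iff matrix_left_right_inverse)
qed

lemma scaleR_cscale: "t *\<^sub>R X = cscale (of_real t) X" for X :: "complex^'m^'m"
  unfolding vec_eq_iff cscale_nth scaleR_nth_nth by simp

lemma lie_g0_lie_g: "X \<in> lie_g0 \<Longrightarrow> X \<in> lie_g"
  by (simp add: lie_g0_def)

text \<open>The same argument with \<open>adjm\<close> in place of \<open>ginv\<close>. The
  parameter is real because \<open>adjm\<close> is antilinear.\<close>

lemma mat_exp_gp:
  assumes X: "X \<in> lie_g0"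
  shows "mat_exp (t *\<^sub>R X) \<in> gp"
proof -
  let ?e = "\<lambda>t. mat_exp (cscale (of_real t) X)"
  have so: "?e t \<in> so_c" by (rule mat_exp_so_c[OF lie_g0_lie_g[OF X]])
  have aX: "adjm (g ** X) = - (X ** adjm g)" for g
  proof -
    have "adjm X = - X" using adjm_lie_g0[OF X] by (simp add: vec_eq_iff cscale_def)
    then show ?thesis by (simp add: adjm_mult matrix_minus_mult)
  qed
  have "(?e t ** adjm (?e t)) $ r $ s = mat 1 $ r $ s" for r s
  proof -
    have de: "((\<lambda>t. ?e t $ r $ q) has_vector_derivative (?e t ** X) $ r $ q) (at t within S)" for r q t S
      by (rule has_vector_derivative_real_field[OF mat_exp_has_derivative])
    have d: "((\<lambda>t. (?e t ** adjm (?e t)) $ r $ s) has_vector_derivative 0) (at t within S)" for t S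
    proof -
      have "((\<lambda>t. \<Sum>q\<in>UNIV. ?e t $ r $ q * adjm (?e t) $ q $ s) has_vector_derivative
          (\<Sum>q\<in>UNIV. ?e t $ r $ q * adjm (?e t ** X) $ q $ s + (?e t ** X) $ r $ q * adjm (?e t) $ q $ s)) (at t within S)"
        unfolding adjm_nth
        by (intro has_vector_derivative_sum has_vector_derivative_mult de has_vector_derivative_mult_right has_vector_derivative_cnj)
      also have "(\<Sum>q\<in>UNIV. ?e t $ r $ q * adjm (?e t ** X) $ q $ s + (?e t ** X) $ r $ q * adjm (?e t) $ q $ s)
         = (?e t ** adjm (?e t ** X) + ?e t ** X ** adjm (?e t)) $ r $ s"
        by (simp add: matmul_nth[of "?e t ** X"] matmul_nth[of "?e t" "adjm _"] sum.distrib)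
      also have "?e t ** adjm (?e t ** X) + ?e t ** X ** adjm (?e t) = 0"
        by (simp add: aX matrix_minus_mult matrix_mul_assoc)
      finally show ?thesis
        by (simp add: matmul_nth)
    qed
    have "\<exists>c. \<forall>t\<in>UNIV. (?e t ** adjm (?e t)) $ r $ s = c"
      using has_vector_derivative_zero_constant[OF convex_UNIV d] by blast
    then have "(?e t ** adjm (?e t)) $ r $ s = (?e 0 ** adjm (?e 0)) $ r $ s" by (metis UNIV_I)
    then show ?thesis using gp_adjm[OF mat1_gp, where 'a = 'a] by (simp add: mat_exp_zero ginv_mat1)
  qed
  then have "?e t ** adjm (?e t) = mat 1" by (simp add: vec_eq_iff)
  then have "ginv (?e t) ** ?e t ** adjm (?e t) = ginv (?e t)" by (simp flip: matrix_mul_assoc)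
  then have "adjm (?e t) = ginv (?e t)" by (simp add: ginv_left[OF so])
  then show ?thesis using so by (simp add: gp_def scaleR_cscale)
qed

section \<open>Differentiability and strong continuity of the representation\<close>

context fock
begin

lemma phi_exp_deriv:
  assumes X: "X \<in> lie_g0"
  shows "((\<lambda>t. phi (mat_exp (t *\<^sub>R X)) v u) has_vector_derivative phi (mat_exp (t *\<^sub>R X)) (gact X v) u) (at t)"
proof -
  let ?g = "\<lambda>z. mat_exp (cscale z X)"
  let ?S = "{z. det (ul (?g z)) \<noteq> 0}"
  have cont: "continuous_on UNIV (\<lambda>z. det (ul (?g z)))"
  proof (rule continuous_at_imp_continuous_on, rule ballI)
    fix z
    show "isCont (\<lambda>z. det (ul (?g z))) z"
      unfolding isCont_def
      by (rule tendsto_det, unfold quarter_nth)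
        (use DERIV_isCont[OF mat_exp_has_derivative[of X _ _ z]] in \<open>simp add: isCont_def\<close>)
  qed
  \<comment> \<open>\<open>phi_deriv\<close> needs complex times around a real one; the block stays
    invertible there since this is an open condition that holds at real times.\<close>
  have "open ?S" using open_Collect_neq[OF cont continuous_on_const, of 0] by simp
  moreover have "complex_of_real t \<in> ?S"
    using gp_invertible[OF mat_exp_gp[OF X, of t]] by (simp add: scaleR_cscale invertible_det_nz)
  ultimately have "((\<lambda>z. phi (?g z) v u) has_field_derivative phi (?g (of_real t)) (gact X v) u) (at (of_real t))"
    by (rule phi_deriv)
      (simp_all add: mat_exp_so_c lie_g0_lie_g X invertible_det_nz mat_exp_has_derivative)
  from has_vector_derivative_real_field[OF this] show ?thesis by (simp add: scaleR_cscale)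
qed

lemma Re_phi_exp_deriv:
  assumes X: "X \<in> lie_g0"
  shows "((\<lambda>t. Re (phi (mat_exp (t *\<^sub>R X)) v u)) has_real_derivative Re (phi (mat_exp (t *\<^sub>R X)) (gact X v) u)) (at t)"
  unfolding has_real_derivative_iff_has_vector_derivative
  by (rule bounded_linear.has_vector_derivative[OF bounded_linear_Re phi_exp_deriv[OF X]])

lemma fip_gact_skew: "X \<in> lie_g0 \<Longrightarrow> fip (gact X v) u = - fip v (gact X u)"
  by (simp add: fip_gact lie_g0_lie_g adjm_lie_g0 gact_cscale fip_psc_right psc_minus_left fip_minus_right)

lemma phi_exp_zero: "phi (mat_exp 0) v u = fip v u"
proof -
  have "cscale 0 0 = (0 :: 'a mat2)" by (simp add: vec_eq_iff cscale_def)
  then show ?thesis using mat_exp_zero[of "0 :: 'a mat2"] by (simp add: phi_mat1)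
qed

text \<open>Weak derivatives suffice: by unitarity the squared norm of the error only involves the
  matrix coefficients \<open>a\<close> and \<open>c\<close>, and their expansions at 0 cancel in the
  limit.\<close>

lemma rho_differentiable:
  assumes X: "X \<in> lie_g0"
  shows "((\<lambda>t. l2n (scl (of_real (1 / t)) (rho (mat_exp (t *\<^sub>R X)) v - crd v) - crd (gact X v))) \<longlongrightarrow> 0) (at 0)"
proof -
  let ?e = "\<lambda>t. mat_exp (t *\<^sub>R X)" and ?x = "gact X v"
  define a b c where "a t = Re (phi (?e t) v v)" and "b t = Re (phi (?e t) ?x v)" and "c t = Re (phi (?e t) v ?x)" for t
  define n where "n = Re (fip ?x ?x)"
  have da: "(a has_real_derivative b t) (at t)" for t
    unfolding a_def b_def by (rule Re_phi_exp_deriv[OF X])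
  \<comment> \<open>Skewness of the action: \<open>a\<close> has no first-order term, so its
    difference quotient may be divided by \<open>t\<close> once more.\<close>
  have b0: "b 0 = 0"
  proof -
    have "Re (fip ?x v) = - Re (fip v ?x)" by (simp add: fip_gact_skew[OF X])
    moreover have "Re (fip v ?x) = Re (fip ?x v)" by (subst fip_cnj) simp
    ultimately show ?thesis by (simp add: b_def phi_exp_zero)
  qed
  have "(b has_real_derivative Re (phi (?e 0) (gact X ?x) v)) (at 0)"
    unfolding b_def by (rule Re_phi_exp_deriv[OF X])
  then have db: "((\<lambda>t. b t / t) \<longlongrightarrow> - n) (at 0)"
    by (simp add: DERIV_def b0 phi_exp_zero n_def fip_gact_skew[OF X, of ?x])
  have "(c has_real_derivative Re (phi (?e 0) ?x ?x)) (at 0)"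
    unfolding c_def by (rule Re_phi_exp_deriv[OF X])
  then have dc: "((\<lambda>t. (c t - c 0) / t) \<longlongrightarrow> n) (at 0)"
    by (simp add: DERIV_def phi_exp_zero n_def)
  have la: "((\<lambda>t. (a t - a 0) / t\<^sup>2) \<longlongrightarrow> - n / 2) (at 0)"
  proof (rule lhopital)
    have "isCont a 0" using da DERIV_isCont by blast
    then show "((\<lambda>t. a t - a 0) \<longlongrightarrow> 0) (at 0)" by (simp add: isCont_def LIM_zero)
    show "((\<lambda>t::real. t\<^sup>2) \<longlongrightarrow> 0) (at 0)" by (rule tendsto_eq_intros) (auto intro!: tendsto_eq_intros)
    show "\<forall>\<^sub>F t in at 0. (t::real)\<^sup>2 \<noteq> 0" by (simp add: eventually_at_filter)
    show "\<forall>\<^sub>F t in at 0. 2 * (t::real) \<noteq> 0" by (simp add: eventually_at_filter)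
    show "\<forall>\<^sub>F t in at 0. ((\<lambda>t. a t - a 0) has_real_derivative b t) (at t)"
      using DERIV_diff[OF da DERIV_const] by (intro always_eventually allI) simp
    show "\<forall>\<^sub>F t in at 0. ((\<lambda>t::real. t\<^sup>2) has_real_derivative 2 * t) (at t)"
      by (intro always_eventually allI) (auto intro!: derivative_eq_intros)
    show "((\<lambda>t. b t / (2 * t)) \<longlongrightarrow> - n / 2) (at 0)"
      using tendsto_divide[OF db tendsto_const, of 2] by (simp add: mult.commute)
  qed
  have main: "(l2n (scl (of_real (1 / t)) (rho (?e t) v - crd v) - crd ?x))\<^sup>2
      = - 2 * ((a t - a 0) / t\<^sup>2) + n - 2 * ((c t - c 0) / t)" if "t \<noteq> 0" for t
  proof -
    have g: "?e t \<in> gp" by (rule mat_exp_gp[OF X])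
    have r: "rho (?e t) v \<in> ell2" using g by simp
    have ip: "l2ip (rho (?e t) v) (crd u) = phi (?e t) v u" for u
      using l2ip_rho[OF g mat1_gp, of v u] by (simp add: rho_mat1 ginv_mat1)
    have nrm: "(l2n (crd p))\<^sup>2 = Re (fip p p)" for p :: "'a var pol"
      using l2ip_self[of "crd p"] by (simp add: l2ip_crd del: of_real_power)
    have nr: "(l2n (rho (?e t) v))\<^sup>2 = Re (fip v v)"
      using l2ip_self[OF r] by (simp add: l2ip_rho_same[OF g] del: of_real_power)
    have d: "rho (?e t) v - crd v \<in> ell2" using r by (simp add: ell2_diff)
    have "(l2n (scl (of_real (1 / t)) (rho (?e t) v - crd v) - crd ?x))\<^sup>2
      = (l2n (scl (of_real (1 / t)) (rho (?e t) v - crd v)))\<^sup>2 + (l2n (crd ?x))\<^sup>2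
        - 2 * Re (l2ip (scl (of_real (1 / t)) (rho (?e t) v - crd v)) (crd ?x))"
      by (rule l2n_sq_diff[OF ell2_scl[OF d] crd_ell2])
    also have "(l2n (scl (of_real (1 / t)) (rho (?e t) v - crd v)))\<^sup>2 = (2 * a 0 - 2 * a t) / t\<^sup>2"
      unfolding l2n_scl[OF d] power_mult_distrib l2n_sq_diff[OF r crd_ell2] nr nrm ip
      by (simp add: a_def phi_exp_zero norm_divide power_divide divide_inverse norm_inverse power_inverse)
    also have "l2ip (scl (of_real (1 / t)) (rho (?e t) v - crd v)) (crd ?x) = of_real (1 / t) * (phi (?e t) v ?x - fip v ?x)"
      unfolding l2ip_scl_left[OF d crd_ell2] l2ip_diff_left[OF r crd_ell2 crd_ell2] ip l2ip_crd ..
    also have "(2 * a 0 - 2 * a t) / t\<^sup>2 + (l2n (crd ?x))\<^sup>2 - 2 * Re (of_real (1 / t) * (phi (?e t) v ?x - fip v ?x))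
       = - 2 * ((a t - a 0) / t\<^sup>2) + n - 2 * ((c t - c 0) / t)"
      by (simp add: nrm n_def c_def phi_exp_zero diff_divide_distrib right_diff_distrib)
    finally show ?thesis .
  qed
  \<comment> \<open>This does not need a second derivative of \<open>a\<close> as input: l'Hopital's
    rule already reduced it to the derivative of \<open>b\<close>.\<close>
  have "((\<lambda>t. - 2 * ((a t - a 0) / t\<^sup>2) + n - 2 * ((c t - c 0) / t)) \<longlongrightarrow> - 2 * (- n / 2) + n - 2 * n) (at 0)"
    by (intro tendsto_intros la dc)
  moreover have "- 2 * (- n / 2) + n - 2 * n = 0" by simp
  ultimately have "((\<lambda>t. - 2 * ((a t - a 0) / t\<^sup>2) + n - 2 * ((c t - c 0) / t)) \<longlongrightarrow> 0) (at 0)" by metis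
  then have "((\<lambda>t. (l2n (scl (of_real (1 / t)) (rho (?e t) v - crd v) - crd ?x))\<^sup>2) \<longlongrightarrow> 0) (at 0)"
    by (rule Lim_transform_eventually) (use main in \<open>auto simp: eventually_at_filter\<close>)
  then have "((\<lambda>t. sqrt ((l2n (scl (of_real (1 / t)) (rho (?e t) v - crd v) - crd ?x))\<^sup>2)) \<longlongrightarrow> sqrt 0) (at 0)"
    by (intro tendsto_real_sqrt) simp
  moreover have "sqrt ((l2n (scl (of_real (1 / t)) (rho (?e t) v - crd v) - crd ?x))\<^sup>2)
      = l2n (scl (of_real (1 / t)) (rho (?e t) v - crd v) - crd ?x)" for t
  proof -
    have "scl (of_real (1 / t)) (rho (?e t) v - crd v) - crd ?x \<in> ell2"
      by (intro ell2_diff ell2_scl rho_ell2 mat_exp_gp X crd_ell2)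
    then show ?thesis by (rule real_sqrt_unique[OF refl l2n_nonneg])
  qed
  ultimately show ?thesis by simp
qed

lemma rho_continuous:
  assumes g: "g \<in> gp" and e: "e > 0"
  obtains d where "d > 0" "\<And>h. h \<in> gp \<Longrightarrow> dist h g < d \<Longrightarrow> l2n (rho h v - rho g v) < e"
proof -
  \<comment> \<open>\<open>phi_tendsto\<close> asks for all values in the group, hence the dummy
    value outside \<open>gp\<close>; the limit is taken within \<open>gp\<close>.\<close>
  define k where "k h = (if h \<in> gp then ginv g ** h else mat 1)" for h
  have k: "k h \<in> gp" for h by (simp add: k_def gp_mult gp_ginv g)
  have g1: "ginv g ** g = mat 1" by (rule ginv_left[OF gp_so_c[OF g]])
  have "((\<lambda>h. phi (k h) v v) \<longlongrightarrow> phi (mat 1) v v) (at g within gp)"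
  proof (rule phi_tendsto)
    fix r s
    have "((\<lambda>h. \<Sum>q\<in>UNIV. ginv g $ r $ q * h $ q $ s) \<longlongrightarrow> (\<Sum>q\<in>UNIV. ginv g $ r $ q * g $ q $ s)) (at g within gp)"
      by (intro tendsto_intros)
    then have "((\<lambda>h. (ginv g ** h) $ r $ s) \<longlongrightarrow> mat 1 $ r $ s) (at g within gp)"
      by (simp add: g1 flip: matmul_nth)
    then show "((\<lambda>h. k h $ r $ s) \<longlongrightarrow> mat 1 $ r $ s) (at g within gp)"
      by (rule Lim_transform_eventually) (auto simp: k_def eventually_at_filter)
  qed (use k in \<open>auto simp: gp_so_c gp_invertible gp_invertible[OF mat1_gp, simplified]\<close>)
  then have "((\<lambda>h. Re (phi (k h) v v)) \<longlongrightarrow> Re (fip v v)) (at g within gp)"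
    by (intro tendsto_Re) (simp add: phi_mat1)
  then have "\<forall>\<^sub>F h in at g within gp. dist (Re (phi (k h) v v)) (Re (fip v v)) < e\<^sup>2 / 2"
    using e by (intro tendstoD) auto
  then obtain d where d: "d > 0" "\<And>h. h \<in> gp \<Longrightarrow> h \<noteq> g \<Longrightarrow> dist h g < d \<Longrightarrow> dist (Re (phi (k h) v v)) (Re (fip v v)) < e\<^sup>2 / 2"
    by (auto simp: eventually_at)
  have "l2n (rho h v - rho g v) < e" if h: "h \<in> gp" "dist h g < d" for h
  proof (cases "h = g")
    case True
    then show ?thesis using e by (simp add: l2n_def)
  next
    case False
    have nr: "(l2n (rho h v))\<^sup>2 = Re (fip v v)" if "h \<in> gp" for h :: "'a mat2"
      using l2ip_self[OF rho_ell2[OF that], of v] by (simp add: l2ip_rho_same[OF that] del: of_real_power)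
    have "(l2n (rho h v - rho g v))\<^sup>2 = 2 * Re (fip v v) - 2 * Re (phi (k h) v v)"
      using h g by (simp add: l2n_sq_diff nr l2ip_rho k_def)
    also have "\<dots> < e\<^sup>2" using d(2)[OF h(1) False h(2)] unfolding dist_real_def by linarith
    finally show ?thesis using e by (simp add: power_less_imp_less_base)
  qed
  then show ?thesis using that d(1) by blast
qed

text \<open>Approximation of \<open>x\<close> by a truncation; \<open>pact_contraction\<close> makes
  the error uniform over the group.\<close>

lemma pact_continuous:
  assumes g: "g \<in> gp" and x: "x \<in> ell2" and e: "e > 0"
  obtains d where "d > 0" "\<And>h. h \<in> gp \<Longrightarrow> dist h g < d \<Longrightarrow> l2n (pact h x - pact g x) < e"
proof -
  have "\<forall>\<^sub>F N in sequentially. dist (l2n (x - trnc N x)) 0 < e / 3"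
    using trnc_tendsto[OF x] e by (intro tendstoD) auto
  then obtain N where "dist (l2n (x - trnc N x)) 0 < e / 3" by (auto simp: eventually_sequentially)
  then have N: "l2n (x - trnc N x) < e / 3" by simp
  define v where "v = (\<Sum>n<N. psc (x n) (bas n :: 'a var pol))"
  have v: "trnc N x = crd v" unfolding v_def by (rule trnc_crd)
  obtain d where d: "d > 0" "\<And>h. h \<in> gp \<Longrightarrow> dist h g < d \<Longrightarrow> l2n (rho h v - rho g v) < e / 3"
    using rho_continuous[OF g, of "e / 3" v] e by auto
  have "l2n (pact h x - pact g x) < e" if h: "h \<in> gp" "dist h g < d" for h
  proof -
    have a: "l2n (pact k x - rho k v) < e / 3" if "k \<in> gp" for k
      using pact_contraction[OF that, of "x - crd v"] N x that by (simp add: v pact_diff pact_crd ell2_diff)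
    have "pact h x - pact g x = (pact h x - rho h v) + ((rho h v - rho g v) + (rho g v - pact g x))" by simp
    then have "l2n (pact h x - pact g x) \<le> l2n (pact h x - rho h v) + (l2n (rho h v - rho g v) + l2n (rho g v - pact g x))"
      using l2n_triangle[of "pact h x - rho h v" "(rho h v - rho g v) + (rho g v - pact g x)"]
        l2n_triangle[of "rho h v - rho g v" "rho g v - pact g x"] h g x
      by (simp only:) (simp add: ell2_diff ell2_add)
    then show ?thesis using a[OF h(1)] a[OF g] d(2)[OF h] by (simp add: l2n_minus_commute[of "rho g v"])
  qed
  then show ?thesis using that d(1) by blast
qed

end

section \<open>Submodules of the Fock space\<close>

context fock
begin

definition perp :: "'n::finite var pol set \<Rightarrow> 'n var pol set" where
  "perp M = {u. \<forall>m\<in>M. fip m u = 0}"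

lemma perp_add: "u \<in> perp M \<Longrightarrow> v \<in> perp M \<Longrightarrow> u + v \<in> perp M"
  and perp_psc: "u \<in> perp M \<Longrightarrow> psc c u \<in> perp M"
  and perp_zero: "0 \<in> perp M"
  by (simp_all add: perp_def fip_add_right fip_psc_right)

lemma perp_sum: "(\<And>x. x \<in> A \<Longrightarrow> f x \<in> perp M) \<Longrightarrow> sum f A \<in> perp M"
  by (induction A rule: infinite_finite_induct) (auto intro: perp_add perp_zero)

text \<open>The logarithmic derivative \<open>N\<close> of the curve acts through
  \<open>opE\<close>, and subtracting the trace term removes the shift contained in
  \<open>opE\<close>.\<close>

lemma dsub_deriv:
  assumes b: "\<And>i j. ((\<lambda>w. b w $ i $ j) has_field_derivative b' $ i $ j) (at z)"
    and N: "N ** b z = b'"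
  shows "((\<lambda>w. fip (dsub (b w) u) m) has_field_derivative
     fip (dsub (b z) (opE (- N) u - psc (of_nat (card C) * trace N) u)) m) (at z)"
proof (induction u arbitrary: m rule: pol_induct)
  case one
  have "opE (- N) 1 - psc (of_nat (card C) * trace N) 1 = 0"
    by (simp add: opE_one trace_def sum_negf)
  then show ?case by (simp add: plin_zero)
next
  case (scale c p)
  have "((\<lambda>w. c * fip (dsub (b w) p) m) has_field_derivative
      c * fip (dsub (b z) (opE (- N) p - psc (of_nat (card C) * trace N) p)) m) (at z)"
    by (rule DERIV_cmult[OF scale])
  then show ?case
    by (simp add: plin_psc[OF plin_dsub] fip_psc_left plin_psc[OF plin_opE] plin_diff[OF plin_dsub] fip_diff_left
        algebra_simps)
next
  case (add p q)
  have "((\<lambda>w. fip (dsub (b w) p) m + fip (dsub (b w) q) m) has_field_derivative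
      fip (dsub (b z) (opE (- N) p - psc (of_nat (card C) * trace N) p)) m
      + fip (dsub (b z) (opE (- N) q - psc (of_nat (card C) * trace N) q)) m) (at z)"
    by (rule DERIV_add[OF add])
  then show ?case
    by (simp add: plin_add[OF plin_dsub] plin_add[OF plin_opE] plin_diff[OF plin_dsub] fip_diff_left fip_add_left
        psc_add_right algebra_simps)
next
  case (var v p)
  obtain l c s where v: "v = (l, c, s)" by (cases v)
  define D where "D u = opE (- N) u - psc (of_nat (card C) * trace N) u" for u
  have Dv: "D (pvar v * p) = pvar v * D p + (if c \<in> C then \<Sum>j\<in>UNIV. psc (N $ l $ j) (pvar (j, c, s) * p) else 0)"
    by (simp add: D_def v opE_pvar psc_minus_left sum_negf right_diff_distrib psc_mult_right)
  show ?case
  proof (cases "c \<in> C")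
    case False
    then show ?thesis using var[of "der v m"]
      unfolding D_def[symmetric] Dv by (simp add: v dsub_pvar fip_pvar_left)
  next
    case True
    have "((\<lambda>w. \<Sum>j\<in>UNIV. b w $ l $ j * fip (dsub (b w) p) (der (j, c, s) m)) has_field_derivative
        (\<Sum>j\<in>UNIV. b' $ l $ j * fip (dsub (b z) p) (der (j, c, s) m) + fip (dsub (b z) (D p)) (der (j, c, s) m) * b z $ l $ j)) (at z)"
      using var unfolding D_def by (intro DERIV_sum DERIV_mult b)
    also have "(\<lambda>w. \<Sum>j\<in>UNIV. b w $ l $ j * fip (dsub (b w) p) (der (j, c, s) m)) = (\<lambda>w. fip (dsub (b w) (pvar v * p)) m)"
      using True by (simp add: v dsub_pvar fip_sum_left fip_psc_left fip_pvar_left)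
    also have "(\<Sum>j\<in>UNIV. b' $ l $ j * fip (dsub (b z) p) (der (j, c, s) m) + fip (dsub (b z) (D p)) (der (j, c, s) m) * b z $ l $ j)
       = fip (dsub (b z) (D (pvar v * p))) m"
    proof -
      have "(\<Sum>j\<in>UNIV. b' $ l $ j * fip (dsub (b z) p) (der (j, c, s) m))
        = fip (dsub (b z) (\<Sum>i\<in>UNIV. psc (N $ l $ i) (pvar (i, c, s) * p))) m"
        unfolding N[symmetric] matmul_nth sum_distrib_right using True
        by (subst sum.swap) (simp add: plin_sum[OF plin_dsub] plin_psc[OF plin_dsub] dsub_pvar fip_sum_left fip_psc_left
            fip_pvar_left sum_distrib_left mult.assoc)
      then show ?thesis unfolding Dv using True
        by (simp add: sum.distrib plin_add[OF plin_dsub] fip_add_left)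
          (simp add: v dsub_pvar fip_sum_left fip_psc_left fip_pvar_left mult.commute[of "fip _ _"])
    qed
    finally show ?thesis by (simp add: D_def)
  qed
qed

lemma dsub_holomorphic:
  assumes "\<And>i j. (\<lambda>w. b w $ i $ j) holomorphic_on S"
  shows "(\<lambda>w. fip (dsub (b w) u) m) holomorphic_on S"
proof (induction u arbitrary: m rule: pol_induct)
  case (var v p)
  obtain l c s where v: "v = (l, c, s)" by (cases v)
  show ?case
    by (cases "c \<in> C")
      (auto simp: v dsub_pvar fip_sum_left fip_psc_left fip_pvar_left intro!: holomorphic_intros assms var)
qed (auto simp: plin_add[OF plin_dsub] plin_psc[OF plin_dsub] fip_add_left fip_psc_left intro!: holomorphic_intros)

lemma opE_unit_expand: "opE A p = (\<Sum>i\<in>UNIV. \<Sum>j\<in>UNIV. psc (A $ i $ j) (opE (mat_unit i j) p))"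
proof -
  have s: "opE (sum F I) p = (\<Sum>i\<in>I. opE (F i) p)" for F :: "'b \<Rightarrow> complex^'a^'a" and I
    by (induction I rule: infinite_finite_induct) (auto simp: opE_add)
  have "A = (\<Sum>i\<in>UNIV. \<Sum>j\<in>UNIV. cscale (A $ i $ j) (mat_unit i j))"
  proof -
    have "(\<Sum>i\<in>UNIV. \<Sum>j\<in>UNIV. cscale (A $ i $ j) (mat_unit i j)) $ a $ b = A $ a $ b" for a b
    proof -
      have "(\<Sum>i\<in>UNIV. \<Sum>j\<in>UNIV. cscale (A $ i $ j) (mat_unit i j)) $ a $ b
         = (\<Sum>i\<in>UNIV. \<Sum>j\<in>UNIV. if j = b then (if i = a then A $ i $ j else 0) else 0)"
        unfolding sum_component cscale_nth mat_unit_def vec_lambda_beta by (intro sum.cong refl) auto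
      then show ?thesis by simp
    qed
    then show ?thesis by (simp add: vec_eq_iff)
  qed
  then have "opE A p = opE (\<Sum>i\<in>UNIV. \<Sum>j\<in>UNIV. cscale (A $ i $ j) (mat_unit i j)) p" by simp
  also have "\<dots> = (\<Sum>i\<in>UNIV. \<Sum>j\<in>UNIV. psc (A $ i $ j) (opE (mat_unit i j) p))"
    by (simp add: s opE_cscale)
  finally show ?thesis .
qed

text \<open>
  Along the line from the identity to \<open>B\<close> all Taylor coefficients at the identity vanish, since the
  space is stable under the Lie algebra.
\<close>

lemma dsub_perp:
  assumes E: "\<And>A u. u \<in> U \<Longrightarrow> opE A u \<in> U" and o: "\<And>u. u \<in> U \<Longrightarrow> fip u m = 0" and u: "u \<in> U"
  shows "fip (dsub B u) m = 0"
proof -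
  define b where "b z = mat 1 + cscale z (B - mat 1)" for z
  have b_nth: "b z $ i $ j = mat 1 $ i $ j + z * (B - mat 1) $ i $ j" for z i j
    by (simp add: b_def cscale_nth)
  have bd: "((\<lambda>w. b w $ i $ j) has_field_derivative (B - mat 1) $ i $ j) (at z)" for i j z
    unfolding b_nth by (auto intro!: derivative_eq_intros)
  define f where "f u z = fip (dsub (b z) u) m" for u z
  have hol: "f u holomorphic_on A" for u A
  proof -
    have "(\<lambda>w. b w $ i $ j) holomorphic_on A" for i j
      unfolding b_nth by (intro holomorphic_intros)
    then show ?thesis unfolding f_def by (rule dsub_holomorphic)
  qed
  \<comment> \<open>\<open>N\<close> exists only where \<open>b\<close> is invertible, in particular
    near 0, whereas \<open>f u\<close> is entire.\<close>
  define S where "S = {z. det (b z) \<noteq> 0}"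
  have "continuous_on UNIV (\<lambda>z. det (b z))"
  proof (rule continuous_at_imp_continuous_on, rule ballI)
    fix z
    show "isCont (\<lambda>z. det (b z)) z"
      unfolding isCont_def by (rule tendsto_det) (use DERIV_isCont[OF bd] in \<open>simp add: isCont_def\<close>)
  qed
  then have S: "open S" unfolding S_def using open_Collect_neq[OF _ continuous_on_const, of _ 0] by simp
  have b0: "b 0 = mat 1" by (simp add: vec_eq_iff b_nth)
  have S0: "0 \<in> S" by (simp add: S_def b0)
  define N where "N z = (B - mat 1) ** matrix_inv (b z)" for z
  have inv: "invertible (b z)" if "z \<in> S" for z using that by (simp add: S_def invertible_det_nz)
  have Nhol: "(\<lambda>z. N z $ i $ j) holomorphic_on S" for i j
  proof -
    have "(\<lambda>z. matrix_inv (b z) $ i $ j) holomorphic_on S" for i j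
      unfolding holomorphic_on_open[OF S]
      using has_field_derivative_matrix_inv[OF bd S _ inv] by blast
    then show ?thesis unfolding N_def matmul_nth by (intro holomorphic_intros)
  qed
  have df: "deriv (f u) z = - (\<Sum>i\<in>UNIV. \<Sum>j\<in>UNIV. N z $ i $ j * f (opE (mat_unit i j) u) z)
      - of_nat (card C) * (\<Sum>i\<in>UNIV. N z $ i $ i * f u z)" if z: "z \<in> S" for u z
  proof (rule DERIV_imp_deriv)
    have Nb: "N z ** b z = B - mat 1"
      by (simp add: N_def matrix_inv_mult[OF inv[OF z]] flip: matrix_mul_assoc)
    have "opE (- N z) u = - (\<Sum>i\<in>UNIV. \<Sum>j\<in>UNIV. psc (N z $ i $ j) (opE (mat_unit i j) u))"
      by (subst opE_unit_expand) (simp add: psc_minus_left sum_negf)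
    then have "fip (dsub (b z) (opE (- N z) u - psc (of_nat (card C) * trace (N z)) u)) m
      = - (\<Sum>i\<in>UNIV. \<Sum>j\<in>UNIV. N z $ i $ j * f (opE (mat_unit i j) u) z) - of_nat (card C) * (\<Sum>i\<in>UNIV. N z $ i $ i * f u z)"
      by (simp add: f_def plin_diff[OF plin_dsub] plin_minus[OF plin_dsub] plin_sum[OF plin_dsub] plin_psc[OF plin_dsub]
          fip_diff_left fip_minus_left fip_sum_left fip_psc_left trace_def sum_distrib_right mult.assoc)
    with dsub_deriv[OF bd Nb, of u m]
    show "(f u has_field_derivative - (\<Sum>i\<in>UNIV. \<Sum>j\<in>UNIV. N z $ i $ j * f (opE (mat_unit i j) u) z)
        - of_nat (card C) * (\<Sum>i\<in>UNIV. N z $ i $ i * f u z)) (at z)"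
      unfolding f_def by simp
  qed
  \<comment> \<open>All \<open>u\<close> are treated together, since the derivative of
    \<open>f u\<close> involves \<open>f\<close> at the elements
    \<open>opE (mat_unit i j) u\<close>. The Leibniz rule leads back to lower orders.\<close>
  have "\<forall>u\<in>U. (deriv ^^ k) (f u) 0 = 0" for k
  proof (induction k rule: less_induct)
    case (less k)
    show ?case
    proof (cases k)
      case 0
      then show ?thesis using o by (simp add: f_def b0 dsub_mat1)
    next
      case (Suc r)
      have prod0: "(deriv ^^ r) (\<lambda>z. N z $ i $ j * f w z) 0 = 0" if "w \<in> U" for i j w
      proof -
        have "(deriv ^^ r) (\<lambda>z. N z $ i $ j * f w z) 0
          = (\<Sum>q = 0..r. of_nat (r choose q) * (deriv ^^ q) (\<lambda>z. N z $ i $ j) 0 * (deriv ^^ (r - q)) (f w) 0)"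
          by (rule higher_deriv_mult[OF Nhol hol S S0])
        also have "\<dots> = 0" using less.IH that Suc by (intro sum.neutral) auto
        finally show ?thesis .
      qed
      have sum0: "(deriv ^^ r) (\<lambda>z. \<Sum>i\<in>I. F i z) 0 = (\<Sum>i\<in>I. (deriv ^^ r) (F i) 0)"
        if "finite I" "\<And>i. F i holomorphic_on S" for I :: "'a set" and F
        using that
      proof (induction I rule: finite_induct)
        case empty
        show ?case by simp
      next
        case (insert x I)
        have "(deriv ^^ r) (\<lambda>z. F x z + (\<Sum>i\<in>I. F i z)) 0 = (deriv ^^ r) (F x) 0 + (deriv ^^ r) (\<lambda>z. \<Sum>i\<in>I. F i z) 0"
          using insert.prems by (intro higher_deriv_add[OF _ _ S S0] holomorphic_intros) auto
        then show ?case using insert by simp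
      qed
      have hp: "(\<lambda>z. N z $ i $ j * f w z) holomorphic_on S" for i j w
        by (intro holomorphic_intros Nhol hol)
      have hs: "(\<lambda>z. \<Sum>j\<in>UNIV. N z $ i $ j * f (w i j) z) holomorphic_on S" for i w
        by (intro holomorphic_intros hp)
      show ?thesis
      proof
        fix u assume u: "u \<in> U"
        let ?P = "\<lambda>z. \<Sum>i\<in>UNIV. \<Sum>j\<in>UNIV. N z $ i $ j * f (opE (mat_unit i j) u) z"
        let ?Q = "\<lambda>z. \<Sum>i\<in>UNIV. N z $ i $ i * f u z"
        have P: "(deriv ^^ r) ?P 0 = 0"
          by (subst sum0, simp, rule hs, subst sum0, simp, rule hp) (simp add: prod0 E u)
        have Q: "(deriv ^^ r) ?Q 0 = 0"
          by (subst sum0, simp, rule hp) (simp add: prod0 u)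
        have hP: "?P holomorphic_on S" and hQ: "?Q holomorphic_on S"
          by (intro holomorphic_intros hs hp)+
        have "(deriv ^^ k) (f u) 0 = (deriv ^^ r) (deriv (f u)) 0"
          by (simp only: Suc funpow_Suc_right comp_apply)
        also have "\<dots> = (deriv ^^ r) (\<lambda>z. (- 1) * ?P z + (- of_nat (card C)) * ?Q z) 0"
          by (rule higher_deriv_transform_within_open[OF _ _ S S0])
            (auto simp: df intro!: holomorphic_intros hs hp holomorphic_deriv hol S)
        also have "\<dots> = (deriv ^^ r) (\<lambda>z. (- 1) * ?P z) 0 + (deriv ^^ r) (\<lambda>z. (- of_nat (card C)) * ?Q z) 0"
          by (rule higher_deriv_add[OF _ _ S S0]) (intro holomorphic_intros hP hQ)+
        also have "\<dots> = (- 1) * (deriv ^^ r) ?P 0 + (- of_nat (card C)) * (deriv ^^ r) ?Q 0"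
          using higher_deriv_cmult[OF hP S0 S] higher_deriv_cmult[OF hQ S0 S] by metis
        finally show "(deriv ^^ k) (f u) 0 = 0" by (simp add: P Q)
      qed
    qed
  qed
  \<comment> \<open>The Taylor expansion of an entire function at 0 determines its value at 1, even
    where \<open>b\<close> degenerates, so \<open>B\<close> may be singular.\<close>
  then have "f u 1 = 0"
    using holomorphic_fun_eq_0_on_connected[OF hol[of u UNIV] open_UNIV connected_UNIV, of 0 1] u by simp
  then show ?thesis by (simp add: f_def b_def)
qed

end

global_interpretation scl: vector_space scl
  by unfold_locales (auto simp: fun_eq_iff algebra_simps)

lemma gl_embed_in_lie_g [simp]: "gl_embed A \<in> lie_g"
  using lie_k_subset_lie_g by (auto simp: lie_k_def)

section \<open>The unitary representation attached to a submodule of polynomials\<close>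

locale fock_module = fock C for C +
  fixes M :: "'n::finite var pol set"
  assumes Msub: "pol.subspace M" and Mact: "\<And>X m. X \<in> lie_g \<Longrightarrow> m \<in> M \<Longrightarrow> gact X m \<in> M"
begin

lemma perp_gact: assumes "u \<in> perp M" "X \<in> lie_g" shows "gact X u \<in> perp M"
proof -
  have "fip m (gact X u) = fip (gact (adjm X) m) u" for m
    using fip_gact[OF lie_g_adjm[OF assms(2)], of m u] by simp
  then show ?thesis using assms Mact[OF lie_g_adjm[OF assms(2)]] by (simp add: perp_def)
qed

lemma perp_opE: "u \<in> perp M \<Longrightarrow> opE A u \<in> perp M"
  using perp_gact[OF _ gl_embed_in_lie_g] by simp

lemma perp_opD: "u \<in> perp M \<Longrightarrow> transpose B = - B \<Longrightarrow> opD B u \<in> perp M"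
  using perp_gact[of u "block 0 B 0 0"] lie_p_plus_subset_lie_g by (auto simp: lie_p_plus_def)

lemma perp_opM: "u \<in> perp M \<Longrightarrow> transpose Y = - Y \<Longrightarrow> opM Y u \<in> perp M"
  using perp_gact[OF _ block_in_lie_g[of 0 Y 0], of u] by (simp add: transpose_zero)

lemma perp_dsub: assumes "u \<in> perp M" shows "dsub B u \<in> perp M"
proof -
  have "fip (dsub B u) m = 0" if "m \<in> M" for m
  proof (rule dsub_perp[OF perp_opE _ assms])
    fix v assume "v \<in> perp M"
    then have "fip m v = 0" using that by (simp add: perp_def)
    then show "fip v m = 0" using fip_cnj[of m v] by simp
  qed
  then have "fip m (dsub B u) = 0" if "m \<in> M" for m
    using that fip_cnj[of m "dsub B u"] by simp
  then show ?thesis by (simp add: perp_def)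
qed

lemma perp_funpow: "(\<And>u. u \<in> perp M \<Longrightarrow> T u \<in> perp M) \<Longrightarrow> u \<in> perp M \<Longrightarrow> (T ^^ j) u \<in> perp M"
  by (induction j) auto

lemma perp_pexp: assumes "u \<in> perp M" "transpose Z = - Z" shows "pexp (opD Z) u \<in> perp M"
proof -
  obtain N where N: "(opD Z ^^ N) u = 0" using lnil_opD[OF assms(2)] by (auto simp: lnil_def)
  show ?thesis unfolding pexp_eq[OF plin_opD N]
    by (intro perp_sum perp_psc perp_funpow perp_opD assms)
qed

lemma perp_thalf: "g \<in> gp \<Longrightarrow> u \<in> perp M \<Longrightarrow> thalf g u \<in> perp M"
  unfolding thalf_def by (intro perp_psc perp_dsub perp_pexp zof_skew gp_so_c gp_invertible)

lemma perp_pJ: "u \<in> perp M \<Longrightarrow> transpose Y = - Y \<Longrightarrow> pJ Y u J \<in> perp M"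
  unfolding pJ_def by (intro perp_sum perp_psc perp_funpow perp_opM)

text \<open>A double orthogonal complement in the role of the closure of \<open>M\<close>: it is
  closed at once, and its invariance reduces to the invariance of \<open>perp M\<close>, a matter of
  polynomials.\<close>

definition hsp :: "(nat \<Rightarrow> complex) set" where
  "hsp = {y \<in> ell2. \<forall>u\<in>perp M. l2ip y (crd u) = 0}"

lemma hsp_ell2: "y \<in> hsp \<Longrightarrow> y \<in> ell2"
  by (simp add: hsp_def)

lemma hsp_crd: "m \<in> M \<Longrightarrow> crd m \<in> hsp"
  by (simp add: hsp_def l2ip_crd perp_def)

text \<open>By unitarity the group element moves to \<open>u\<close> as its inverse. There
  \<open>thalf\<close> and the partial sums \<open>pJ\<close> stay in \<open>perp M\<close>, and
  orthogonality passes to the limit.\<close>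

lemma hsp_pact: assumes y: "y \<in> hsp" and g: "(g :: 'n mat2) \<in> gp" shows "pact g y \<in> hsp"
proof -
  have "l2ip (pact g y) (crd u) = 0" if u: "u \<in> perp M" for u
  proof -
    let ?h = "ginv g" and ?w = "thalf (ginv g) u"
    have h: "?h \<in> gp" by (rule gp_ginv[OF g])
    have sk: "transpose (yof ?h) = - yof ?h" using gp_contr[OF h] by (simp add: contr_def)
    have "l2ip (pact g y) (crd u) = l2ip (pact g y) (pact g (pact ?h (crd u)))"
      by (simp add: pact_inverse g)
    also have "\<dots> = l2ip y (rho ?h u)"
      using y by (subst pact_isometry) (auto simp: g h hsp_ell2 pact_crd)
    finally have e: "l2ip (pact g y) (crd u) = l2ip y (rho ?h u)" .
    have "l2ip y (crd (pJ (yof ?h) ?w J)) = 0" for J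
      using y perp_pJ[OF perp_thalf[OF h u] sk] by (simp add: hsp_def)
    moreover have "(\<lambda>J. l2ip y (crd (pJ (yof ?h) ?w J))) \<longlonglongrightarrow> l2ip y (rho ?h u)"
      unfolding rho_ey using ey_limit[OF gp_contr[OF h], of ?w] y by (intro l2ip_tendsto_right) (auto simp: hsp_ell2)
    ultimately have "l2ip y (rho ?h u) = 0" by (simp add: LIMSEQ_const_iff)
    with e show ?thesis by simp
  qed
  then show ?thesis using y g by (simp add: hsp_def)
qed

lemma hsp_subspace: "scl.subspace hsp"
  unfolding scl.subspace_def hsp_def by (auto simp: ell2_add ell2_scl l2ip_add_left l2ip_scl_left)

lemma hsp_hilbert: "hilbert_space scl hsp l2ip"
  unfolding hilbert_space_def
proof (intro conjI ballI allI impI)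
  show "vector_space scl" by (rule scl.vector_space_axioms)
  show "scl.subspace hsp" by (rule hsp_subspace)
  fix x y z c assume "x \<in> hsp" "y \<in> hsp" "z \<in> hsp"
  then show "l2ip (x + y) z = l2ip x z + l2ip y z" "l2ip (scl c x) y = c * l2ip x y" "l2ip y x = cnj (l2ip x y)"
    by (auto intro: l2ip_add_left l2ip_scl_left l2ip_cnj simp: hsp_ell2)
next
  fix x :: "nat \<Rightarrow> complex" assume x: "x \<in> hsp" "x \<noteq> 0"
  then have "l2n x \<noteq> 0" using l2n_eq_0 hsp_ell2 by blast
  then show "0 < Re (l2ip x x)" by (simp add: l2ip_self hsp_ell2 x(1) del: of_real_power)
next
  fix x :: "nat \<Rightarrow> nat \<Rightarrow> complex"
  assume "(\<forall>k. x k \<in> hsp) \<and> (\<forall>e>0. \<exists>M. \<forall>k\<ge>M. \<forall>l\<ge>M. ip_norm l2ip (x k - x l) < e)"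
  then have x: "\<And>k. x k \<in> hsp" and c: "\<And>e. e > 0 \<Longrightarrow> \<exists>M. \<forall>k\<ge>M. \<forall>l\<ge>M. l2n (x k - x l) < e"
    by (auto simp: ip_norm_l2ip ell2_diff hsp_ell2)
  obtain y where y: "y \<in> ell2" "(\<lambda>k. l2n (x k - y)) \<longlonglongrightarrow> 0"
    using ell2_complete[OF hsp_ell2[OF x] c] by blast
  have "l2ip y (crd u) = 0" if "u \<in> perp M" for u
  proof -
    have "(\<lambda>k. l2ip (x k) (crd u)) \<longlonglongrightarrow> l2ip y (crd u)"
      using y x by (intro l2ip_tendsto_left) (auto simp: hsp_ell2)
    then show ?thesis using x that by (simp add: hsp_def LIMSEQ_const_iff)
  qed
  then show "\<exists>y\<in>hsp. (\<lambda>k. ip_norm l2ip (x k - y)) \<longlonglongrightarrow> 0"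
    using y x by (intro bexI[of _ y]) (auto simp: hsp_def ip_norm_l2ip ell2_diff)
qed

lemma cover_path_gp: "\<gamma> \<in> cover_paths \<Longrightarrow> \<gamma> 1 \<in> gp"
  using so_star_subset_gp pathfinish_in_path_image[of \<gamma>] by (auto simp: cover_paths_def pathfinish_def)

text \<open>A path acts through its endpoint in the linear group, so invariance under homotopy is
  immediate.\<close>

lemma hsp_unitary_rep: "unitary_rep scl hsp l2ip (\<lambda>\<gamma> :: real \<Rightarrow> 'n mat2. pact (\<gamma> 1))"
  unfolding unitary_rep_def
proof (intro conjI ballI allI impI)
  show "hilbert_space scl hsp l2ip" by (rule hsp_hilbert)
next
  fix \<gamma> :: "real \<Rightarrow> 'n mat2" assume "\<gamma> \<in> cover_paths"
  then have g: "\<gamma> 1 \<in> gp" by (rule cover_path_gp)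
  show "bij_betw (pact (\<gamma> 1)) hsp hsp"
    by (rule bij_betw_byWitness[where f' = "pact (ginv (\<gamma> 1))"])
      (use g in \<open>auto simp: pact_inverse hsp_ell2 intro: hsp_pact gp_ginv\<close>)
  fix c x y assume x: "x \<in> hsp" "y \<in> hsp"
  then show "pact (\<gamma> 1) (x + y) = pact (\<gamma> 1) x + pact (\<gamma> 1) y" "pact (\<gamma> 1) (scl c x) = scl c (pact (\<gamma> 1) x)"
    "l2ip (pact (\<gamma> 1) x) (pact (\<gamma> 1) y) = l2ip x y"
    using g by (auto intro: pact_add pact_scl pact_isometry simp: hsp_ell2)
  fix \<delta> :: "real \<Rightarrow> 'n mat2" assume \<delta>: "\<delta> \<in> cover_paths"
  show "pact (\<gamma> 1 ** \<delta> 1) x = pact (\<gamma> 1) (pact (\<delta> 1) x)"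
    using g cover_path_gp[OF \<delta>] x by (simp add: pact_mult hsp_ell2)
next
  fix \<gamma> \<delta> :: "real \<Rightarrow> 'n mat2" and x :: "nat \<Rightarrow> complex" assume "homotopic_paths so_star_group \<gamma> \<delta>"
  then have "\<gamma> 1 = \<delta> 1" using homotopic_paths_imp_pathfinish by (auto simp: pathfinish_def)
  then show "pact (\<gamma> 1) x = pact (\<delta> 1) x" by simp
next
  fix x \<gamma> and e :: real assume x: "x \<in> hsp" and \<gamma>: "(\<gamma> :: real \<Rightarrow> 'n mat2) \<in> cover_paths" and e: "e > 0"
  obtain d where d: "d > 0" "\<And>h. h \<in> gp \<Longrightarrow> dist h (\<gamma> 1) < d \<Longrightarrow> l2n (pact h x - pact (\<gamma> 1) x) < e"
    using pact_continuous[OF cover_path_gp[OF \<gamma>] hsp_ell2[OF x] e] by blast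
  show "\<exists>d>0. \<forall>\<delta>\<in>cover_paths. (\<forall>t\<in>{0..1}. dist (\<delta> t) (\<gamma> t) < d) \<longrightarrow> ip_norm l2ip (pact (\<delta> 1) x - pact (\<gamma> 1) x) < e"
  proof (intro exI[of _ d] conjI ballI impI d(1))
    fix \<delta> :: "real \<Rightarrow> 'n mat2" assume \<delta>: "\<delta> \<in> cover_paths" and "\<forall>t\<in>{0..1}. dist (\<delta> t) (\<gamma> t) < d"
    then have "dist (\<delta> 1) (\<gamma> 1) < d" by simp
    then show "ip_norm l2ip (pact (\<delta> 1) x - pact (\<gamma> 1) x) < e"
      using d(2)[OF cover_path_gp[OF \<delta>]] cover_path_gp[OF \<delta>] cover_path_gp[OF \<gamma>] hsp_ell2[OF x]
      by (simp add: ip_norm_l2ip ell2_diff)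
  qed
qed

end

section \<open>\<open>K\<close>-finite vectors\<close>

text \<open>The family may have repetitions, and then a difference of two equal members is the
  relation.\<close>

lemma scl_dependent:
  assumes "finite B" "card B \<le> N" and x: "\<And>j. j \<le> N \<Longrightarrow> x j \<in> scl.span B"
  obtains c where "\<exists>j\<le>N. c j \<noteq> 0" "(\<Sum>j\<le>N. scl (c j) (x j)) = 0"
proof (cases "inj_on x {..N}")
  case True
  have "\<not> scl.independent (x ` {..N})"
  proof
    assume "scl.independent (x ` {..N})"
    then have "card (x ` {..N}) \<le> card B" using scl.independent_span_bound[OF assms(1)] x by blast
    then show False using card_image[OF True] assms(2) by simp
  qed
  then obtain u where u: "\<exists>v\<in>x ` {..N}. u v \<noteq> 0" "(\<Sum>v\<in>x ` {..N}. scl (u v) v) = 0"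
    using scl.dependent_finite[of "x ` {..N}"] by auto
  have "(\<Sum>j\<le>N. scl (u (x j)) (x j)) = 0"
    using u(2) unfolding sum.reindex[OF True] comp_def .
  then show ?thesis using u(1) that[of "\<lambda>j. u (x j)"] by auto
next
  case False
  then obtain i j where ij: "i \<le> N" "j \<le> N" "i \<noteq> j" "x i = x j" by (auto simp: inj_on_def)
  define c where "c k = (if k = i then 1 else if k = j then - 1 else (0 :: complex))" for k
  have "(\<Sum>k\<le>N. scl (c k) (x k)) = (\<Sum>k\<in>{i, j}. scl (c k) (x k))"
    by (rule sum.mono_neutral_right) (use ij in \<open>auto simp: c_def fun_eq_iff\<close>)
  also have "\<dots> = 0" using ij by (simp add: c_def fun_eq_iff)
  finally have "(\<Sum>k\<le>N. scl (c k) (x k)) = 0" .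
  moreover have "\<exists>k\<le>N. c k \<noteq> 0" using ij(1) by (intro exI[of _ i]) (simp add: c_def)
  ultimately show ?thesis using that by blast
qed

lemma crd_span: "(p :: 'v::countable pol) \<in> pol.span B \<Longrightarrow> crd p \<in> scl.span (crd ` B)"
proof (induction p rule: pol.span_induct_alt)
  case base
  have "crd (0 :: 'v pol) = scl 0 (crd (0 :: 'v pol))" using crd_psc[of 0 "0 :: 'v pol"] by simp
  then have "crd (0 :: 'v pol) = 0" by (simp add: fun_eq_iff)
  then show ?case using scl.span_zero by metis
next
  case (step c x y)
  then show ?case unfolding crd_add crd_psc by (intro scl.span_add scl.span_scale) (auto intro: scl.span_base)
qed

lemma fip_span_left: "\<lbrakk>p \<in> pol.span B; \<And>b. b \<in> B \<Longrightarrow> fip b u = 0\<rbrakk> \<Longrightarrow> fip p u = 0"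
  by (induction p rule: pol.span_induct_alt) (simp_all add: fip_add_left fip_psc_left)

lemma finite_projection:
  assumes "finite B"
  obtains m where "m \<in> pol.span B" "\<And>b. b \<in> pol.span B \<Longrightarrow> fip b (p - m) = 0"
proof -
  have "\<forall>p. \<exists>m \<in> pol.span B. \<forall>b\<in>B. fip b (p - m) = 0"
    using assms
  proof (induction B rule: finite_induct)
    case empty
    then show ?case by (auto intro: pol.span_zero)
  next
    case (insert b B)
    have mono: "m \<in> pol.span B \<Longrightarrow> m \<in> pol.span (insert b B)" for m
      using pol.span_mono[of B "insert b B"] by auto
    obtain mb where mb: "mb \<in> pol.span B" "\<And>x. x \<in> B \<Longrightarrow> fip x (b - mb) = 0" using insert.IH by blast
    define b' where "b' = b - mb"
    have b': "fip x b' = 0" if "x \<in> pol.span B" for x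
      using fip_span_left[OF that] mb(2) by (auto simp: b'_def)
    show ?case
    proof
      fix p
      obtain m where m: "m \<in> pol.span B" "\<And>x. x \<in> B \<Longrightarrow> fip x (p - m) = 0" using insert.IH by blast
      have m0: "fip x (p - m) = 0" if "x \<in> pol.span B" for x
        using fip_span_left[OF that] m(2) by auto
      \<comment> \<open>Gram-Schmidt step. If \<open>b' = 0\<close> then the quotient is 0 by
        convention and \<open>c\<close> remains correct.\<close>
      define c where "c = fip (p - m) b' / fip b' b'"
      have c: "fip b' (p - m) = cnj c * fip b' b'"
      proof (cases "b' = 0")
        case False
        then have "fip b' b' \<noteq> 0" by (simp add: fip_self_eq_0)
        then show ?thesis using fip_cnj[of b' "p - m"] fip_cnj[of b' b'] by (simp add: c_def)
      qed simp
      have "m + psc c b' \<in> pol.span (insert b B)"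
        unfolding b'_def by (intro pol.span_add pol.span_scale pol.span_diff mono m(1) mb(1) pol.span_base) simp
      moreover have "fip x (p - (m + psc c b')) = 0" if "x \<in> insert b B" for x
      proof -
        have e: "fip x (p - (m + psc c b')) = fip x (p - m) - cnj c * fip x b'" for x
          by (simp add: fip_diff_right fip_add_right fip_psc_right)
        have "fip b y = fip b' y + fip mb y" for y by (simp add: b'_def fip_diff_left)
        then show ?thesis using that c b' m0 mb(1) by (auto simp: e pol.span_base)
      qed
      ultimately show "\<exists>m\<in>pol.span (insert b B). \<forall>x\<in>insert b B. fip x (p - m) = 0" by blast
    qed
  qed
  then obtain m where "m \<in> pol.span B" "\<And>b. b \<in> B \<Longrightarrow> fip b (p - m) = 0" by blast
  then show ?thesis using that fip_span_left by blast
qed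

section \<open>Degrees, and finite-dimensional stable subspaces\<close>

context fock
begin

text \<open>No inert variable occurs. This restores finiteness: among the infinitely many variables
  only those in columns from \<open>C\<close> remain.\<close>

definition conly :: "'n::finite var pol \<Rightarrow> bool" where
  "conly p \<longleftrightarrow> (\<forall>v. fst (snd v) \<notin> C \<longrightarrow> der v p = 0)"

lemma conly_zero: "conly 0"
  and conly_add: "conly p \<Longrightarrow> conly q \<Longrightarrow> conly (p + q)"
  and conly_psc: "conly p \<Longrightarrow> conly (psc c p)"
  and conly_minus: "conly p \<Longrightarrow> conly (- p)"
  and conly_mult: "conly p \<Longrightarrow> conly q \<Longrightarrow> conly (p * q)"
  and conly_diff: "conly p \<Longrightarrow> conly q \<Longrightarrow> conly (p - q)"
  by (auto simp: conly_def der_add der_psc der_minus der_diff der_mult)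

lemma conly_sum: "(\<And>i. i \<in> A \<Longrightarrow> conly (f i)) \<Longrightarrow> conly (sum f A)"
  by (induction A rule: infinite_finite_induct) (auto intro: conly_zero conly_add)

lemma conly_pvar: "c \<in> C \<Longrightarrow> conly (pvar (l, c, s))"
  by (auto simp: conly_def der_pvar)

lemma conly_der: "conly p \<Longrightarrow> conly (der v p)"
  unfolding conly_def using der_commute[of _ v p] by auto

lemma conly_opE: "conly p \<Longrightarrow> conly (opE A p)"
  unfolding opE_def by (intro conly_diff conly_minus conly_sum conly_psc conly_mult conly_pvar conly_der) auto

lemma conly_opM: "conly p \<Longrightarrow> conly (opM A p)"
  unfolding opM_def qf_def by (intro conly_mult conly_sum conly_psc conly_pvar) auto

definition cdm :: "('n::finite var \<Rightarrow>\<^sub>0 nat) \<Rightarrow> nat" where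
  "cdm m = (\<Sum>v\<in>UNIV \<times> C \<times> UNIV. Poly_Mapping.lookup m v)"

lemma chom_single: "chom (int (cdm m)) (Poly_Mapping.single m 1)"
proof (induction m rule: mono_induct)
  case zero
  then show ?case using chom_one by (simp add: cdm_def flip: one_poly_mapping_def)
next
  case (step m v)
  obtain l c s where v: "v = (l, c, s)" by (cases v)
  have "cdm (m + Poly_Mapping.single v 1) = cdm m + (\<Sum>w\<in>UNIV \<times> C \<times> UNIV. if w = v then 1 else 0)"
    by (simp add: cdm_def lookup_add lookup_single when_def sum.distrib eq_commute del: One_nat_def)
  also have "\<dots> = cdm m + (if c \<in> C then 1 else 0)"
    using finC by (simp add: v)
  finally show ?case
    using chom_pvar[OF step, of c l s] by (simp add: v pvar_times_single split: if_splits)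
qed

lemma chom_bas: "chom (int (cdm (menum n :: 'n::finite var \<Rightarrow>\<^sub>0 nat))) (bas n :: 'n var pol)"
  unfolding bas_def by (intro chom_psc chom_single)

lemma conly_crd:
  fixes p :: "'n::finite var pol"
  assumes "conly p" "crd p n \<noteq> 0"
  shows "Poly_Mapping.keys (menum n :: 'n var \<Rightarrow>\<^sub>0 nat) \<subseteq> UNIV \<times> C \<times> UNIV"
proof
  fix v assume v: "v \<in> Poly_Mapping.keys (menum n :: 'n var \<Rightarrow>\<^sub>0 nat)"
  let ?m = "menum n :: 'n var \<Rightarrow>\<^sub>0 nat"
  have "Poly_Mapping.single v 1 + (?m - Poly_Mapping.single v 1) = ?m"
    using v by (intro poly_mapping_eqI) (auto simp: lookup_add lookup_minus lookup_single when_def in_keys_iff)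
  then have "Poly_Mapping.single ?m 1 = pvar v * Poly_Mapping.single (?m - Poly_Mapping.single v 1) 1"
    by (simp add: pvar_times_single add.commute)
  then have "crd p n = of_real (1 / sqrt (mfact ?m)) * fip (der v p) (Poly_Mapping.single (?m - Poly_Mapping.single v 1) 1)"
    by (simp add: crd_def bas_def fip_psc_right fip_pvar_right)
  then have "der v p \<noteq> 0" using assms(2) by auto
  then have "fst (snd v) \<in> C" using assms(1) unfolding conly_def by blast
  then show "v \<in> UNIV \<times> C \<times> UNIV" by (cases v) auto
qed

lemma finite_monomials:
  "finite {n. Poly_Mapping.keys (menum n :: 'n::finite var \<Rightarrow>\<^sub>0 nat) \<subseteq> UNIV \<times> C \<times> UNIV \<and> cdm (menum n :: 'n var \<Rightarrow>\<^sub>0 nat) \<le> N}"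
    (is "finite ?S")
proof -
  let ?V = "UNIV \<times> C \<times> UNIV :: 'n var set"
  let ?f = "\<lambda>n. Poly_Mapping.lookup (menum n :: 'n var \<Rightarrow>\<^sub>0 nat)"
  have fV: "finite ?V" using finC by simp
  have "?f ` ?S \<subseteq> {f. \<forall>x. (x \<in> ?V \<longrightarrow> f x \<in> {..N}) \<and> (x \<notin> ?V \<longrightarrow> f x = 0)}"
  proof (clarify, intro conjI impI)
    fix n and x :: "'n var"
    assume n: "Poly_Mapping.keys (menum n :: 'n var \<Rightarrow>\<^sub>0 nat) \<subseteq> ?V" "cdm (menum n :: 'n var \<Rightarrow>\<^sub>0 nat) \<le> N"
    { assume "x \<in> ?V"
      then have "?f n x \<le> cdm (menum n :: 'n var \<Rightarrow>\<^sub>0 nat)"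
        unfolding cdm_def using fV by (intro member_le_sum) auto
      then show "?f n x \<in> {..N}" using n by simp }
    { assume "x \<notin> ?V" then show "?f n x = 0" using n(1) by (auto simp: in_keys_iff) }
  qed
  then have "finite (?f ` ?S)"
    using finite_set_of_finite_funs[OF fV finite_atMost] finite_subset by blast
  moreover have "inj_on ?f ?S"
    by (rule inj_onI) (metis bij_menum bij_is_inj injD poly_mapping_eqI)
  ultimately show ?thesis by (rule finite_imageD)
qed

text \<open>For block diagonal elements both exponentials disappear, so polynomials go to
  polynomials.\<close>

lemma rho_block:
  assumes "g \<in> gp" "ur g = 0" "ll g = 0"
  shows "rho g v = crd (psc (1 / det (ul g) ^ card C) (dsub (matrix_inv (ul g)) v))"
proof -
  have "cnjm 0 = (0 :: complex^'a^'a)" by (simp add: vec_eq_iff)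
  then show ?thesis
    unfolding rho_def phi_def thalf_def crd_def fun_eq_iff
    by (simp add: zof_def yof_def assms pexp_zero_op)
qed

lemma span_pvar:
  assumes "x \<in> pol.span B" "w \<in> F"
  shows "pvar w * x \<in> pol.span ((\<lambda>(w, b). pvar w * b) ` (F \<times> B))"
  using assms(1)
proof (induction x rule: pol.span_induct_alt)
  case (step c x y)
  have "pvar w * x \<in> (\<lambda>(w, b). pvar w * b) ` (F \<times> B)" using step assms(2) by force
  then have "psc c (pvar w * x) + pvar w * y \<in> pol.span ((\<lambda>(w, b). pvar w * b) ` (F \<times> B))"
    using step(2) by (intro pol.span_add pol.span_scale) (rule pol.span_base, blast, blast)
  then show ?case by (simp add: distrib_left psc_mult_right)
qed (simp add: pol.span_zero)

lemma span_stable: "plin T \<Longrightarrow> (\<And>b. b \<in> B \<Longrightarrow> T b \<in> pol.span B') \<Longrightarrow> x \<in> pol.span B \<Longrightarrow> T x \<in> pol.span B'"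
  by (erule pol.span_induct_alt[of x B]) (auto simp: plin_zero plin_add plin_psc intro: pol.span_zero pol.span_add pol.span_scale)

lemma finite_stable:
  fixes p :: "'n::finite var pol"
  obtains B where "finite B" "p \<in> pol.span B"
    "\<And>A x. x \<in> pol.span B \<Longrightarrow> opE A x \<in> pol.span B" "\<And>A x. x \<in> pol.span B \<Longrightarrow> dsub A x \<in> pol.span B"
proof -
  have "\<exists>B. finite B \<and> p \<in> pol.span B \<and> (\<forall>A. \<forall>b\<in>B. opE A b \<in> pol.span B \<and> dsub A b \<in> pol.span B)"
  proof (induction p rule: pol_induct)
    case one
    have "(1 :: 'n var pol) \<in> pol.span {1}" by (rule pol.span_base) simp
    then show ?case
      by (intro exI[of _ "{1}"]) (auto simp: opE_one psc_minus_left intro!: pol.span_neg pol.span_scale)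
  next
    case (scale c p)
    then show ?case using pol.span_scale by blast
  next
    case (add p q)
    then obtain B B' where B: "finite B" "p \<in> pol.span B" "\<And>A b. b \<in> B \<Longrightarrow> opE A b \<in> pol.span B \<and> dsub A b \<in> pol.span B"
      and B': "finite B'" "q \<in> pol.span B'" "\<And>A b. b \<in> B' \<Longrightarrow> opE A b \<in> pol.span B' \<and> dsub A b \<in> pol.span B'" by blast
    have m: "x \<in> pol.span B \<Longrightarrow> x \<in> pol.span (B \<union> B')" "x \<in> pol.span B' \<Longrightarrow> x \<in> pol.span (B \<union> B')" for x
      using pol.span_mono[of B "B \<union> B'"] pol.span_mono[of B' "B \<union> B'"] by auto
    show ?case
      using B B' by (intro exI[of _ "B \<union> B'"] conjI allI ballI pol.span_add) (auto intro: m)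
  next
    case (var v p)
    then obtain B where B: "finite B" "p \<in> pol.span B" "\<And>A b. b \<in> B \<Longrightarrow> opE A b \<in> pol.span B \<and> dsub A b \<in> pol.span B" by blast
    \<comment> \<open>All variables in the same column and half as \<open>v\<close>: both
      \<open>opE\<close> and \<open>dsub\<close> mix the rows but keep column and half, so
      \<open>F\<close> times \<open>B\<close> spans a stable space.\<close>
    define F where "F = (UNIV \<times> {fst (snd v)} \<times> {snd (snd v)} :: 'n var set)"
    let ?B = "(\<lambda>(w, b). pvar w * b) ` (F \<times> B)"
    have vF: "v \<in> F" by (cases v) (simp add: F_def)
    have j: "(j, c, s) \<in> F" if "(l, c, s) \<in> F" for l c s j using that by (simp add: F_def)
    have "opE A b \<in> pol.span ?B \<and> dsub A b \<in> pol.span ?B" if b: "b \<in> ?B" for A b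
    proof -
      obtain l c s x where x: "b = pvar (l, c, s) * x" "(l, c, s) \<in> F" "x \<in> B" using b by auto
      note sp = span_pvar[OF _ j[OF x(2)]]
      have x': "x \<in> pol.span B" "opE A x \<in> pol.span B" "dsub A x \<in> pol.span B" using B x pol.span_base by auto
      show ?thesis unfolding x(1) opE_pvar dsub_pvar
        by (auto intro!: pol.span_diff pol.span_sum pol.span_scale sp x' simp: pol.span_zero)
    qed
    then show ?case
      using B span_pvar[OF B(2) vF] by (intro exI[of _ ?B]) (auto simp: F_def)
  qed
  then obtain B where B: "finite B" "p \<in> pol.span B" "\<And>A b. b \<in> B \<Longrightarrow> opE A b \<in> pol.span B"
    "\<And>A b. b \<in> B \<Longrightarrow> dsub A b \<in> pol.span B" by blast
  show ?thesis
    by (rule that[OF B(1,2)]) (auto intro: span_stable[OF plin_opE B(3)] span_stable[OF plin_dsub B(4)])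
qed

end

section \<open>The central circle of K and the degrees of K-finite vectors\<close>

definition tor :: "real \<Rightarrow> 'n::finite mat2" where
  "tor t = block (cscale (cis t) (mat 1)) 0 0 (cscale (cis (- t)) (mat 1))"

lemma tor_nth: "tor t $ r $ s = (if r = s then case r of Inl i \<Rightarrow> cis t | Inr i \<Rightarrow> cis (- t) else 0)"
  by (cases r; cases s) (auto simp: tor_def cscale_nth mat_def)

lemma tor_quarters: "ul (tor t) = cscale (cis t) (mat 1)" "ur (tor t) = 0" "ll (tor t) = 0"
  by (simp_all add: vec_eq_iff tor_nth ul_def ur_def ll_def cscale_nth mat_def)

lemma tor_zero: "tor 0 = mat 1"
  by (auto simp: vec_eq_iff tor_nth mat_def split: sum.splits)

lemma ginv_tor: "ginv (tor t) = (tor (- t) :: 'n::finite mat2)"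
proof -
  have "ginv (tor t) $ r $ s = (tor (- t) :: 'n mat2) $ r $ s" for r s
    by (cases r; cases s) (auto simp: ginv_nth tor_nth)
  then show ?thesis by (simp add: vec_eq_iff)
qed

lemma tor_so_star: "(tor t :: 'a::finite mat2) \<in> so_star_group"
proof -
  have m: "(A ** tor t) $ r $ s = A $ r $ s * (case s of Inl i \<Rightarrow> cis t | Inr i \<Rightarrow> cis (- t))" for A :: "'a mat2" and r s
    by (simp add: matmul_nth tor_nth if_distrib cong: if_cong)
  have "transpose (tor t) ** sym_form ** tor t = (sym_form :: 'a mat2)"
  proof -
    have "(transpose (tor t) ** sym_form ** tor t) $ r $ s = (sym_form :: 'a mat2) $ r $ s" for r s
      unfolding m by (cases r; cases s) (auto simp: sym_form_mult transpose_def tor_nth sym_form_nth cis_mult)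
    then show ?thesis by (simp add: vec_eq_iff)
  qed
  moreover have "conj_transpose (tor t) ** herm_form ** tor t = (herm_form :: 'a mat2)"
  proof -
    have "(conj_transpose (tor t) ** herm_form ** tor t) $ r $ s = (herm_form :: 'a mat2) $ r $ s" for r s
      unfolding m by (cases r; cases s) (auto simp: herm_form_mult conj_transpose_nth tor_nth herm_form_nth cis_mult cis_cnj)
    then show ?thesis by (simp add: vec_eq_iff)
  qed
  moreover have "det (tor t :: 'a mat2) = 1"
  proof -
    have "det (tor t :: 'a mat2) = (\<Prod>r\<in>UNIV. (tor t :: 'a mat2) $ r $ r)"
      by (rule det_diagonal) (simp add: tor_nth)
    also have "\<dots> = (\<Prod>i\<in>(UNIV :: 'a set). cis t) * (\<Prod>i\<in>(UNIV :: 'a set). cis (- t))"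
      unfolding UNIV_Plus_UNIV[symmetric] by (subst prod.Plus) (simp_all add: tor_nth)
    also have "\<dots> = 1" by (simp add: cis_mult flip: power_mult_distrib)
    finally show ?thesis .
  qed
  ultimately show ?thesis by (simp add: so_star_group_def)
qed

lemma continuous_on_matrixI:
  fixes f :: "'t::topological_space \<Rightarrow> complex^'m^'k"
  assumes "\<And>i j. continuous_on S (\<lambda>s. f s $ i $ j)"
  shows "continuous_on S f"
proof -
  have "continuous_on S (\<lambda>s. f s $ i)" for i
    using continuous_on_vec_lambda[of S "\<lambda>j s. f s $ i $ j"] assms by simp
  then show ?thesis using continuous_on_vec_lambda[of S "\<lambda>i s. f s $ i"] by simp
qed

lemma cartan_inv_nth: "cartan_inv X $ r $ s = sg r * sg s * X $ r $ s"
  by (simp add: cartan_inv_def herm_form_mult mult_ac)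

lemma cartan_inv_fixed: "cartan_inv X = X \<longleftrightarrow> ur X = 0 \<and> ll X = 0"
proof
  assume X: "cartan_inv X = X"
  have "X $ Inl i $ Inr j = 0" "X $ Inr i $ Inl j = 0" for i j
    using arg_cong[OF X, of "\<lambda>X. X $ Inl i $ Inr j"] arg_cong[OF X, of "\<lambda>X. X $ Inr i $ Inl j"]
    by (simp_all add: cartan_inv_nth)
  then show "ur X = 0 \<and> ll X = 0" by (simp add: vec_eq_iff ur_def ll_def)
next
  assume "ur X = 0 \<and> ll X = 0"
  then have X: "X $ Inl i $ Inr j = 0" "X $ Inr i $ Inl j = 0" for i j
    by (auto simp: ur_def ll_def vec_eq_iff)
  have "cartan_inv X $ r $ s = X $ r $ s" for r s
    by (cases r; cases s) (simp_all add: cartan_inv_nth X)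
  then show "cartan_inv X = X" by (simp add: vec_eq_iff)
qed

lemma cover_K_end:
  assumes "\<kappa> \<in> cover_K"
  shows "\<kappa> 1 \<in> gp" "ur (\<kappa> 1) = 0" "ll (\<kappa> 1) = 0"
proof -
  have "\<kappa> 1 = (cartan_inv \<circ> \<kappa>) 1"
    using assms homotopic_paths_imp_pathfinish by (fastforce simp: cover_K_def pathfinish_def)
  then have "cartan_inv (\<kappa> 1) = \<kappa> 1" by simp
  then show "ur (\<kappa> 1) = 0" "ll (\<kappa> 1) = 0" by (simp_all add: cartan_inv_fixed)
  show "\<kappa> 1 \<in> gp"
    using assms so_star_subset_gp pathfinish_in_path_image[of \<kappa>] by (auto simp: cover_K_def cover_paths_def pathfinish_def)
qed

lemma tor_cover_K: "(\<lambda>s. tor (t * s) :: 'a::finite mat2) \<in> cover_K"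
proof -
  have "continuous_on {0..1} (\<lambda>s. (tor (t * s) :: 'a mat2) $ i $ j)" for i j
    by (cases "i = j"; cases j) (auto simp: tor_nth intro!: continuous_intros)
  then have "path (\<lambda>s. tor (t * s) :: 'a mat2)"
    unfolding path_def by (rule continuous_on_matrixI)
  moreover have "path_image (\<lambda>s. tor (t * s) :: 'a mat2) \<subseteq> so_star_group"
    by (auto simp: path_image_def tor_so_star)
  ultimately show ?thesis
    by (simp add: cover_K_def cover_paths_def pathstart_def tor_zero comp_def cartan_inv_fixed[THEN iffD2] tor_quarters homotopic_paths_refl)
qed

context fock
begin

lemma l2ip_bas: assumes "y \<in> ell2" shows "l2ip y (crd (bas n :: 'n::finite var pol)) = y n"
  using fun_cong[OF pact_mat1[OF assms, where 'a = 'n], of n] by (simp add: pact_def ginv_mat1 rho_mat1)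

text \<open>The circle acts by a character of the degree, times a common factor from the
  determinant. That factor depends on \<open>t\<close>, but only its being nonzero matters.\<close>

lemma pact_tor:
  obtains K where "K \<noteq> 0" "\<And>n y. y \<in> ell2 \<Longrightarrow>
    pact (tor t :: 'n::finite mat2) y n = K * cis (- t) ^ cdm (menum n :: 'n var \<Rightarrow>\<^sub>0 nat) * y n"
proof -
  let ?g = "tor (- t) :: 'n mat2"
  have g: "?g \<in> gp" using tor_so_star so_star_subset_gp by blast
  define K where "K = cnj (1 / det (ul ?g) ^ card C)"
  have "det (ul ?g) \<noteq> 0" using gp_invertible[OF g] by (simp add: invertible_det_nz)
  then have K0: "K \<noteq> 0" by (simp add: K_def)
  have mi: "matrix_inv (cscale (cis (- t)) (mat 1)) = (cscale (cis t) (mat 1) :: complex^'n^'n)"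
  proof -
    let ?A = "cscale (cis (- t)) (mat 1) :: complex^'n^'n" and ?B = "cscale (cis t) (mat 1) :: complex^'n^'n"
    have "?A ** matrix_inv ?A = mat 1"
      using gp_invertible[OF g] matrix_inv_mult(1)[of ?A] by (simp add: tor_quarters)
    then have "?B ** (?A ** matrix_inv ?A) = ?B" by simp
    then show ?thesis by (simp add: matrix_mul_assoc) (simp add: cscale_mult cscale_cscale cis_mult)
  qed
  have "pact (tor t :: 'n mat2) y n = K * cis (- t) ^ cdm (menum n :: 'n var \<Rightarrow>\<^sub>0 nat) * y n" if y: "y \<in> ell2" for y n
  proof -
    let ?d = "cdm (menum n :: 'n var \<Rightarrow>\<^sub>0 nat)"
    have "dsub (cscale (cis t) (mat 1)) (bas n) = psc (cis t ^ ?d) (bas n :: 'n var pol)"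
      using chom_bas[of n, unfolded chom_def, rule_format, of "cis t"] by simp
    then have "rho ?g (bas n) = scl (1 / det (ul ?g) ^ card C * cis t ^ ?d) (crd (bas n :: 'n var pol))"
      by (simp add: rho_block g tor_quarters mi crd_psc mult_ac)
    then have "pact (tor t :: 'n mat2) y n = cnj (1 / det (ul ?g) ^ card C * cis t ^ ?d) * y n"
      unfolding pact_def ginv_tor by (simp only:) (simp only: l2ip_scl_right y l2ip_bas crd_ell2)
    then show ?thesis by (simp add: K_def cis_cnj)
  qed
  then show ?thesis using K0 that by blast
qed

text \<open>A Vandermonde argument: a relation between the \<open>N + 1\<close> translates at
  equidistant times gives a nonzero polynomial of degree at most \<open>N\<close> that has a root
  for every occurring degree.\<close>

lemma torus_finite_degrees:
  fixes y :: "nat \<Rightarrow> complex"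
  assumes y: "y \<in> ell2" and B: "finite B" and sp: "\<And>t. pact (tor t :: 'n::finite mat2) y \<in> scl.span B"
  shows "finite {cdm (menum n :: 'n var \<Rightarrow>\<^sub>0 nat) | n. y n \<noteq> 0}" (is "finite ?D")
proof (rule ccontr)
  assume inf: "infinite ?D"
  define N where "N = card B"
  obtain D where D: "finite D" "card D = Suc N" "D \<subseteq> ?D"
    using infinite_arbitrarily_large[OF inf] by blast
  \<comment> \<open>The angles \<open>th * d\<close> then lie in \<open>[0, 1]\<close>, where the
    cosine is injective, so different degrees give different roots.\<close>
  define th where "th = 1 / real (Suc (Max D))"
  have th: "0 \<le> th * real d" "th * real d \<le> 1" if "d \<in> D" for d
    using Max_ge[OF D(1) that] by (auto simp: th_def divide_simps)
  have "\<exists>K. \<forall>j. K j \<noteq> 0 \<and> (\<forall>n. pact (tor (real j * th) :: 'n mat2) y n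
      = K j * cis (- (real j * th)) ^ cdm (menum n :: 'n var \<Rightarrow>\<^sub>0 nat) * y n)"
    by (rule choice) (metis pact_tor y)
  then obtain K where K: "\<And>j. K j \<noteq> 0"
    "\<And>j n. pact (tor (real j * th) :: 'n mat2) y n = K j * cis (- (real j * th)) ^ cdm (menum n :: 'n var \<Rightarrow>\<^sub>0 nat) * y n" by blast
  obtain c where c: "\<exists>j\<le>N. c j \<noteq> 0" "(\<Sum>j\<le>N. scl (c j) (pact (tor (real j * th) :: 'n mat2) y)) = 0"
    using scl_dependent[OF B, of N "\<lambda>j. pact (tor (real j * th) :: 'n mat2) y"] sp by (auto simp: N_def)
  let ?P = "\<lambda>z. (\<Sum>j\<le>N. (c j * K j) * z ^ j) = 0"
  have root: "?P (cis (- (th * real d)))" if d: "d \<in> D" for d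
  proof -
    obtain n where n: "d = cdm (menum n :: 'n var \<Rightarrow>\<^sub>0 nat)" "y n \<noteq> 0" using d D(3) by blast
    have "(sum f A) n = (\<Sum>j\<in>A. f j n)" for f :: "nat \<Rightarrow> nat \<Rightarrow> complex" and A
      by (induction A rule: infinite_finite_induct) auto
    then have "(\<Sum>j\<le>N. c j * pact (tor (real j * th) :: 'n mat2) y n) = 0"
      using fun_cong[OF c(2), of n] by simp
    then have "(\<Sum>j\<le>N. c j * (K j * cis (- (real j * th)) ^ d * y n)) = 0"
      by (simp add: K(2) n(1))
    moreover have "cis (- (real j * th)) ^ d = cis (- (th * real d)) ^ j" for j
      by (simp only: Complex.DeMoivre) (rule arg_cong[of _ _ cis], simp add: mult_ac)
    ultimately have "(\<Sum>j\<le>N. (c j * K j) * cis (- (th * real d)) ^ j) * y n = 0"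
      unfolding sum_distrib_right by (simp only: mult.assoc)
    then show ?thesis using n(2) by simp
  qed
  have inj: "inj_on (\<lambda>d. cis (- (th * real d))) D"
  proof (rule inj_onI)
    fix d e assume de: "d \<in> D" "e \<in> D" and "cis (- (th * real d)) = cis (- (th * real e))"
    then have "cos (th * real d) = cos (th * real e)" by (simp add: complex_eq_iff)
    then have "th * real d = th * real e"
      using th[OF de(1)] th[OF de(2)] pi_gt3 by (rule_tac cos_inj_pi) linarith+
    then show "d = e" by (simp add: th_def)
  qed
  have k: "\<exists>j\<le>N. c j * K j \<noteq> 0" using c(1) K(1) by auto
  have "Suc N = card ((\<lambda>d. cis (- (th * real d))) ` D)" by (simp add: card_image[OF inj] D(2))
  also have "\<dots> \<le> card {z. ?P z}"
    by (rule card_mono[OF polyfun_rootbound_finite[OF k]]) (use root in auto)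
  also have "\<dots> \<le> N" by (rule polyfun_rootbound_card[OF k])
  finally show False by simp
qed

end

text \<open>A homogeneous spanning set stands in for a grading of \<open>M\<close>.\<close>

locale graded_fock_module = fock_module C M for C and M :: "'n::finite var pol set" +
  fixes W :: "'n var pol set"
  assumes MW: "M \<subseteq> pol.span W" and WM: "W \<subseteq> M"
    and W: "\<And>w. w \<in> W \<Longrightarrow> conly w \<and> (\<exists>d. chom d w)"
begin

lemma M_conly: assumes "m \<in> M" shows "conly m"
proof -
  have "m \<in> pol.span W" using assms MW by blast
  then show ?thesis
    by (induction m rule: pol.span_induct_alt) (auto intro: conly_zero conly_add conly_psc dest: W)
qed

text \<open>Only the central circle is needed: it bounds the degrees, hence \<open>y\<close> is a
  polynomial \<open>p\<close>, and the projection \<open>m\<close> of \<open>p\<close> to the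
  relevant homogeneous part of \<open>M\<close> turns out to be \<open>p\<close>.\<close>

lemma K_finite_subset:
  assumes y: "y \<in> hsp" and B: "finite B" and sp: "\<And>t. pact (tor t :: 'n mat2) y \<in> scl.span B"
  shows "y \<in> crd ` M"
proof -
  let ?mn = "menum :: nat \<Rightarrow> 'n var \<Rightarrow>\<^sub>0 nat" and ?bas = "bas :: nat \<Rightarrow> 'n var pol"
  let ?V = "UNIV \<times> C \<times> UNIV :: 'n var set"
  define D where "D = {cdm (?mn n) | n. y n \<noteq> 0}"
  have D: "finite D" unfolding D_def by (rule torus_finite_degrees[OF hsp_ell2[OF y] B sp])
  then obtain N where N: "D \<subseteq> {..N}" using finite_nat_iff_bounded_le by blast
  define S where "S = {n. Poly_Mapping.keys (?mn n) \<subseteq> ?V \<and> cdm (?mn n) \<in> D}"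
  have S: "finite S"
    by (rule finite_subset[OF _ finite_monomials[where 'n = 'n, of N]]) (use N in \<open>auto simp: S_def\<close>)
  \<comment> \<open>A monomial with an inert variable is orthogonal to \<open>M\<close>, hence lies
    in \<open>perp M\<close>, so \<open>y\<close> has no coordinate there.\<close>
  have yS: "n \<in> S" if "y n \<noteq> 0" for n
  proof -
    have "Poly_Mapping.keys (?mn n) \<subseteq> ?V"
    proof (rule ccontr)
      assume "\<not> Poly_Mapping.keys (?mn n) \<subseteq> ?V"
      then have "fip m (?bas n) = 0" if "m \<in> M" for m
        using conly_crd[OF M_conly[OF that]] by (auto simp: crd_def)
      then have "?bas n \<in> perp M" by (simp add: perp_def)
      then have "l2ip y (crd (?bas n)) = 0" using y by (simp add: hsp_def)
      then show False using that l2ip_bas[OF hsp_ell2[OF y], where 'n = 'n] by simp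
    qed
    then show ?thesis using that by (auto simp: S_def D_def)
  qed
  define p where "p = (\<Sum>n\<in>S. psc (y n) (?bas n))"
  have "crd p n = y n" for n
  proof -
    have "crd p n = (\<Sum>m\<in>S. y m * crd (?bas m) n)" by (simp add: p_def crd_def fip_sum_left fip_psc_left)
    also have "\<dots> = y n" using S yS by (auto simp: crd_bas if_distrib cong: if_cong)
    finally show ?thesis .
  qed
  then have yp: "y = crd p" by (simp add: fun_eq_iff)
  \<comment> \<open>The generators in the degrees of \<open>p\<close>. They span a
    finite-dimensional space, so the projection exists without completeness.\<close>
  define W' where "W' = {w \<in> W. \<exists>d\<in>D. chom (int d) w}"
  have W': "w \<in> pol.span (?bas ` S)" if w: "w \<in> W'" for w
  proof -
    obtain d where d: "d \<in> D" "chom (int d) w" using w by (auto simp: W'_def)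
    obtain N where N: "\<And>n. n \<ge> N \<Longrightarrow> crd w n = 0" using crd_bound[of w] by blast
    have "psc (crd w n) (?bas n) \<in> pol.span (?bas ` S)" for n
    proof (cases "crd w n = 0")
      case False
      then have "int d = int (cdm (?mn n))" using chom_orth[OF d(2) chom_bas[of n]] by (auto simp: crd_def)
      then have "n \<in> S" using d(1) conly_crd[OF _ False] W[of w] w by (auto simp: S_def W'_def)
      then show ?thesis by (intro pol.span_scale pol.span_base) simp
    qed (simp add: pol.span_zero)
    then show ?thesis by (subst pol_expand[OF N]) (auto intro: pol.span_sum)
  qed
  obtain B' where B': "B' \<subseteq> W'" "pol.independent B'" "W' \<subseteq> pol.span B'"
    using pol.maximal_independent_subset by blast
  have "finite B'"
    using pol.independent_span_bound[OF _ B'(2), of "?bas ` S"] S B'(1) W' by auto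
  then obtain m where m: "m \<in> pol.span B'" "\<And>b. b \<in> pol.span B' \<Longrightarrow> fip b (p - m) = 0"
    using finite_projection by blast
  have B'M: "B' \<subseteq> M" using B'(1) WM by (auto simp: W'_def)
  have mM: "m \<in> M" using m(1) pol.span_minimal[OF B'M Msub] by blast
  \<comment> \<open>Generators in \<open>W'\<close> are orthogonal to \<open>p - m\<close> by the
    choice of \<open>m\<close>, the others because of their degree.\<close>
  have "p - m \<in> perp M"
  proof -
    have "fip w (p - m) = 0" if w: "w \<in> W" for w
    proof (cases "w \<in> W'")
      case True
      then show ?thesis using m(2) B'(3) by blast
    next
      case False
      obtain d where d: "chom d w" using W[OF w] by blast
      have "m \<in> pol.span (?bas ` S)"
        using m(1) pol.span_minimal[of B' "pol.span (?bas ` S)"] B'(1) W' by (auto simp: pol.subspace_span)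
      moreover have "p \<in> pol.span (?bas ` S)"
        unfolding p_def by (intro pol.span_sum pol.span_scale pol.span_base) simp
      ultimately have "p - m \<in> pol.span (?bas ` S)" by (simp add: pol.span_diff)
      moreover have "fip (?bas n) w = 0" if "n \<in> S" for n
        using chom_orth[OF chom_bas[of n] d] False w that d by (auto simp: W'_def S_def)
      ultimately have "fip (p - m) w = 0" by (auto intro: fip_span_left)
      then show ?thesis using fip_cnj[of w "p - m"] by simp
    qed
    then show ?thesis using MW fip_span_left[of _ W "p - m"] by (auto simp: perp_def)
  qed
  moreover from this have "fip p (p - m) = 0"
    using y by (simp add: hsp_def yp l2ip_crd)
  ultimately have "fip (p - m) (p - m) = 0"
    using mM by (simp add: fip_diff_left perp_def)
  then have "p = m" by (simp add: fip_self_eq_0)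
  then show ?thesis using yp mM by simp
qed

lemma K_finite_eq: "K_finite scl hsp (\<lambda>\<gamma> :: real \<Rightarrow> 'n mat2. pact (\<gamma> 1)) = crd ` M"
proof
  show "K_finite scl hsp (\<lambda>\<gamma> :: real \<Rightarrow> 'n mat2. pact (\<gamma> 1)) \<subseteq> crd ` M"
  proof
    fix y assume "y \<in> K_finite scl hsp (\<lambda>\<gamma> :: real \<Rightarrow> 'n mat2. pact (\<gamma> 1))"
    then obtain B where y: "y \<in> hsp" and B: "finite B" and sp: "\<And>\<kappa> :: real \<Rightarrow> 'n mat2. \<kappa> \<in> cover_K \<Longrightarrow> pact (\<kappa> 1) y \<in> scl.span B"
      unfolding K_finite_def by blast
    show "y \<in> crd ` M"
      by (rule K_finite_subset[OF y B]) (use sp[OF tor_cover_K] in simp)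
  qed
  show "crd ` M \<subseteq> K_finite scl hsp (\<lambda>\<gamma> :: real \<Rightarrow> 'n mat2. pact (\<gamma> 1))"
  proof
    fix y assume "y \<in> crd ` M"
    then obtain m where m: "m \<in> M" "y = crd m" by blast
    obtain B where B: "finite B" "m \<in> pol.span B" "\<And>A x. x \<in> pol.span B \<Longrightarrow> dsub A x \<in> pol.span B"
      using finite_stable[of m] by metis
    have "pact (\<kappa> 1) y \<in> scl.span (crd ` B)" if "\<kappa> \<in> cover_K" for \<kappa> :: "real \<Rightarrow> 'n mat2"
    proof -
      have "pact (\<kappa> 1) y = crd (psc (1 / det (ul (\<kappa> 1)) ^ card C) (dsub (matrix_inv (ul (\<kappa> 1))) m))"
        using cover_K_end[OF that] by (simp add: m(2) pact_crd rho_block)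
      then show ?thesis using crd_span[of _ B] B by (simp add: pol.span_scale)
    qed
    then show "y \<in> K_finite scl hsp (\<lambda>\<gamma> :: real \<Rightarrow> 'n mat2. pact (\<gamma> 1))"
      unfolding K_finite_def using hsp_crd[OF m(1)] m(2) B(1) by (auto intro!: exI[of _ "crd ` B"])
  qed
qed

end

section \<open>The exponential series of elements of \<open>lie_k0\<close>\<close>

lemma lie_k0_block:
  assumes "X \<in> lie_k0"
  shows "ur X = 0" "ll X = 0"
  using assms by (auto simp: lie_k0_def cartan_inv_fixed)

lemma mpow_block: "ur X = 0 \<Longrightarrow> ll X = 0 \<Longrightarrow> ur (mpow X k) = 0 \<and> ll (mpow X k) = 0"
proof (induction k)
  case 0
  show ?case by (simp add: vec_eq_iff ur_def ll_def mat_def)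
next
  case (Suc k)
  then show ?case by (simp add: mpow_Suc quarter_mult)
qed

lemma mat_exp_block:
  fixes X :: "'n::finite mat2"
  assumes "ur X = 0" "ll X = 0"
  shows "ur (mat_exp (cscale z X)) = 0" "ll (mat_exp (cscale z X)) = 0"
proof -
  have "mpow X k $ Inl i $ Inr j = 0" "mpow X k $ Inr i $ Inl j = 0" for i j k
    using mpow_block[OF assms, of k] by (auto simp: vec_eq_iff ur_def ll_def)
  then show "ur (mat_exp (cscale z X)) = 0" "ll (mat_exp (cscale z X)) = 0"
    by (simp_all add: vec_eq_iff ur_def ll_def mat_exp_nth)
qed

lemma block_invertible:
  assumes "g \<in> so_c" "ll g = 0"
  shows "invertible (ul g)"
proof -
  have "transpose (lr g) ** ul g = mat 1" using so_c_quarters(2)[OF assms(1)] by (simp add: assms(2))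
  then show ?thesis using matrix_left_right_inverse invertible_def by metis
qed

lemma l2n_finite_tendsto:
  assumes F: "finite F" and z: "\<And>m n. n \<notin> F \<Longrightarrow> x m n = 0" and t: "\<And>n. (\<lambda>m. x m n) \<longlonglongrightarrow> 0"
  shows "(\<lambda>m. l2n (x m)) \<longlonglongrightarrow> 0"
proof -
  have "l2n (x m) = sqrt (\<Sum>n\<in>F. (cmod (x m n))\<^sup>2)" for m
    unfolding l2n_def by (subst suminf_finite[OF F]) (use z in auto)
  moreover have "(\<lambda>m. sqrt (\<Sum>n\<in>F. (cmod (x m n))\<^sup>2)) \<longlonglongrightarrow> sqrt (\<Sum>n\<in>F. (cmod 0)\<^sup>2)"
    by (intro tendsto_intros t)
  ultimately show ?thesis by simp
qed

context fock
begin

lemma rho_exp_block: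
  fixes X :: "'n::finite mat2"
  assumes X: "X \<in> lie_k0"
  shows "(\<lambda>m. l2n (rho (mat_exp X) v - crd (\<Sum>j<m. psc (of_real (1 / fact j)) ((gact X ^^ j) v)))) \<longlonglongrightarrow> 0"
proof -
  let ?g = "\<lambda>z. mat_exp (cscale z X)"
  have X0: "X \<in> lie_g0" and Xg: "X \<in> lie_g" using X by (auto simp: lie_k0_def lie_g0_def)
  note Xb = lie_k0_block[OF X]
  have gp: "mat_exp X \<in> gp" using mat_exp_gp[OF X0, of 1] by simp
  have g1: "?g 1 = mat_exp X" by simp
  have so: "?g z \<in> so_c" for z by (rule mat_exp_so_c[OF Xg])
  have coord: "(\<lambda>m. crd (\<Sum>j<m. psc (of_real (1 / fact j)) ((gact X ^^ j) v)) n) \<longlonglongrightarrow> rho (mat_exp X) v n" for n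
  proof -
    have "(\<lambda>j. phi (?g 0) ((gact X ^^ j) v) (bas n) / fact j * 1 ^ j) sums phi (?g 1) v (bas n)"
      by (rule phi_taylor[of 2])
        (use so block_invertible[OF so mat_exp_block(2)[OF Xb]] Xg mat_exp_has_derivative in auto)
    then have "(\<lambda>j. fip ((gact X ^^ j) v) (bas n) / fact j) sums rho (mat_exp X) v n"
      by (simp add: mat_exp_zero phi_mat1 rho_def)
    then show ?thesis by (simp add: sums_def crd_def fip_sum_left fip_psc_left)
  qed
  obtain B where B: "finite B" "v \<in> pol.span B" "\<And>A x. x \<in> pol.span B \<Longrightarrow> opE A x \<in> pol.span B"
    using finite_stable[of v] by metis
  \<comment> \<open>The orbit of \<open>v\<close> stays in a finite-dimensional space, so all
    sequences are supported in one finite set and coordinatewise convergence is convergence in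
    norm.\<close>
  define F where "F = (\<Union>b\<in>B. {n. crd b n \<noteq> 0})"
  have F: "finite F" unfolding F_def using B(1) crd_finite by blast
  have cF: "crd p n = 0" if "n \<notin> F" "p \<in> pol.span B" for p n
    unfolding crd_def by (rule fip_span_left[OF that(2)]) (use that(1) in \<open>auto simp: F_def crd_def\<close>)
  have gX: "gact X p = opE (ul X) p" for p by (simp add: gact_def Xb op_zero)
  have pw: "(gact X ^^ j) v \<in> pol.span B" for j
    by (induction j) (auto simp: gX B)
  have part: "(\<Sum>j<m. psc (of_real (1 / fact j)) ((gact X ^^ j) v)) \<in> pol.span B" for m
    by (intro pol.span_sum pol.span_scale pw)
  have r0: "rho (mat_exp X) v n = 0" if "n \<notin> F" for n
    using coord[of n] cF[OF that part] by (simp add: LIMSEQ_const_iff)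
  show ?thesis
  proof (rule l2n_finite_tendsto[OF F])
    fix m n assume "n \<notin> F"
    then show "(rho (mat_exp X) v - crd (\<Sum>j<m. psc (of_real (1 / fact j)) ((gact X ^^ j) v))) n = 0"
      using r0 cF part by simp
  next
    fix n
    have "(\<lambda>m. rho (mat_exp X) v n - crd (\<Sum>j<m. psc (of_real (1 / fact j)) ((gact X ^^ j) v)) n)
        \<longlonglongrightarrow> rho (mat_exp X) v n - rho (mat_exp X) v n"
      by (intro tendsto_intros coord)
    then show "(\<lambda>m. (rho (mat_exp X) v - crd (\<Sum>j<m. psc (of_real (1 / fact j)) ((gact X ^^ j) v))) n) \<longlonglongrightarrow> 0"
      by simp
  qed
qed

end

context graded_fock_module
begin

text \<open>The module is embedded through the coordinates \<open>crd\<close> of its polynomial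
  model; the clauses of \<open>gK_iso\<close> are \<open>K_finite_eq\<close>,
  \<open>rho_differentiable\<close> and \<open>rho_exp_block\<close>.\<close>

theorem unitary_moduleI:
  fixes T0 :: "'v::ab_group_add \<Rightarrow> 'n var pol"
  assumes lin: "Vector_Spaces.linear scV psc T0" and inj: "inj T0" and ran: "range T0 = M"
    and act: "\<And>X v. X \<in> lie_g \<Longrightarrow> T0 (actV X v) = gact X (T0 v)"
  shows "unitary_module scV actV"
proof -
  define T where "T v = crd (T0 v)" for v
  interpret T0: Vector_Spaces.linear scV psc T0 by (rule lin)
  have exp1: "exp_path X 1 = mat_exp X" for X :: "'n mat2" by (simp add: exp_path_def)
  have l: "Vector_Spaces.linear scV scl T"
    unfolding Vector_Spaces.linear_iff T_def
    using T0.vs1.vector_space_axioms scl.vector_space_axioms by (simp add: T0.add T0.scale crd_add crd_psc)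
  have bij: "bij_betw T UNIV (K_finite scl hsp (\<lambda>\<gamma> :: real \<Rightarrow> 'n mat2. pact (\<gamma> 1)))"
    unfolding K_finite_eq bij_betw_def
  proof
    show "inj T" unfolding T_def by (rule injI) (metis crd_inj injD inj)
    show "range T = crd ` M" using ran by (auto simp: T_def)
  qed
  have der: "((\<lambda>t. ip_norm l2ip (scl (of_real (1 / t)) (pact (exp_path (t *\<^sub>R X) 1) (T v) - T v) - T (actV X v))) \<longlongrightarrow> 0) (at 0)"
    if X: "X \<in> lie_g0" for X :: "'n mat2" and v
  proof -
    have "ip_norm l2ip (scl (of_real (1 / t)) (pact (exp_path (t *\<^sub>R X) 1) (T v) - T v) - T (actV X v))
      = l2n (scl (of_real (1 / t)) (rho (mat_exp (t *\<^sub>R X)) (T0 v) - crd (T0 v)) - crd (gact X (T0 v)))" for t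
    proof -
      have g: "mat_exp (t *\<^sub>R X) \<in> gp" by (rule mat_exp_gp[OF X])
      have m: "scl (of_real (1 / t)) (rho (mat_exp (t *\<^sub>R X)) (T0 v) - crd (T0 v)) - crd (gact X (T0 v)) \<in> ell2"
        using g by (intro ell2_diff ell2_scl) auto
      show ?thesis
        unfolding exp1 T_def pact_crd[OF g] act[OF lie_g0_lie_g[OF X]] by (rule ip_norm_l2ip[OF m])
    qed
    then show ?thesis using rho_differentiable[OF X, of "T0 v"] by simp
  qed
  have exp: "(\<lambda>m. ip_norm l2ip (pact (exp_path X 1) (T v) - (\<Sum>j<m. scl (of_real (1 / fact j)) (T ((actV X ^^ j) v))))) \<longlonglongrightarrow> 0"
    if X: "X \<in> lie_k0" for X :: "'n mat2" and v
  proof -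
    have X0: "X \<in> lie_g0" using X by (auto simp: lie_k0_def)
    have g: "mat_exp X \<in> gp" using mat_exp_gp[OF X0, of 1] by simp
    have it: "T ((actV X ^^ j) v) = crd ((gact X ^^ j) (T0 v))" for j
    proof -
      have "T0 ((actV X ^^ j) v) = (gact X ^^ j) (T0 v)"
        by (induction j) (simp_all add: act lie_g0_lie_g X0)
      then show ?thesis by (simp add: T_def)
    qed
    have s: "(\<Sum>j<m. scl (of_real (1 / fact j)) (T ((actV X ^^ j) v)))
      = crd (\<Sum>j<m. psc (of_real (1 / fact j)) ((gact X ^^ j) (T0 v)))" for m
    proof (induction m)
      case 0
      show ?case by (simp add: fun_eq_iff crd_def)
    next
      case (Suc m)
      then show ?case unfolding sum.lessThan_Suc crd_add crd_psc it by simp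
    qed
    have "ip_norm l2ip (pact (exp_path X 1) (T v) - (\<Sum>j<m. scl (of_real (1 / fact j)) (T ((actV X ^^ j) v))))
      = l2n (rho (mat_exp X) (T0 v) - crd (\<Sum>j<m. psc (of_real (1 / fact j)) ((gact X ^^ j) (T0 v))))" for m
      unfolding exp1 s unfolding T_def pact_crd[OF g] by (intro ip_norm_l2ip ell2_diff) (simp_all add: g)
    then show ?thesis using rho_exp_block[OF X, of "T0 v"] by simp
  qed
  have "gK_iso scV actV scl hsp l2ip (\<lambda>\<gamma> :: real \<Rightarrow> 'n mat2. pact (\<gamma> 1)) T"
    unfolding gK_iso_def using l bij der exp by blast
  then show ?thesis unfolding unitary_module_def using hsp_unitary_rep by blast
qed

end

section \<open>Highest weight vectors\<close>

lemma pos_less: "i < j \<Longrightarrow> pos i < pos (j :: 'n::{finite,linorder})"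
proof -
  assume "i < j"
  then have "{k. k \<le> i} \<subseteq> {k. k \<le> j}" "j \<notin> {k. k \<le> i}" by auto
  then have "{k. k \<le> i} \<subset> {k. k \<le> j}" by blast
  then show ?thesis unfolding pos_def by (intro psubset_card_mono) auto
qed

lemma pos_less_iff: "pos i < pos j \<longleftrightarrow> i < (j :: 'n::{finite,linorder})"
  using pos_less[of i j] pos_less[of j i] by (cases i j rule: linorder_cases) auto

lemma pos_inj: "pos i = pos j \<longleftrightarrow> i = (j :: 'n::{finite,linorder})"
  using pos_less_iff[of i j] pos_less_iff[of j i] by (cases i j rule: linorder_cases) auto

lemma pos_le: "pos (j :: 'n::{finite,linorder}) \<le> CARD('n)"
  unfolding pos_def by (rule card_mono) auto

lemma pos_ge: "1 \<le> pos (j :: 'n::{finite,linorder})"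
  unfolding pos_def by (simp add: Suc_le_eq card_gt_0_iff) auto

text \<open>Positive and strictly decreasing along the index, so \<open>hel\<close> is a regular
  element on which all positive roots take positive integral values.\<close>

definition hht :: "'n::{finite,linorder} \<Rightarrow> nat" where
  "hht j = CARD('n) + 1 - pos j"

lemma hht_pos: "hht j > 0"
  using pos_le[of j] by (simp add: hht_def)

lemma hht_less: "j < i \<Longrightarrow> hht i < hht j"
  using pos_le[of i] pos_less[of j i] by (simp add: hht_def)

definition hel :: "'n::{finite,linorder} mat2" where
  "hel = gl_embed (diag_mat (\<chi> j. of_nat (hht j)))"

definition nm :: "complex^'n^'n \<Rightarrow> 'n::finite mat2" where
  "nm Y = block 0 0 Y 0"

lemma gl_embed_quarters [simp]:
  "ul (gl_embed A) = A" "ur (gl_embed A) = 0" "ll (gl_embed A) = 0" "lr (gl_embed A) = - transpose A"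
  by (simp_all add: gl_embed_def vec_eq_iff ul_def ur_def ll_def lr_def)

lemma nm_quarters [simp]: "ul (nm Y) = 0" "ur (nm Y) = 0" "ll (nm Y) = Y" "lr (nm Y) = 0"
  by (simp_all add: nm_def vec_eq_iff ul_def ur_def ll_def lr_def)

lemma diag_mat_mult: "(diag_mat h ** A) $ i $ j = h $ i * A $ i $ j" "(A ** diag_mat h) $ i $ j = A $ i $ j * h $ j"
  by (simp_all add: matmul_nth diag_mat_def if_distrib[of "\<lambda>x. x * _"] if_distrib[of "\<lambda>x. _ * x"] cong: if_cong)

lemma transpose_diag_mat [simp]: "transpose (diag_mat h) = diag_mat h"
  by (auto simp: vec_eq_iff transpose_def diag_mat_def)

lemma nm_in_lie_g: "transpose Y = - Y \<Longrightarrow> nm Y \<in> lie_g"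
  using block_in_lie_g[of 0 Y 0] by (simp add: nm_def transpose_zero)

text \<open>Negative root vectors with the amount by which they lower the eigenvalue of
  \<open>hel\<close>. In the second rule \<open>i = j\<close> yields the zero matrix, which does no
  harm.\<close>

inductive nroot :: "'n::{finite,linorder} mat2 \<Rightarrow> nat \<Rightarrow> bool" where
  "j < i \<Longrightarrow> nroot (gl_embed (mat_unit i j)) (hht j - hht i)"
| "nroot (nm (mat_unit i j - mat_unit j i)) (hht i + hht j)"

lemma transpose_diff: "transpose (A - B) = transpose A - transpose B" for A B :: "complex^'n^'m"
  by (simp add: vec_eq_iff transpose_def)

lemma mat_unit_skew: "transpose (mat_unit i j - mat_unit j i) = - (mat_unit i j - mat_unit j i)"
proof -
  have "transpose (mat_unit i j) = mat_unit j i" for i j :: 'a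
    by (simp add: vec_eq_iff transpose_def mat_unit_def conj_commute)
  then show ?thesis by (simp add: transpose_diff)
qed

lemma nroot_lie_g: "nroot Y d \<Longrightarrow> Y \<in> lie_g"
  by (erule nroot.cases) (simp, simp only: nm_in_lie_g[OF mat_unit_skew])

lemma nroot_pos: "nroot Y d \<Longrightarrow> d > 0"
  by (erule nroot.cases) (auto simp: hht_less hht_pos)

lemma bracket_gl_embed:
  "bracket (gl_embed A) (gl_embed B) = gl_embed (A ** B - B ** A)"
  "bracket (gl_embed A) (nm Y) = nm (- (transpose A ** Y) - Y ** A)"
  by (rule mat2_eqI; simp add: bracket_def quarter_mult matrix_transpose_mul[symmetric] matrix_minus_mult transpose_diff)+

lemma cscale_gl_embed: "cscale c (gl_embed A) = gl_embed (cscale c A)"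
  and cscale_nm: "cscale c (nm Y) = nm (cscale c Y)"
  by (rule mat2_eqI; simp add: vec_eq_iff cscale_nth transpose_def)+

lemma nroot_hel: "nroot Y d \<Longrightarrow> bracket hel Y = cscale (- of_nat d) Y"
proof (erule nroot.cases)
  fix i j assume Y: "Y = gl_embed (mat_unit i j)" "d = hht j - hht i" and ij: "j < i"
  then have d: "(of_nat d :: complex) = of_nat (hht j) - of_nat (hht i)" using hht_less[OF ij] by (simp add: of_nat_diff)
  have "diag_mat h ** mat_unit i j - mat_unit i j ** diag_mat h = cscale (h $ i - h $ j) (mat_unit i j)" for h
    by (simp add: vec_eq_iff diag_mat_mult cscale_nth mat_unit_def algebra_simps)
  then show "bracket hel Y = cscale (- of_nat d) Y" unfolding Y(1) d hel_def bracket_gl_embed cscale_gl_embed by simp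
next
  fix i j assume Y: "Y = nm (mat_unit i j - mat_unit j i)" "d = hht i + hht j"
  let ?E = "mat_unit i j - mat_unit j i"
  have "- (transpose (diag_mat h) ** ?E) - ?E ** diag_mat h = cscale (- (h $ i + h $ j)) ?E" for h
    by (auto simp: vec_eq_iff diag_mat_mult cscale_nth mat_unit_def algebra_simps)
  then show "bracket hel Y = cscale (- of_nat d) Y" unfolding Y hel_def bracket_gl_embed cscale_nm by simp
qed

definition borel_alg :: "'n::{finite,linorder} mat2 set" where
  "borel_alg = {X \<in> lie_g. ll X = 0 \<and> (\<forall>i j. j < i \<longrightarrow> ul X $ i $ j = 0)}"

lemma sum_mat_unit: "(\<Sum>(i, j)\<in>UNIV. cscale (a i j) (mat_unit i j)) $ r $ s = a r s"
proof -
  have "(\<Sum>(i, j)\<in>UNIV. cscale (a i j) (mat_unit i j)) $ r $ s = (\<Sum>x\<in>UNIV. if x = (r, s) then a r s else 0)"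
    unfolding sum_component by (intro sum.cong refl) (auto simp: cscale_nth mat_unit_def split: if_splits)
  then show ?thesis by simp
qed

lemma gl_embed_sum: "gl_embed (sum F I) = (\<Sum>i\<in>I. gl_embed (F i))"
  and nm_sum: "nm (sum F I) = (\<Sum>i\<in>I. nm (F i))"
proof -
  have "gl_embed 0 = (0 :: 'a mat2)" "nm 0 = (0 :: 'a mat2)" by (rule mat2_eqI; simp add: vec_eq_iff transpose_def)+
  moreover have "gl_embed (A + B) = gl_embed A + (gl_embed B :: 'a mat2)" "nm (A + B) = nm A + (nm B :: 'a mat2)" for A B
    by (rule mat2_eqI; simp add: transpose_add)+
  ultimately show "gl_embed (sum F I) = (\<Sum>i\<in>I. gl_embed (F i))" "nm (sum F I) = (\<Sum>i\<in>I. nm (F i))"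
    by (induction I rule: infinite_finite_induct; simp)+
qed

lemma gl_embed_expand: "gl_embed A = (\<Sum>(i, j)\<in>UNIV. cscale (A $ i $ j) (gl_embed (mat_unit i j)))"
proof -
  have "A = (\<Sum>(i, j)\<in>UNIV. cscale (A $ i $ j) (mat_unit i j))" unfolding vec_eq_iff sum_mat_unit by simp
  then have "gl_embed A = gl_embed (\<Sum>(i, j)\<in>UNIV. cscale (A $ i $ j) (mat_unit i j))" by simp
  then show ?thesis by (simp add: gl_embed_sum cscale_gl_embed split_beta)
qed

text \<open>The sum runs over ordered pairs, so each root vector is counted twice; hence the factor
  1/2.\<close>

lemma nm_expand: assumes "transpose Y = - Y"
  shows "nm Y = (\<Sum>(i, j)\<in>UNIV. cscale (Y $ i $ j / 2) (nm (mat_unit i j - mat_unit j i)))"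
proof -
  have "(\<Sum>(i, j)\<in>UNIV. cscale (Y $ i $ j / 2) (mat_unit i j - mat_unit j i)) $ r $ s = Y $ r $ s" for r s
  proof -
    have "(\<Sum>(i, j)\<in>UNIV. cscale (Y $ i $ j / 2) (mat_unit i j - mat_unit j i)) $ r $ s
      = (\<Sum>x\<in>UNIV. (if x = (r, s) then Y $ r $ s / 2 else 0) - (if x = (s, r) then Y $ s $ r / 2 else 0))"
      unfolding sum_component
    proof (rule sum.cong[OF refl], clarify)
      fix i j
      show "cscale (Y $ i $ j / 2) (mat_unit i j - mat_unit j i) $ r $ s
        = (if (i, j) = (r, s) then Y $ r $ s / 2 else 0) - (if (i, j) = (s, r) then Y $ s $ r / 2 else 0)"
        by (cases "i = r"; cases "j = s"; cases "i = s"; cases "j = r"; simp add: cscale_nth mat_unit_def)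
    qed
    also have "\<dots> = Y $ r $ s / 2 - Y $ s $ r / 2" by (simp add: sum_subtractf)
    also have "Y $ s $ r = - Y $ r $ s" by (rule skew_nth[OF assms])
    finally show ?thesis by simp
  qed
  then have "Y = (\<Sum>(i, j)\<in>UNIV. cscale (Y $ i $ j / 2) (mat_unit i j - mat_unit j i))" unfolding vec_eq_iff by simp
  then have "nm Y = nm (\<Sum>(i, j)\<in>UNIV. cscale (Y $ i $ j / 2) (mat_unit i j - mat_unit j i))" by simp
  then show ?thesis by (simp add: nm_sum cscale_nm split_beta)
qed

text \<open>Kept abstract because it is instantiated three times: for the given module, for the
  polynomials, and for their product.\<close>

locale hw_module =
  fixes sc :: "complex \<Rightarrow> 'v::ab_group_add \<Rightarrow> 'v" and act :: "'n::{finite,linorder} mat2 \<Rightarrow> 'v \<Rightarrow> 'v"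
    and lam :: "'n \<Rightarrow> int" and x0 :: 'v
  assumes mod: "lie_module lie_g sc act"
    and wt: "\<And>h. act (gl_embed (diag_mat h)) x0 = sc (\<Sum>j\<in>UNIV. of_int (lam j) * h $ j) x0"
    and raise: "\<And>i j. i < j \<Longrightarrow> act (gl_embed (mat_unit i j)) x0 = 0"
    and pplus: "\<And>X. X \<in> lie_p_plus \<Longrightarrow> act X x0 = 0"
begin

sublocale vector_space sc using mod by (simp add: lie_module_def)

lemma act_linear: "X \<in> lie_g \<Longrightarrow> Vector_Spaces.linear sc sc (act X)"
  and act_plus: "X \<in> lie_g \<Longrightarrow> Y \<in> lie_g \<Longrightarrow> act (X + Y) v = act X v + act Y v"
  and act_cscale: "X \<in> lie_g \<Longrightarrow> act (cscale c X) v = sc c (act X v)"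
  and act_bracket: "X \<in> lie_g \<Longrightarrow> Y \<in> lie_g \<Longrightarrow> act (bracket X Y) v = act X (act Y v) - act Y (act X v)"
  using mod by (auto simp: lie_module_def)

lemma act_add: "X \<in> lie_g \<Longrightarrow> act X (v + w) = act X v + act X w"
  and act_sc: "X \<in> lie_g \<Longrightarrow> act X (sc c v) = sc c (act X v)"
  using act_linear unfolding Vector_Spaces.linear_iff by auto

lemma act_0: "X \<in> lie_g \<Longrightarrow> act X 0 = 0"
  using act_sc[of X 0 0] by simp

lemma act_diff: "X \<in> lie_g \<Longrightarrow> act X (v - w) = act X v - act X w"
  using act_add[of X "v - w" w] by (simp add: algebra_simps)

lemma act_sum: "(\<And>i. i \<in> I \<Longrightarrow> F i \<in> lie_g) \<Longrightarrow> act (sum F I) v = (\<Sum>i\<in>I. act (F i) v) \<and> sum F I \<in> lie_g"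
proof (induction I rule: infinite_finite_induct)
  case (insert x I)
  then show ?case by (simp add: act_plus lie_g_add)
next
  case empty
  have "act (cscale 0 0) v = sc 0 (act 0 v)" by (rule act_cscale) (simp add: lie_g_zero)
  moreover have "cscale 0 0 = (0 :: 'n mat2)" by (simp add: vec_eq_iff cscale_nth)
  ultimately show ?case by (simp add: lie_g_zero)
next
  case (infinite I)
  have "act (cscale 0 0) v = sc 0 (act 0 v)" by (rule act_cscale) (simp add: lie_g_zero)
  moreover have "cscale 0 0 = (0 :: 'n mat2)" by (simp add: vec_eq_iff cscale_nth)
  ultimately show ?case using infinite by (simp add: lie_g_zero)
qed

text \<open>The submodule generated by \<open>x0\<close>. Only negative root vectors are applied,
  which makes the weight argument in \<open>V_low\<close> direct; stability under the whole algebra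
  is \<open>V_act\<close>.\<close>

inductive_set V :: "'v set" where
  base: "x0 \<in> V"
| add: "x \<in> V \<Longrightarrow> y \<in> V \<Longrightarrow> x + y \<in> V"
| scale: "x \<in> V \<Longrightarrow> sc c x \<in> V"
| neg: "x \<in> V \<Longrightarrow> nroot Y d \<Longrightarrow> act Y x \<in> V"

lemma V_zero: "0 \<in> V"
  using V.scale[OF V.base, of 0] by simp

lemma V_sum: "(\<And>i. i \<in> I \<Longrightarrow> f i \<in> V) \<Longrightarrow> sum f I \<in> V"
  by (induction I rule: infinite_finite_induct) (auto intro: V_zero V.add)

lemma borel_hw: assumes "X \<in> borel_alg" shows "\<exists>c. act X x0 = sc c x0"
proof -
  have X: "X \<in> lie_g" "ll X = 0" "\<And>i j. j < i \<Longrightarrow> ul X $ i $ j = 0" using assms by (auto simp: borel_alg_def)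
  let ?B = "block 0 (ur X) 0 0"
  have B: "?B \<in> lie_p_plus" using X(1) by (auto simp: lie_p_plus_def lie_g_quarters)
  have XB: "X = gl_embed (ul X) + ?B"
    by (rule mat2_eqI) (use X in \<open>auto simp: lie_g_quarters\<close>)
  have E: "act (gl_embed (mat_unit i j)) x0 = (if i = j then sc (of_int (lam i)) x0 else 0)" if "i \<le> j" for i j
  proof (cases "i = j")
    case True
    have "mat_unit i i = diag_mat (\<chi> j. if j = i then 1 else 0)"
      by (auto simp: vec_eq_iff mat_unit_def diag_mat_def)
    then show ?thesis using True wt[of "\<chi> j. if j = i then 1 else 0"] by (simp add: if_distrib cong: if_cong)
  next
    case False
    then show ?thesis using that raise[of i j] by auto
  qed
  have "act X x0 = act (gl_embed (ul X)) x0"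
    by (subst XB) (use B pplus lie_p_plus_subset_lie_g in \<open>auto simp: act_plus\<close>)
  also have "\<dots> = (\<Sum>(i, j)\<in>UNIV. sc (ul X $ i $ j) (act (gl_embed (mat_unit i j)) x0))"
    unfolding gl_embed_expand[of "ul X"]
    by (subst act_sum[THEN conjunct1]) (auto simp: act_cscale lie_g_cscale split_beta)
  also have "\<dots> = (\<Sum>(i, j)\<in>UNIV. sc (if i = j then ul X $ i $ j * of_int (lam i) else 0) x0)"
  proof (rule sum.cong[OF refl], clarify)
    fix i j
    show "sc (ul X $ i $ j) (act (gl_embed (mat_unit i j)) x0) = sc (if i = j then ul X $ i $ j * of_int (lam i) else 0) x0"
      using E[of i j] X(3)[of j i] by (cases "i \<le> j") auto
  qed
  also have "\<dots> = sc (\<Sum>(i, j)\<in>UNIV. if i = j then ul X $ i $ j * of_int (lam i) else 0) x0"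
    by (simp add: scale_sum_left split_beta)
  finally show ?thesis by blast
qed

lemma V_nm: assumes "x \<in> V" "transpose Y = - Y" shows "act (nm Y) x \<in> V"
  unfolding nm_expand[OF assms(2)]
  by (subst act_sum[THEN conjunct1])
    (auto intro!: V_sum V.scale V.neg[OF assms(1) nroot.intros(2)] lie_g_cscale nroot_lie_g[OF nroot.intros(2)] simp: act_cscale nroot_lie_g[OF nroot.intros(2)] split_beta)

lemma V_lower:
  assumes "x \<in> V" and A: "\<And>i j. i \<le> j \<Longrightarrow> A $ i $ j = 0"
  shows "act (gl_embed A) x \<in> V"
proof -
  have "sc (A $ i $ j) (act (gl_embed (mat_unit i j)) x) \<in> V" for i j
    by (cases "j < i") (use A assms(1) in \<open>auto intro: V.scale V.neg nroot.intros simp: not_less V_zero\<close>)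
  then show ?thesis unfolding gl_embed_expand[of A]
    by (subst act_sum[THEN conjunct1]) (auto intro!: V_sum lie_g_cscale simp: act_cscale split_beta)
qed

lemma lie_g_triangular:
  assumes "Z \<in> lie_g"
  obtains A Y Zb where "Z = gl_embed A + nm Y + Zb" "\<And>i j. i \<le> j \<Longrightarrow> A $ i $ j = 0" "transpose Y = - Y" "Zb \<in> borel_alg"
proof
  let ?A = "\<chi> i j. if j < i then ul Z $ i $ j else 0" and ?U = "\<chi> i j. if j < i then 0 else ul Z $ i $ j"
  show "Z = gl_embed ?A + nm (ll Z) + block ?U (ur Z) 0 (- transpose ?U)"
    by (rule mat2_eqI) (use assms in \<open>auto simp: lie_g_quarters vec_eq_iff transpose_def\<close>)
  show "transpose (ll Z) = - ll Z" using assms by (simp add: lie_g_quarters)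
  have "block ?U (ur Z) 0 (- transpose ?U) \<in> lie_g"
    by (rule block_in_lie_g) (use assms in \<open>auto simp: lie_g_quarters transpose_zero\<close>)
  then show "block ?U (ur Z) 0 (- transpose ?U) \<in> borel_alg"
    by (simp add: borel_alg_def)
qed auto

text \<open>\<open>X\<close> is commuted past the negative root vector. The bracket may have
  components of all kinds, and its Borel component is covered since \<open>X\<close> is arbitrary in
  the induction.\<close>

lemma V_borel: "x \<in> V \<Longrightarrow> X \<in> borel_alg \<Longrightarrow> act X x \<in> V"
proof (induction arbitrary: X rule: V.induct)
  case base
  then show ?case using borel_hw V.scale[OF V.base] by metis
next
  case (add x y)
  then show ?case using V.add by (simp add: borel_alg_def act_add)
next
  case (scale x c)
  then show ?case using V.scale by (simp add: borel_alg_def act_sc)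
next
  case (neg x Y d)
  have X: "X \<in> lie_g" using neg.prems by (simp add: borel_alg_def)
  have Y: "Y \<in> lie_g" by (rule nroot_lie_g[OF neg.hyps(2)])
  obtain A S Zb where Z: "bracket X Y = gl_embed A + nm S + Zb" "\<And>i j. i \<le> j \<Longrightarrow> A $ i $ j = 0"
    "transpose S = - S" "Zb \<in> borel_alg"
    using lie_g_triangular[OF lie_g_bracket[OF X Y]] by metis
  have Zb: "Zb \<in> lie_g" using Z(4) by (simp add: borel_alg_def)
  have "act X (act Y x) = act Y (act X x) + act (bracket X Y) x"
    by (simp add: act_bracket X Y)
  also have "\<dots> = act Y (act X x) + (act (gl_embed A) x + act (nm S) x + act Zb x)"
    unfolding Z(1) by (simp add: act_plus lie_g_add nm_in_lie_g Z(3) Zb)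
  also have "\<dots> \<in> V"
    using neg Z by (intro V.add V_lower V_nm V.neg[OF _ neg.hyps(2)]) auto
  finally show ?case .
qed

lemma V_act: assumes "x \<in> V" "Z \<in> lie_g" shows "act Z x \<in> V"
proof -
  obtain A S Zb where Z: "Z = gl_embed A + nm S + Zb" "\<And>i j. i \<le> j \<Longrightarrow> A $ i $ j = 0"
    "transpose S = - S" "Zb \<in> borel_alg"
    using lie_g_triangular[OF assms(2)] by metis
  have Zb: "Zb \<in> lie_g" using Z(4) by (simp add: borel_alg_def)
  show ?thesis unfolding Z(1)
    using assms(1) Z by (simp add: act_plus lie_g_add nm_in_lie_g Zb) (intro V.add V_lower V_nm V_borel, auto)
qed

definition top :: real where "top = (\<Sum>j\<in>UNIV. of_int (lam j) * of_nat (hht j))"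

text \<open>Generalized eigenvectors of \<open>hel\<close> are described by killing them with such
  factors, so no decomposition into weight spaces is required.\<close>

definition hmu :: "real \<Rightarrow> 'v \<Rightarrow> 'v" where "hmu \<mu> x = act hel x - sc (of_real \<mu>) x"

lemma hel_lie_g: "hel \<in> lie_g"
  by (simp add: hel_def)

lemma hmu_top: "hmu top x0 = 0"
  using wt[of "\<chi> j. of_nat (hht j)"] by (simp add: hmu_def hel_def top_def)

lemma hmu_add: "hmu \<mu> (x + y) = hmu \<mu> x + hmu \<mu> y"
  and hmu_sc: "hmu \<mu> (sc c x) = sc c (hmu \<mu> x)"
  by (simp_all add: hmu_def act_add act_sc hel_lie_g scale_right_distrib scale_right_diff_distrib mult.commute)

lemma hmu_0: "hmu \<mu> 0 = 0"
  by (simp add: hmu_def act_0 hel_lie_g)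

lemma hmu_comm: "hmu \<mu> (hmu \<nu> x) = hmu \<nu> (hmu \<mu> x)"
  by (simp add: hmu_def act_diff act_sc hel_lie_g scale_right_diff_distrib mult.commute algebra_simps)

lemma hmu_nroot: assumes "nroot Y d" shows "hmu (\<mu> - real d) (act Y x) = act Y (hmu \<mu> x)"
proof -
  have Y: "Y \<in> lie_g" by (rule nroot_lie_g[OF assms])
  have "act hel (act Y x) = act Y (act hel x) + act (bracket hel Y) x"
    by (simp add: act_bracket hel_lie_g Y)
  then show ?thesis
    by (simp add: hmu_def nroot_hel[OF assms] act_cscale act_diff act_sc Y scale_left_diff_distrib)
qed

text \<open>The sum of the generalized eigenspaces of \<open>hel\<close> for the real eigenvalues smaller than that of \<open>x0\<close>.\<close>

inductive low :: "'v \<Rightarrow> bool" where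
  zero: "low 0"
| step: "\<mu> < top \<Longrightarrow> low (hmu \<mu> x) \<Longrightarrow> low x"

lemma low_hmu: "low x \<Longrightarrow> low (hmu \<nu> x)"
proof (induction rule: low.induct)
  case zero
  then show ?case by (simp add: hmu_0 low.zero)
next
  case (step \<mu> x)
  then show ?case using low.step[of \<mu> "hmu \<nu> x"] by (simp add: hmu_comm)
qed

lemma low_add: "low x \<Longrightarrow> low y \<Longrightarrow> low (x + y)"
proof (induction arbitrary: y rule: low.induct)
  case (step \<mu> x)
  then show ?case using low.step[of \<mu> "x + y"] by (simp add: hmu_add low_hmu)
qed simp

lemma low_sc: "low x \<Longrightarrow> low (sc c x)"
proof (induction rule: low.induct)
  case (step \<mu> x)
  then show ?case using low.step[of \<mu> "sc c x"] by (simp add: hmu_sc)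
qed (simp add: low.zero)

lemma low_nroot: "low x \<Longrightarrow> nroot Y d \<Longrightarrow> low (act Y x)"
proof (induction rule: low.induct)
  case zero
  then show ?case by (simp add: act_0 nroot_lie_g low.zero)
next
  case (step \<mu> x)
  then show ?case using low.step[of "\<mu> - real d" "act Y x"] by (simp add: hmu_nroot)
qed

text \<open>The highest weight has multiplicity one: \<open>V\<close> is spanned by
  \<open>x0\<close> modulo lower eigenvalues.\<close>

lemma V_low: "x \<in> V \<Longrightarrow> \<exists>c. low (x - sc c x0)"
proof (induction rule: V.induct)
  case base
  then show ?case using low.zero by (intro exI[of _ 1]) simp
next
  case (add x y)
  then obtain c d where "low (x - sc c x0)" "low (y - sc d x0)" by blast
  then show ?case using low_add by (intro exI[of _ "c + d"]) (fastforce simp: scale_left_distrib algebra_simps)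
next
  case (scale x c)
  then obtain d where "low (x - sc d x0)" by blast
  from low_sc[OF this, of c] show ?case by (intro exI[of _ "c * d"]) (simp add: scale_right_diff_distrib)
next
  case (neg x Y d)
  then obtain c where c: "low (x - sc c x0)" by blast
  have Y: "Y \<in> lie_g" by (rule nroot_lie_g[OF neg.hyps(2)])
  have "low (act Y x0)"
    by (rule low.step[of "top - real d"]) (use nroot_pos[OF neg.hyps(2)] in \<open>auto simp: hmu_nroot[OF neg.hyps(2)] hmu_top act_0 Y low.zero\<close>)
  then have "low (act Y (x - sc c x0) + sc c (act Y x0))"
    by (intro low_add low_sc low_nroot[OF c neg.hyps(2)])
  then show ?case by (intro exI[of _ 0]) (simp add: act_diff act_sc Y)
qed

end

section \<open>Comparison with the irreducible quotient\<close>

lemma lookup_wscale [simp]: "Poly_Mapping.lookup (wscale c x) k = c * Poly_Mapping.lookup x k"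
  unfolding wscale_def by (transfer fixing: c) (auto simp: when_def)

global_interpretation wsc: vector_space wscale
  by unfold_locales (auto intro!: poly_mapping_eqI simp: lookup_add algebra_simps)

lemma left_mult_pure: "left_mult X (pure w f) = pure (X # w) f"
proof -
  have "wscale 1 x = x" for x :: "'b \<Rightarrow>\<^sub>0 complex" by (rule wsc.scale_one)
  then show ?thesis by (simp add: left_mult_def pure_def lookup_single)
qed

text \<open>The vector is the image of the highest weight vector of \<open>F\<close> under the empty
  word.\<close>

lemma is_L_hw:
  fixes scF :: "complex \<Rightarrow> 'f::ab_group_add \<Rightarrow> 'f" and scL :: "complex \<Rightarrow> 'v::ab_group_add \<Rightarrow> 'v"
    and actL :: "'n::{finite,linorder} mat2 \<Rightarrow> 'v \<Rightarrow> 'v"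
  assumes "is_L lam scF actF scL actL"
  obtains v where "v \<noteq> 0" "hw_module scL actL lam v"
proof -
  obtain \<Psi> where F: "is_F lam scF actF" and L: "irreducible_lie_module lie_g scL actL" and \<Psi>: "verma_epi scF actF scL actL \<Psi>"
    using assms by (auto simp: is_L_def)
  have Lm: "lie_module lie_g scL actL" and Ln: "(UNIV :: 'v set) \<noteq> {0}" using L by (auto simp: irreducible_lie_module_def)
  have Fm: "lie_module lie_k scF actF"
    and Firr: "\<And>W. module.subspace scF W \<Longrightarrow> (\<forall>X\<in>lie_k. actF X ` W \<subseteq> W) \<Longrightarrow> W = {0} \<or> W = UNIV"
    using F by (auto simp: is_F_def irreducible_lie_module_def)
  interpret scL: vector_space scL using Lm by (simp add: lie_module_def)
  interpret scF: vector_space scF using Fm by (simp add: lie_module_def)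
  obtain vF where vF: "vF \<noteq> 0"
    "\<And>h. actF (gl_embed (diag_mat h)) vF = scF (\<Sum>j\<in>UNIV. of_int (lam j) * h $ j) vF"
    "\<And>i j. i < j \<Longrightarrow> actF (gl_embed (mat_unit i j)) vF = 0"
    using F by (auto simp: is_F_def)
  have linF: "actF X (a + b) = actF X a + actF X b" "actF X (scF c a) = scF c (actF X a)" if "X \<in> lie_k" for X a b c
    using Fm that unfolding lie_module_def Vector_Spaces.linear_iff by auto
  have actL0: "actL X 0 = 0" if X: "X \<in> lie_g" for X
  proof -
    have "actL X (scL 0 0) = scL 0 (actL X 0)" using Lm X unfolding lie_module_def Vector_Spaces.linear_iff by blast
    then show ?thesis by simp
  qed
  define \<Phi> where "\<Phi> x = \<Psi> (verma_class scF actF x)" for x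
  have surj: "\<Phi> ` words_space = UNIV"
    and Padd: "\<And>x y. x \<in> words_space \<Longrightarrow> y \<in> words_space \<Longrightarrow> \<Phi> (x + y) = \<Phi> x + \<Phi> y"
    and Psc: "\<And>c x. x \<in> words_space \<Longrightarrow> \<Phi> (wscale c x) = scL c (\<Phi> x)"
    and Plm: "\<And>X x. X \<in> lie_g \<Longrightarrow> x \<in> words_space \<Longrightarrow> \<Phi> (left_mult X x) = actL X (\<Phi> x)"
    using \<Psi> by (auto simp: verma_epi_def Let_def \<Phi>_def gen_verma_def image_image)
  have ws: "pure w f \<in> words_space" if "set w \<subseteq> lie_g" for w and f :: 'f
    unfolding words_space_def by (rule wsc.span_base) (use that in auto)
  have Peq: "\<Phi> x = \<Phi> y" if "x - y \<in> verma_rel scF actF" for x y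
  proof -
    have s: "x - y \<in> wsc.span (verma_rel scF actF)" using that by (rule wsc.span_base)
    have "z - x \<in> wsc.span (verma_rel scF actF) \<longleftrightarrow> z - y \<in> wsc.span (verma_rel scF actF)" for z
      using wsc.span_add[OF _ s, of "z - x"] wsc.span_diff[OF _ s, of "z - y"] by auto
    then show ?thesis by (simp add: \<Phi>_def verma_class_def)
  qed
  have P0: "\<Phi> 0 = 0"
  proof -
    have "\<Phi> (wscale 0 0) = scL 0 (\<Phi> 0)" by (rule Psc) (simp add: words_space_def wsc.span_zero)
    then show ?thesis by simp
  qed
  define J where "J f = \<Phi> (pure [] f)" for f
  have Jadd: "J (f + g) = J f + J g" for f g
  proof -
    have "\<Phi> (pure [] (f + g)) = \<Phi> (pure [] f + pure [] g)"
      using verma_rel.vec_add[of "[]" f g scF actF] by (intro Peq) (simp add: diff_diff_eq)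
    then show ?thesis by (simp add: J_def Padd ws)
  qed
  have Jsc: "J (scF c f) = scL c (J f)" for c f
  proof -
    have "\<Phi> (pure [] (scF c f)) = \<Phi> (wscale c (pure [] f))"
      by (rule Peq) (rule verma_rel.vec_scale, simp)
    then show ?thesis by (simp add: J_def Psc ws)
  qed
  have lie_kg: "X \<in> lie_g" if "X \<in> lie_k" for X :: "'n mat2" using that lie_k_subset_lie_g by blast
  have Jk: "actL X (J f) = J (actF X f)" if "X \<in> lie_k" for X f
  proof -
    have "actL X (J f) = \<Phi> (pure [X] f)" using Plm[OF lie_kg[OF that] ws[of "[]" f]] by (simp add: J_def left_mult_pure)
    also have "\<dots> = J (actF X f)" unfolding J_def
      by (rule Peq) (use verma_rel.balanced_k[of "[]" X f actF scF] that in simp)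
    finally show ?thesis .
  qed
  have Jp: "actL X (J f) = 0" if X: "X \<in> lie_p_plus" for X f
  proof -
    have "actL X (J f) = \<Phi> (pure [X] f)"
      using Plm[of X, OF _ ws[of "[]" f]] X lie_p_plus_subset_lie_g by (auto simp: J_def left_mult_pure)
    also have "\<dots> = \<Phi> 0" by (rule Peq) (use verma_rel.balanced_p[of "[]" X f scF actF] X in simp)
    finally show ?thesis by (simp add: P0)
  qed
  \<comment> \<open>Otherwise the kernel of \<open>J\<close> is a nonzero submodule of the
    irreducible \<open>F\<close>, so \<open>J\<close> vanishes. Then all words map to 0,
    contradicting surjectivity onto a nonzero module.\<close>
  have "J vF \<noteq> 0"
  proof
    assume "J vF = 0"
    have "scF.subspace {f. J f = 0}"
      using Jsc[of 0 0] by (auto simp: scF.subspace_def Jadd Jsc)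
    moreover have "\<forall>X\<in>lie_k. actF X ` {f. J f = 0} \<subseteq> {f. J f = 0}"
    proof clarify
      fix X :: "'n mat2" and f assume "X \<in> lie_k" "J f = 0"
      then show "J (actF X f) = 0" using Jk[of X f] actL0[of X] lie_kg[of X] by simp
    qed
    ultimately have "{f. J f = 0} = {0} \<or> {f. J f = 0} = UNIV" by (rule Firr)
    then have J0: "J f = 0" for f using \<open>J vF = 0\<close> vF(1) by blast
    have w0: "\<Phi> (pure w f) = 0" if "set w \<subseteq> lie_g" for w f
      using that
    proof (induction w)
      case Nil
      then show ?case using J0 by (simp add: J_def)
    next
      case (Cons X w)
      then show ?case using Plm[of X "pure w f"] ws[of w f] by (simp add: left_mult_pure actL0)
    qed
    have "\<Phi> x = 0" if "x \<in> words_space" for x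
    proof -
      have "x \<in> words_space \<and> \<Phi> x = 0" using that unfolding words_space_def
      proof (induction x rule: wsc.span_induct_alt)
        case base
        then show ?case by (simp add: wsc.span_zero P0)
      next
        case (step c x y)
        then have "x \<in> words_space" "\<Phi> x = 0" using ws w0 by auto
        then show ?case using step Padd[of "wscale c x" y] Psc[of x c]
          by (auto simp: words_space_def intro: wsc.span_add wsc.span_scale)
      qed
      then show ?thesis by simp
    qed
    then have "(UNIV :: 'v set) \<subseteq> {0}" unfolding surj[symmetric] by auto
    then show False using Ln by auto
  qed
  moreover have "hw_module scL actL lam (J vF)"
  proof
    fix h and i j :: 'n
    show "actL (gl_embed (diag_mat h)) (J vF) = scL (\<Sum>j\<in>UNIV. of_int (lam j) * h $ j) (J vF)"
      by (subst Jk) (auto simp: lie_k_def vF(2) Jsc)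
    show "i < j \<Longrightarrow> actL (gl_embed (mat_unit i j)) (J vF) = 0"
      by (subst Jk) (use Jsc[of 0 0] in \<open>auto simp: lie_k_def vF(3)\<close>)
  qed (use Lm Jp in auto)
  ultimately show ?thesis using that by blast
qed

section \<open>From a highest weight vector among the polynomials to unitarity\<close>

context fock
begin

text \<open>A homogeneous spanning set for the submodule generated by \<open>f\<close>.
  \<open>opD\<close> does not occur, since \<open>V\<close> is built from negative root
  vectors.\<close>

inductive_set words :: "'n::finite var pol \<Rightarrow> 'n var pol set" for f where
  base: "f \<in> words f"
| opE: "w \<in> words f \<Longrightarrow> opE A w \<in> words f"
| opM: "w \<in> words f \<Longrightarrow> transpose Y = - Y \<Longrightarrow> opM Y w \<in> words f"

lemma words_graded: "w \<in> words f \<Longrightarrow> conly f \<Longrightarrow> chom d f \<Longrightarrow> conly w \<and> (\<exists>d. chom d w)"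
  by (induction rule: words.induct) (blast intro: conly_opE conly_opM chom_opE chom_opM)+

lemma gact_nm: "gact (nm Y) p = opM Y p"
  by (simp add: nm_def)

lemma lie_module_gact: "lie_module lie_g psc (gact :: 'n::finite mat2 \<Rightarrow> _)"
  unfolding lie_module_def Vector_Spaces.linear_iff
  using plin_add[OF plin_gact] plin_psc[OF plin_gact]
  by (auto simp: gact_add gact_cscale gact_bracket pol.vector_space_axioms)

lemma adjm_hel: "adjm hel = hel"
proof -
  have "adjm hel $ r $ s = (hel :: 'a mat2) $ r $ s" for r s
    by (cases r; cases s) (auto simp: adjm_nth hel_def gl_embed_def transpose_def diag_mat_def)
  then show ?thesis by (simp add: vec_eq_iff)
qed

theorem hw_unitary:
  fixes scL :: "complex \<Rightarrow> 'v::ab_group_add \<Rightarrow> 'v" and actL :: "'n::{finite,linorder} mat2 \<Rightarrow> 'v \<Rightarrow> 'v"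
    and f :: "'n var pol"
  assumes irr: "irreducible_lie_module lie_g scL actL"
    and hv: "hw_module scL actL lam v" and v: "v \<noteq> 0"
    and hf: "hw_module psc gact lam f" and f: "f \<noteq> 0" "conly f" "chom d f"
  shows "unitary_module scL actL"
proof -
  interpret L: hw_module scL actL lam v by (rule hv)
  interpret F: hw_module psc gact lam f by (rule hf)
  define psP where "psP c x = (scL c (fst x), psc c (snd x))" for c and x :: "'v \<times> 'n var pol"
  define gaP where "gaP X x = (actL X (fst x), gact X (snd x))" for X and x :: "'v \<times> 'n var pol"
  have vsP: "vector_space psP"
    by unfold_locales (auto simp: psP_def L.scale_right_distrib L.scale_left_distrib psc_add_right psc_add_left prod_eq_iff)
  interpret P: hw_module psP gaP lam "(v, f)"
  proof
    show "lie_module lie_g psP gaP"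
      unfolding lie_module_def Vector_Spaces.linear_iff
      using vsP by (auto simp: gaP_def psP_def L.act_add L.act_sc L.act_plus L.act_cscale L.act_bracket
          F.act_add F.act_sc F.act_plus F.act_cscale F.act_bracket)
    fix h and i j :: 'n
    show "gaP (gl_embed (diag_mat h)) (v, f) = psP (\<Sum>j\<in>UNIV. of_int (lam j) * h $ j) (v, f)"
      unfolding gaP_def psP_def fst_conv snd_conv L.wt F.wt ..
    show "i < j \<Longrightarrow> gaP (gl_embed (mat_unit i j)) (v, f) = 0"
      unfolding gaP_def fst_conv snd_conv by (simp only: L.raise F.raise zero_prod_def)
    show "X \<in> lie_p_plus \<Longrightarrow> gaP X (v, f) = 0" for X
      by (simp add: gaP_def L.pplus F.pplus zero_prod_def)
  qed
  have hel_f: "gact hel f = psc (of_real P.top) f"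
    using F.hmu_top by (simp add: F.hmu_def)
  have hel_v: "actL hel v = scL (of_real P.top) v"
    using L.hmu_top by (simp add: L.hmu_def)
  \<comment> \<open>\<open>hel\<close> is self-adjoint and \<open>f\<close> belongs to the
    eigenvalue \<open>P.top\<close>, so lower generalized eigenvectors are orthogonal to
    \<open>f\<close>.\<close>
  have low_f: "fip (snd x) f = 0" if "P.low x" for x
    using that
  proof (induction rule: P.low.induct)
    case zero
    show ?case by (simp add: zero_prod_def)
  next
    case (step \<mu> x)
    have "fip (gact hel (snd x)) f = of_real P.top * fip (snd x) f"
      by (simp add: fip_gact P.hel_lie_g adjm_hel hel_f fip_psc_right)
    then have "(of_real P.top - of_real \<mu>) * fip (snd x) f = 0"
      using step.IH by (simp add: P.hmu_def gaP_def psP_def fip_diff_left fip_psc_left left_diff_distrib)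
    moreover have "complex_of_real P.top - of_real \<mu> \<noteq> 0" using step.hyps(1) by (simp flip: of_real_diff)
    ultimately show ?case by simp
  qed
  \<comment> \<open>On this side no inner product is available; instead a multiple of
    \<open>v\<close> is followed through the factors \<open>P.hmu\<close>, each of which scales it
    by a nonzero number.\<close>
  have low_v: "c = 0" if "P.low x" "fst x = scL c v" for x c
    using that
  proof (induction arbitrary: c rule: P.low.induct)
    case zero
    then show ?case using v by (simp add: zero_prod_def)
  next
    case (step \<mu> x)
    have "fst (P.hmu \<mu> x) = scL ((of_real P.top - of_real \<mu>) * c) v"
      by (simp add: P.hmu_def gaP_def psP_def step.prems L.act_sc P.hel_lie_g hel_v L.scale_left_diff_distrib left_diff_distrib right_diff_distrib mult.commute)
    then have "(of_real P.top - of_real \<mu>) * c = 0" by (rule step.IH)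
    moreover have "complex_of_real P.top - of_real \<mu> \<noteq> 0" using step.hyps(1) by (simp flip: of_real_diff)
    ultimately show ?case by simp
  qed
  have orth: "fip w f = 0" if w: "(0, w) \<in> P.V" for w
  proof -
    obtain c where c: "P.low ((0, w) - psP c (v, f))" using P.V_low[OF w] by blast
    then have "- c = 0" by (rule low_v) (simp add: psP_def)
    then have "P.low ((0, w) - psP 0 (v, f))" using c by simp
    then show ?thesis using low_f[of "(0, w)"] by (simp add: psP_def zero_prod_def[symmetric])
  qed
  have stab: "(0, gact X w) \<in> P.V" if "(0, w) \<in> P.V" "X \<in> lie_g" for X w
    using P.V_act[OF that] by (simp add: gaP_def L.act_0 that(2))
  \<comment> \<open>Adjointness moves the generators of \<open>P.V\<close> to \<open>w\<close>, and
    the elements \<open>(0, w)\<close> are stable under the action, so orthogonality to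
    \<open>f\<close> spreads to the whole second projection.\<close>
  have orthV: "\<forall>w. (0, w) \<in> P.V \<longrightarrow> fip w (snd y) = 0" if "y \<in> P.V" for y
    using that
  proof (induction rule: P.V.induct)
    case base
    show ?case using orth by simp
  next
    case (neg x Y d)
    have Y: "Y \<in> lie_g" by (rule nroot_lie_g[OF neg.hyps(2)])
    have "fip w (gact Y (snd x)) = fip (gact (adjm Y) w) (snd x)" for w
      using fip_gact[OF lie_g_adjm[OF Y], of w "snd x"] by simp
    moreover have "snd (gaP Y x) = gact Y (snd x)" by (simp add: gaP_def)
    ultimately show ?case using neg.IH stab lie_g_adjm[OF Y] by simp
  next
    case (scale x c)
    moreover have "snd (psP c x) = psc c (snd x)" by (simp add: psP_def)
    ultimately show ?case by (simp add: fip_psc_right)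
  qed (simp add: fip_add_right)
  have w0: "w = 0" if "(0, w) \<in> P.V" for w
    using orthV[OF that, rule_format, OF that] by (simp add: fip_self_eq_0)
  have Vdiff: "x - y \<in> P.V" if "x \<in> P.V" "y \<in> P.V" for x y
    using P.V.add[OF that(1) P.V.scale[OF that(2), of "- 1"]] by simp
  have sub: "(\<And>W. L.subspace W \<Longrightarrow> (\<And>X w. X \<in> lie_g \<Longrightarrow> w \<in> W \<Longrightarrow> actL X w \<in> W) \<Longrightarrow> W = {0} \<or> W = UNIV)"
    using irr unfolding irreducible_lie_module_def by blast
  \<comment> \<open>By irreducibility the alternative would be that all \<open>(l, 0)\<close> lie in
    \<open>P.V\<close>. Then \<open>(v, 0)\<close> and hence \<open>(0, f)\<close> would, against
    \<open>w0\<close>.\<close>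
  have l0: "l = 0" if l: "(l, 0) \<in> P.V" for l
  proof -
    have "{l. (l, 0) \<in> P.V} = {0} \<or> {l. (l, 0) \<in> P.V} = UNIV"
    proof (rule sub)
      show "L.subspace {l. (l, 0) \<in> P.V}"
        unfolding L.subspace_def
      proof (intro conjI allI ballI)
        show "0 \<in> {l. (l, 0) \<in> P.V}" using P.V_zero by (simp add: zero_prod_def)
        fix x y c assume xy: "x \<in> {l. (l, 0) \<in> P.V}" "y \<in> {l. (l, 0) \<in> P.V}"
        show "x + y \<in> {l. (l, 0) \<in> P.V}" using P.V.add[of "(x, 0)" "(y, 0)"] xy by simp
        show "scL c x \<in> {l. (l, 0) \<in> P.V}" using P.V.scale[of "(x, 0)" c] xy by (simp add: psP_def)
      qed
      show "actL X w \<in> {l. (l, 0) \<in> P.V}" if "X \<in> lie_g" "w \<in> {l. (l, 0) \<in> P.V}" for X w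
        using P.V_act[of "(w, 0)" X] that by (simp add: gaP_def F.act_0)
    qed
    moreover have "{l. (l, 0) \<in> P.V} \<noteq> UNIV"
    proof
      assume "{l. (l, 0) \<in> P.V} = UNIV"
      then have "(v, 0) \<in> P.V" by blast
      then have "(0, f) \<in> P.V" using Vdiff[OF P.V.base] by fastforce
      then show False using w0 f(1) by blast
    qed
    ultimately show ?thesis using l by blast
  qed
  have "{l. \<exists>w. (l, w) \<in> P.V} = {0} \<or> {l. \<exists>w. (l, w) \<in> P.V} = UNIV"
  proof (rule sub)
    show "L.subspace {l. \<exists>w. (l, w) \<in> P.V}"
      unfolding L.subspace_def
    proof (intro conjI allI ballI)
      show "0 \<in> {l. \<exists>w. (l, w) \<in> P.V}" using P.V_zero by (auto simp: zero_prod_def)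
      fix x y c assume "x \<in> {l. \<exists>w. (l, w) \<in> P.V}" "y \<in> {l. \<exists>w. (l, w) \<in> P.V}"
      then obtain w z where wz: "(x, w) \<in> P.V" "(y, z) \<in> P.V" by blast
      show "x + y \<in> {l. \<exists>w. (l, w) \<in> P.V}" using P.V.add[OF wz] by auto
      show "scL c x \<in> {l. \<exists>w. (l, w) \<in> P.V}" using P.V.scale[OF wz(1), of c] by (auto simp: psP_def)
    qed
    show "actL X w \<in> {l. \<exists>w. (l, w) \<in> P.V}" if X: "X \<in> lie_g" and w: "w \<in> {l. \<exists>w. (l, w) \<in> P.V}" for X w
    proof -
      obtain z where "(w, z) \<in> P.V" using w by blast
      from P.V_act[OF this X] show ?thesis by (auto simp: gaP_def)
    qed
  qed
  then have "\<exists>w. (l, w) \<in> P.V" for l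
    using v P.V.base by blast
  then obtain T0 where T0: "\<And>l. (l, T0 l) \<in> P.V" by metis
  have T0u: "w = T0 l" if "(l, w) \<in> P.V" for l w
    using Vdiff[OF that T0[of l]] w0[of "w - T0 l"] by simp
  define M where "M = snd ` P.V"
  have ran: "range T0 = M"
    unfolding M_def using T0 T0u by (force simp: image_iff)
  have WM: "words f \<subseteq> M"
  proof
    fix w assume "w \<in> words f"
    then show "w \<in> M"
    proof (induction rule: words.induct)
      case base
      show ?case unfolding M_def using P.V.base by force
    next
      case (opE w A)
      then obtain l where "(l, w) \<in> P.V" by (auto simp: M_def)
      from P.V_act[OF this gl_embed_in_lie_g[of A]] show ?case
        unfolding M_def by (force simp: gaP_def)
    next
      case (opM w Y)
      then obtain l where "(l, w) \<in> P.V" by (auto simp: M_def)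
      from P.V_act[OF this nm_in_lie_g[OF opM.hyps(2)]] show ?case
        unfolding M_def by (force simp: gaP_def gact_nm)
    qed
  qed
  have MW: "snd x \<in> pol.span (words f)" if "x \<in> P.V" for x
    using that
  proof (induction rule: P.V.induct)
    case base
    show ?case by (simp add: pol.span_base words.base)
  next
    case (add x y)
    then show ?case by (simp add: pol.span_add)
  next
    case (scale x c)
    then show ?case by (simp add: psP_def pol.span_scale)
  next
    case (neg x Y d)
    have "plin (gact Y)" by simp
    moreover have "gact Y w \<in> pol.span (words f)" if "w \<in> words f" for w
      using neg.hyps(2)
    proof cases
      case (1 j i)
      then show ?thesis using that by (simp add: pol.span_base words.opE)
    next
      case (2 i j)
      then show ?thesis using words.opM[OF that mat_unit_skew] by (simp add: gact_nm pol.span_base)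
    qed
    ultimately show ?case using span_stable[of "gact Y" "words f" "words f" "snd x"] neg.IH by (simp add: gaP_def)
  qed
  interpret graded_fock_module C M "words f"
  proof
    show "pol.subspace M"
      unfolding pol.subspace_def M_def
    proof (intro conjI allI ballI)
      show "0 \<in> snd ` P.V" using P.V_zero by force
      fix x y c assume "x \<in> snd ` P.V" "y \<in> snd ` P.V"
      then obtain l k where lk: "(l, x) \<in> P.V" "(k, y) \<in> P.V" by force
      show "x + y \<in> snd ` P.V" using P.V.add[OF lk] by force
      show "psc c x \<in> snd ` P.V" using P.V.scale[OF lk(1), of c] by (force simp: psP_def)
    qed
    show "gact X m \<in> M" if X: "X \<in> lie_g" and m: "m \<in> M" for X m
    proof -
      obtain l where "(l, m) \<in> P.V" using m by (auto simp: M_def)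
      from P.V_act[OF this X] show ?thesis unfolding M_def by (force simp: gaP_def)
    qed
    show "M \<subseteq> pol.span (words f)" using MW by (auto simp: M_def)
    show "words f \<subseteq> M" by (rule WM)
    show "conly w \<and> (\<exists>d. chom d w)" if "w \<in> words f" for w
      using words_graded[OF that f(2,3)] .
  qed
  show ?thesis
  proof (rule unitary_moduleI[of scL T0 actL])
    show "Vector_Spaces.linear scL psc T0"
      unfolding Vector_Spaces.linear_iff
    proof (intro conjI allI)
      fix x y c
      show "T0 (x + y) = T0 x + T0 y" using T0u[of "x + y" "T0 x + T0 y"] P.V.add[OF T0 T0, of x y] by simp
      show "T0 (scL c x) = psc c (T0 x)" using T0u[of "scL c x" "psc c (T0 x)"] P.V.scale[OF T0, of c x] by (simp add: psP_def)
    qed (rule L.vector_space_axioms pol.vector_space_axioms)+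
    show "inj T0"
    proof (rule injI)
      fix x y assume "T0 x = T0 y"
      then have "(x - y, 0) \<in> P.V" using Vdiff[OF T0[of x] T0[of y]] by simp
      then show "x = y" using l0 by fastforce
    qed
    show "range T0 = M" by (rule ran)
    show "T0 (actL X l) = gact X (T0 l)" if "X \<in> lie_g" for X l
      using T0u[of "actL X l" "gact X (T0 l)"] P.V_act[OF T0 that, of l] by (simp add: gaP_def)
  qed
qed

end

section \<open>The highest weight vector in the Fock space\<close>

definition derivation :: "('r::comm_ring_1 \<Rightarrow> 'r) \<Rightarrow> bool" where
  "derivation D \<longleftrightarrow> (\<forall>p q. D (p + q) = D p + D q) \<and> (\<forall>p q. D (p * q) = D p * q + p * D q)"

lemma derivation_add: "derivation D \<Longrightarrow> D (p + q) = D p + D q"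
  and derivation_mult: "derivation D \<Longrightarrow> D (p * q) = D p * q + p * D q"
  by (auto simp: derivation_def)

lemma derivation_0: "derivation D \<Longrightarrow> D 0 = 0"
  using derivation_add[of D 0 0] by simp

lemma derivation_1: "derivation D \<Longrightarrow> D 1 = 0"
  using derivation_mult[of D 1 1] by simp

lemma derivation_minus: "derivation D \<Longrightarrow> D (- p) = - D p"
  using derivation_add[of D "- p" p] derivation_0[of D] by (simp add: eq_neg_iff_add_eq_0)

lemma derivation_sum: assumes "derivation D" shows "D (sum f A) = (\<Sum>x\<in>A. D (f x))"
  by (induction A rule: infinite_finite_induct) (auto simp: derivation_0[OF assms] derivation_add[OF assms])

lemma derivation_prod:
  assumes "derivation D" "finite A"
  shows "D (prod f A) = (\<Sum>r\<in>A. \<Prod>i\<in>A. if i = r then D (f i) else f i)"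
  using assms(2)
proof (induction A rule: finite_induct)
  case empty
  then show ?case by (simp add: derivation_1[OF assms(1)])
next
  case (insert x A)
  have "(\<Prod>i\<in>A. if i = x then D (f i) else f i) = prod f A"
    using insert.hyps by (intro prod.cong) auto
  moreover have "(\<Prod>i\<in>insert x A. if i = r then D (f i) else f i) = f x * (\<Prod>i\<in>A. if i = r then D (f i) else f i)" if "r \<in> A" for r
    using insert.hyps that by auto
  ultimately show ?case using insert by (simp add: derivation_mult[OF assms(1)] sum_distrib_left)
qed

lemma derivation_sign: assumes "derivation D" shows "D (of_int (sign p) * q) = of_int (sign p) * D q"
  by (cases p rule: sign_cases) (simp_all add: derivation_minus[OF assms])

text \<open>Leibniz rule along the rows. In this form a derivation that replaces one row by another
  produces equal rows.\<close>

lemma derivation_det: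
  fixes A :: "'r::comm_ring_1^'n^'n"
  assumes D: "derivation D"
  shows "D (det A) = (\<Sum>r\<in>UNIV. det (\<chi> i. if i = r then \<chi> j. D (A $ i $ j) else A $ i))"
proof -
  have "(if i = r then \<chi> j. D (A $ i $ j) else A $ i) $ j = (if i = r then D (A $ i $ j) else A $ i $ j)" for i r j
    by simp
  then have "(\<Sum>r\<in>UNIV. det (\<chi> i. if i = r then \<chi> j. D (A $ i $ j) else A $ i))
    = (\<Sum>r\<in>UNIV. \<Sum>p | p permutes UNIV. of_int (sign p) * (\<Prod>i\<in>UNIV. if i = r then D (A $ i $ p i) else A $ i $ p i))"
    by (simp add: det_def)
  also have "\<dots> = (\<Sum>p | p permutes UNIV. of_int (sign p) * (\<Sum>r\<in>UNIV. \<Prod>i\<in>UNIV. if i = r then D (A $ i $ p i) else A $ i $ p i))"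
    by (subst sum.swap) (simp add: sum_distrib_left)
  also have "\<dots> = D (det A)"
    by (simp add: det_def derivation_sum[OF D] derivation_sign[OF D] derivation_prod[OF D])
  finally show ?thesis ..
qed

lemma hom_det:
  fixes h :: "'r::comm_ring_1 \<Rightarrow> 's::comm_ring_1" and A :: "'r^'n^'n"
  assumes a: "\<And>x y. h (x + y) = h x + h y" and m: "\<And>x y. h (x * y) = h x * h y" and o: "h 1 = 1"
  shows "h (det A) = det (\<chi> i j. h (A $ i $ j))"
proof -
  have z: "h 0 = 0" using a[of 0 0] by simp
  have n: "h (- x) = - h x" for x using a[of "- x" x] by (simp add: z eq_neg_iff_add_eq_0)
  have "h (sum f B) = (\<Sum>x\<in>B. h (f x))" for f and B :: "('n \<Rightarrow> 'n) set"
    by (induction B rule: infinite_finite_induct) (auto simp: z a)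
  moreover have "h (prod f B) = (\<Prod>x\<in>B. h (f x))" for f and B :: "'n set"
    by (induction B rule: infinite_finite_induct) (auto simp: o m)
  moreover have "h (of_int (sign p) * x) = of_int (sign p) * h x" for p :: "'n \<Rightarrow> 'n" and x
    by (cases p rule: sign_cases) (simp_all add: n)
  ultimately show ?thesis by (simp add: det_def)
qed

lemma derivation_psc_power:
  assumes "derivation D" "D p = psc \<mu> p"
  shows "D (p ^ k) = psc (of_nat k * \<mu>) (p ^ k)"
proof (induction k)
  case 0
  show ?case by (simp add: derivation_1[OF assms(1)])
next
  case (Suc k)
  then show ?case by (simp add: derivation_mult[OF assms(1)] assms(2) psc_mult_left psc_mult_right distrib_right flip: psc_add_left)
qed

lemma derivation_psc_prod:
  assumes D: "derivation D" and "\<And>s. s \<in> S \<Longrightarrow> D (p s) = psc (\<mu> s) (p s)"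
  shows "D (prod p S) = psc (sum \<mu> S) (prod p S)"
  using assms(2)
proof (induction S rule: infinite_finite_induct)
  case (insert s S)
  then show ?case by (simp add: derivation_mult[OF D] psc_mult_left psc_mult_right flip: psc_add_left)
qed (simp_all add: derivation_1[OF D])

lemma derivation_der: "derivation (der v)"
  by (simp add: derivation_def der_add der_mult)

section \<open>Padded minors and their products\<close>

type_synonym 'n prow = "'n var pol^'n"
type_synonym 'n pmat = "'n prow^'n"

lemma det_row_zero:
  fixes A :: "'r::comm_ring_1^'n^'n"
  assumes "\<And>j. A $ r $ j = 0"
  shows "det A = 0"
proof -
  have "A = (\<chi> i. if i = r then 0 else A $ i)" by (simp add: vec_eq_iff assms)
  then show ?thesis using det_row_0[of r "\<lambda>i. A $ i"] by simp
qed

definition bot_rows :: "nat \<Rightarrow> 'n::{finite,linorder} set" where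
  "bot_rows s = {i. pos i > CARD('n) - s}"

text \<open>The identity outside the last \<open>s\<close> rows pads the minor to the fixed index
  type. \<open>CARD('n) - pos j\<close> runs from 0 to \<open>s - 1\<close>, and only the half
  \<open>False\<close> is used, so that \<open>opD\<close> annihilates the result.\<close>

definition mmat :: "nat \<Rightarrow> 'n::{finite,linorder} pmat" where
  "mmat s = (\<chi> i j. if i \<in> bot_rows s then if j \<in> bot_rows s then pvar (i, CARD('n) - pos j, False) else 0
                    else if i = j then 1 else 0)"

lemma det_mmat_derivation:
  assumes D: "derivation D"
  shows "D (det (mmat s :: 'n::{finite,linorder} pmat))
    = (\<Sum>r\<in>bot_rows s. det (\<chi> i. if i = r then \<chi> j. D (mmat s $ i $ j) else mmat s $ i :: 'n pmat))"
proof -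
  have "det (\<chi> i. if i = r then \<chi> j. D (mmat s $ i $ j) else mmat s $ i :: 'n pmat) = 0" if "r \<notin> bot_rows s" for r :: 'n
    by (rule det_row_zero[of _ r]) (use that in \<open>auto simp: mmat_def derivation_0[OF D] derivation_1[OF D]\<close>)
  then show ?thesis unfolding derivation_det[OF D]
    by (intro sum.mono_neutral_right) auto
qed

context fock
begin

text \<open>The polarization operator without sign and shift; having order one and no constant term,
  it is a derivation.\<close>

definition lieE :: "complex^'n^'n \<Rightarrow> 'n::finite var pol \<Rightarrow> 'n var pol" where
  "lieE A p = - opE A p - psc (of_nat (card C) * trace A) p"

lemma lieE_pvar_mult: "lieE A (pvar (l, c, s) * p) = (if c \<in> C then \<Sum>j\<in>UNIV. psc (A $ l $ j) (pvar (j, c, s)) else 0) * p + pvar (l, c, s) * lieE A p"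
  by (simp add: lieE_def opE_pvar right_diff_distrib psc_mult_right sum_distrib_right psc_mult_left)

lemma lieE_one: "lieE A 1 = 0"
  by (simp add: lieE_def opE_one psc_minus_left)

lemma lieE_pvar: "lieE A (pvar (l, c, s)) = (if c \<in> C then \<Sum>j\<in>UNIV. psc (A $ l $ j) (pvar (j, c, s)) else 0)"
  using lieE_pvar_mult[of A l c s 1] by (simp add: lieE_one)

lemma plin_lieE: "plin (lieE A)"
  by (rule plinI) (simp_all add: lieE_def plin_add[OF plin_opE] plin_psc[OF plin_opE] psc_add_right psc_diff_right mult.commute)

lemma lieE_derivation: "derivation (lieE A)"
proof -
  have "lieE A (p * q) = lieE A p * q + p * lieE A q" for p q :: "'a var pol"
  proof (induction p rule: pol_induct)
    case (var v p)
    obtain l c s where v: "v = (l, c, s)" by (cases v)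
    show ?case unfolding v mult.assoc lieE_pvar_mult var by (simp add: distrib_left distrib_right mult.assoc)
  qed (simp_all add: lieE_one plin_add[OF plin_lieE] plin_psc[OF plin_lieE] distrib_right distrib_left psc_add_right psc_mult_left)
  then show ?thesis by (simp add: derivation_def plin_add[OF plin_lieE])
qed

lemma chom_mult: "chom d p \<Longrightarrow> chom e q \<Longrightarrow> chom (d + e) (p * q)"
  by (simp add: chom_def dsub_def psub_mult power_int_add psc_mult_left psc_mult_right mult.commute)

lemma chom_prod: "(\<And>i. i \<in> A \<Longrightarrow> chom (d i) (p i)) \<Longrightarrow> chom (sum d A) (prod p A)"
  by (induction A rule: infinite_finite_induct) (auto intro: chom_one chom_mult)

lemma chom_power: "chom d p \<Longrightarrow> chom (int k * d) (p ^ k)"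
  using chom_prod[of "{..<k}" "\<lambda>_. d" "\<lambda>_. p"] by simp

context
  fixes q :: nat and b :: "nat \<Rightarrow> nat"
  assumes qC: "{..<q} \<subseteq> C"
begin

lemma rows_col:
  assumes "s \<le> q" "(j :: 'n::{finite,linorder}) \<in> bot_rows s"
  shows "CARD('n) - pos j \<in> C"
proof -
  have "CARD('n) - pos j < q" using assms pos_ge[of j] pos_le[of j] by (simp add: bot_rows_def)
  then show ?thesis using qC by auto
qed

lemma chom_mmat:
  assumes "s \<le> q"
  shows "\<exists>d. chom d (det (mmat s :: 'n::{finite,linorder} pmat))"
proof -
  let ?d = "\<lambda>i :: 'n. if i \<in> bot_rows s then 1 else 0"
  have "c \<in> C \<Longrightarrow> chom 1 (pvar (i, c, False) :: 'n var pol)" for i c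
    using chom_pvar[OF chom_one, of c i False] by simp
  then have e: "chom (?d i) (mmat s $ i $ j :: 'n var pol)" for i j
    using rows_col[OF assms, of j] by (auto simp: mmat_def chom_zero chom_one)
  have "chom (sum ?d UNIV) (of_int (sign p) * (\<Prod>i\<in>UNIV. mmat s $ i $ p i :: 'n var pol))" for p
    by (cases p rule: sign_cases) (auto intro!: chom_prod chom_minus e)
  then show ?thesis unfolding det_def by (intro exI chom_sum)
qed

definition hwv :: "'n::{finite,linorder} var pol" where
  "hwv = (\<Prod>s\<in>{1..q}. det (mmat s) ^ b s)"

lemma hwv_derivation:
  assumes D: "derivation D" and "\<And>s. s \<in> {1..q} \<Longrightarrow> D (det (mmat s :: 'n::{finite,linorder} pmat)) = psc (\<mu> s) (det (mmat s))"
  shows "D (hwv :: 'n var pol) = psc (\<Sum>s\<in>{1..q}. of_nat (b s) * \<mu> s) hwv"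
  unfolding hwv_def by (intro derivation_psc_prod D derivation_psc_power assms)

lemma hwv_derivation_zero:
  assumes D: "derivation D" and 0: "\<And>i c. c \<in> C \<Longrightarrow> D (pvar (i, c, False)) = 0"
  shows "D (hwv :: 'n::{finite,linorder} var pol) = 0"
proof -
  have "D (det (mmat s :: 'n pmat)) = psc 0 (det (mmat s))" if "s \<in> {1..q}" for s
  proof -
    have "det (\<chi> i. if i = r then \<chi> j. D (mmat s $ i $ j) else mmat s $ i :: 'n pmat) = 0" for r
      by (rule det_row_zero[of _ r]) (use that in \<open>auto simp: mmat_def derivation_0[OF D] derivation_1[OF D] 0 rows_col\<close>)
    then show ?thesis by (simp add: det_mmat_derivation[OF D])
  qed
  from hwv_derivation[OF D this] show ?thesis by simp
qed

lemma hwv_conly: "conly (hwv :: 'n::{finite,linorder} var pol)"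
  unfolding conly_def
proof (intro allI impI)
  fix v :: "'n var" assume v: "fst (snd v) \<notin> C"
  show "der v hwv = 0"
    by (rule hwv_derivation_zero[OF derivation_der]) (use v in \<open>cases v, auto simp: der_pvar\<close>)
qed

lemma hwv_opD: "opD B (hwv :: 'n::{finite,linorder} var pol) = 0"
proof -
  have "der (j, c, True) (hwv :: 'n var pol) = 0" for j c
    by (rule hwv_derivation_zero[OF derivation_der]) (simp add: der_pvar)
  then show ?thesis by (simp add: opD_def)
qed

lemma hwv_chom: "\<exists>d. chom d (hwv :: 'n::{finite,linorder} var pol)"
proof -
  have "\<exists>d. \<forall>s\<in>{1..q}. chom (d s) (det (mmat s :: 'n pmat) ^ b s)"
  proof (rule bchoice, rule ballI)
    fix s assume "s \<in> {1..q}"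
    then obtain d where "chom d (det (mmat s :: 'n pmat))" using chom_mmat[of s, where 'n = 'n] by auto
    then show "\<exists>d. chom d (det (mmat s :: 'n pmat) ^ b s)" using chom_power by blast
  qed
  then obtain d where d: "\<forall>s\<in>{1..q}. chom (d s) (det (mmat s :: 'n pmat) ^ b s)" by (rule exE)
  have "chom (sum d {1..q}) (hwv :: 'n var pol)" unfolding hwv_def by (rule chom_prod) (rule d[rule_format])
  then show ?thesis by (rule exI)
qed

text \<open>A substitution that turns every padded matrix into the identity and hence the product
  into 1.\<close>

lemma hwv_nonzero: "hwv \<noteq> (0 :: 'n::{finite,linorder} var pol)"
proof -
  define \<sigma> :: "'n var \<Rightarrow> 'n var pol" where "\<sigma> = (\<lambda>(i, c, s). if c = CARD('n) - pos i then 1 else 0)"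
  have "psub \<sigma> (det (mmat s :: 'n pmat)) = 1" for s
  proof -
    have "psub \<sigma> (mmat s $ i $ j) = mat 1 $ i $ j" for i j :: 'n
      using pos_le[of i] pos_le[of j] pos_inj[of i j]
      by (auto simp: mmat_def \<sigma>_def mat_def plin_zero[OF plin_psub])
    then have "(\<chi> i j. psub \<sigma> (mmat s $ i $ j)) = (mat 1 :: 'n pmat)" by (simp add: vec_eq_iff)
    then show ?thesis by (subst hom_det) (simp_all add: psub_add psub_mult)
  qed
  moreover have "psub \<sigma> (p ^ k) = psub \<sigma> p ^ k" for p k
    by (induction k) (simp_all add: psub_mult)
  moreover have "psub \<sigma> (prod p S) = (\<Prod>s\<in>S. psub \<sigma> (p s))" for p and S :: "nat set"
    by (induction S rule: infinite_finite_induct) (simp_all add: psub_mult)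
  ultimately have "psub \<sigma> hwv = 1" by (simp add: hwv_def)
  then show ?thesis using plin_zero[OF plin_psub, of \<sigma>] by auto
qed

text \<open>The operator replaces row \<open>i\<close> of a minor by row \<open>j\<close>. Since
  \<open>i < j\<close>, row \<open>j\<close> belongs to every minor that contains row
  \<open>i\<close>, so two rows become equal.\<close>

lemma hwv_raise: assumes "i < j" shows "opE (mat_unit i j) hwv = (0 :: 'n::{finite,linorder} var pol)"
proof -
  let ?D = "lieE (mat_unit i j) :: 'n var pol \<Rightarrow> _"
  note D = lieE_derivation[of "mat_unit i j"]
  have pv: "?D (pvar (l, c, s)) = (if c \<in> C \<and> l = i then pvar (j, c, s) else 0)" for l c s
    by (simp add: lieE_pvar mat_unit_def if_distrib[of "\<lambda>a. psc a _"] cong: if_cong)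
  have "?D (det (mmat s)) = psc 0 (det (mmat s))" if s: "s \<in> {1..q}" for s
  proof -
    have "det (\<chi> l. if l = r then \<chi> m. ?D (mmat s $ l $ m) else mmat s $ l :: 'n pmat) = 0" if r: "r \<in> bot_rows s" for r
    proof (cases "r = i")
      case True
      have j: "j \<in> bot_rows s" "i \<in> bot_rows s" using r True pos_less[OF assms] by (auto simp: bot_rows_def)
      have "?D (mmat s $ i $ m) = mmat s $ j $ m" for m
        using j rows_col[of s m] s by (auto simp: mmat_def pv derivation_0[OF D])
      then show ?thesis using assms True
        by (intro det_identical_rows[of i j]) (auto simp: row_def vec_eq_iff)
    next
      case False
      then show ?thesis
        by (intro det_row_zero[of _ r]) (use r in \<open>auto simp: mmat_def pv derivation_0[OF D] derivation_1[OF D]\<close>)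
    qed
    then show ?thesis by (simp add: det_mmat_derivation[OF D])
  qed
  from hwv_derivation[OF D this] have "?D hwv = 0" by simp
  moreover have "trace (mat_unit i j) = 0" using assms by (auto simp: trace_def mat_unit_def intro!: sum.neutral)
  ultimately show ?thesis by (simp add: lieE_def)
qed

text \<open>The derivation scales each row \<open>r\<close> of a minor by \<open>h $ r\<close>; the
  trace term is the shift in \<open>opE\<close>.\<close>

lemma hwv_weight:
  "opE (diag_mat h) (hwv :: 'n::{finite,linorder} var pol)
    = psc (- (\<Sum>s\<in>{1..q}. of_nat (b s) * (\<Sum>r\<in>bot_rows s. h $ r)) - of_nat (card C) * (\<Sum>j\<in>UNIV. h $ j)) hwv"
proof -
  let ?D = "lieE (diag_mat h) :: 'n var pol \<Rightarrow> _"
  note D = lieE_derivation[of "diag_mat h"]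
  have pv: "?D (pvar (l, c, s)) = (if c \<in> C then psc (h $ l) (pvar (l, c, s)) else 0)" for l c s
    by (simp add: lieE_pvar diag_mat_def if_distrib[of "\<lambda>a. psc a _"] cong: if_cong)
  have "?D (det (mmat s)) = psc (\<Sum>r\<in>bot_rows s. h $ r) (det (mmat s))" if s: "s \<in> {1..q}" for s
  proof -
    have "det (\<chi> l. if l = r then \<chi> m. ?D (mmat s $ l $ m) else mmat s $ l :: 'n pmat) = psc (h $ r) (det (mmat s))"
      if r: "r \<in> bot_rows s" for r
    proof -
      have "?D (mmat s $ r $ m) = psc (h $ r) (mmat s $ r $ m)" for m
        using r rows_col[of s m] s by (auto simp: mmat_def pv derivation_0[OF D])
      then have "(\<chi> l. if l = r then \<chi> m. ?D (mmat s $ l $ m) else mmat s $ l :: 'n pmat)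
        = (\<chi> l. if l = r then Poly_Mapping.single 0 (h $ r) *s (mmat s $ l) else mmat s $ l)"
        by (auto simp: vec_eq_iff psc_def)
      moreover have "(\<chi> l. if l = r then mmat s $ l else mmat s $ l) = (mmat s :: 'n pmat)"
        by (simp add: vec_eq_iff)
      ultimately show ?thesis by (simp add: det_row_mul psc_def)
    qed
    then show ?thesis by (simp add: det_mmat_derivation[OF D] psc_sum_left)
  qed
  from hwv_derivation[OF D this]
  have "?D hwv = psc (\<Sum>s\<in>{1..q}. of_nat (b s) * (\<Sum>r\<in>bot_rows s. h $ r)) hwv" .
  moreover have "trace (diag_mat h) = (\<Sum>j\<in>UNIV. h $ j)" by (simp add: trace_def diag_mat_def)
  moreover have "opE (diag_mat h) hwv = - ?D hwv - psc (of_nat (card C) * trace (diag_mat h)) hwv"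
    by (simp add: lieE_def)
  ultimately show ?thesis by (simp add: pol.scale_left_diff_distrib psc_minus_left)
qed

end

end

theorem theorem5p12:
  fixes n p i :: nat and a :: "nat \<Rightarrow> int" and lam1 :: int
    and lam :: "'n::{finite,linorder} \<Rightarrow> int"
    and scF :: "complex \<Rightarrow> 'f::ab_group_add \<Rightarrow> 'f" and actF :: "'n mat2 \<Rightarrow> 'f \<Rightarrow> 'f"
    and scL :: "complex \<Rightarrow> 'v::ab_group_add \<Rightarrow> 'v" and actL :: "'n mat2 \<Rightarrow> 'v \<Rightarrow> 'v"
  assumes "n = CARD('n)" and "n \<ge> 3"
    and "2 \<le> p" and "p \<le> n" and "1 \<le> i" and "i \<le> p div 2"
    and "\<forall>j k. 1 \<le> j \<and> j \<le> k \<and> k \<le> n - p \<longrightarrow> a j \<ge> a k"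
    and "\<forall>j. 1 \<le> j \<and> j \<le> n - p \<longrightarrow> a j \<ge> 1"
    and "lam1 = - int n + int p - int i + 1"
    and "\<forall>j. lam j = (if pos j \<le> p then lam1 else lam1 - a (n + 1 - pos j))"
    and "is_L lam scF actF scL actL"
  shows "unitary_module scL actL"
proof -
  define q k where "q = n - p" and "k = nat (- lam1)"
  \<comment> \<open>Since \<open>k = n - p + i - 1\<close>, the bound \<open>i \<ge> 1\<close>
    provides enough columns for the minors of size up to \<open>q\<close>.\<close>
  have k: "lam1 = - int k" "q \<le> k" using assms(4,5,9) by (auto simp: q_def k_def)
  interpret fock "{..<k}" by unfold_locales simp
  have qC: "{..<q} \<subseteq> {..<k}" using k(2) by auto
  \<comment> \<open>Extended by 0 so that the difference at \<open>s = q\<close> is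
    \<open>a q\<close> itself.\<close>
  define A where "A s = (if s \<le> q then a s else 0)" for s
  define b where "b s = nat (A s - A (Suc s))" for s
  \<comment> \<open>The differences are nonnegative: below \<open>q\<close> by monotonicity of
    \<open>a\<close>, at \<open>q\<close> by its positivity.\<close>
  have b: "int (b s) = A s - A (Suc s)" if "1 \<le> s" "s \<le> q" for s
  proof -
    have "A (Suc s) \<le> A s" using assms(7)[rule_format, of s "Suc s"] assms(8)[rule_format, of s] that
      by (auto simp: A_def q_def)
    then show ?thesis by (simp add: b_def)
  qed
  have tele: "(\<Sum>s\<in>{t..q}. int (b s)) = A t" if "1 \<le> t" for t
  proof (cases "t \<le> Suc q")
    case True
    then show ?thesis
      using that
    proof (induction t rule: inc_induct)
      case base
      show ?case by (simp add: A_def)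
    next
      case (step t)
      have "(\<Sum>s\<in>{t..q}. int (b s)) = int (b t) + (\<Sum>s\<in>{Suc t..q}. int (b s))"
        using step.hyps by (intro sum.atLeast_Suc_atMost) simp
      then show ?case using step b[of t] by simp
    qed
  qed (simp add: A_def)
  let ?f = "hwv q b :: 'n var pol"
  have wt: "- (\<Sum>s\<in>{1..q}. of_nat (b s) * (\<Sum>r\<in>bot_rows s. h $ r)) - of_nat (card {..<k}) * (\<Sum>j\<in>UNIV. h $ j)
      = (\<Sum>j\<in>UNIV. of_int (lam j) * h $ j)" for h :: "(complex, 'n) vec"
  proof -
    have "(\<Sum>s\<in>{1..q}. of_nat (b s) * (\<Sum>r\<in>bot_rows s. h $ r))
      = (\<Sum>s\<in>{1..q}. \<Sum>r\<in>UNIV. if r \<in> bot_rows s then of_nat (b s) * h $ r else 0)"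
      by (simp add: sum_distrib_left sum.If_cases)
    also have "\<dots> = (\<Sum>r\<in>UNIV. \<Sum>s\<in>{1..q}. if r \<in> bot_rows s then of_nat (b s) * h $ r else 0)"
      by (rule sum.swap)
    also have "\<dots> = (\<Sum>r\<in>UNIV. (- of_int (lam r) - of_nat k) * h $ r)"
    proof (rule sum.cong[OF refl])
      fix r :: 'n
      \<comment> \<open>The position counted from the end: row \<open>r\<close> occurs exactly in
        the minors of size at least \<open>t\<close>, so the exponents telescope to
        \<open>A t\<close>.\<close>
      define t where "t = n + 1 - pos r"
      have t: "1 \<le> t" "t \<le> q \<longleftrightarrow> \<not> pos r \<le> p" using pos_le[of r] pos_ge[of r] assms(1,4) by (auto simp: t_def q_def)
      have rt: "r \<in> bot_rows s \<longleftrightarrow> t \<le> s" for s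
        using pos_le[of r] pos_ge[of r] assms(1) by (auto simp: bot_rows_def t_def)
      have "(\<Sum>s\<in>{1..q}. if r \<in> bot_rows s then of_nat (b s) * h $ r else 0) = (\<Sum>s\<in>{1..q} \<inter> {s. t \<le> s}. of_nat (b s) * h $ r)"
        by (simp add: rt sum.If_cases)
      also have "{1..q} \<inter> {s. t \<le> s} = {t..q}" using t(1) by auto
      also have "(\<Sum>s\<in>{t..q}. of_nat (b s) * h $ r) = of_int (\<Sum>s\<in>{t..q}. int (b s)) * h $ r"
        by (simp add: sum_distrib_right)
      also have "\<dots> = (- of_int (lam r) - of_nat k) * h $ r"
        unfolding tele[OF t(1)] using t(2) assms(10)[rule_format, of r] k(1) by (simp add: A_def t_def)
      finally show "(\<Sum>s\<in>{1..q}. if r \<in> bot_rows s then of_nat (b s) * h $ r else 0) = (- of_int (lam r) - of_nat k) * h $ r" .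
    qed
    finally show ?thesis
      by (simp add: left_diff_distrib sum_subtractf sum_negf sum_distrib_left)
  qed
  have hf: "hw_module psc gact lam ?f"
  proof
    show "lie_module lie_g psc (gact :: 'n mat2 \<Rightarrow> _)" by (rule lie_module_gact)
    show "gact (gl_embed (diag_mat h)) ?f = psc (\<Sum>j\<in>UNIV. of_int (lam j) * h $ j) ?f" for h
      unfolding gact_gl_embed hwv_weight[OF qC] wt ..
    show "gact (gl_embed (mat_unit i j)) ?f = 0" if "i < j" for i j
      unfolding gact_gl_embed by (rule hwv_raise[OF qC that])
    show "gact X ?f = 0" if "X \<in> lie_p_plus" for X
      using that by (auto simp: lie_p_plus_def hwv_opD[OF qC])
  qed
  obtain v where v: "v \<noteq> 0" "hw_module scL actL lam v" using is_L_hw[OF assms(11)] .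
  have L: "irreducible_lie_module lie_g scL actL" using assms(11) by (simp add: is_L_def)
  obtain d where "chom d ?f" using hwv_chom[OF qC] by blast
  then show ?thesis by (rule hw_unitary[OF L v(2,1) hf hwv_nonzero[OF qC] hwv_conly[OF qC]])
qed

end
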